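(* Let $\Omega\subset\mathbb R^{n+1}$, $n\ge2$, be a domain satisfying the corkscrew condition and with $n$-Ahlfors regular boundary, either bounded or with unbounded boundary, and let $r\in[1,\infty)$, $p\in(1,\infty)$, with $r',p'$ the respective Hölder conjugates. Then the identity $$(\mathbf N_{r,p})^*=\mathbf C_{r',p'}\oplus L^{p'}(\partial\Omega,\sigma)$$ holds in the sense that (i) For any $F\in\mathbf C_{r',p'}$ and $g\in L^{p'}(\partial\Omega,\sigma)$, the functional $T$ given by $$T(u):=\int_\Omega uF\,dm+\int_{\partial\Omega}ug\,d\sigma,\qquad u\in\mathbf N_{r,p},$$ is a well-defined bounded linear functional on $\mathbf N_{r,p}$. (ii) If $T\in(\mathbf N_{r,p})^*$, then there exist unique $F\in\mathbf C_{r',p'}$ and $g\in L^{p'}(\partial\Omega,\sigma)$ such that $$T(u)=\int_\Omega uF\,dm+\int_{\partial\Omega}ug\,d\sigma\qquad\text{for all }u\in\mathbf N_{r,p}.$$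
   Context: A domain is an open set. $m$ is Lebesgue measure on $\mathbb R^{n+1}$, $\sigma=\mathcal H^n|_{\partial\Omega}$ is $n$-dimensional Hausdorff measure restricted to $\partial\Omega$, $\delta(x)=\operatorname{dist}(x,\partial\Omega)$, and $B(x,\rho)$ is the open Euclidean ball of radius $\rho$ centered at $x$. A set $E\subset\mathbb R^{n+1}$ is $n$-Ahlfors regular if there is $C_0>0$ with $C_0^{-1}\rho^n\le\mathcal H^n(B(x,\rho)\cap E)\le C_0\rho^n$ for all $x\in E$ and $0<\rho\le\operatorname{diam}(E)$. $\Omega$ satisfies the corkscrew condition if there is $c>0$ such that for each $x\in\partial\Omega$ and $\rho\in(0,2\operatorname{diam}\Omega)$ there is a ball $B\subset B(x,\rho)\cap\Omega$ with radius $\ge c\rho$. For $\alpha>0$ and $\xi\in\partial\Omega$, let $\gamma_\alpha(\xi)=\{x\in\Omega:|x-\xi|<(1+\alpha)\delta(x)\}$. For $r\in[1,\infty)$, $\hat c\in(0,1/2]$ and $u\in L^r_{\mathrm{loc}}(\Omega)$, set $$\widetilde{\mathcal N}_{\alpha,\hat c,r}(u)(\xi)=\sup_{x\in\gamma_\alpha(\xi)}\Big(\frac{1}{m(B(x,\hat c\delta(x)))}\int_{B(x,\hat c\delta(x))}|u|^r\,dm\Big)^{1/r},\qquad\xi\in\partial\Omega.$$ For $q\in[1,\infty]$ and $H\in L^q_{\mathrm{loc}}(\Omega)$, set $$\mathscr C_{\hat c,q}(H)(\xi)=\sup_{\rho>0}\frac1{\rho^n}\int_{B(\xi,\rho)\cap\Omega}\Big(\frac{1}{m(B(x,\hat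 c\delta(x)))}\int_{B(x,\hat c\delta(x))}|H|^q\,dm\Big)^{1/q}dm(x),\qquad\xi\in\partial\Omega,$$ where for $q=\infty$ the inner $L^q$ average is replaced by $\|H\|_{L^\infty(B(x,\hat c\delta(x)))}$. Fix $\alpha_0>0$, $\hat c_0\in(0,1/2]$ and write $\widetilde{\mathcal N}_r=\widetilde{\mathcal N}_{\alpha_0,\hat c_0,r}$, $\mathscr C_q=\mathscr C_{\hat c_0,q}$. $\mathbf N_{r,p}$ is the completion of $C_c(\overline\Omega)$ (continuous functions on $\overline\Omega$ with compact support in $\overline\Omega$) under the norm $\|u\|_{\mathbf N_{r,p}}=\|\widetilde{\mathcal N}_r(u)\|_{L^p(\partial\Omega,\sigma)}$. $\mathbf C_{q,s}$ is the completion of $C_c(\Omega)$ (continuous functions with compact support in $\Omega$) under the norm $\|H\|_{\mathbf C_{q,s}}=\|\mathscr C_q(H)\|_{L^{s}(\partial\Omega,\sigma)}$. When $q,s\in(1,\infty)$, $\mathbf C_{q,s}$ may also be identified with the Banach space of functions $H\in L^q_{\mathrm{loc}}(\Omega)$ such that $\|\mathscr C_q(H)\|_{L^{s}(\partial\Omega,\sigma)}<\infty$. Each $u\in\mathbf N_{r,p}$ has a trace $u|_{\partial\Omega}\in L^p(\partial\Omega,\sigma)$, defined as the $L^p(\partial\Omega,\sigma)$-limit of $u_k|_{\partial\Omega}$ for any sequence $u_k\in C_c(\overline\Omega)$ converging to $u$ in $\mathbf N_{r,p}$; in the integral $\int_{\partial\Omega}ug\,d\sigma$, $u$ denotes this 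trace.
   Formalization: For r = 1 (r' = ∞), C_{∞,p'} is taken as all H in L^∞_loc(Ω) with finite norm instead of the completion of C_c(Ω); that completion has only continuous elements, so (ii) fails for T(u) = ∫_B u dm with B a small ball inside Ω. *)

theory Defs
  imports "HOL-Analysis.Analysis" "HOL-Probability.Essential_Supremum"
begin

text \<open>The library's \<^const>\<open>diameter\<close> is real-valued and carries no information on unbounded sets.\<close>

definition ediameter :: "'a::metric_space set \<Rightarrow> ennreal" where
  "ediameter S = (SUP x\<in>S. SUP y\<in>S. ennreal (dist x y))"

text \<open>
  The \<open>n\<close>-dimensional Hausdorff outer measure, for \<open>n \<ge> 1\<close>, normalised so that it is Lebesgue
  measure when \<open>n\<close> is the dimension of the space. The empty set is allowed among the \<open>U i\<close>, so
  finite covers are included.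
\<close>

definition hausdorff_outer :: "nat \<Rightarrow> 'a::metric_space set \<Rightarrow> ennreal" where
  "hausdorff_outer n E =
     (SUP e\<in>{0<..}. INF U\<in>{U :: nat \<Rightarrow> 'a set. E \<subseteq> (\<Union>i. U i) \<and> (\<forall>i. ediameter (U i) \<le> ennreal e)}.
        \<Sum>i. ennreal (unit_ball_vol (real n) / 2 ^ n) * ediameter (U i) ^ n)"

text \<open>
  \<^const>\<open>hausdorff_outer\<close> is a metric outer measure, hence countably additive on the Borel sets, so
  \<^const>\<open>measure_of\<close> does not collapse to the zero measure here.
\<close>

definition hausdorff_measure :: "nat \<Rightarrow> 'a::metric_space measure" where
  "hausdorff_measure n = measure_of UNIV (sets borel) (hausdorff_outer n)"

definition bdry_measure :: "nat \<Rightarrow> 'a::metric_space set \<Rightarrow> 'a measure" where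
  "bdry_measure n \<Omega> = restrict_space (hausdorff_measure n) (frontier \<Omega>)"

definition ahlfors_regular :: "nat \<Rightarrow> 'a::metric_space set \<Rightarrow> bool" where
  "ahlfors_regular n E \<longleftrightarrow>
     (\<exists>C>0. \<forall>x\<in>E. \<forall>\<rho>>0. ennreal \<rho> \<le> ediameter E \<longrightarrow>
        ennreal (\<rho> ^ n / C) \<le> hausdorff_outer n (ball x \<rho> \<inter> E) \<and>
        hausdorff_outer n (ball x \<rho> \<inter> E) \<le> ennreal (C * \<rho> ^ n))"

definition corkscrew :: "'a::metric_space set \<Rightarrow> bool" where
  "corkscrew \<Omega> \<longleftrightarrow>
     (\<exists>c>0. \<forall>x\<in>frontier \<Omega>. \<forall>\<rho>>0. ennreal \<rho> < 2 * ediameter \<Omega> \<longrightarrow>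
        (\<exists>z s. c * \<rho> \<le> s \<and> ball z s \<subseteq> ball x \<rho> \<inter> \<Omega>))"

text \<open>Powers of extended nonnegative reals, for positive exponents \<open>a\<close>.\<close>

definition epowr :: "ennreal \<Rightarrow> real \<Rightarrow> ennreal" where
  "epowr x a = (if x = \<infinity> then \<infinity> else ennreal (enn2real x powr a))"

definition Lnorm :: "ennreal \<Rightarrow> 'b measure \<Rightarrow> ('b \<Rightarrow> ennreal) \<Rightarrow> ennreal" where
  "Lnorm q M f =
     (if q = \<infinity> then esssup M f
      else epowr (\<integral>\<^sup>+x. epowr (f x) (enn2real q) \<partial>M) (1 / enn2real q))"

definition Lspace :: "ennreal \<Rightarrow> 'b measure \<Rightarrow> ('b \<Rightarrow> real) set" where
  "Lspace q M = {f \<in> borel_measurable M. Lnorm q M (\<lambda>x. ennreal \<bar>f x\<bar>) < \<infinity>}"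

text \<open>
  The functions of the spaces below are total functions of which only the values on \<open>\<Omega>\<close> (or on its
  closure, for continuous functions) matter. They represent their classes modulo equality almost
  everywhere.
\<close>

definition Lloc :: "ennreal \<Rightarrow> 'a::euclidean_space set \<Rightarrow> ('a \<Rightarrow> real) set" where
  "Lloc q \<Omega> = {u \<in> borel_measurable (lebesgue_on \<Omega>).
     \<forall>K. compact K \<and> K \<subseteq> \<Omega> \<longrightarrow> Lnorm q (lebesgue_on K) (\<lambda>x. ennreal \<bar>u x\<bar>) < \<infinity>}"

definition Laverage :: "ennreal \<Rightarrow> ('a::euclidean_space \<Rightarrow> real) \<Rightarrow> 'a set \<Rightarrow> ennreal" where
  "Laverage q f B =
     (if q = \<infinity> then esssup (lebesgue_on B) (\<lambda>y. ennreal \<bar>f y\<bar>)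
      else epowr ((\<integral>\<^sup>+y\<in>B. ennreal (\<bar>f y\<bar> powr enn2real q) \<partial>lebesgue) / emeasure lebesgue B)
                 (1 / enn2real q))"

definition Cc :: "'a::topological_space set \<Rightarrow> ('a \<Rightarrow> real) set" where
  "Cc S = {u. continuous_on S u \<and> (\<exists>K. compact K \<and> K \<subseteq> S \<and> (\<forall>x\<in>S - K. u x = 0))}"

definition bdry_dist :: "'a::metric_space set \<Rightarrow> 'a \<Rightarrow> real" where
  "bdry_dist \<Omega> x = infdist x (frontier \<Omega>)"

definition nt_cone :: "'a::metric_space set \<Rightarrow> real \<Rightarrow> 'a \<Rightarrow> 'a set" where
  "nt_cone \<Omega> \<alpha> \<xi> = {x \<in> \<Omega>. dist x \<xi> < (1 + \<alpha>) * bdry_dist \<Omega> x}"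

definition nt_max ::
    "'a::euclidean_space set \<Rightarrow> real \<Rightarrow> real \<Rightarrow> ennreal \<Rightarrow> ('a \<Rightarrow> real) \<Rightarrow> 'a \<Rightarrow> ennreal" where
  "nt_max \<Omega> \<alpha> c r u \<xi> = (SUP x\<in>nt_cone \<Omega> \<alpha> \<xi>. Laverage r u (ball x (c * bdry_dist \<Omega> x)))"

definition N_norm ::
    "nat \<Rightarrow> 'a::euclidean_space set \<Rightarrow> real \<Rightarrow> real \<Rightarrow> ennreal \<Rightarrow> ennreal \<Rightarrow> ('a \<Rightarrow> real) \<Rightarrow> ennreal" where
  "N_norm n \<Omega> \<alpha> c r p u = Lnorm p (bdry_measure n \<Omega>) (nt_max \<Omega> \<alpha> c r u)"

text \<open>
  The completion of \<open>C\<^sub>c\<close> of the closure of \<open>\<Omega>\<close>, realised as its closure among the locally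
  \<open>r\<close>-integrable functions on \<open>\<Omega>\<close>. This is the completion: a Cauchy sequence for the norm converges
  in \<open>L\<^sup>r\<close> on compact subsets of \<open>\<Omega>\<close>, and by Fatou's lemma it converges in norm to that limit.
\<close>

definition N_space ::
    "nat \<Rightarrow> 'a::euclidean_space set \<Rightarrow> real \<Rightarrow> real \<Rightarrow> ennreal \<Rightarrow> ennreal \<Rightarrow> ('a \<Rightarrow> real) set" where
  "N_space n \<Omega> \<alpha> c r p = {u \<in> Lloc r \<Omega>. \<exists>U. (\<forall>k::nat. U k \<in> Cc (closure \<Omega>)) \<and>
     (\<lambda>k. N_norm n \<Omega> \<alpha> c r p (\<lambda>x. U k x - u x)) \<longlonglongrightarrow> 0}"

definition bdry_trace ::
    "nat \<Rightarrow> 'a::euclidean_space set \<Rightarrow> real \<Rightarrow> real \<Rightarrow> ennreal \<Rightarrow> ennreal \<Rightarrow> ('a \<Rightarrow> real) \<Rightarrow> 'a \<Rightarrow> real" where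
  "bdry_trace n \<Omega> \<alpha> c r p u = (SOME f. f \<in> Lspace p (bdry_measure n \<Omega>) \<and>
     (\<forall>U. (\<forall>k::nat. U k \<in> Cc (closure \<Omega>)) \<and>
          (\<lambda>k. N_norm n \<Omega> \<alpha> c r p (\<lambda>x. U k x - u x)) \<longlonglongrightarrow> 0 \<longrightarrow>
          (\<lambda>k. Lnorm p (bdry_measure n \<Omega>) (\<lambda>\<xi>. ennreal \<bar>U k \<xi> - f \<xi>\<bar>)) \<longlonglongrightarrow> 0))"

definition carleson ::
    "nat \<Rightarrow> 'a::euclidean_space set \<Rightarrow> real \<Rightarrow> ennreal \<Rightarrow> ('a \<Rightarrow> real) \<Rightarrow> 'a \<Rightarrow> ennreal" where
  "carleson n \<Omega> c q H \<xi> =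
     (SUP \<rho>\<in>{0<..}. (\<integral>\<^sup>+x\<in>ball \<xi> \<rho> \<inter> \<Omega>. Laverage q H (ball x (c * bdry_dist \<Omega> x)) \<partial>lebesgue)
                      / ennreal (\<rho> ^ n))"

definition C_norm ::
    "nat \<Rightarrow> 'a::euclidean_space set \<Rightarrow> real \<Rightarrow> ennreal \<Rightarrow> ennreal \<Rightarrow> ('a \<Rightarrow> real) \<Rightarrow> ennreal" where
  "C_norm n \<Omega> c q s H = Lnorm s (bdry_measure n \<Omega>) (carleson n \<Omega> c q H)"

text \<open>
  The Banach space of locally \<open>q\<close>-integrable functions of finite norm. For \<open>1 < q < \<infinity>\<close> and
  \<open>1 < s < \<infinity>\<close> this is the completion of the continuous functions with compact support in \<open>\<Omega>\<close>.
  For \<open>q = \<infinity>\<close> it is larger: the completion then has only continuous elements and does not contain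
  the indicator function of a small ball, although that function acts on \<open>N\<close> by integration.
\<close>

definition C_space ::
    "nat \<Rightarrow> 'a::euclidean_space set \<Rightarrow> real \<Rightarrow> ennreal \<Rightarrow> ennreal \<Rightarrow> ('a \<Rightarrow> real) set" where
  "C_space n \<Omega> c q s = {H \<in> Lloc q \<Omega>. C_norm n \<Omega> c q s H < \<infinity>}"

text \<open>
  Bounded linear functionals on a space \<open>X\<close> of representatives with extended-valued norm \<open>N\<close>.
  Invariance under almost everywhere equality follows from linearity and the bound.
\<close>

definition bounded_functional ::
    "('a \<Rightarrow> real) set \<Rightarrow> (('a \<Rightarrow> real) \<Rightarrow> ennreal) \<Rightarrow> (('a \<Rightarrow> real) \<Rightarrow> real) \<Rightarrow> bool" where
  "bounded_functional X N T \<longleftrightarrow>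
     (\<forall>u\<in>X. \<forall>v\<in>X. T (\<lambda>x. u x + v x) = T u + T v) \<and>
     (\<forall>a. \<forall>u\<in>X. T (\<lambda>x. a * u x) = a * T u) \<and>
     (\<exists>K. \<forall>u\<in>X. ennreal \<bar>T u\<bar> \<le> ennreal K * N u)"

end

theory Submission
  imports Defs
begin

text \<open>
  Part (i) is the Carleson-type inequality \<open>\<integral>\<^sub>\<Omega> U H \<le> K \<integral> N(U) C(H) d\<sigma>\<close>, applied to averages over Whitney balls
  and followed by Hoelder's inequality, together with the bound of the trace by the norm of \<open>u\<close>.

  For (ii), testing \<open>T\<close> on bounded functions of compact support in \<open>\<Omega>\<close> and the Radon-Nikodym theorem
  give \<open>F\<close> with \<open>T u = \<integral> u F\<close> for these \<open>u\<close>. The Carleson functional of \<open>F\<close> is dominated by the maximal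
  function of its conical integral; pairing the latter with \<open>\<psi> \<in> L\<^sup>p(\<sigma>)\<close> amounts to applying \<open>T\<close> to a
  superposition of local extremisers for \<open>F\<close> weighted by averages of \<open>\<psi>\<close>, whose nontangential maximal
  function is at most a multiple of the maximal function of \<open>\<psi>\<close>. Hence \<open>F\<close> has finite norm. The functional
  \<open>T u - \<integral> u F\<close> vanishes on functions supported away from the boundary, and the norm of \<open>u\<close> restricted
  to a thin boundary layer is controlled by the \<open>L\<^sup>p\<close> norm of its boundary values; so this functional
  is bounded on the boundary values and is represented by some \<open>g \<in> L\<^bsup>p'\<^esup>\<close>.

  Throughout, \<open>\<sigma>\<close> is replaced by the measure \<open>M\<close> on the whole space that it induces.
\<close>

section \<open>Powers and norms with extended nonnegative values\<close>

text \<open>The aperture \<open>a\<close> and the Whitney constant \<open>c\<close> are fixed and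
  arbitrary, so no norm may be traded for one with another aperture. What makes this possible is
  that the shadow of a point \<open>x\<close>, the set of boundary points whose cone contains
  \<open>x\<close>, has measure comparable to \<open>\<delta> x ^ n\<close> for every positive
  aperture: it contains a boundary ball of radius \<open>min a 1 * \<delta> x\<close> about a
  nearest boundary point. Passing between \<Omega> and its boundary is then Fubini over shadows. The
  lower density bound is needed at radii up to \<open>\<delta> x\<close>, which can exceed the
  diameter of the boundary; this is where the alternative that \<Omega> is bounded or has unbounded
  boundary enters. The corkscrew condition enters at small scales, in the bound for traces of
  continuous functions. For r = 1 the conjugate exponent is infinite and exact local extremisers
  need not exist; near extremisers, with the loss of a factor 2, take their place. Constants are
  never sharp: a triangle inequality with constant 4 suffices, because norms only have to be finite,
  comparable or convergent to 0.\<close>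

lemma tendsto_ennreal_inverse_Suc: "(\<lambda>k. ennreal (1 / real (Suc k))) \<longlonglongrightarrow> 0"
  using tendsto_ennrealI[OF LIMSEQ_inverse_real_of_nat] by (simp add: inverse_eq_divide)

lemma ennreal_mult_left_cancel_le: "0 < m \<Longrightarrow> ennreal m * x \<le> ennreal m * y \<Longrightarrow> x \<le> y"
  using ennreal_mult_le_mult_iff[of "ennreal m" x y] by simp

abbreviation Lp :: "real \<Rightarrow> 'b measure \<Rightarrow> ('b \<Rightarrow> real) \<Rightarrow> ennreal" where
  "Lp P M f \<equiv> Lnorm (ennreal P) M (\<lambda>x. ennreal \<bar>f x\<bar>)"

lemma epowr_ennreal: "0 \<le> x \<Longrightarrow> epowr (ennreal x) a = ennreal (x powr a)"
  by (simp add: epowr_def)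

lemma epowr_0 [simp]: "epowr 0 a = 0"
  by (simp add: epowr_def)

lemma epowr_1 [simp]: "epowr 1 a = 1"
  by (simp add: epowr_def)

lemma epowr_top [simp]: "epowr top a = top"
  by (simp add: epowr_def)

lemma epowr_mono: "x \<le> y \<Longrightarrow> 0 < a \<Longrightarrow> epowr x a \<le> epowr y a"
  by (cases x; cases y) (auto simp: epowr_ennreal top_unique intro!: ennreal_leI powr_mono2)

lemma epowr_mult: "0 < a \<Longrightarrow> epowr (x * y) a = epowr x a * epowr y a"
proof -
  assume a: "0 < a"
  show ?thesis
  proof (cases "x = 0 \<or> y = 0")
    case False
    then have "0 < x" "0 < y" by (auto simp: zero_less_iff_neq_zero)
    then show ?thesis using a
      by (cases x; cases y)
         (auto simp: epowr_ennreal ennreal_mult[symmetric] powr_mult ennreal_top_mult ennreal_mult_top)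
  qed auto
qed

lemma epowr_epowr: "epowr (epowr x a) b = epowr x (a * b)"
  by (cases x) (auto simp: epowr_ennreal powr_powr)

lemma epowr_one [simp]: "epowr x 1 = x"
  by (cases x) (auto simp: epowr_ennreal)

lemma epowr_inverse: "0 < a \<Longrightarrow> epowr (epowr x a) (1 / a) = x" "0 < a \<Longrightarrow> epowr (epowr x (1 / a)) a = x"
  by (simp_all add: epowr_epowr)

lemma epowr_add: "0 < a \<Longrightarrow> 0 < b \<Longrightarrow> epowr x (a + b) = epowr x a * epowr x b"
  by (cases x) (auto simp: epowr_ennreal powr_add ennreal_mult)

lemma epowr_eq_0_iff [simp]: "epowr x a = 0 \<longleftrightarrow> x = 0"
  by (cases x) (auto simp: epowr_ennreal)

lemma epowr_eq_top_iff [simp]: "epowr x a = top \<longleftrightarrow> x = top"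
  by (cases x) (auto simp: epowr_ennreal)

lemma epowr_less_top_iff [simp]: "epowr x a < top \<longleftrightarrow> x < top"
  by (auto simp: less_top[symmetric])

lemma epowr_le_iff: "0 < a \<Longrightarrow> epowr x a \<le> epowr y a \<longleftrightarrow> x \<le> y"
  by (metis epowr_inverse(1) epowr_mono divide_pos_pos zero_less_one)

lemma epowr_le_swap: "0 < a \<Longrightarrow> epowr x a \<le> y \<longleftrightarrow> x \<le> epowr y (1 / a)"
  by (metis epowr_inverse(2) epowr_le_iff)

lemma epowr_SUP: "0 < a \<Longrightarrow> epowr (SUP i\<in>I. f i) a = (SUP i\<in>I. epowr (f i) a)"
proof (rule antisym)
  assume a: "0 < a"
  have "(SUP i\<in>I. f i) \<le> epowr (SUP i\<in>I. epowr (f i) a) (1 / a)"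
    by (rule SUP_least, rule epowr_le_swap[OF a, THEN iffD1], rule SUP_upper)
  then show "epowr (SUP i\<in>I. f i) a \<le> (SUP i\<in>I. epowr (f i) a)"
    by (simp add: epowr_le_swap[OF a])
  show "(SUP i\<in>I. epowr (f i) a) \<le> epowr (SUP i\<in>I. f i) a"
    by (intro SUP_least epowr_mono SUP_upper a)
qed

lemma borel_measurable_epowr [measurable]:
  assumes [measurable]: "f \<in> borel_measurable M"
  shows "(\<lambda>x. epowr (f x) a) \<in> borel_measurable M"
  unfolding epowr_def by measurable

text \<open>Doubling the larger of the two terms avoids convexity, and with it any distinction
  between \<open>a < 1\<close> and \<open>1 \<le> a\<close>; the inequality is used both at an
  exponent and at its reciprocal.\<close>

lemma epowr_sum_le:
  assumes "0 < a"
  shows "epowr (x + y) a \<le> epowr 2 a * (epowr x a + epowr y a)"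
proof -
  have "epowr (x + y) a \<le> epowr (2 * max x y) a"
    by (intro epowr_mono assms) (metis add_mono max.cobounded1 max.cobounded2 mult_2)
  also have "\<dots> = epowr 2 a * epowr (max x y) a" by (simp add: epowr_mult assms)
  also have "\<dots> \<le> epowr 2 a * (epowr x a + epowr y a)"
    by (intro mult_left_mono) (auto simp: max_def)
  finally show ?thesis .
qed

lemma Lnorm_ennreal:
  "0 < P \<Longrightarrow> Lnorm (ennreal P) M f = epowr (\<integral>\<^sup>+x. epowr (f x) P \<partial>M) (1 / P)"
  by (simp add: Lnorm_def)

lemma epowr_Lnorm:
  "0 < P \<Longrightarrow> epowr (Lnorm (ennreal P) M f) P = (\<integral>\<^sup>+x. epowr (f x) P \<partial>M)"
  by (simp add: Lnorm_ennreal epowr_inverse)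

lemma Lnorm_mono_AE:
  assumes "0 < P" "AE x in M. f x \<le> g x"
  shows "Lnorm (ennreal P) M f \<le> Lnorm (ennreal P) M g"
  using assms by (auto simp: Lnorm_ennreal intro!: epowr_mono nn_integral_mono_AE)

lemma Lnorm_cong_AE:
  assumes "0 < P" "AE x in M. f x = g x"
  shows "Lnorm (ennreal P) M f = Lnorm (ennreal P) M g"
  using assms by (auto intro!: antisym Lnorm_mono_AE)

lemma Lnorm_cmult:
  assumes "0 < P" "f \<in> borel_measurable M"
  shows "Lnorm (ennreal P) M (\<lambda>x. c * f x) = c * Lnorm (ennreal P) M f"
  using assms by (simp add: Lnorm_ennreal epowr_mult nn_integral_cmult epowr_inverse)

text \<open>The 4 is 2 times 2: \<open>epowr_sum_le\<close> at exponent \<open>P\<close> costs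
  \<open>epowr 2 P\<close>, which the root turns into 2, and at exponent \<open>1 / P\<close> it
  costs \<open>epowr 2 (1 / P)\<close>, which is at most 2.\<close>

lemma Lnorm_add_le:
  assumes P: "1 \<le> P" and [measurable]: "f \<in> borel_measurable M" "g \<in> borel_measurable M"
  shows "Lnorm (ennreal P) M (\<lambda>x. f x + g x) \<le> 4 * (Lnorm (ennreal P) M f + Lnorm (ennreal P) M g)"
proof -
  let ?A = "\<integral>\<^sup>+x. epowr (f x) P \<partial>M" and ?B = "\<integral>\<^sup>+x. epowr (g x) P \<partial>M"
  have P0: "0 < P" "0 < 1 / P" using P by auto
  have "(\<integral>\<^sup>+x. epowr (f x + g x) P \<partial>M) \<le> (\<integral>\<^sup>+x. epowr 2 P * (epowr (f x) P + epowr (g x) P) \<partial>M)"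
    by (intro nn_integral_mono epowr_sum_le P0)
  also have "\<dots> = epowr 2 P * (?A + ?B)"
    by (subst nn_integral_cmult; simp add: nn_integral_add)
  finally have "Lnorm (ennreal P) M (\<lambda>x. f x + g x) \<le> epowr (epowr 2 P * (?A + ?B)) (1 / P)"
    unfolding Lnorm_ennreal[OF P0(1)] by (intro epowr_mono P0)
  also have "\<dots> = 2 * epowr (?A + ?B) (1 / P)"
    by (simp add: epowr_mult P0 epowr_inverse(1)[OF P0(1)])
  also have "\<dots> \<le> 2 * (epowr 2 (1 / P) * (epowr ?A (1 / P) + epowr ?B (1 / P)))"
    by (intro mult_left_mono epowr_sum_le P0) auto
  also have "\<dots> \<le> 2 * (2 * (epowr ?A (1 / P) + epowr ?B (1 / P)))"
  proof (intro mult_left_mono mult_right_mono)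
    have "(2::real) powr (1 / P) \<le> 2 powr 1" using P by (intro powr_mono) auto
    then show "epowr 2 (1 / P) \<le> 2"
      using epowr_ennreal[of 2 "1 / P"] ennreal_leI[of "2 powr (1/P)" 2] by simp
  qed auto
  finally show ?thesis by (simp add: Lnorm_ennreal P0 mult.assoc[symmetric])
qed

lemma Lnorm_SUP:
  assumes P: "0 < P" and [measurable]: "\<And>i. f i \<in> borel_measurable M" and "incseq f"
  shows "Lnorm (ennreal P) M (\<lambda>x. SUP i. f i x) = (SUP i::nat. Lnorm (ennreal P) M (f i))"
proof -
  have "incseq (\<lambda>i x. epowr (f i x) P)"
    using assms(3) by (auto simp: incseq_def le_fun_def intro!: epowr_mono P)
  then show ?thesis
    using P by (simp add: Lnorm_ennreal epowr_SUP nn_integral_monotone_convergence_SUP)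
qed

lemma Lnorm_eq_0:
  assumes "0 < P" "f \<in> borel_measurable M" "Lnorm (ennreal P) M f = 0"
  shows "AE x in M. f x = 0"
  using assms by (simp add: Lnorm_ennreal nn_integral_0_iff_AE)

lemma Lnorm_bounded_support:
  assumes P: "0 < P" and [measurable]: "A \<in> sets M" and "\<And>x. x \<in> space M \<Longrightarrow> f x \<le> c * indicator A x"
  shows "Lnorm (ennreal P) M f \<le> c * epowr (emeasure M A) (1 / P)"
proof -
  have "Lnorm (ennreal P) M f \<le> Lnorm (ennreal P) M (\<lambda>x. c * indicator A x)"
    using assms by (intro Lnorm_mono_AE) auto
  also have "\<dots> = c * Lnorm (ennreal P) M (indicator A)"
    by (rule Lnorm_cmult) (auto simp: P)
  also have "(\<lambda>x. epowr (indicator A x :: ennreal) P) = indicator A"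
    by (auto simp: indicator_def)
  then have "Lnorm (ennreal P) M (indicator A) = epowr (emeasure M A) (1 / P)"
    by (simp add: Lnorm_ennreal P)
  finally show ?thesis .
qed

lemma ennreal_Young:
  assumes "1 < P" "1 < Q" "1 / P + 1 / Q = 1"
  shows "x * y \<le> ennreal (1 / P) * epowr x P + ennreal (1 / Q) * epowr y Q"
proof (cases "x = 0 \<or> y = 0")
  case False
  then have xy: "0 < x" "0 < y" by (auto simp: zero_less_iff_neq_zero)
  show ?thesis
  proof (cases "x = top \<or> y = top")
    case True
    then show ?thesis using assms xy by (auto simp: ennreal_mult_top)
  next
    case False
    then obtain a b where ab: "x = ennreal a" "y = ennreal b" "0 \<le> a" "0 \<le> b"
      by (cases x; cases y) auto
    have "a * b \<le> a powr P / P + b powr Q / Q"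
      using Youngs_inequality[of P Q a b] assms ab by auto
    then show ?thesis
      using ab assms by (simp add: epowr_ennreal ennreal_mult[symmetric] ennreal_plus[symmetric] ennreal_leI
          del: ennreal_plus)
  qed
qed auto

lemma Lnorm_Holder:
  assumes PQ: "1 < P" "1 < Q" "1 / P + 1 / Q = 1"
    and [measurable]: "f \<in> borel_measurable M" "g \<in> borel_measurable M"
  shows "(\<integral>\<^sup>+x. f x * g x \<partial>M) \<le> Lnorm (ennreal P) M f * Lnorm (ennreal Q) M g"
proof -
  let ?a = "Lnorm (ennreal P) M f" and ?b = "Lnorm (ennreal Q) M g"
  have P0: "0 < P" "0 < Q" using PQ by auto
  \<comment> \<open>If one norm is zero the integrand vanishes almost everywhere; if one is infinite
    and the other positive, the right-hand side is infinite. Only in the remaining case can both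
    functions be scaled to norm one for Young's inequality.\<close>
  consider "?a = 0 \<or> ?b = 0" | "?a \<noteq> 0" "?b \<noteq> 0" "?a = top \<or> ?b = top"
    | "0 < ?a" "?a < top" "0 < ?b" "?b < top" by (metis less_top zero_less_iff_neq_zero)
  then show ?thesis
  proof cases
    case 1
    then have "(AE x in M. f x = 0) \<or> (AE x in M. g x = 0)"
      using Lnorm_eq_0[OF P0(1), of f M] Lnorm_eq_0[OF P0(2), of g M] by auto
    then have "AE x in M. f x * g x = 0" by auto
    then show ?thesis by (subst nn_integral_0_iff_AE[THEN iffD2]) auto
  next
    case 2
    then show ?thesis by (auto simp: ennreal_mult_top ennreal_top_mult)
  next
    case 3
    then obtain a b where ab: "?a = ennreal a" "?b = ennreal b" "0 < a" "0 < b"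
      by (cases ?a; cases ?b) auto
    let ?f = "\<lambda>x. ennreal (1 / a) * f x" and ?g = "\<lambda>x. ennreal (1 / b) * g x"
    have 1: "Lnorm (ennreal P) M ?f = 1" "Lnorm (ennreal Q) M ?g = 1"
      using ab by (simp_all add: Lnorm_cmult P0 ennreal_mult[symmetric])
    have "(\<integral>\<^sup>+x. ?f x * ?g x \<partial>M)
        \<le> (\<integral>\<^sup>+x. ennreal (1 / P) * epowr (?f x) P + ennreal (1 / Q) * epowr (?g x) Q \<partial>M)"
      by (intro nn_integral_mono ennreal_Young PQ)
    also have "\<dots> = ennreal (1 / P) * epowr (Lnorm (ennreal P) M ?f) P + ennreal (1 / Q) * epowr (Lnorm (ennreal Q) M ?g) Q"
      by (simp add: nn_integral_add nn_integral_cmult epowr_Lnorm P0)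
    also have "\<dots> = 1"
      using PQ P0 by (simp only: 1 epowr_1 mult_1_right) (simp add: ennreal_plus[symmetric] del: ennreal_plus)
    finally have *: "(\<integral>\<^sup>+x. ?f x * ?g x \<partial>M) \<le> 1" .
    have "f x * g x = ennreal (a * b) * (?f x * ?g x)" for x
    proof -
      have "ennreal (a * b) * (?f x * ?g x) = (ennreal (a * b) * ennreal (1 / a) * ennreal (1 / b)) * (f x * g x)"
        by (simp add: algebra_simps)
      also have "ennreal (a * b) * ennreal (1 / a) * ennreal (1 / b) = 1"
        using ab by (simp add: ennreal_mult[symmetric])
      finally show ?thesis by simp
    qed
    then have "(\<integral>\<^sup>+x. f x * g x \<partial>M) = (\<integral>\<^sup>+x. ennreal (a * b) * (?f x * ?g x) \<partial>M)"
      by simp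
    also have "\<dots> = ennreal (a * b) * (\<integral>\<^sup>+x. ?f x * ?g x \<partial>M)"
      by (rule nn_integral_cmult) simp
    also have "\<dots> \<le> ennreal (a * b) * 1" by (intro mult_left_mono *) auto
    finally show ?thesis using ab by (simp add: ennreal_mult)
  qed
qed

lemma conjugate_exponents:
  assumes "1 < P" "1 / P + 1 / Q = (1::real)"
  shows "1 < Q" "(Q - 1) * P = Q" "(P - 1) * Q = P"
proof -
  have Q0: "Q \<noteq> 0" using assms by auto
  then have e: "Q + P = P * Q" using assms by (simp add: field_simps)
  have "1 / Q = 1 - 1 / P" using assms by simp
  moreover have "0 < 1 - 1 / P" using assms by simp
  moreover have "0 < 1 / P" using assms(1) by simp
  ultimately have "0 < 1 / Q" "1 / Q < 1" by linarith+
  then show "1 < Q" by (metis divide_less_eq_1_pos zero_less_divide_1_iff)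
  show "(Q - 1) * P = Q" "(P - 1) * Q = P" using e by (auto simp: algebra_simps)
qed

text \<open>The dual exponent of the test functions is reached with \<open>\<psi> = f\<^bsup>Q-1\<^esup>\<close>, truncated so that
  both sides are finite.\<close>

lemma Lnorm_converse_Holder:
  assumes PQ: "1 < P" "1 / P + 1 / Q = 1"
    and [measurable]: "f \<in> borel_measurable M"
    and D: "\<And>i::nat. D i \<in> sets M" "incseq D" "space M \<subseteq> (\<Union>i. D i)" "\<And>i. emeasure M (D i) < top"
    and test: "\<And>\<psi> i. \<psi> \<in> borel_measurable M \<Longrightarrow> \<forall>x. 0 \<le> \<psi> x \<Longrightarrow> \<exists>B. \<forall>x. \<psi> x \<le> B \<Longrightarrow>
        \<forall>x. x \<notin> D i \<longrightarrow> \<psi> x = (0::real) \<Longrightarrow>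
        (\<integral>\<^sup>+x. f x * ennreal (\<psi> x) \<partial>M) \<le> K * Lnorm (ennreal P) M (\<lambda>x. ennreal (\<psi> x))"
  shows "Lnorm (ennreal Q) M f \<le> K"
proof -
  have Q: "1 < Q" "(Q - 1) * P = Q" using conjugate_exponents[OF PQ] by auto
  have P0: "0 < P" "0 < Q" using PQ Q by auto
  note [measurable] = D(1)
  define g where "g i x = min (f x) (of_nat i) * indicator (D i) x" for i x
  have [measurable]: "g i \<in> borel_measurable M" for i unfolding g_def by measurable
  have gle: "g i x \<le> f x" for i x by (auto simp: g_def indicator_def)
  have inc: "incseq g"
    using D(2) by (auto simp: incseq_def le_fun_def g_def indicator_def intro!: min.mono)
      (auto simp: of_nat_mono le_max_iff_disj min_le_iff_disj)
  have sup: "(SUP i. g i x) = f x" if x: "x \<in> space M" for x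
  proof (rule antisym)
    show "(SUP i. g i x) \<le> f x" by (intro SUP_least gle)
    obtain i0 where "x \<in> D i0" using x D(3) by auto
    then have i0: "x \<in> D i" if "i0 \<le> i" for i using that D(2) by (auto simp: incseq_def)
    show "f x \<le> (SUP i. g i x)"
    proof (rule dense_le)
      fix y assume y: "y < f x"
      then obtain k where k: "y < of_nat k"
        by (metis less_top ennreal_Ex_less_of_nat top.not_eq_extremum order_less_le_trans top_greatest infinity_ennreal_def)
      have "y \<le> g (max i0 k) x"
        using y k i0[of "max i0 k"]
        by (auto simp: g_def min_def intro!: less_imp_le) (metis order_less_le_trans of_nat_mono max.cobounded2)
      then show "y \<le> (SUP i. g i x)" by (rule SUP_upper2[OF UNIV_I])
    qed
  qed
  have "Lnorm (ennreal Q) M (g i) \<le> K" for i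
  proof -
    have gfin: "g i x < top" for x by (auto simp: g_def indicator_def min_def less_top[symmetric] top_unique)
    define \<psi> where "\<psi> x = enn2real (g i x) powr (Q - 1)" for x
    have psi: "ennreal (\<psi> x) = epowr (g i x) (Q - 1)" for x
      using gfin[of x] by (simp add: \<psi>_def epowr_def less_top)
    let ?I = "\<integral>\<^sup>+x. epowr (g i x) Q \<partial>M"
    have "?I \<le> (\<integral>\<^sup>+x. f x * ennreal (\<psi> x) \<partial>M)"
    proof (rule nn_integral_mono)
      fix x
      have "epowr (g i x) Q = g i x * epowr (g i x) (Q - 1)"
        using epowr_add[of 1 "Q - 1" "g i x"] Q by simp
      then show "epowr (g i x) Q \<le> f x * ennreal (\<psi> x)"
        by (simp add: psi mult_right_mono gle)
    qed
    also have "\<dots> \<le> K * Lnorm (ennreal P) M (\<lambda>x. ennreal (\<psi> x))"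
    proof (rule test[of _ i])
      show "\<exists>B. \<forall>x. \<psi> x \<le> B"
      proof (intro exI allI)
        fix x show "\<psi> x \<le> real i powr (Q - 1)" unfolding \<psi>_def
        proof (rule powr_mono2)
          have "g i x \<le> of_nat i" by (auto simp: g_def indicator_def)
          then show "enn2real (g i x) \<le> real i"
            by (metis enn2real_leI of_nat_0_le_iff ennreal_of_nat_eq_real_of_nat)
        qed (use Q in auto)
      qed
      show "\<psi> \<in> borel_measurable M" unfolding \<psi>_def by measurable
    qed (auto simp: \<psi>_def g_def)
    also have "Lnorm (ennreal P) M (\<lambda>x. ennreal (\<psi> x)) = epowr ?I (1 / P)"
      using Q by (simp add: Lnorm_ennreal P0 psi epowr_epowr)
    \<comment> \<open>The factor \<open>epowr ?I (1 / P)\<close> can be cancelled once the integral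
      is known to be finite, which is what the truncation ensures, and nonzero.\<close>
    finally have le: "?I \<le> K * epowr ?I (1 / P)" .
    have "?I \<le> (\<integral>\<^sup>+x. epowr (of_nat i) Q * indicator (D i) x \<partial>M)"
      by (intro nn_integral_mono) (auto simp: g_def indicator_def intro!: epowr_mono P0)
    also have "\<dots> = epowr (of_nat i) Q * emeasure M (D i)" by (simp add: nn_integral_cmult)
    also have "\<dots> < top" using D(4)[of i] ennreal_of_nat_eq_real_of_nat[of i]
      by (auto simp: ennreal_mult_less_top)
    finally have fin: "?I < top" .
    show ?thesis
    proof (cases "?I = 0")
      case True then show ?thesis by (simp add: Lnorm_ennreal P0)
    next
      case False
      have "1 / P + 1 / Q = 1" by fact
      then have "?I = epowr ?I (1 / Q) * epowr ?I (1 / P)"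
        using epowr_add[of "1 / Q" "1 / P" ?I] P0 by (simp add: add.commute)
      then have "epowr ?I (1 / Q) * epowr ?I (1 / P) \<le> K * epowr ?I (1 / P)" using le by simp
      then have "epowr ?I (1 / Q) \<le> K"
        using False fin by (subst (asm) mult.commute, subst (asm) (2) mult.commute)
          (auto simp: ennreal_mult_le_mult_iff less_top)
      then show ?thesis by (simp add: Lnorm_ennreal P0)
    qed
  qed
  then have "(SUP i. Lnorm (ennreal Q) M (g i)) \<le> K" by (intro SUP_least)
  also have "(SUP i. Lnorm (ennreal Q) M (g i)) = Lnorm (ennreal Q) M (\<lambda>x. SUP i. g i x)"
    by (rule Lnorm_SUP[symmetric]) (auto intro: inc P0)
  also have "\<dots> = Lnorm (ennreal Q) M f"
    using sup by (intro Lnorm_cong_AE P0) (auto intro!: AE_I2)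
  finally show ?thesis .
qed

section \<open>Hausdorff measure\<close>

definition hausdorff_pre :: "nat \<Rightarrow> real \<Rightarrow> 'a::metric_space set \<Rightarrow> ennreal" where
  "hausdorff_pre n e E = (INF U\<in>{U :: nat \<Rightarrow> 'a set. E \<subseteq> (\<Union>i. U i) \<and> (\<forall>i. ediameter (U i) \<le> ennreal e)}.
        \<Sum>i. ennreal (unit_ball_vol (real n) / 2 ^ n) * ediameter (U i) ^ n)"

lemma hausdorff_outer_eq_pre: "hausdorff_outer n E = (SUP e\<in>{0<..}. hausdorff_pre n e E)"
  by (simp add: hausdorff_outer_def hausdorff_pre_def)

lemma ediameter_empty [simp]: "ediameter {} = 0"
  by (simp add: ediameter_def bot_ennreal)

lemma ediameter_ge: "x \<in> U \<Longrightarrow> y \<in> U \<Longrightarrow> ennreal (dist x y) \<le> ediameter U"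
  unfolding ediameter_def by (rule SUP_upper2[of x], assumption, rule SUP_upper)

lemma hausdorff_pre_le:
  "E \<subseteq> (\<Union>i. U i) \<Longrightarrow> (\<And>i. ediameter (U i) \<le> ennreal e) \<Longrightarrow>
   hausdorff_pre n e E \<le> (\<Sum>i. ennreal (unit_ball_vol (real n) / 2 ^ n) * ediameter (U i) ^ n)"
  unfolding hausdorff_pre_def by (rule INF_lower) auto

lemma hausdorff_pre_le_outer: "0 < e \<Longrightarrow> hausdorff_pre n e E \<le> hausdorff_outer n E"
  unfolding hausdorff_outer_eq_pre by (rule SUP_upper) auto

lemma hausdorff_pre_mono: "A \<subseteq> B \<Longrightarrow> hausdorff_pre n e A \<le> hausdorff_pre n e B"
  unfolding hausdorff_pre_def by (rule INF_superset_mono) auto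

lemma hausdorff_pre_antimono: "e \<le> e' \<Longrightarrow> hausdorff_pre n e' A \<le> hausdorff_pre n e A"
  unfolding hausdorff_pre_def
  by (rule INF_superset_mono) (auto intro: order_trans ennreal_leI)

lemma hausdorff_outer_mono: "A \<subseteq> B \<Longrightarrow> hausdorff_outer n A \<le> hausdorff_outer n B"
  unfolding hausdorff_outer_eq_pre by (intro SUP_mono) (auto intro: hausdorff_pre_mono)

lemma hausdorff_outer_empty: "1 \<le> n \<Longrightarrow> hausdorff_outer n ({} :: 'a::metric_space set) = 0"
proof -
  assume n: "1 \<le> n"
  have "hausdorff_pre n e ({} :: 'a set) = 0" for e
    using hausdorff_pre_le[of "{}" "\<lambda>_. {}" e n] n by (simp add: zero_power)
  then have "hausdorff_outer n ({} :: 'a set) \<le> 0"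
    unfolding hausdorff_outer_eq_pre by (intro SUP_least) simp
  then show ?thesis by simp
qed

lemma hausdorff_pre_UN:
  fixes A :: "nat \<Rightarrow> 'a::metric_space set"
  shows "hausdorff_pre n e (\<Union>i. A i) \<le> (\<Sum>i. hausdorff_pre n e (A i))"
proof (cases "(\<Sum>i. hausdorff_pre n e (A i)) = top")
  case False
  let ?w = "\<lambda>U::'a set. ennreal (unit_ball_vol (real n) / 2 ^ n) * ediameter U ^ n"
  have fin: "hausdorff_pre n e (A i) < top" for i
    using False ennreal_suminf_lessD[of "\<lambda>i. hausdorff_pre n e (A i)" top i] by (simp add: less_top)
  show ?thesis
  proof (rule ennreal_le_epsilon)
    fix d :: real assume d: "0 < d"
    have "\<exists>U. A i \<subseteq> (\<Union>j. U j) \<and> (\<forall>j. ediameter (U j) \<le> ennreal e) \<and>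
        (\<Sum>j::nat. ?w (U j)) \<le> hausdorff_pre n e (A i) + ennreal (d * (1/2) ^ Suc i)" for i
    proof -
      have "hausdorff_pre n e (A i) < hausdorff_pre n e (A i) + ennreal (d * (1/2) ^ Suc i)"
      proof (cases "hausdorff_pre n e (A i)")
        case (real a)
        then have "ennreal a + ennreal (d * (1/2) ^ Suc i) = ennreal (a + d * (1/2) ^ Suc i)"
          using d by (intro ennreal_plus[symmetric]) auto
        then show ?thesis using real d by (simp del: ennreal_plus power_Suc) (intro ennreal_lessI add_nonneg_pos; simp)
      qed (use fin[of i] in simp)
      then show ?thesis
        unfolding hausdorff_pre_def[of n e "A i"] INF_less_iff by (auto intro: less_imp_le)
    qed
    then obtain U where U: "\<And>i. A i \<subseteq> (\<Union>j. U i j)" "\<And>i j. ediameter (U i j) \<le> ennreal e"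
      "\<And>i. (\<Sum>j::nat. ?w (U i j)) \<le> hausdorff_pre n e (A i) + ennreal (d * (1/2) ^ Suc i)"
      by metis
    define V where "V k = (case prod_decode k of (i, j) \<Rightarrow> U i j)" for k
    have "hausdorff_pre n e (\<Union>i. A i) \<le> (\<Sum>k. ?w (V k))"
    proof (rule hausdorff_pre_le)
      show "(\<Union>i. A i) \<subseteq> (\<Union>k. V k)"
      proof safe
        fix x i assume "x \<in> A i"
        then obtain j where "x \<in> U i j" using U(1) by blast
        then have "x \<in> V (prod_encode (i, j))" by (simp add: V_def)
        then show "x \<in> (\<Union>k. V k)" by blast
      qed
      show "ediameter (V i) \<le> ennreal e" for i by (auto simp: V_def U split: prod.split)
    qed
    also have "(\<Sum>k. ?w (V k)) = (\<Sum>i. \<Sum>j. ?w (U i j))"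
      using suminf_ennreal_2dimen[of "\<lambda>i. \<Sum>j. ?w (U i j)" "\<lambda>p. ?w (case p of (i, j) \<Rightarrow> U i j)"]
      by (simp only: V_def comp_def prod.case)
    also have "\<dots> \<le> (\<Sum>i. hausdorff_pre n e (A i) + ennreal (d * (1/2) ^ Suc i))"
      by (intro suminf_le U(3)) auto
    also have "\<dots> = (\<Sum>i. hausdorff_pre n e (A i)) + (\<Sum>i. ennreal (d * (1/2) ^ Suc i))"
      by (rule suminf_add[symmetric]) auto
    also have "(\<Sum>i. ennreal (d * (1/2) ^ Suc i)) = ennreal d"
      using d sums_mult[OF power_half_series, of d] by (intro suminf_ennreal_eq) auto
    finally show "hausdorff_pre n e (\<Union>i. A i) \<le> (\<Sum>i. hausdorff_pre n e (A i)) + ennreal d" .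
  qed
qed (simp add: top_unique)

lemma hausdorff_outer_UN:
  "hausdorff_outer n (\<Union>i. A i) \<le> (\<Sum>i::nat. hausdorff_outer n (A i))"
  unfolding hausdorff_outer_eq_pre[of n "\<Union>i. A i"]
  by (intro SUP_least order_trans[OF hausdorff_pre_UN] suminf_le hausdorff_pre_le_outer) auto

lemma hausdorff_outer_Un:
  assumes "1 \<le> n"
  shows "hausdorff_outer n (A \<union> B) \<le> hausdorff_outer n A + hausdorff_outer n B"
proof -
  let ?F = "\<lambda>i::nat. if i = 0 then A else if i = 1 then B else {}"
  have "(\<Union>i. ?F i) = A \<union> B" by (auto split: if_splits)
  then have "hausdorff_outer n (A \<union> B) \<le> (\<Sum>i. hausdorff_outer n (?F i))"
    using hausdorff_outer_UN[of n ?F] by simp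
  also have "\<dots> = (\<Sum>i\<in>{0,1}. hausdorff_outer n (?F i))"
    by (rule suminf_finite) (auto simp: hausdorff_outer_empty[OF assms])
  finally show ?thesis by simp
qed

text \<open>A set of diameter below \<open>d\<close> cannot meet both \<open>A\<close> and
  \<open>B\<close>, so a fine enough cover of the union splits into a cover of \<open>A\<close> and
  a cover of \<open>B\<close> without common members.\<close>

lemma hausdorff_outer_separated:
  assumes n: "1 \<le> n" and d: "0 < d" "\<And>x y. x \<in> A \<Longrightarrow> y \<in> B \<Longrightarrow> d \<le> dist x y"
  shows "hausdorff_outer n A + hausdorff_outer n B \<le> hausdorff_outer n (A \<union> B)"
proof -
  let ?w = "\<lambda>U. ennreal (unit_ball_vol (real n) / 2 ^ n) * ediameter U ^ n"
  have small: "hausdorff_pre n e A + hausdorff_pre n e B \<le> hausdorff_pre n e (A \<union> B)"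
    if e: "0 < e" "e < d" for e
    unfolding hausdorff_pre_def[of n e "A \<union> B"]
  proof (rule INF_greatest)
    fix U :: "nat \<Rightarrow> 'a set"
    assume "U \<in> {U. A \<union> B \<subseteq> (\<Union>i. U i) \<and> (\<forall>i. ediameter (U i) \<le> ennreal e)}"
    then have U: "A \<subseteq> (\<Union>i. U i)" "B \<subseteq> (\<Union>i. U i)" "\<forall>i. ediameter (U i) \<le> ennreal e" by auto
    have no: "U i \<inter> A = {} \<or> U i \<inter> B = {}" for i
    proof (rule ccontr)
      assume "\<not> ?thesis"
      then obtain x y where "x \<in> U i" "x \<in> A" "y \<in> U i" "y \<in> B" by auto
      then have "ennreal (dist x y) \<le> ennreal e" "d \<le> dist x y"
        using order_trans[OF ediameter_ge[of x "U i" y] U(3)[rule_format, of i]] d(2)[of x y] by simp_all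
      then show False using e by (simp add: ennreal_le_iff)
    qed
    let ?V = "\<lambda>i. if U i \<inter> A = {} then {} else U i" and ?W = "\<lambda>i. if U i \<inter> B = {} then {} else U i"
    have "hausdorff_pre n e A \<le> (\<Sum>i. ?w (?V i))"
    proof (rule hausdorff_pre_le[of A ?V e n])
      show "A \<subseteq> (\<Union>i. ?V i)"
      proof
        fix x assume "x \<in> A"
        moreover then obtain i where "x \<in> U i" using U(1) by blast
        ultimately have "x \<in> ?V i" by auto
        then show "x \<in> (\<Union>i. ?V i)" by blast
      qed
    qed (use U(3) in simp)
    moreover have "hausdorff_pre n e B \<le> (\<Sum>i. ?w (?W i))"
    proof (rule hausdorff_pre_le[of B ?W e n])
      show "B \<subseteq> (\<Union>i. ?W i)"
      proof
        fix x assume "x \<in> B"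
        moreover then obtain i where "x \<in> U i" using U(2) by blast
        ultimately have "x \<in> ?W i" by auto
        then show "x \<in> (\<Union>i. ?W i)" by blast
      qed
    qed (use U(3) in simp)
    ultimately have "hausdorff_pre n e A + hausdorff_pre n e B \<le> (\<Sum>i. ?w (?V i)) + (\<Sum>i. ?w (?W i))"
      by (rule add_mono)
    also have "\<dots> = (\<Sum>i. ?w (?V i) + ?w (?W i))"
      by (rule suminf_add) auto
    also have "\<dots> \<le> (\<Sum>i. ?w (U i))"
    proof (intro suminf_le)
      fix i show "?w (?V i) + ?w (?W i) \<le> ?w (U i)" using no[of i] n by (auto simp: power_0_left)
    qed auto
    finally show "hausdorff_pre n e A + hausdorff_pre n e B \<le> (\<Sum>i. ?w (U i))" .
  qed
  \<comment> \<open>The two suprema run over independent scales \<open>a\<close> and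
    \<open>b\<close>; by antitonicity both are dominated by a common scale below
    \<open>d\<close>.\<close>
  have le: "hausdorff_pre n a A + hausdorff_pre n b B \<le> hausdorff_outer n (A \<union> B)" if "0 < a" "0 < b" for a b
  proof -
    let ?e = "min (min a b) (d / 2)"
    have e: "0 < ?e" "?e < d" "?e \<le> a" "?e \<le> b" using that d by (auto simp: min_less_iff_disj)
    have "hausdorff_pre n a A + hausdorff_pre n b B \<le> hausdorff_pre n ?e A + hausdorff_pre n ?e B"
      by (intro add_mono hausdorff_pre_antimono e)
    also have "\<dots> \<le> hausdorff_pre n ?e (A \<union> B)" by (rule small[OF e(1,2)])
    also have "\<dots> \<le> hausdorff_outer n (A \<union> B)" by (rule hausdorff_pre_le_outer[OF e(1)])
    finally show ?thesis .
  qed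
  have "hausdorff_outer n A + hausdorff_outer n B
      = (SUP a\<in>{0<..}. (SUP b\<in>{0<..}. hausdorff_pre n a A + hausdorff_pre n b B))"
    unfolding hausdorff_outer_eq_pre
    by (subst ennreal_SUP_add_left[symmetric], simp)
       (intro SUP_cong refl ennreal_SUP_add_right, simp)
  also have "\<dots> \<le> hausdorff_outer n (A \<union> B)" by (intro SUP_least le) auto
  finally show ?thesis .
qed

lemma hausdorff_outer_separated_sum:
  fixes R :: "nat \<Rightarrow> 'a::metric_space set"
  assumes n: "1 \<le> n"
    and d: "\<And>i j. i < j \<Longrightarrow> \<exists>d>0. \<forall>k\<le>i. \<forall>l\<ge>j. \<forall>x\<in>R k. \<forall>y\<in>R l. d \<le> dist x y"
  shows "(\<Sum>i<m. hausdorff_outer n (R i)) \<le> hausdorff_outer n (\<Union>i<m. R i)"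
proof (induction m)
  case (Suc m)
  show ?case
  proof (cases "m = 0")
    case False
    obtain e where e: "e > 0" "\<forall>k\<le>m-1. \<forall>l\<ge>m. \<forall>x\<in>R k. \<forall>y\<in>R l. e \<le> dist x y"
      using d[of "m-1" m] False by auto
    have "(\<Sum>i<Suc m. hausdorff_outer n (R i)) \<le> hausdorff_outer n (\<Union>i<m. R i) + hausdorff_outer n (R m)"
      using Suc by (simp add: add_right_mono)
    also have "\<dots> \<le> hausdorff_outer n ((\<Union>i<m. R i) \<union> R m)"
    proof (rule hausdorff_outer_separated[OF n e(1)])
      fix x y assume "x \<in> \<Union> (R ` {..<m})" "y \<in> R m"
      then obtain k where "k < m" "x \<in> R k" by auto
      then have "k \<le> m - 1" by simp
      then show "e \<le> dist x y" using e(2) \<open>x \<in> R k\<close> \<open>y \<in> R m\<close> by blast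
    qed
    also have "(\<Union>i<m. R i) \<union> R m = (\<Union>i<Suc m. R i)" by (auto simp: less_Suc_eq)
    finally show ?thesis .
  qed (simp add: lessThan_Suc)
qed simp

text \<open>Caratheodory's argument for metric outer measures. The set \<open>X - F\<close> is
  exhausted by the sets \<open>D k\<close> of points at distance at least \<open>1 / (k + 1)\<close>
  from \<open>F\<close>, for which additivity is known. What \<open>D k\<close> misses is a union of
  thin slices \<open>R j\<close>; slices of equal parity are separated, so their measures are
  summable, and the tail of the sum tends to 0.\<close>

lemma hausdorff_outer_closed:
  fixes F :: "'a::metric_space set"
  assumes n: "1 \<le> n" and F: "closed F"
  shows "hausdorff_outer n (X \<inter> F) + hausdorff_outer n (X - F) \<le> hausdorff_outer n X"
proof (cases "F = {} \<or> hausdorff_outer n X = top")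
  case True
  then show ?thesis using hausdorff_outer_empty[OF n] by auto
next
  case False
  then have Fne: "F \<noteq> {}" and fin: "hausdorff_outer n X < top" by (auto simp: less_top)
  define D where "D k = {x\<in>X. 1 / real (k+1) \<le> infdist x F}" for k
  define R where "R j = {x\<in>X. 1 / real (j+2) \<le> infdist x F \<and> infdist x F < 1 / real (j+1)}" for j
  have dist_ge: "infdist x F - infdist y F \<le> dist x y" for x y
    using infdist_triangle[of x F y] by simp
  \<comment> \<open>Here \<open>c\<close> is the parity, 0 or 1. Slices of equal parity have at
    least one slice between them, and \<open>?d\<close> is the width of the slice that follows the
    one with index \<open>2 * i + c\<close>. Adjacent slices may touch.\<close>
  have sep: "\<exists>d>0. \<forall>k\<le>i. \<forall>l\<ge>j. \<forall>x\<in>R (2*k+c). \<forall>y\<in>R (2*l+c). d \<le> dist x y" if "i < j" for i j c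
  proof (intro exI conjI allI impI ballI)
    let ?d = "1 / real (2*i+c+2) - 1 / real (2*i+c+3)"
    show "0 < ?d" by (simp add: frac_less2)
    fix k l x y assume kl: "k \<le> i" "j \<le> l" and xy: "x \<in> R (2*k+c)" "y \<in> R (2*l+c)"
    have "1 / real (2*i+c+2) \<le> 1 / real (2*k+c+2)" using kl by (intro divide_left_mono) auto
    also have "\<dots> \<le> infdist x F" using xy by (simp add: R_def)
    finally have 1: "1 / real (2*i+c+2) \<le> infdist x F" .
    have "infdist y F < 1 / real (2*l+c+1)" using xy by (simp add: R_def)
    also have "\<dots> \<le> 1 / real (2*i+c+3)" using kl that by (intro divide_left_mono) auto
    finally show "?d \<le> dist x y" using 1 dist_ge[of x y] by linarith
  qed
  have RX: "hausdorff_outer n (\<Union>i<m. R (2*i+c)) \<le> hausdorff_outer n X" for m c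
    by (rule hausdorff_outer_mono) (auto simp: R_def)
  have "(\<Sum>i. hausdorff_outer n (R (2*i+c))) \<le> hausdorff_outer n X" for c
    unfolding suminf_eq_SUP
    by (intro SUP_least order_trans[OF hausdorff_outer_separated_sum[OF n sep] RX])
  from this[of 0] this[of 1]
  have fin2: "(\<Sum>i. hausdorff_outer n (R (2*i))) < top" "(\<Sum>i. hausdorff_outer n (R (2*i+1))) < top"
    using fin by (auto intro: order_le_less_trans)
  have "(\<Sum>j<m. hausdorff_outer n (R j))
      \<le> (\<Sum>i. hausdorff_outer n (R (2*i))) + (\<Sum>i. hausdorff_outer n (R (2*i+1)))" for m
  proof -
    have "(\<Sum>j<m. hausdorff_outer n (R j)) \<le> (\<Sum>j<2*m. hausdorff_outer n (R j))"
      by (intro sum_mono2) auto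
    also have "\<dots> = (\<Sum>i<m. hausdorff_outer n (R (2*i))) + (\<Sum>i<m. hausdorff_outer n (R (2*i+1)))"
      by (induction m) (auto simp: algebra_simps)
    also have "\<dots> \<le> (\<Sum>i. hausdorff_outer n (R (2*i))) + (\<Sum>i. hausdorff_outer n (R (2*i+1)))"
      by (intro add_mono sum_le_suminf) auto
    finally show ?thesis .
  qed
  then have "(\<Sum>j. hausdorff_outer n (R j))
      \<le> (\<Sum>i. hausdorff_outer n (R (2*i))) + (\<Sum>i. hausdorff_outer n (R (2*i+1)))"
    unfolding suminf_eq_SUP[of "\<lambda>j. hausdorff_outer n (R j)"] by (rule SUP_least)
  also have "\<dots> < top" using fin2 by simp
  finally have sfin: "(\<Sum>j. hausdorff_outer n (R j)) < top" .
  then have Rfin: "hausdorff_outer n (R j) < top" for j by (rule ennreal_suminf_lessD)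
  define r where "r j = enn2real (hausdorff_outer n (R j))" for j
  have r: "hausdorff_outer n (R j) = ennreal (r j)" "0 \<le> r j" for j using Rfin by (auto simp: r_def)
  have sr: "summable r"
    using sfin r by (intro summable_suminf_not_top) (auto simp: less_top)
  show ?thesis
  proof (rule ennreal_le_epsilon)
    fix e :: real assume "0 < e"
    then obtain k where k: "norm (\<Sum>i. r (i + k)) < e" using suminf_exist_split[OF _ sr] by blast
    have sub: "X - F \<subseteq> D k \<union> (\<Union>i. R (i + k))"
    proof
      fix x assume x: "x \<in> X - F"
      then have pos: "0 < infdist x F" using F Fne by (simp add: infdist_pos_not_in_closed)
      show "x \<in> D k \<union> (\<Union>i. R (i + k))"
      proof (cases "x \<in> D k")
        case False
        then have lt: "infdist x F < 1 / real (k+1)" using x by (simp add: D_def)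
        \<comment> \<open>The index of the slice containing \<open>x\<close>. Its upper edge comes
          from minimality, except when \<open>m = k\<close>, where it comes from \<open>x\<close>
          not being in \<open>D k\<close>.\<close>
        define m where "m = (LEAST m. 1 / real (m+2) \<le> infdist x F)"
        obtain m0 where "1 / real (Suc m0) < infdist x F" using nat_approx_posE[OF pos] by blast
        then have "1 / real (m0 + 2) \<le> infdist x F"
          by (intro order_trans[OF _ less_imp_le[OF \<open>1 / real (Suc m0) < infdist x F\<close>]] divide_left_mono) auto
        then have m1: "1 / real (m+2) \<le> infdist x F" unfolding m_def by (rule LeastI)
        have mk: "k \<le> m"
        proof (rule ccontr)
          assume "\<not> k \<le> m"
          then have "1 / real (k+1) \<le> 1 / real (m+2)" by (intro divide_left_mono) auto
          then show False using m1 lt by linarith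
        qed
        have "infdist x F < 1 / real (m+1)"
        proof (cases "m = k")
          case False
          then have "m - 1 < m" using mk by auto
          then have "\<not> 1 / real (m - 1 + 2) \<le> infdist x F" unfolding m_def by (rule not_less_Least)
          moreover have "m - 1 + 2 = m + 1" using False mk by auto
          ultimately show ?thesis by simp
        qed (use lt in simp)
        then have "x \<in> R (m - k + k)" using m1 mk x by (simp add: R_def)
        then show ?thesis by blast
      qed simp
    qed
    have "hausdorff_outer n (X - F) \<le> hausdorff_outer n (D k) + hausdorff_outer n (\<Union>i. R (i + k))"
      using hausdorff_outer_mono[OF sub] hausdorff_outer_Un[OF n] order_trans by blast
    also have "hausdorff_outer n (\<Union>i. R (i + k)) \<le> (\<Sum>i. ennreal (r (i + k)))"
      using hausdorff_outer_UN[of n "\<lambda>i. R (i + k)"] by (simp add: r)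
    also have "(\<Sum>i. ennreal (r (i + k))) = ennreal (\<Sum>i. r (i + k))"
      using sr r(2) by (intro suminf_ennreal2) (auto simp: summable_iff_shift)
    also have "\<dots> \<le> ennreal e" using k by (intro ennreal_leI) auto
    finally have XF: "hausdorff_outer n (X - F) \<le> hausdorff_outer n (D k) + ennreal e"
      by (simp add: add_left_mono)
    have "hausdorff_outer n (X \<inter> F) + hausdorff_outer n (D k) \<le> hausdorff_outer n ((X \<inter> F) \<union> D k)"
    proof (rule hausdorff_outer_separated[OF n, of "1 / real (k+1)"])
      fix x y assume "x \<in> X \<inter> F" "y \<in> D k"
      then show "1 / real (k+1) \<le> dist x y"
        using infdist_le[of x F y] by (auto simp: D_def dist_commute)
    qed simp
    also have "\<dots> \<le> hausdorff_outer n X" by (rule hausdorff_outer_mono) (auto simp: D_def)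
    finally show "hausdorff_outer n (X \<inter> F) + hausdorff_outer n (X - F) \<le> hausdorff_outer n X + ennreal e"
      using add_left_mono[OF XF, of "hausdorff_outer n (X \<inter> F)"]
      by (metis (no_types, lifting) add.assoc add_right_mono order_trans)
  qed
qed

text \<open>Closed sets split every set additively, so the sigma-algebra of Caratheodory measurable
  sets contains the Borel sets.\<close>

lemma measure_space_hausdorff_outer:
  assumes n: "1 \<le> n"
  shows "measure_space UNIV (sets borel) (hausdorff_outer n :: 'a::metric_space set \<Rightarrow> ennreal)"
proof -
  let ?H = "hausdorff_outer n :: 'a set \<Rightarrow> ennreal"
  let ?L = "lambda_system UNIV UNIV ?H"
  interpret sigma_algebra UNIV "UNIV :: 'a set set"
    using sigma_algebra_Pow[of UNIV] by simp
  have om: "outer_measure_space UNIV ?H"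
    unfolding outer_measure_space_def positive_def increasing_def countably_subadditive_def
    using hausdorff_outer_empty[OF n] hausdorff_outer_mono hausdorff_outer_UN by auto
  have ms: "measure_space UNIV ?L ?H" by (rule caratheodory_lemma[OF om])
  then have sa: "sigma_algebra UNIV ?L" by (simp add: measure_space_def)
  have "C \<in> ?L" if "closed C" for C
  proof -
    have "?H (X \<inter> C) + ?H (X - C) = ?H X" for X
      using hausdorff_outer_closed[OF n that, of X] hausdorff_outer_Un[OF n, of "X \<inter> C" "X - C"]
      by (simp add: Int_Diff_Un antisym)
    then show ?thesis by (simp add: lambda_system_eq)
  qed
  then have "sigma_sets UNIV {C. closed C} \<subseteq> ?L"
    by (intro sigma_algebra.sigma_sets_subset[OF sa]) auto
  then have "sets borel \<subseteq> ?L"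
    by (simp add: borel_eq_closed)
  then show ?thesis
    by (intro measure_down[OF ms]) (use sets.sigma_algebra_axioms[of borel] in auto)
qed

lemma sets_hausdorff_measure [simp, measurable_cong]: "sets (hausdorff_measure n) = sets borel"
  using sets.sigma_sets_eq[of "borel :: 'a measure"] by (simp add: hausdorff_measure_def)

lemma space_hausdorff_measure [simp]: "space (hausdorff_measure n) = UNIV"
  by (simp add: hausdorff_measure_def space_measure_of_conv)

lemma emeasure_hausdorff_measure:
  "1 \<le> n \<Longrightarrow> A \<in> sets borel \<Longrightarrow> emeasure (hausdorff_measure n) A = hausdorff_outer n A"
  using measure_space_hausdorff_outer[of n] sets.sigma_sets_eq[of "borel :: 'a measure"]
  by (metis (no_types, lifting) emeasure_measure_of_conv hausdorff_measure_def space_borel)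

section \<open>Functionals on bounded functions of bounded support\<close>

lemma ennreal_tendsto_0_le:
  fixes f g :: "'i \<Rightarrow> ennreal"
  assumes "(f \<longlongrightarrow> 0) F" "\<And>k. g k \<le> c * f k" "c < top"
  shows "(g \<longlongrightarrow> 0) F"
proof (rule tendsto_sandwich[OF _ _ tendsto_const])
  show "((\<lambda>k. c * f k) \<longlongrightarrow> 0) F"
    using ennreal_tendsto_cmult[OF assms(3,1)] by simp
qed (use assms(2) in auto)

lemma tendsto_of_ennreal_dist:
  assumes "((\<lambda>k. ennreal \<bar>a k - l\<bar>) \<longlongrightarrow> 0) F"
  shows "(a \<longlongrightarrow> l) F"
proof -
  have "((\<lambda>k. \<bar>a k - l\<bar>) \<longlongrightarrow> 0) F"
    using assms tendsto_ennreal_iff[of "\<lambda>k. \<bar>a k - l\<bar>" F 0] by simp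
  then show ?thesis using LIM_zero_iff tendsto_rabs_zero_iff by blast
qed

text \<open>The bound by a positive power of a finite measure does two things: it makes the additive
  set function continuous at the empty set, hence countably additive, and it makes it absolutely
  continuous, so that Radon-Nikodym applies.\<close>

lemma additive_nonneg_density:
  assumes "finite_measure M" and a: "0 < a"
    and nn: "\<And>A. A \<in> sets M \<Longrightarrow> 0 \<le> \<nu> A"
    and add: "\<And>A B. A \<in> sets M \<Longrightarrow> B \<in> sets M \<Longrightarrow> A \<inter> B = {} \<Longrightarrow> \<nu> (A \<union> B) = \<nu> A + \<nu> B"
    and bd: "\<And>A. A \<in> sets M \<Longrightarrow> \<nu> A \<le> K * measure M A powr a"
  shows "\<exists>g. integrable M g \<and> (\<forall>A\<in>sets M. \<nu> A = (\<integral>x. g x * indicator A x \<partial>M))"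
proof -
  interpret finite_measure M by fact
  let ?m = "\<lambda>A. ennreal (\<nu> A)"
  have 0: "\<nu> {} = 0" using add[of "{}" "{}"] by simp
  have ca: "countably_additive (sets M) ?m"
  proof (rule sets.empty_continuous_imp_countably_additive)
    show "positive (sets M) ?m" by (simp add: positive_def 0)
    show "additive (sets M) ?m" by (auto simp: additive_def add nn)
    fix A :: "nat \<Rightarrow> 'a set" assume A: "range A \<subseteq> sets M" "decseq A" "(\<Inter>i. A i) = {}"
    have "(\<lambda>i. measure M (A i)) \<longlonglongrightarrow> 0"
      using finite_Lim_measure_decseq[OF A(1,2)] A(3) by simp
    then have "(\<lambda>i. K * measure M (A i) powr a) \<longlonglongrightarrow> K * 0"
      by (intro tendsto_mult tendsto_const tendsto_zero_powrI[of _ _ _ a]) (auto intro: a)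
    then have "(\<lambda>i. \<nu> (A i)) \<longlonglongrightarrow> 0"
      by (intro tendsto_sandwich[of "\<lambda>_. 0" "\<lambda>i. \<nu> (A i)" _ "\<lambda>i. K * measure M (A i) powr a"])
         (use A bd nn in \<open>auto intro!: always_eventually\<close>)
    then show "(\<lambda>i. ?m (A i)) \<longlonglongrightarrow> 0" using tendsto_ennrealI by fastforce
  qed simp
  define N where "N = measure_of (space M) (sets M) ?m"
  have sN: "sets N = sets M" by (simp add: N_def)
  have eN: "emeasure N A = ?m A" if "A \<in> sets M" for A
    using that ca unfolding N_def
    by (intro emeasure_measure_of_sigma) (auto simp: positive_def 0 sets.sigma_algebra_axioms)
  have "absolutely_continuous M N"
  proof (unfold absolutely_continuous_def, safe)
    fix A assume A: "A \<in> null_sets M"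
    then have "\<nu> A \<le> 0" using bd[of A] by (auto simp: measure_def null_sets_def)
    then show "A \<in> null_sets N" using A eN sN by (auto simp: null_sets_def ennreal_neg)
  qed
  then obtain f where f[measurable]: "f \<in> borel_measurable M" and fN: "density M f = N"
    using Radon_Nikodym[OF _ sN] by auto
  have fA: "(\<integral>\<^sup>+x. f x * indicator A x \<partial>M) = ?m A" if "A \<in> sets M" for A
    using eN[OF that] that by (simp add: fN[symmetric] emeasure_density)
  have ffin: "AE x in M. f x \<noteq> \<infinity>"
    by (rule nn_integral_PInf_AE) (use fA[of "space M"] in \<open>auto simp: mult_indicator_subset cong: nn_integral_cong\<close>)
  have fA': "(\<integral>\<^sup>+x. ennreal (enn2real (f x) * indicator A x) \<partial>M) = ?m A" if "A \<in> sets M" for A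
    using ffin unfolding fA[OF that, symmetric]
    by (intro nn_integral_cong_AE) (auto simp: indicator_def less_top)
  show ?thesis
  proof (intro exI conjI ballI)
    show "integrable M (\<lambda>x. enn2real (f x))"
      using fA'[of "space M"] by (intro integrableI_nonneg) (auto cong: nn_integral_cong)
    fix A assume A: "A \<in> sets M"
    show "\<nu> A = (\<integral>x. enn2real (f x) * indicator A x \<partial>M)"
      using A fA'[OF A] nn[OF A] by (subst integral_eq_nn_integral) auto
  qed
qed

text \<open>Jordan decomposition: the positive variation \<open>np\<close>, the supremum of \<nu>
  over measurable subsets, is again additive with a bound of the same form, and so is
  \<open>np - \<nu>\<close>. Both are nonnegative, and the two densities are subtracted.\<close>

lemma additive_bounded_density:
  assumes "finite_measure M" and a: "0 < a"
    and add: "\<And>A B. A \<in> sets M \<Longrightarrow> B \<in> sets M \<Longrightarrow> A \<inter> B = {} \<Longrightarrow> \<nu> (A \<union> B) = \<nu> A + \<nu> B"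
    and bd: "\<And>A. A \<in> sets M \<Longrightarrow> \<bar>\<nu> A\<bar> \<le> K * measure M A powr a"
  shows "\<exists>g. integrable M g \<and> (\<forall>A\<in>sets M. \<nu> A = (\<integral>x. g x * indicator A x \<partial>M))"
proof -
  interpret finite_measure M by fact
  have 0: "\<nu> {} = 0" using add[of "{}" "{}"] by simp
  define np where "np A = (SUP B\<in>{B\<in>sets M. B \<subseteq> A}. \<nu> B)" for A
  have leK: "\<nu> B \<le> \<bar>K\<bar> * measure M A powr a" if "A \<in> sets M" "B \<in> sets M" "B \<subseteq> A" for A B
  proof -
    have "\<nu> B \<le> \<bar>K\<bar> * measure M B powr a"
      using bd[of B] that by (smt (verit) mult_right_mono powr_ge_zero)
    also have "\<dots> \<le> \<bar>K\<bar> * measure M A powr a"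
      using that a by (intro mult_left_mono powr_mono2 finite_measure_mono) auto
    finally show ?thesis .
  qed
  have bdd: "bdd_above (\<nu> ` {B\<in>sets M. B \<subseteq> A})" if "A \<in> sets M" for A
    using leK[OF that] by (auto simp: bdd_above_def)
  have np_ge: "\<nu> B \<le> np A" if "A \<in> sets M" "B \<in> sets M" "B \<subseteq> A" for A B
    unfolding np_def by (rule cSUP_upper) (use that bdd in auto)
  have np_le: "np A \<le> c" if "A \<in> sets M" "\<And>B. B \<in> sets M \<Longrightarrow> B \<subseteq> A \<Longrightarrow> \<nu> B \<le> c" for A c
    unfolding np_def by (rule cSUP_least) (use that in auto)
  have np0: "0 \<le> np A" if "A \<in> sets M" for A using np_ge[OF that, of "{}"] 0 by simp
  have npK: "np A \<le> \<bar>K\<bar> * measure M A powr a" if "A \<in> sets M" for A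
    using that leK by (intro np_le) auto
  have npadd: "np (A \<union> B) = np A + np B" if AB: "A \<in> sets M" "B \<in> sets M" "A \<inter> B = {}" for A B
  proof (rule antisym)
    show "np (A \<union> B) \<le> np A + np B"
    proof (rule np_le)
      fix C assume C: "C \<in> sets M" "C \<subseteq> A \<union> B"
      then have "C = (C \<inter> A) \<union> (C \<inter> B)" by auto
      then have "\<nu> C = \<nu> (C \<inter> A) + \<nu> (C \<inter> B)" using add[of "C \<inter> A" "C \<inter> B"] C AB by auto
      then show "\<nu> C \<le> np A + np B" using np_ge[of A "C \<inter> A"] np_ge[of B "C \<inter> B"] C AB by auto
    qed (use AB in auto)
    have "np A \<le> np (A \<union> B) - np B"
    proof (rule np_le)
      fix C assume C: "C \<in> sets M" "C \<subseteq> A"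
      have "np B \<le> np (A \<union> B) - \<nu> C"
      proof (rule np_le)
        fix D assume D: "D \<in> sets M" "D \<subseteq> B"
        have "\<nu> (C \<union> D) = \<nu> C + \<nu> D" using C D AB by (intro add) auto
        moreover have "\<nu> (C \<union> D) \<le> np (A \<union> B)" using C D AB by (intro np_ge) auto
        ultimately show "\<nu> D \<le> np (A \<union> B) - \<nu> C" by simp
      qed (use AB in auto)
      then show "\<nu> C \<le> np (A \<union> B) - np B" by simp
    qed (use AB in auto)
    then show "np A + np B \<le> np (A \<union> B)" by simp
  qed
  obtain g1 where g1: "integrable M g1" "\<And>A. A \<in> sets M \<Longrightarrow> np A = (\<integral>x. g1 x * indicator A x \<partial>M)"
    using additive_nonneg_density[OF assms(1) a np0 npadd npK] by blast
  have "\<exists>g. integrable M g \<and> (\<forall>A\<in>sets M. np A - \<nu> A = (\<integral>x. g x * indicator A x \<partial>M))"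
  proof (rule additive_nonneg_density[OF assms(1) a])
    fix A B assume A: "A \<in> sets M"
    show "0 \<le> np A - \<nu> A" using np_ge[OF A A] by simp
    show "np A - \<nu> A \<le> (2 * \<bar>K\<bar>) * measure M A powr a"
      using npK[OF A] bd[OF A] by (smt (verit) mult_right_mono powr_ge_zero left_diff_distrib)
    assume "B \<in> sets M" "A \<inter> B = {}"
    then show "np (A \<union> B) - \<nu> (A \<union> B) = np A - \<nu> A + (np B - \<nu> B)"
      using npadd[OF A] add[OF A] by simp
  qed
  then obtain g2 where g2: "integrable M g2" "\<And>A. A \<in> sets M \<Longrightarrow> np A - \<nu> A = (\<integral>x. g2 x * indicator A x \<partial>M)"
    by blast
  show ?thesis
  proof (intro exI conjI ballI)
    show "integrable M (\<lambda>x. g1 x - g2 x)" using g1 g2 by simp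
    fix A assume A: "A \<in> sets M"
    have "(\<integral>x. (g1 x - g2 x) * indicator A x \<partial>M) = (\<integral>x. g1 x * indicator A x \<partial>M) - (\<integral>x. g2 x * indicator A x \<partial>M)"
      using A g1(1) g2(1)
      by (subst Bochner_Integration.integral_diff[symmetric])
         (auto simp: left_diff_distrib intro!: integrable_real_mult_indicator)
    then show "\<nu> A = (\<integral>x. (g1 x - g2 x) * indicator A x \<partial>M)" using g1(2)[OF A] g2(2)[OF A] by simp
  qed
qed

text \<open>Rounding \<open>u\<close> down to multiples of \<open>e\<close>. The level 0 is left out
  of \<open>I\<close>, so that each remaining level set lies where \<open>u\<close> is nonzero and
  inherits the support of \<open>u\<close>.\<close>

lemma bounded_uniform_simple:
  fixes u :: "'a \<Rightarrow> real"
  assumes [measurable]: "u \<in> borel_measurable M" and B: "\<And>x. \<bar>u x\<bar> \<le> B" and e: "0 < e"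
  obtains I :: "int set" and A where "finite I" "\<And>k. A k \<in> sets M"
    "\<And>k x. k \<in> I \<Longrightarrow> x \<in> A k \<Longrightarrow> u x \<noteq> 0"
    "\<And>x. x \<in> space M \<Longrightarrow> \<bar>u x - (\<Sum>k\<in>I. (e * of_int k) * indicator (A k) x)\<bar> \<le> e"
proof
  let ?I = "{\<lfloor>- B / e\<rfloor>..\<lfloor>B / e\<rfloor>} - {0}"
  let ?A = "\<lambda>k. {x\<in>space M. \<lfloor>u x / e\<rfloor> = k}"
  show "finite ?I" by simp
  show "?A k \<in> sets M" for k by measurable
  show "u x \<noteq> 0" if "k \<in> ?I" "x \<in> ?A k" for k x using that by auto
  fix x assume x: "x \<in> space M"
  have "(\<Sum>k\<in>?I. (e * of_int k) * indicator (?A k) x) = (\<Sum>k\<in>?I. if k = \<lfloor>u x / e\<rfloor> then e * of_int k else 0)"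
    using x by (intro sum.cong) (auto simp: indicator_def)
  also have "\<dots> = (if \<lfloor>u x / e\<rfloor> \<in> ?I then e * of_int \<lfloor>u x / e\<rfloor> else 0)" by simp
  also have "\<dots> = e * of_int \<lfloor>u x / e\<rfloor>"
  proof -
    have "- B / e \<le> u x / e" "u x / e \<le> B / e" using B[of x] e by (auto intro!: divide_right_mono simp del: minus_divide_left[symmetric])
    then have "\<lfloor>u x / e\<rfloor> \<in> {\<lfloor>- B / e\<rfloor>..\<lfloor>B / e\<rfloor>}" by (auto intro: floor_mono)
    then show ?thesis by auto
  qed
  finally have s: "(\<Sum>k\<in>?I. (e * of_int k) * indicator (?A k) x) = e * of_int \<lfloor>u x / e\<rfloor>" .
  have "u x = e * (u x / e)" using e by simp
  then have "u x - e * of_int \<lfloor>u x / e\<rfloor> = e * (u x / e - of_int \<lfloor>u x / e\<rfloor>)" by (simp only: right_diff_distrib)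
  also have "\<bar>\<dots>\<bar> \<le> e"
  proof -
    have "0 \<le> u x / e - of_int \<lfloor>u x / e\<rfloor>" "u x / e - of_int \<lfloor>u x / e\<rfloor> \<le> 1" by linarith+
    then show ?thesis using e by (simp add: abs_mult mult_left_le)
  qed
  finally show "\<bar>u x - (\<Sum>k\<in>?I. (e * of_int k) * indicator (?A k) x)\<bar> \<le> e" using s by simp
qed

text \<open>Unlike the continuous functions, this class contains the sign of a Borel function times
  a truncated weight, which is what converse Hoelder arguments test with.\<close>

definition bounded_supp :: "'a measure \<Rightarrow> (nat \<Rightarrow> 'a set) \<Rightarrow> ('a \<Rightarrow> real) set" where
  "bounded_supp M K = {u \<in> borel_measurable M. (\<exists>B. \<forall>x. \<bar>u x\<bar> \<le> B) \<and> (\<exists>j. \<forall>x. x \<notin> K j \<longrightarrow> u x = 0)}"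

lemma bounded_suppI:
  "u \<in> borel_measurable M \<Longrightarrow> (\<And>x. \<bar>u x\<bar> \<le> B) \<Longrightarrow> (\<And>x. x \<notin> K j \<Longrightarrow> u x = 0) \<Longrightarrow> u \<in> bounded_supp M K"
  unfolding bounded_supp_def by blast

lemma bounded_suppE:
  assumes "u \<in> bounded_supp M K"
  obtains B j where "u \<in> borel_measurable M" "\<And>x. \<bar>u x\<bar> \<le> B" "0 \<le> B" "\<And>x. x \<notin> K j \<Longrightarrow> u x = 0"
proof -
  obtain B j where "u \<in> borel_measurable M" "\<And>x. \<bar>u x\<bar> \<le> B" "\<And>x. x \<notin> K j \<Longrightarrow> u x = 0"
    using assms unfolding bounded_supp_def by blast
  moreover have "0 \<le> B" using order_trans[OF abs_ge_zero \<open>\<And>x. \<bar>u x\<bar> \<le> B\<close>] .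
  ultimately show thesis using that[of B j] by blast
qed

lemma bounded_supp_cmult: "u \<in> bounded_supp M K \<Longrightarrow> (\<lambda>x. c * u x) \<in> bounded_supp M K"
proof -
  assume "u \<in> bounded_supp M K"
  then obtain B j where u: "u \<in> borel_measurable M" "\<And>x. \<bar>u x\<bar> \<le> B" "\<And>x. x \<notin> K j \<Longrightarrow> u x = 0"
    by (rule bounded_suppE) blast
  then show ?thesis
    by (intro bounded_suppI[of _ _ "\<bar>c\<bar> * B" _ j]) (auto simp: abs_mult intro: mult_left_mono)
qed

lemma bounded_supp_add:
  assumes K: "incseq K" and "u \<in> bounded_supp M K" "v \<in> bounded_supp M K"
  shows "(\<lambda>x. u x + v x) \<in> bounded_supp M K"
proof -
  obtain B j where u: "u \<in> borel_measurable M" "\<And>x. \<bar>u x\<bar> \<le> B" "\<And>x. x \<notin> K j \<Longrightarrow> u x = 0"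
    using assms(2) by (rule bounded_suppE) blast
  obtain C l where v: "v \<in> borel_measurable M" "\<And>x. \<bar>v x\<bar> \<le> C" "\<And>x. x \<notin> K l \<Longrightarrow> v x = 0"
    using assms(3) by (rule bounded_suppE) blast
  show ?thesis
  proof (rule bounded_suppI[of _ _ "B + C" _ "max j l"])
    show "\<bar>u x + v x\<bar> \<le> B + C" for x using u(2)[of x] v(2)[of x] by linarith
    fix x assume "x \<notin> K (max j l)"
    moreover have "K j \<subseteq> K (max j l)" "K l \<subseteq> K (max j l)" using K by (auto simp: incseq_def)
    ultimately have "x \<notin> K j" "x \<notin> K l" by blast+
    then show "u x + v x = 0" using u v by simp
  qed (use u v in simp)
qed

lemma bounded_supp_sum:
  assumes K: "incseq K" and "finite I" "\<And>i. i \<in> I \<Longrightarrow> f i \<in> bounded_supp M K"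
  shows "(\<lambda>x. \<Sum>i\<in>I. f i x) \<in> bounded_supp M K"
  using assms(2,3)
proof (induction I)
  case empty show ?case by (auto simp: bounded_supp_def)
next
  case (insert i I) then show ?case using bounded_supp_add[OF K] by simp
qed

lemma bounded_supp_indicator:
  "A \<in> sets M \<Longrightarrow> A \<subseteq> K j \<Longrightarrow> (indicator A :: _ \<Rightarrow> real) \<in> bounded_supp M K"
  by (rule bounded_suppI[of _ _ 1 _ j]) (auto simp: indicator_def)

lemma Lnorm_abs_bounded:
  assumes "0 < P" "A \<in> sets M" "\<And>x. x \<in> space M \<Longrightarrow> \<bar>f x\<bar> \<le> c" "\<And>x. x \<in> space M \<Longrightarrow> x \<notin> A \<Longrightarrow> f x = 0"
  shows "Lp P M f \<le> ennreal c * epowr (emeasure M A) (1 / P)"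
proof (rule Lnorm_bounded_support[OF assms(1,2)])
  fix x assume "x \<in> space M"
  then show "ennreal \<bar>f x\<bar> \<le> ennreal c * indicator A x"
    using assms(3,4)[of x] by (auto simp: indicator_def intro: ennreal_leI)
qed

text \<open>The density is found on each of the disjoint pieces of the exhaustion and glued.\<close>

theorem bounded_supp_functional:
  assumes K: "incseq K" "\<And>j::nat. K j \<in> sets M" "\<And>j. emeasure M (K j) < top"
    and S_add: "\<And>u v. u \<in> bounded_supp M K \<Longrightarrow> v \<in> bounded_supp M K \<Longrightarrow> S (\<lambda>x. u x + v x) = S u + S v"
    and S_mult: "\<And>c u. u \<in> bounded_supp M K \<Longrightarrow> S (\<lambda>x. c * u x) = c * (S u :: real)"
    and P: "0 < P"
    and bd: "\<And>j. \<exists>C. \<forall>u\<in>bounded_supp M K. (\<forall>x. x \<notin> K j \<longrightarrow> u x = 0) \<longrightarrow>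
        ennreal \<bar>S u\<bar> \<le> ennreal C * Lp P M u"
  obtains g where "g \<in> borel_measurable M"
    "\<And>u. u \<in> bounded_supp M K \<Longrightarrow> integrable M (\<lambda>x. u x * g x)"
    "\<And>u. u \<in> bounded_supp M K \<Longrightarrow> S u = (\<integral>x. u x * g x \<partial>M)"
proof -
  note [measurable] = K(2)
  have S_sum: "S (\<lambda>x. \<Sum>i\<in>I. f i x) = (\<Sum>i\<in>I. S (f i))"
    if "finite I" "\<And>i. i \<in> I \<Longrightarrow> f i \<in> bounded_supp M K" for I and f :: "'i \<Rightarrow> 'a \<Rightarrow> real"
    using that
  proof (induction I)
    case empty
    have "(\<lambda>x. 0) \<in> bounded_supp M K" by (auto simp: bounded_supp_def)
    from S_mult[OF this, of 0] show ?case by simp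
  next
    case (insert i I)
    have "(\<lambda>x. \<Sum>i\<in>I. f i x) \<in> bounded_supp M K" using insert by (intro bounded_supp_sum[OF K(1)]) auto
    then show ?case using insert S_add[of "f i" "\<lambda>x. \<Sum>i\<in>I. f i x"] by simp
  qed
  define A where "A = disjointed K"
  have A[measurable]: "A j \<in> sets M" for j unfolding A_def using K(2) sets.range_disjointed_sets[of K M] by blast
  have AK: "A j \<subseteq> K j" for j by (simp add: A_def disjointed_subset)
  have Adisj: "x \<in> A i \<Longrightarrow> x \<in> A j \<Longrightarrow> i = j" for x i j
    using disjoint_family_disjointed[of K] by (auto simp: A_def disjoint_family_on_def)
  have Afin: "emeasure M (A j) < top" for j
    using emeasure_mono[OF AK K(2), of j] K(3)[of j] by (rule order_le_less_trans)
  obtain C where C: "\<And>j u. u\<in>bounded_supp M K \<Longrightarrow> (\<forall>x. x \<notin> K j \<longrightarrow> u x = 0) \<Longrightarrow>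
        ennreal \<bar>S u\<bar> \<le> ennreal (C j) * Lp P M u"
    using bd by metis
  \<comment> \<open>For functions supported in a set \<open>B\<close> inside one piece, the norm
    bound turns into a bound by the power \<open>1 / P\<close> of the measure of \<open>B\<close>,
    the form required by \<open>additive_bounded_density\<close>.\<close>
  have Sle: "\<bar>S u\<bar> \<le> \<bar>C j\<bar> * (c * measure M B powr (1 / P))"
    if u: "u \<in> bounded_supp M K" and c: "\<And>x. \<bar>u x\<bar> \<le> c" and B: "B \<in> sets M" "B \<subseteq> A j" "\<And>x. x \<notin> B \<Longrightarrow> u x = 0" for u c j B
  proof -
    have c0: "0 \<le> c" using c[of undefined] by simp
    have Bfin: "emeasure M B = ennreal (measure M B)"
      using emeasure_mono[OF B(2), of M] Afin[of j] by (intro emeasure_eq_ennreal_measure) (auto simp: less_top)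
    have "ennreal \<bar>S u\<bar> \<le> ennreal (C j) * Lp P M u"
      using B AK[of j] by (intro C u) blast
    also have "\<dots> \<le> ennreal \<bar>C j\<bar> * (ennreal c * epowr (emeasure M B) (1 / P))"
      by (intro mult_mono Lnorm_abs_bounded P B c ennreal_leI) auto
    also have "\<dots> = ennreal (\<bar>C j\<bar> * (c * measure M B powr (1 / P)))"
      using c0 by (simp add: Bfin epowr_ennreal ennreal_mult)
    finally show ?thesis using c0 by (subst (asm) ennreal_le_iff) auto
  qed
  have ind: "(indicator (B \<inter> A j) :: _ \<Rightarrow> real) \<in> bounded_supp M K" if "B \<in> sets M" for B j
    using AK[of j] that by (intro bounded_supp_indicator[where j=j]) auto
  \<comment> \<open>Cutting \<open>M\<close> down to one piece yields a finite measure even if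
    \<open>M\<close> itself is infinite.\<close>
  define N where "N j = density M (indicator (A j))" for j
  have sN[simp, measurable_cong]: "sets (N j) = sets M" for j by (simp add: N_def)
  have eN: "emeasure (N j) B = emeasure M (B \<inter> A j)" if "B \<in> sets M" for B j
  proof -
    have "emeasure (N j) B = (\<integral>\<^sup>+x. indicator (A j) x * indicator B x \<partial>M)"
      unfolding N_def using that by (intro emeasure_density) auto
    also have "\<dots> = (\<integral>\<^sup>+x. indicator (B \<inter> A j) x \<partial>M)"
      by (intro nn_integral_cong) (auto simp: indicator_def)
    also have "\<dots> = emeasure M (B \<inter> A j)" using that by (intro nn_integral_indicator) auto
    finally show ?thesis .
  qed
  have fN: "finite_measure (N j)" for j
    using Afin[of j] eN[of "space M" j] sets.sets_into_space[OF A[of j]]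
    by (intro finite_measureI) (simp add: N_def Int_absorb1 less_top)
  have "\<exists>g. integrable (N j) g \<and> (\<forall>B\<in>sets (N j). S (indicator (B \<inter> A j)) = (\<integral>x. g x * indicator B x \<partial>N j))" for j
  proof (rule additive_bounded_density[OF fN, where a = "1 / P" and K = "\<bar>C j\<bar>"])
    show "0 < 1 / P" using P by simp
    fix B assume "B \<in> sets (N j)" then have B: "B \<in> sets M" by simp
    have "\<bar>S (indicator (B \<inter> A j))\<bar> \<le> \<bar>C j\<bar> * (1 * measure M (B \<inter> A j) powr (1 / P))"
      by (rule Sle[OF ind[OF B]]) (use B in \<open>auto simp: indicator_def\<close>)
    also have "measure M (B \<inter> A j) = measure (N j) B" using eN[OF B] by (simp add: measure_def)
    finally show "\<bar>S (indicator (B \<inter> A j))\<bar> \<le> \<bar>C j\<bar> * measure (N j) B powr (1 / P)" by simp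
    fix B' assume B': "B' \<in> sets (N j)" "B \<inter> B' = {}"
    have "indicator ((B \<union> B') \<inter> A j) = (\<lambda>x. indicator (B \<inter> A j) x + indicator (B' \<inter> A j) x :: real)"
      using B' by (auto simp: indicator_def fun_eq_iff)
    then show "S (indicator ((B \<union> B') \<inter> A j)) = S (indicator (B \<inter> A j)) + S (indicator (B' \<inter> A j))"
      using S_add[OF ind ind] B B' by simp
  qed
  then obtain G where G: "\<And>j. integrable (N j) (G j)"
    "\<And>j B. B \<in> sets M \<Longrightarrow> S (indicator (B \<inter> A j)) = (\<integral>x. G j x * indicator B x \<partial>N j)"
    by (metis sN)
  have Gm[measurable]: "G j \<in> borel_measurable M" for j using borel_measurable_integrable[OF G(1), of j] by simp
  have Ndens: "N j = density M (\<lambda>x. ennreal (indicator (A j) x))" for j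
    by (simp add: N_def ennreal_indicator)
  have GI: "integrable M (\<lambda>x. indicator (A j) x * G j x)" for j
    using G(1)[of j] unfolding Ndens by (subst (asm) integrable_density) auto
  define h where "h j x = indicator (A j) x * G j x" for j x
  have hm[measurable]: "h j \<in> borel_measurable M" for j unfolding h_def by measurable
  have hI: "integrable M (h j)" for j using GI by (simp add: h_def[abs_def])
  have hS: "S (indicator (B \<inter> A j)) = (\<integral>x. h j x * indicator B x \<partial>M)" if B[measurable]: "B \<in> sets M" for B j
    unfolding G(2)[OF B] Ndens h_def by (subst integral_density) (auto simp: algebra_simps)
  \<comment> \<open>For simple functions the identity is the choice of the density. Approximating
    \<open>v\<close> uniformly within \<open>e\<close> changes either side by at most a constant
    times \<open>e\<close>, and \<open>e\<close> is sent to 0.\<close>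
  have piece: "integrable M (\<lambda>x. v x * h j x) \<and> S v = (\<integral>x. v x * h j x \<partial>M)"
    if v: "v \<in> borel_measurable M" "\<And>x. \<bar>v x\<bar> \<le> b" "\<And>x. x \<notin> A j \<Longrightarrow> v x = 0" for v b j
  proof
    note [measurable] = v(1)
    have vb: "v \<in> bounded_supp M K" using v AK[of j] by (intro bounded_suppI[of _ _ b _ j]) auto
    have b0: "0 \<le> b" using v(2)[of undefined] by simp
    show vI: "integrable M (\<lambda>x. v x * h j x)"
      by (rule Bochner_Integration.integrable_bound[OF integrable_mult_right[OF integrable_abs[OF hI[of j]], of b]])
         (use v(2) b0 in \<open>auto simp: abs_mult intro!: mult_right_mono\<close>)
    define c where "c = \<bar>C j\<bar> * measure M (A j) powr (1 / P) + (\<integral>x. \<bar>h j x\<bar> \<partial>M)"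
    have "\<bar>S v - (\<integral>x. v x * h j x \<partial>M)\<bar> \<le> e * c" if e: "0 < e" for e
    proof -
      obtain I :: "int set" and D where I: "finite I" and D[measurable]: "\<And>k. D k \<in> sets M"
        and Dv: "\<And>k x. k \<in> I \<Longrightarrow> x \<in> D k \<Longrightarrow> v x \<noteq> 0"
        and ap: "\<And>x. x \<in> space M \<Longrightarrow> \<bar>v x - (\<Sum>k\<in>I. (e * of_int k) * indicator (D k) x)\<bar> \<le> e"
        using bounded_uniform_simple[OF v(1,2) e] by metis
      define s where "s x = (\<Sum>k\<in>I. (e * of_int k) * indicator (D k) x)" for x :: 'a
      have DA: "D k \<subseteq> A j" if "k \<in> I" for k using Dv[OF that] v(3) by blast
      have indD: "(indicator (D k) :: 'a \<Rightarrow> real) \<in> bounded_supp M K" if "k \<in> I" for k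
        using DA[OF that] AK[of j] by (intro bounded_supp_indicator[OF D, of _ _ j]) auto
      have sb: "s \<in> bounded_supp M K" unfolding s_def
        by (intro bounded_supp_sum[OF K(1) I] bounded_supp_cmult indD)
      have sm[measurable]: "s \<in> borel_measurable M" unfolding s_def by measurable
      have s0: "s x = 0" if "x \<notin> A j" for x
        unfolding s_def using DA that by (intro sum.neutral) (auto simp: indicator_def)
      have hD: "integrable M (\<lambda>x. h j x * indicator (D k) x)" for k
        by (intro integrable_real_mult_indicator hI D)
      have "S s = (\<Sum>k\<in>I. e * of_int k * S (indicator (D k)))"
        unfolding s_def using indD by (simp add: S_sum[OF I] bounded_supp_cmult S_mult)
      also have "\<dots> = (\<Sum>k\<in>I. e * of_int k * (\<integral>x. h j x * indicator (D k) x \<partial>M))"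
      proof (intro sum.cong refl)
        fix k assume "k \<in> I"
        then have "D k \<inter> A j = D k" using DA by auto
        then show "e * of_int k * S (indicator (D k)) = e * of_int k * (\<integral>x. h j x * indicator (D k) x \<partial>M)"
          using hS[OF D, of k j] by simp
      qed
      also have "\<dots> = (\<integral>x. (\<Sum>k\<in>I. e * of_int k * (h j x * indicator (D k) x)) \<partial>M)"
        by (subst Bochner_Integration.integral_sum) (auto intro!: integrable_mult_right hD)
      also have "\<dots> = (\<integral>x. s x * h j x \<partial>M)"
        unfolding s_def by (simp add: sum_distrib_left sum_distrib_right mult_ac)
      finally have Ss: "S s = (\<integral>x. s x * h j x \<partial>M)" .
      have sI: "integrable M (\<lambda>x. s x * h j x)"
      proof -
        have "integrable M (\<lambda>x. \<Sum>k\<in>I. e * of_int k * (h j x * indicator (D k) x))"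
          by (auto intro!: integrable_mult_right hD)
        then show ?thesis unfolding s_def by (simp add: sum_distrib_left sum_distrib_right mult_ac)
      qed
      define d where "d x = v x + (-1) * s x" for x
      have db: "d \<in> bounded_supp M K" unfolding d_def
        by (intro bounded_supp_add[OF K(1)] vb bounded_supp_cmult sb)
      have de: "\<bar>d x\<bar> \<le> e" for x
      proof (cases "x \<in> space M")
        case True then show ?thesis using ap[OF True] by (simp add: d_def s_def)
      next
        case False
        then have "x \<notin> A j" using sets.sets_into_space[OF A] by blast
        then show ?thesis using v(3) s0 e by (simp add: d_def)
      qed
      have "S d = S v - S s"
        unfolding d_def using S_add[OF vb bounded_supp_cmult[OF sb, of "-1"]] S_mult[OF sb, of "-1"] by simp
      moreover have "\<bar>S d\<bar> \<le> \<bar>C j\<bar> * (e * measure M (A j) powr (1 / P))"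
        by (rule Sle[OF db de]) (auto simp: d_def v(3) s0)
      moreover have "\<bar>(\<integral>x. v x * h j x \<partial>M) - (\<integral>x. s x * h j x \<partial>M)\<bar> \<le> e * (\<integral>x. \<bar>h j x\<bar> \<partial>M)"
      proof -
        have "(\<integral>x. v x * h j x \<partial>M) - (\<integral>x. s x * h j x \<partial>M) = (\<integral>x. d x * h j x \<partial>M)"
          using vI sI by (subst Bochner_Integration.integral_diff[symmetric]) (auto simp: d_def algebra_simps)
        also have "\<bar>\<dots>\<bar> \<le> (\<integral>x. \<bar>d x * h j x\<bar> \<partial>M)" by (rule integral_abs_bound)
        also have "\<dots> \<le> (\<integral>x. e * \<bar>h j x\<bar> \<partial>M)"
        proof (rule integral_mono)
          have "integrable M (\<lambda>x. d x * h j x)" using vI sI by (simp add: d_def algebra_simps)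
          then show "integrable M (\<lambda>x. \<bar>d x * h j x\<bar>)" by (rule integrable_abs)
          show "integrable M (\<lambda>x. e * \<bar>h j x\<bar>)" using hI[of j] by simp
        qed (use de in \<open>auto simp: abs_mult intro: mult_right_mono\<close>)
        finally show ?thesis by simp
      qed
      ultimately show ?thesis using Ss unfolding c_def by (simp add: algebra_simps)
    qed
    then have "\<bar>S v - (\<integral>x. v x * h j x \<partial>M)\<bar> \<le> 0 * c"
    proof -
      assume le: "\<And>e. 0 < e \<Longrightarrow> \<bar>S v - (\<integral>x. v x * h j x \<partial>M)\<bar> \<le> e * c"
      have "((\<lambda>e. e * c) \<longlongrightarrow> 0 * c) (at_right 0)" by (intro tendsto_intros)
      then show ?thesis
        by (rule tendsto_lowerbound) (use le in \<open>auto simp: eventually_at_right_less intro!: eventually_at_rightI[of 0 1]\<close>)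
    qed
    then show "S v = (\<integral>x. v x * h j x \<partial>M)" by simp
  qed
  \<comment> \<open>At each point at most one summand is nonzero, so the series only glues the
    pieces.\<close>
  define g where "g x = (\<Sum>j. h j x)" for x
  have g: "g x = h j x" if "x \<in> A j" for x j
  proof -
    have "g x = (\<Sum>i\<in>{j}. h i x)" unfolding g_def
      by (rule suminf_finite) (use that Adisj in \<open>auto simp: h_def indicator_def\<close>)
    then show ?thesis by simp
  qed
  have gm: "g \<in> borel_measurable M" unfolding g_def[abs_def] by measurable
  have main: "integrable M (\<lambda>x. u x * g x) \<and> S u = (\<integral>x. u x * g x \<partial>M)" if u: "u \<in> bounded_supp M K" for u
  proof -
    from u obtain B J where uB[measurable]: "u \<in> borel_measurable M" and B: "\<And>x. \<bar>u x\<bar> \<le> B" "0 \<le> B"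
      and J: "\<And>x. x \<notin> K J \<Longrightarrow> u x = 0" by (rule bounded_suppE) blast
    define v where "v j x = indicator (A j) x * u x" for j x
    have v: "v j \<in> borel_measurable M" "\<And>x. \<bar>v j x\<bar> \<le> B" "\<And>x. x \<notin> A j \<Longrightarrow> v j x = 0" for j
    proof -
      show "v j \<in> borel_measurable M" unfolding v_def[abs_def] by measurable
    qed (use B in \<open>auto simp: v_def indicator_def\<close>)
    have KJ: "K J = (\<Union>j\<le>J. A j)"
    proof -
      have "K J = (\<Union>j\<in>{0..<Suc J}. K j)"
        using K(1) by (fastforce simp: incseq_def less_Suc_eq_le)
      also have "\<dots> = (\<Union>j\<in>{0..<Suc J}. A j)"
        unfolding A_def by (rule finite_UN_disjointed_eq[symmetric])
      finally show ?thesis by (simp add: atLeast0LessThan lessThan_Suc_atMost)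
    qed
    have us: "u x = (\<Sum>j\<le>J. v j x)" "u x * g x = (\<Sum>j\<le>J. v j x * h j x)" for x
    proof -
      have "(\<Sum>j\<le>J. v j x) = u x \<and> (\<Sum>j\<le>J. v j x * h j x) = u x * g x"
      proof (cases "x \<in> K J")
        case True
        then obtain i where i: "i \<le> J" "x \<in> A i" using KJ by auto
        have vz: "v j x = 0" if "j \<noteq> i" for j using that i Adisj by (auto simp: v_def indicator_def)
        have "(\<Sum>j\<le>J. v j x) = (\<Sum>j\<in>{i}. v j x)" "(\<Sum>j\<le>J. v j x * h j x) = (\<Sum>j\<in>{i}. v j x * h j x)"
          by (rule sum.mono_neutral_right; use i vz in simp)+
        then show ?thesis using i g[OF i(2)] by (simp add: v_def)
      qed (simp add: J v_def)
      then show "u x = (\<Sum>j\<le>J. v j x)" "u x * g x = (\<Sum>j\<le>J. v j x * h j x)" by auto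
    qed
    have vb: "v j \<in> bounded_supp M K" for j by (rule bounded_suppI[OF v(1) v(2), of _ j]) (use v(3) AK[of j] in blast)
    have "S u = S (\<lambda>x. \<Sum>j\<le>J. v j x)" using us(1) by (metis ext)
    also have "\<dots> = (\<Sum>j\<le>J. S (v j))" by (rule S_sum) (auto intro: vb)
    also have "\<dots> = (\<Sum>j\<le>J. \<integral>x. v j x * h j x \<partial>M)" using piece[OF v] by simp
    also have "\<dots> = (\<integral>x. (\<Sum>j\<le>J. v j x * h j x) \<partial>M)"
      using piece[OF v] by (subst Bochner_Integration.integral_sum) auto
    finally show ?thesis using piece[OF v] by (simp add: us(2))
  qed
  show thesis by (rule that[OF gm]) (use main in auto)
qed

text \<open>The Riesz-Fischer argument, run with the integrals of P-th powers, so that it covers all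
  \<open>P > 0\<close> without a triangle inequality: a fast subsequence converges almost
  everywhere, and Fatou's lemma gives convergence in norm.\<close>

lemma Lp_complete:
  fixes f :: "nat \<Rightarrow> 'a \<Rightarrow> real"
  assumes P: "0 < P" and [measurable]: "\<And>k. f k \<in> borel_measurable M"
    and cauchy: "\<And>e::real. 0 < e \<Longrightarrow> \<exists>N. \<forall>k\<ge>N. \<forall>l\<ge>N. Lp P M (\<lambda>x. f k x - f l x) \<le> ennreal e"
  obtains F where "F \<in> borel_measurable M" "(\<lambda>k. Lp P M (\<lambda>x. f k x - F x)) \<longlonglongrightarrow> 0"
proof -
  define I where "I k l = (\<integral>\<^sup>+x. ennreal (\<bar>f k x - f l x\<bar> powr P) \<partial>M)" for k l
  have LI: "Lp P M (\<lambda>x. f k x - F x) = epowr (\<integral>\<^sup>+x. ennreal (\<bar>f k x - F x\<bar> powr P) \<partial>M) (1 / P)" for k F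
    by (simp add: Lnorm_ennreal P epowr_ennreal)
  have I: "\<exists>N. \<forall>k\<ge>N. \<forall>l\<ge>N. I k l \<le> ennreal e" if e: "0 < e" for e
  proof -
    have "0 < e powr (1 / P)" using e by simp
    from cauchy[OF this] obtain N where
      N: "\<forall>k\<ge>N. \<forall>l\<ge>N. epowr (I k l) (1 / P) \<le> ennreal (e powr (1 / P))"
      unfolding LI I_def by auto
    have "epowr (ennreal e) (1 / P) = ennreal (e powr (1 / P))" using e by (simp add: epowr_ennreal)
    then show ?thesis using N P by (metis epowr_le_iff divide_pos_pos zero_less_one)
  qed
  have "\<exists>N. \<forall>k\<ge>N. \<forall>l\<ge>N. I k l \<le> ennreal ((1/4) powr (real j * P))" for j by (rule I) simp
  then obtain N where N: "\<And>j k l. N j \<le> k \<Longrightarrow> N j \<le> l \<Longrightarrow> I k l \<le> ennreal ((1/4) powr (real j * P))" by metis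
  define r where "r j = (\<Sum>i\<le>j. N i)" for j
  have rN: "N j \<le> r j" for j unfolding r_def by (rule member_le_sum) auto
  have rinc: "r j \<le> r (Suc j)" for j by (simp add: r_def)
  \<comment> \<open>The weight \<open>2 powr (j * P)\<close> against the bound
    \<open>(1/4) powr (j * P)\<close> leaves a convergent series. Where the sum of the weighted
    increments is finite, the increments of the subsequence decay like the powers of 1/2.\<close>
  define h where "h j x = 2 powr (real j * P) * \<bar>f (r (Suc j)) x - f (r j) x\<bar> powr P" for j x
  have [measurable]: "h j \<in> borel_measurable M" for j unfolding h_def by measurable
  have "(\<integral>\<^sup>+x. (\<Sum>j. ennreal (h j x)) \<partial>M) = (\<Sum>j. \<integral>\<^sup>+x. ennreal (h j x) \<partial>M)"
    by (rule nn_integral_suminf) auto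
  also have "\<dots> \<le> (\<Sum>j. ennreal ((1/2) powr (real j * P)))"
  proof (intro suminf_le)
    fix j
    have "(\<integral>\<^sup>+x. ennreal (h j x) \<partial>M) = ennreal (2 powr (real j * P)) * I (r (Suc j)) (r j)"
      unfolding h_def I_def by (subst nn_integral_cmult[symmetric]) (auto simp: ennreal_mult)
    also have "\<dots> \<le> ennreal (2 powr (real j * P)) * ennreal ((1/4) powr (real j * P))"
      using rN[of j] rinc[of j] by (intro mult_left_mono N) auto
    also have "\<dots> = ennreal ((1/2) powr (real j * P))"
      by (subst ennreal_mult[symmetric]) (auto simp: powr_mult[symmetric])
    finally show "(\<integral>\<^sup>+x. ennreal (h j x) \<partial>M) \<le> ennreal ((1/2) powr (real j * P))" .
  qed auto
  also have "\<dots> < top"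
  proof -
    have eq: "(1/2) powr (real j * P) = ((1/2) powr P) ^ j" for j
      by (simp add: powr_powr[symmetric] powr_realpow mult.commute)
    have "(1/2::real) powr P < 1 powr P" using P by (intro powr_less_mono2) auto
    then have "(1/2::real) powr P < 1" by simp
    then have "summable (\<lambda>j. ((1/2::real) powr P) ^ j)" by (intro summable_geometric) auto
    then show ?thesis unfolding eq by (simp add: suminf_ennreal2 less_top)
  qed
  finally have fin: "(\<integral>\<^sup>+x. (\<Sum>j. ennreal (h j x)) \<partial>M) \<noteq> \<infinity>" by (simp add: less_top)
  have ae: "AE x in M. (\<Sum>j. ennreal (h j x)) \<noteq> \<infinity>"
    by (rule nn_integral_PInf_AE[OF _ fin]) simp
  define F where "F x = lim (\<lambda>j. f (r j) x)" for x
  have Fm: "F \<in> borel_measurable M" unfolding F_def[abs_def] by measurable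
  have conv: "AE x in M. (\<lambda>j. f (r j) x) \<longlonglongrightarrow> F x"
    using ae
  proof (rule AE_mp, intro AE_I2 impI)
    fix x assume "(\<Sum>j. ennreal (h j x)) \<noteq> \<infinity>"
    then obtain B where B: "(\<Sum>j. ennreal (h j x)) = ennreal B" "0 \<le> B" by (cases "\<Sum>j. ennreal (h j x)") auto
    have hB: "h j x \<le> B" for j
    proof -
      have "ennreal (h j x) \<le> (\<Sum>j. ennreal (h j x))"
        using sum_le_suminf[of "\<lambda>j. ennreal (h j x)" "{j}"] by simp
      then show ?thesis using B by (simp add: ennreal_le_iff)
    qed
    have dB: "\<bar>f (r (Suc j)) x - f (r j) x\<bar> \<le> B powr (1 / P) * (1/2) ^ j" for j
    proof -
      have "(2 ^ j * \<bar>f (r (Suc j)) x - f (r j) x\<bar>) powr P = h j x"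
        by (simp add: h_def powr_mult powr_powr[symmetric] powr_realpow)
      then have "((2 ^ j * \<bar>f (r (Suc j)) x - f (r j) x\<bar>) powr P) powr (1 / P) \<le> B powr (1 / P)"
        using hB[of j] P by (intro powr_mono2) (auto simp: h_def)
      then have "2 ^ j * \<bar>f (r (Suc j)) x - f (r j) x\<bar> \<le> B powr (1 / P)"
        using P by (simp add: powr_powr)
      then show ?thesis by (simp add: field_simps power_one_over)
    qed
    have "summable (\<lambda>j. f (r (Suc j)) x - f (r j) x)"
      by (rule summable_comparison_test'[of "\<lambda>j. B powr (1 / P) * (1/2) ^ j"])
         (auto intro!: summable_mult summable_geometric dB)
    then have "convergent (\<lambda>j. \<Sum>i<j. f (r (Suc i)) x - f (r i) x)"
      by (simp add: summable_iff_convergent)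
    then have "convergent (\<lambda>j. f (r j) x - f (r 0) x)" by (simp only: sum_lessThan_telescope[of "\<lambda>i. f (r i) x"])
    then have "convergent (\<lambda>j. f (r j) x)"
      using convergent_diff_const_right_iff by blast
    then show "(\<lambda>j. f (r j) x) \<longlonglongrightarrow> F x" unfolding F_def by (simp add: convergent_LIMSEQ_iff)
  qed
  have Fle: "(\<integral>\<^sup>+x. ennreal (\<bar>f k x - F x\<bar> powr P) \<partial>M) \<le> ennreal ((1/4) powr (real j * P))" if k: "N j \<le> k" for k j
  proof -
    have "(\<integral>\<^sup>+x. ennreal (\<bar>f k x - F x\<bar> powr P) \<partial>M) \<le> (\<integral>\<^sup>+x. liminf (\<lambda>i. ennreal (\<bar>f k x - f (r i) x\<bar> powr P)) \<partial>M)"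
    proof (rule nn_integral_mono_AE, rule AE_mp[OF conv], intro AE_I2 impI)
      fix x assume "(\<lambda>j. f (r j) x) \<longlonglongrightarrow> F x"
      then have "(\<lambda>i. ennreal (\<bar>f k x - f (r i) x\<bar> powr P)) \<longlonglongrightarrow> ennreal (\<bar>f k x - F x\<bar> powr P)"
        using P by (intro tendsto_ennrealI tendsto_powr' tendsto_rabs tendsto_diff tendsto_const) auto
      then have "liminf (\<lambda>i. ennreal (\<bar>f k x - f (r i) x\<bar> powr P)) = ennreal (\<bar>f k x - F x\<bar> powr P)"
        by (intro lim_imp_Liminf) auto
      then show "ennreal (\<bar>f k x - F x\<bar> powr P) \<le> liminf (\<lambda>i. ennreal (\<bar>f k x - f (r i) x\<bar> powr P))" by simp
    qed
    also have "\<dots> \<le> liminf (\<lambda>i. I k (r i))" unfolding I_def by (rule nn_integral_liminf) auto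
    also have "\<dots> \<le> limsup (\<lambda>i. I k (r i))" by (rule Liminf_le_Limsup) simp
    also have "\<dots> \<le> ennreal ((1/4) powr (real j * P))"
    proof (rule Limsup_bounded)
      show "\<forall>\<^sub>F i in sequentially. I k (r i) \<le> ennreal ((1/4) powr (real j * P))"
      proof (rule eventually_sequentiallyI[of j])
        fix i assume "j \<le> i"
        then have "r j \<le> r i" unfolding r_def by (intro sum_mono2) auto
        then show "I k (r i) \<le> ennreal ((1/4) powr (real j * P))" using rN[of j] k by (intro N) auto
      qed
    qed
    finally show ?thesis .
  qed
  have "(\<lambda>k. Lp P M (\<lambda>x. f k x - F x)) \<longlonglongrightarrow> 0"
  proof (rule order_tendstoI)
    fix y :: ennreal assume y: "0 < y"
    have "(\<lambda>j. ennreal ((1/4) ^ j)) \<longlonglongrightarrow> 0"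
      using tendsto_ennrealI[OF LIMSEQ_power_zero[of "1/4::real"]] by simp
    then obtain j where j: "ennreal ((1/4) ^ j) < y"
      using y by (auto dest!: order_tendstoD(2)[of _ 0 _ y] simp: eventually_sequentially) (meson order_refl)
    show "\<forall>\<^sub>F k in sequentially. Lp P M (\<lambda>x. f k x - F x) < y"
    proof (rule eventually_sequentiallyI[of "N j"])
      fix k assume "N j \<le> k"
      from Fle[OF this] have "epowr (\<integral>\<^sup>+x. ennreal (\<bar>f k x - F x\<bar> powr P) \<partial>M) (1 / P) \<le> epowr (ennreal ((1/4) powr (real j * P))) (1 / P)"
        using P by (intro epowr_mono) auto
      also have "\<dots> = ennreal ((1/4) ^ j)" using P by (simp add: epowr_ennreal powr_powr powr_realpow)
      finally show "Lp P M (\<lambda>x. f k x - F x) < y" using j LI by simp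
    qed
  qed auto
  with Fm show thesis by (rule that)
qed

lemma Lnorm_triangle:
  fixes f g h :: "'a \<Rightarrow> real"
  assumes P: "1 \<le> P" and [measurable]: "f \<in> borel_measurable M" "g \<in> borel_measurable M" "h \<in> borel_measurable M"
  shows "Lp P M (\<lambda>x. f x - h x)
    \<le> 4 * (Lp P M (\<lambda>x. f x - g x) + Lp P M (\<lambda>x. g x - h x))"
proof -
  have "Lp P M (\<lambda>x. f x - h x)
      \<le> Lnorm (ennreal P) M (\<lambda>x. ennreal \<bar>f x - g x\<bar> + ennreal \<bar>g x - h x\<bar>)"
    using P by (intro Lnorm_mono_AE AE_I2) (auto simp: ennreal_plus[symmetric] simp del: ennreal_plus intro!: ennreal_leI)
  also have "\<dots> \<le> 4 * (Lp P M (\<lambda>x. f x - g x) + Lp P M (\<lambda>x. g x - h x))"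
    by (rule Lnorm_add_le[OF P]) auto
  finally show ?thesis .
qed

lemma Lnorm_abs_cmult:
  assumes "0 < P" "f \<in> borel_measurable M"
  shows "Lp P M (\<lambda>x. c * f x) = ennreal \<bar>c\<bar> * Lp P M f"
  using Lnorm_cmult[OF assms(1), of "\<lambda>x. ennreal \<bar>f x\<bar>" M "ennreal \<bar>c\<bar>"] assms(2)
  by (simp add: abs_mult ennreal_mult)

lemma Lnorm_eq_0_unique:
  fixes f g :: "'a \<Rightarrow> real"
  assumes P: "1 \<le> P" and "f \<in> borel_measurable M" "g \<in> borel_measurable M" "\<And>k. h k \<in> borel_measurable M"
    and f: "(\<lambda>k::nat. Lp P M (\<lambda>x. h k x - f x)) \<longlonglongrightarrow> 0"
    and g: "(\<lambda>k::nat. Lp P M (\<lambda>x. h k x - g x)) \<longlonglongrightarrow> 0"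
  shows "AE x in M. f x = g x"
proof -
  let ?a = "\<lambda>k. Lp P M (\<lambda>x. h k x - f x)" and ?b = "\<lambda>k. Lp P M (\<lambda>x. h k x - g x)"
  have le: "Lp P M (\<lambda>x. f x - g x) \<le> 4 * (?a k + ?b k)" for k
    using Lnorm_triangle[OF P assms(2) assms(4)[of k] assms(3)] by (simp add: abs_minus_commute)
  have "(\<lambda>k. 4 * (?a k + ?b k)) \<longlonglongrightarrow> 4 * (0 + 0)"
    by (intro ennreal_tendsto_cmult tendsto_add f g) simp
  then have "Lp P M (\<lambda>x. f x - g x) \<le> 4 * (0 + 0)"
    by (rule LIMSEQ_le_const) (use le in auto)
  then have "AE x in M. ennreal \<bar>f x - g x\<bar> = 0"
    using P assms by (intro Lnorm_eq_0[of P]) auto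
  then show ?thesis by (auto simp: ennreal_eq_0_iff)
qed

section \<open>Density of continuous functions\<close>

definition cont_supp :: "('a::euclidean_space \<Rightarrow> real) set" where
  "cont_supp = {f. continuous_on UNIV f \<and> (\<exists>R. \<forall>x. R \<le> norm x \<longrightarrow> f x = 0)}"

lemma cont_supp_cmult: "f \<in> cont_supp \<Longrightarrow> (\<lambda>x. c * f x) \<in> cont_supp"
  unfolding cont_supp_def by (auto intro!: continuous_intros)

lemma cont_supp_add:
  assumes "f \<in> cont_supp" "g \<in> cont_supp" shows "(\<lambda>x. f x + g x) \<in> cont_supp"
proof -
  obtain R S where "\<forall>x. R \<le> norm x \<longrightarrow> f x = 0" "\<forall>x. S \<le> norm x \<longrightarrow> g x = 0"
    using assms unfolding cont_supp_def by auto
  then have "\<forall>x. max R S \<le> norm x \<longrightarrow> f x + g x = 0" by auto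
  then have "\<exists>R. \<forall>x. R \<le> norm x \<longrightarrow> f x + g x = 0" by blast
  moreover have "continuous_on UNIV (\<lambda>x. f x + g x)"
    using assms unfolding cont_supp_def by (auto intro!: continuous_intros)
  ultimately show ?thesis unfolding cont_supp_def by blast
qed

locale locally_finite_borel =
  fixes M :: "'a::euclidean_space measure"
  assumes sets_M [simp, measurable_cong]: "sets M = sets borel"
    and finite_ball: "emeasure M (ball x r) < top"
begin

lemma space_M [simp]: "space M = UNIV"
  using sets_eq_imp_space_eq[OF sets_M] by simp

abbreviation balls :: "nat \<Rightarrow> 'a set" where "balls j \<equiv> ball 0 (real j)"

lemma incseq_balls: "incseq balls"
  by (auto simp: incseq_def)

lemma balls_UNIV: "space M \<subseteq> (\<Union>j. balls j)"
  using reals_Archimedean2 by (fastforce simp: dist_norm)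

lemma cont_supp_bounded_supp: "f \<in> cont_supp \<Longrightarrow> f \<in> bounded_supp M balls"
proof -
  assume f: "f \<in> cont_supp"
  then obtain R where c: "continuous_on UNIV f" and R: "\<And>x. R \<le> norm x \<Longrightarrow> f x = 0" unfolding cont_supp_def by auto
  obtain j :: nat where j: "R \<le> real j" using real_arch_simple by blast
  have "bounded (f ` cball 0 (real j))"
    by (intro compact_imp_bounded compact_continuous_image continuous_on_subset[OF c]) auto
  then obtain B where "\<forall>y\<in>f ` cball 0 (real j). norm y \<le> B" unfolding bounded_iff by blast
  then have B: "\<And>x. norm x \<le> real j \<Longrightarrow> \<bar>f x\<bar> \<le> B" by auto
  have B0: "0 \<le> B" using B[of 0] by simp
  show ?thesis
  proof (rule bounded_suppI[of _ _ B _ j])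
    show "f \<in> borel_measurable M" using c by (simp add: borel_measurable_continuous_onI cong: measurable_cong_sets)
    show "\<bar>f x\<bar> \<le> B" for x using B[of x] R[of x] j B0 by (cases "norm x \<le> real j") auto
    show "f x = 0" if "x \<notin> balls j" for x using that R[of x] j by (simp add: dist_norm)
  qed
qed

lemma cont_supp_measurable: "f \<in> cont_supp \<Longrightarrow> f \<in> borel_measurable M"
  using cont_supp_bounded_supp unfolding bounded_supp_def by blast

text \<open>Cut down to a ball, \<open>M\<close> is a finite Borel measure and hence regular, so
  \<open>A\<close> lies between a compact \<open>C\<close> and an open \<open>V\<close> of nearly
  equal measure. A Urysohn function for this pair differs from the indicator of \<open>A\<close>
  only on \<open>V - C\<close>, and there by at most 1.\<close>

lemma cont_supp_indicator_approx:
  assumes A: "A \<in> sets borel" "A \<subseteq> balls j" and P: "0 < P" and e: "0 < e"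
  shows "\<exists>\<phi>\<in>cont_supp. Lp P M (\<lambda>x. \<phi> x - indicator A x) \<le> ennreal e"
proof -
  define N where "N = density M (indicator (balls j))"
  have sN: "sets N = sets borel" by (simp add: N_def)
  have eN: "emeasure N B = emeasure M (B \<inter> balls j)" if "B \<in> sets borel" for B
  proof -
    have "emeasure N B = (\<integral>\<^sup>+x. indicator (balls j) x * indicator B x \<partial>M)"
      unfolding N_def using that by (intro emeasure_density borel_measurable_indicator) auto
    also have "\<dots> = (\<integral>\<^sup>+x. indicator (B \<inter> balls j) x \<partial>M)"
      by (intro nn_integral_cong) (auto simp: indicator_def)
    also have "\<dots> = emeasure M (B \<inter> balls j)" using that by (intro nn_integral_indicator) auto
    finally show ?thesis .
  qed
  have fin: "emeasure N B < top" if "B \<in> sets borel" for B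
  proof -
    have "emeasure M (B \<inter> balls j) \<le> emeasure M (balls j)" using that by (intro emeasure_mono) auto
    then show ?thesis using eN[OF that] finite_ball[of 0 "real j"] by (auto intro: order_le_less_trans)
  qed
  have Nfin: "emeasure N (space N) \<noteq> \<infinity>"
    using fin[of UNIV] sets_eq_imp_space_eq[OF sN] by (simp add: less_top)
  \<comment> \<open>The set \<open>V - C\<close> will have measure at most \<open>2 * d\<close>,
    that is \<open>e powr P\<close>, whose P-th root is \<open>e\<close>.\<close>
  define d where "d = e powr P / 2"
  have d: "0 < d" using e by (simp add: d_def)
  have lt: "emeasure N A < emeasure N A + ennreal d"
    using fin[OF A(1)] d by (cases "emeasure N A") (auto simp: ennreal_plus[symmetric] ennreal_lessI simp del: ennreal_plus)
  obtain U where U: "A \<subseteq> U" "open U" "emeasure N U < emeasure N A + ennreal d"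
    using lt unfolding outer_regular[OF sN Nfin A(1)] INF_less_iff by auto
  obtain C where C: "C \<subseteq> A" "compact C" "emeasure N A \<le> emeasure N C + ennreal d"
  proof (cases "emeasure N A = 0")
    case True
    then show thesis using that[of "{}"] by simp
  next
    case False
    obtain a where a: "emeasure N A = ennreal a" "0 \<le> a" using fin[OF A(1)] by (cases "emeasure N A") auto
    have "ennreal (a - d) < emeasure N A" using a d False by (auto intro: ennreal_lessI)
    then obtain C where C: "C \<subseteq> A" "compact C" "ennreal (a - d) < emeasure N C"
      unfolding inner_regular[OF sN Nfin A(1)] less_SUP_iff by auto
    have "ennreal a \<le> ennreal (a - d) + ennreal d"
      using d a by (cases "d \<le> a") (auto simp: ennreal_plus[symmetric] ennreal_neg ennreal_leI simp del: ennreal_plus)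
    also have "\<dots> \<le> emeasure N C + ennreal d" using C(3) by (intro add_right_mono) simp
    finally show thesis using that[of C] C a by simp
  qed
  define V where "V = U \<inter> balls j"
  have V: "A \<subseteq> V" "open V" "V \<subseteq> balls j" using U A by (auto simp: V_def)
  have Cb: "C \<in> sets borel" using C(2) by (simp add: borel_compact)
  have Vb[measurable]: "V \<in> sets borel" using V(2) by simp
  have Vd: "emeasure M (V - C) \<le> ennreal (2 * d)"
  proof -
    have "emeasure N C + emeasure M (V - C) = emeasure N C + emeasure N (V - C)"
    proof -
      have "(V - C) \<inter> balls j = V - C" using V(3) by blast
      then show ?thesis using eN[of "V - C"] Cb by simp
    qed
    also have "\<dots> = emeasure N V" using C V Cb by (subst plus_emeasure) (auto simp: sN Un_absorb1)
    also have "\<dots> \<le> emeasure N U" using U by (intro emeasure_mono) (auto simp: V_def sN)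
    also have "\<dots> \<le> (emeasure N C + ennreal d) + ennreal d" using U(3) C(3) by (meson add_right_mono less_imp_le order_trans)
    also have "\<dots> = emeasure N C + ennreal (2 * d)" using d by (simp add: add.assoc ennreal_plus[symmetric] del: ennreal_plus)
    finally show ?thesis using fin[OF Cb] by (auto simp: ennreal_add_left_cancel_le)
  qed
  obtain \<phi> :: "'a \<Rightarrow> real" where \<phi>: "continuous_on UNIV \<phi>" "\<And>x. \<phi> x \<in> closed_segment 1 0"
    "\<And>x. x \<in> C \<Longrightarrow> \<phi> x = 1" "\<And>x. x \<in> - V \<Longrightarrow> \<phi> x = 0"
    using Urysohn[of C "- V" 1 0] compact_imp_closed[OF C(2)] V(2) C(1) V(1) by (auto simp: closed_Compl)
  have \<phi>01: "0 \<le> \<phi> x" "\<phi> x \<le> 1" for x using \<phi>(2)[of x] by (auto simp: closed_segment_eq_real_ivl)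
  show ?thesis
  proof (rule bexI)
    have "\<phi> x = 0" if "real j \<le> norm x" for x
    proof -
      have "x \<notin> balls j" using that by simp
      then show ?thesis using \<phi>(4)[of x] V(3) by blast
    qed
    then show "\<phi> \<in> cont_supp" using \<phi>(1) unfolding cont_supp_def by blast
    have "Lp P M (\<lambda>x. \<phi> x - indicator A x) \<le> ennreal 1 * epowr (emeasure M (V - C)) (1 / P)"
    proof (rule Lnorm_abs_bounded[OF P])
      show "\<bar>\<phi> x - indicator A x\<bar> \<le> 1" for x using \<phi>01[of x] by (auto simp: indicator_def)
      show "\<phi> x - indicator A x = 0" if "x \<notin> V - C" for x
        using that \<phi>(3,4)[of x] C(1) V(1) by (auto simp: indicator_def)
    qed (use Cb in simp)
    also have "\<dots> \<le> epowr (ennreal (2 * d)) (1 / P)" using Vd P by (simp add: epowr_mono)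
    also have "\<dots> = ennreal e" using e P by (simp add: d_def epowr_ennreal powr_powr)
    finally show "Lp P M (\<lambda>x. \<phi> x - indicator A x) \<le> ennreal e" .
  qed
qed

lemma cont_supp_dense:
  assumes f: "f \<in> bounded_supp M balls" and P: "1 \<le> P" and e: "0 < e"
  shows "\<exists>\<phi>\<in>cont_supp. Lp P M (\<lambda>x. \<phi> x - f x) \<le> ennreal e"
proof -
  have P0: "0 < P" using P by simp
  \<comment> \<open>The functions that can be approximated to any accuracy form a linear space
    containing the indicators of bounded Borel sets, hence also the simple function \<open>s\<close>
    below.\<close>
  define Ap where "Ap = {f \<in> borel_measurable M. \<forall>e>0. \<exists>\<phi>\<in>cont_supp. Lp P M (\<lambda>x. \<phi> x - f x) \<le> ennreal e}"
  have ApI: "A \<in> sets borel \<Longrightarrow> A \<subseteq> balls j \<Longrightarrow> (indicator A :: 'a \<Rightarrow> real) \<in> Ap" for A j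
    using cont_supp_indicator_approx[OF _ _ P0] by (auto simp: Ap_def)
  have ApC: "(\<lambda>x. c * f x) \<in> Ap" if f: "f \<in> Ap" for c :: real and f
  proof -
    have [measurable]: "f \<in> borel_measurable M" using f by (simp add: Ap_def)
    have "\<exists>\<phi>\<in>cont_supp. Lp P M (\<lambda>x. \<phi> x - c * f x) \<le> ennreal e" if e: "0 < e" for e
    proof -
      obtain \<phi> where \<phi>: "\<phi> \<in> cont_supp" "Lp P M (\<lambda>x. \<phi> x - f x) \<le> ennreal (e / (\<bar>c\<bar> + 1))"
      proof -
        have "0 < e / (\<bar>c\<bar> + 1)" using e by (intro divide_pos_pos) auto
        then show thesis using f that unfolding Ap_def by blast
      qed
      note [measurable] = cont_supp_measurable[OF \<phi>(1)]
      have "Lp P M (\<lambda>x. c * \<phi> x - c * f x) = ennreal \<bar>c\<bar> * Lp P M (\<lambda>x. \<phi> x - f x)"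
        using Lnorm_abs_cmult[OF P0, of "\<lambda>x. \<phi> x - f x" M c] by (simp add: right_diff_distrib)
      also have "\<dots> \<le> ennreal \<bar>c\<bar> * ennreal (e / (\<bar>c\<bar> + 1))" by (intro mult_left_mono \<phi>) simp
      also have "\<dots> \<le> ennreal e"
        using e by (subst ennreal_mult[symmetric]) (auto intro!: ennreal_leI simp: field_simps)
      finally show ?thesis using cont_supp_cmult[OF \<phi>(1)] by (rule bexI)
    qed
    then show ?thesis by (simp add: Ap_def)
  qed
  have ApA: "(\<lambda>x. f x + g x) \<in> Ap" if f: "f \<in> Ap" and g: "g \<in> Ap" for f g
  proof -
    have [measurable]: "f \<in> borel_measurable M" "g \<in> borel_measurable M" using f g by (simp_all add: Ap_def)
    have "\<exists>\<phi>\<in>cont_supp. Lp P M (\<lambda>x. \<phi> x - (f x + g x)) \<le> ennreal e" if e: "0 < e" for e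
    proof -
      have e8: "0 < e / 8" using e by simp
      obtain \<phi> where \<phi>: "\<phi> \<in> cont_supp" "Lp P M (\<lambda>x. \<phi> x - f x) \<le> ennreal (e / 8)"
        using f e8 unfolding Ap_def by blast
      obtain \<psi> where \<psi>: "\<psi> \<in> cont_supp" "Lp P M (\<lambda>x. \<psi> x - g x) \<le> ennreal (e / 8)"
        using g e8 unfolding Ap_def by blast
      note [measurable] = cont_supp_measurable[OF \<phi>(1)] cont_supp_measurable[OF \<psi>(1)]
      have "Lp P M (\<lambda>x. (\<phi> x + \<psi> x) - (f x + g x))
         \<le> 4 * (Lp P M (\<lambda>x. (\<phi> x + \<psi> x) - (f x + \<psi> x)) + Lp P M (\<lambda>x. (f x + \<psi> x) - (f x + g x)))"
        by (rule Lnorm_triangle[OF P]) auto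
      also have "\<dots> \<le> 4 * (ennreal (e / 8) + ennreal (e / 8))"
        using \<phi>(2) \<psi>(2) by (intro mult_left_mono add_mono) auto
      also have "\<dots> = ennreal e"
        using e by (simp add: ennreal_plus[symmetric] ennreal_mult[symmetric] ennreal_numeral[symmetric] del: ennreal_plus ennreal_numeral)
      finally show ?thesis using cont_supp_add[OF \<phi>(1) \<psi>(1)] by (rule bexI)
    qed
    then show ?thesis by (simp add: Ap_def)
  qed
  have ApS: "(\<lambda>x. \<Sum>i\<in>I. g i x) \<in> Ap" if "finite I" "\<And>i. i \<in> I \<Longrightarrow> g i \<in> Ap" for I :: "int set" and g
    using that
  proof (induction I)
    case empty
    show ?case using ApI[of "{}"] by (simp add: indicator_def[abs_def])
  next
    case (insert i I) then show ?case using ApA[of "g i" "\<lambda>x. \<Sum>i\<in>I. g i x"] by simp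
  qed
  obtain B j where fm[measurable]: "f \<in> borel_measurable M" and B: "\<And>x. \<bar>f x\<bar> \<le> B" and j: "\<And>x. x \<notin> balls j \<Longrightarrow> f x = 0"
    using f by (rule bounded_suppE) blast
  obtain m where m: "emeasure M (balls j) = ennreal m" "0 \<le> m" using finite_ball[of 0 "real j"] by (cases "emeasure M (balls j)") auto
  \<comment> \<open>Ensures \<open>d * m powr (1 / P) \<le> e / 8\<close>, the error of
    \<open>s\<close>. Together with a second error of \<open>e / 8\<close> and the constant 4 of
    \<open>Lnorm_triangle\<close> this adds up to \<open>e\<close>.\<close>
  define d where "d = e / 8 / (m powr (1 / P) + 1)"
  have d: "0 < d" using e by (auto simp: d_def add_nonneg_pos)
  obtain I :: "int set" and D where I: "finite I" and D[measurable]: "\<And>k. D k \<in> sets M"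
    and Df: "\<And>k x. k \<in> I \<Longrightarrow> x \<in> D k \<Longrightarrow> f x \<noteq> 0"
    and ap: "\<And>x. x \<in> space M \<Longrightarrow> \<bar>f x - (\<Sum>k\<in>I. (d * of_int k) * indicator (D k) x)\<bar> \<le> d"
    using bounded_uniform_simple[OF fm B d] by metis
  define s where "s x = (\<Sum>k\<in>I. (d * of_int k) * indicator (D k) x)" for x
  have Dj: "D k \<subseteq> balls j" if "k \<in> I" for k using Df[OF that] j by blast
  have sA: "s \<in> Ap" unfolding s_def[abs_def]
    by (rule ApS[OF I], rule ApC, rule ApI[of _ j]) (use D Dj in auto)
  then have [measurable]: "s \<in> borel_measurable M" by (simp add: Ap_def)
  have s0: "s x = 0" if "x \<notin> balls j" for x
  proof -
    have "x \<notin> D k" if "k \<in> I" for k using Dj[OF that] \<open>x \<notin> balls j\<close> by blast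
    then show ?thesis unfolding s_def by (intro sum.neutral) auto
  qed
  have "Lp P M (\<lambda>x. s x - f x) \<le> ennreal d * epowr (emeasure M (balls j)) (1 / P)"
    using ap j s0 by (intro Lnorm_abs_bounded P0) (auto simp: s_def abs_minus_commute)
  also have "\<dots> = ennreal (d * m powr (1 / P))" using m d by (simp add: epowr_ennreal ennreal_mult)
  also have "\<dots> \<le> ennreal (e / 8)"
  proof (intro ennreal_leI)
    have "m powr (1 / P) / (m powr (1 / P) + 1) \<le> 1" using add_nonneg_pos[of "m powr (1 / P)" 1] by simp
    from mult_left_mono[OF this, of "e / 8"] show "d * m powr (1 / P) \<le> e / 8" using e by (simp add: d_def)
  qed
  finally have sf: "Lp P M (\<lambda>x. s x - f x) \<le> ennreal (e / 8)" .
  have "0 < e / 8" using e by simp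
  then obtain \<phi> where \<phi>: "\<phi> \<in> cont_supp" "Lp P M (\<lambda>x. \<phi> x - s x) \<le> ennreal (e / 8)"
    using sA unfolding Ap_def by blast
  note [measurable] = cont_supp_measurable[OF \<phi>(1)]
  have "Lp P M (\<lambda>x. \<phi> x - f x)
      \<le> 4 * (Lp P M (\<lambda>x. \<phi> x - s x) + Lp P M (\<lambda>x. s x - f x))"
    by (rule Lnorm_triangle[OF P]) auto
  also have "\<dots> \<le> 4 * (ennreal (e / 8) + ennreal (e / 8))"
    using \<phi>(2) sf by (intro mult_left_mono add_mono) auto
  also have "\<dots> = ennreal e"
    using e by (simp add: ennreal_plus[symmetric] ennreal_mult[symmetric] ennreal_numeral[symmetric] del: ennreal_plus ennreal_numeral)
  finally show ?thesis using \<phi>(1) by (rule bexI)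
qed

text \<open>The functional is first extended by density to bounded Borel functions of bounded support.\<close>

theorem dense_functional:
  fixes \<iota> :: "('a \<Rightarrow> real) \<Rightarrow> 'a \<Rightarrow> real"
  assumes PQ: "1 < P" "1 / P + 1 / Q = 1"
    and X_add: "\<And>u v. u \<in> X \<Longrightarrow> v \<in> X \<Longrightarrow> (\<lambda>x. u x + v x) \<in> X"
    and X_mult: "\<And>c u. u \<in> X \<Longrightarrow> (\<lambda>x. c * u x) \<in> X"
    and \<iota>_add: "\<And>u v. \<iota> (\<lambda>x. u x + v x) = (\<lambda>x. \<iota> u x + \<iota> v x)"
    and \<iota>_mult: "\<And>c u. \<iota> (\<lambda>x. c * u x) = (\<lambda>x. c * \<iota> u x)"
    and XB: "\<And>u. u \<in> X \<Longrightarrow> \<iota> u \<in> bounded_supp M balls"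
    and dense: "\<And>f e. f \<in> bounded_supp M balls \<Longrightarrow> 0 < e \<Longrightarrow> \<exists>u\<in>X. Lp P M (\<lambda>x. \<iota> u x - f x) \<le> ennreal e"
    and T_add: "\<And>u v. u \<in> X \<Longrightarrow> v \<in> X \<Longrightarrow> T (\<lambda>x. u x + v x) = T u + T v"
    and T_mult: "\<And>c u. u \<in> X \<Longrightarrow> T (\<lambda>x. c * u x) = c * (T u :: real)"
    and bd: "\<And>u. u \<in> X \<Longrightarrow> ennreal \<bar>T u\<bar> \<le> ennreal C * Lp P M (\<iota> u)"
  obtains g where "g \<in> borel_measurable M" "Lp Q M g < top" "\<And>u. u \<in> X \<Longrightarrow> T u = (\<integral>x. \<iota> u x * g x \<partial>M)"
proof -
  have P: "1 \<le> P" "0 < P" using PQ by auto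
  let ?n = "Lp P M" and ?B = "bounded_supp M balls"
  have Bm: "f \<in> borel_measurable M" if "f \<in> ?B" for f using that by (simp add: bounded_supp_def)
  note Xm = Bm[OF XB]
  \<comment> \<open>One approximating sequence is fixed for every function; the extension
    \<open>S\<close> is defined as the limit of \<open>T\<close> along it.\<close>
  have "\<exists>\<Phi>. \<forall>f\<in>?B. \<forall>k::nat. \<Phi> f k \<in> X \<and> ?n (\<lambda>x. \<iota> (\<Phi> f k) x - f x) \<le> ennreal (1 / real (Suc k))"
  proof (rule bchoice, rule ballI, rule choice, rule allI)
    fix f k assume "f \<in> ?B"
    then show "\<exists>u. u \<in> X \<and> ?n (\<lambda>x. \<iota> u x - f x) \<le> ennreal (1 / real (Suc k))"
      using dense[of f "1 / real (Suc k)"] by auto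
  qed
  then obtain \<Phi> where \<Phi>: "\<And>f k. f \<in> ?B \<Longrightarrow> \<Phi> f k \<in> X"
    "\<And>f k. f \<in> ?B \<Longrightarrow> ?n (\<lambda>x. \<iota> (\<Phi> f k) x - f x) \<le> ennreal (1 / real (Suc k))" by blast
  have \<Phi>0: "(\<lambda>k. ?n (\<lambda>x. \<iota> (\<Phi> f k) x - f x)) \<longlonglongrightarrow> 0" if f: "f \<in> ?B" for f
    by (rule tendsto_sandwich[OF _ _ tendsto_const tendsto_ennreal_inverse_Suc]) (use \<Phi>(2)[OF f] in auto)
  have Tdiff: "ennreal \<bar>T u - T v\<bar> \<le> ennreal C * (4 * (?n (\<lambda>x. \<iota> u x - f x) + ?n (\<lambda>x. \<iota> v x - f x)))"
    if uv: "u \<in> X" "v \<in> X" and f: "f \<in> ?B" for u v f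
  proof -
    note v = X_mult[OF uv(2), of "-1"]
    have "\<iota> (\<lambda>x. u x + (-1) * v x) = (\<lambda>x. \<iota> u x - \<iota> v x)" unfolding \<iota>_add \<iota>_mult by simp
    moreover have "T (\<lambda>x. u x + (-1) * v x) = T u - T v" unfolding T_add[OF uv(1) v] T_mult[OF uv(2)] by simp
    ultimately have "ennreal \<bar>T u - T v\<bar> \<le> ennreal C * ?n (\<lambda>x. \<iota> u x - \<iota> v x)"
      using bd[OF X_add[OF uv(1) v]] by (simp only:)
    also have "\<dots> \<le> ennreal C * (4 * (?n (\<lambda>x. \<iota> u x - f x) + ?n (\<lambda>x. f x - \<iota> v x)))"
      by (intro mult_left_mono Lnorm_triangle[OF P(1)] Xm uv Bm f) simp
    finally show ?thesis by (simp only: abs_minus_commute)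
  qed
  define S where "S f = lim (\<lambda>k. T (\<Phi> f k))" for f
  have Tconv: "convergent (\<lambda>k. T (\<Phi> f k))" if f: "f \<in> ?B" for f
  proof (intro Cauchy_convergent metric_CauchyI)
    fix e :: real assume e: "0 < e"
    have "(\<lambda>k. ennreal C * (4 * (ennreal (1 / real (Suc k)) + ennreal (1 / real (Suc k))))) \<longlonglongrightarrow> ennreal C * (4 * (0 + 0))"
      by (intro ennreal_tendsto_cmult tendsto_add tendsto_ennreal_inverse_Suc) auto
    then have "\<forall>\<^sub>F k in sequentially. ennreal C * (4 * (ennreal (1 / real (Suc k)) + ennreal (1 / real (Suc k)))) < ennreal e"
      using e by (intro order_tendstoD(2)) auto
    then obtain K where K: "ennreal C * (4 * (ennreal (1 / real (Suc K)) + ennreal (1 / real (Suc K)))) < ennreal e"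
      unfolding eventually_sequentially by blast
    show "\<exists>K. \<forall>m\<ge>K. \<forall>l\<ge>K. dist (T (\<Phi> f m)) (T (\<Phi> f l)) < e"
    proof (intro exI allI impI)
      fix m l assume ml: "K \<le> m" "K \<le> l"
      have le: "?n (\<lambda>x. \<iota> (\<Phi> f m) x - f x) \<le> ennreal (1 / real (Suc K))" if "K \<le> m" for m
        by (rule order_trans[OF \<Phi>(2)[OF f]]) (use that in \<open>auto intro!: ennreal_leI divide_left_mono\<close>)
      have "ennreal \<bar>T (\<Phi> f m) - T (\<Phi> f l)\<bar> \<le> ennreal C * (4 * (ennreal (1 / real (Suc K)) + ennreal (1 / real (Suc K))))"
        by (rule order_trans[OF Tdiff[OF \<Phi>(1)[OF f] \<Phi>(1)[OF f] f]]) (intro mult_left_mono add_mono le ml; simp)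
      also note K
      finally show "dist (T (\<Phi> f m)) (T (\<Phi> f l)) < e" using e by (simp add: dist_real_def ennreal_less_iff)
    qed
  qed
  \<comment> \<open>The limit is the same along every sequence that converges in norm. Linearity of
    \<open>S\<close>, and its agreement with \<open>T\<close> on \<open>X\<close>, then follow by
    choosing a convenient sequence.\<close>
  have Slim: "(\<lambda>k. T (w k)) \<longlonglongrightarrow> S f"
    if f: "f \<in> ?B" and w: "\<And>k. w k \<in> X" "(\<lambda>k. ?n (\<lambda>x. \<iota> (w k) x - f x)) \<longlonglongrightarrow> 0" for f w
  proof -
    have "(\<lambda>k. ?n (\<lambda>x. \<iota> (w k) x - f x) + ?n (\<lambda>x. \<iota> (\<Phi> f k) x - f x)) \<longlonglongrightarrow> 0"
      using tendsto_add[OF w(2) \<Phi>0[OF f]] by simp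
    then have "(\<lambda>k. ennreal \<bar>(T (w k) - T (\<Phi> f k)) - 0\<bar>) \<longlonglongrightarrow> 0"
      by (rule ennreal_tendsto_0_le[where c="ennreal C * 4"])
         (use Tdiff[OF w(1) \<Phi>(1)[OF f] f] in \<open>simp_all add: mult.assoc ennreal_mult_less_top\<close>)
    then have "(\<lambda>k. T (w k) - T (\<Phi> f k)) \<longlonglongrightarrow> 0" by (rule tendsto_of_ennreal_dist)
    from tendsto_add[OF this, of "\<lambda>k. T (\<Phi> f k)" "S f"] show ?thesis
      using Tconv[OF f] by (simp add: convergent_LIMSEQ_iff S_def)
  qed
  have S\<iota>: "S (\<iota> u) = T u" if u: "u \<in> X" for u
    using Slim[OF XB[OF u], of "\<lambda>_. u"] u P by (auto simp: Lnorm_ennreal LIMSEQ_const_iff)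
  have Sadd: "S (\<lambda>x. f x + h x) = S f + S h" if fh: "f \<in> ?B" "h \<in> ?B" for f h
  proof -
    note [measurable] = Bm[OF fh(1)] Bm[OF fh(2)] Xm[OF \<Phi>(1)[OF fh(1)]] Xm[OF \<Phi>(1)[OF fh(2)]]
    have "(\<lambda>k. T (\<lambda>x. \<Phi> f k x + \<Phi> h k x)) \<longlonglongrightarrow> S (\<lambda>x. f x + h x)"
    proof (rule Slim)
      show "(\<lambda>x. f x + h x) \<in> ?B" by (rule bounded_supp_add[OF incseq_balls fh])
      show "(\<lambda>x. \<Phi> f k x + \<Phi> h k x) \<in> X" for k by (intro X_add \<Phi> fh)
      have "(\<lambda>k. ?n (\<lambda>x. \<iota> (\<Phi> f k) x - f x) + ?n (\<lambda>x. \<iota> (\<Phi> h k) x - h x)) \<longlonglongrightarrow> 0"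
        using tendsto_add[OF \<Phi>0[OF fh(1)] \<Phi>0[OF fh(2)]] by simp
      then show "(\<lambda>k. ?n (\<lambda>x. \<iota> (\<lambda>x. \<Phi> f k x + \<Phi> h k x) x - (f x + h x))) \<longlonglongrightarrow> 0"
      proof (rule ennreal_tendsto_0_le)
        fix k
        have "?n (\<lambda>x. (\<iota> (\<Phi> f k) x + \<iota> (\<Phi> h k) x) - (f x + h x))
            \<le> 4 * (?n (\<lambda>x. (\<iota> (\<Phi> f k) x + \<iota> (\<Phi> h k) x) - (f x + \<iota> (\<Phi> h k) x)) + ?n (\<lambda>x. (f x + \<iota> (\<Phi> h k) x) - (f x + h x)))"
          by (rule Lnorm_triangle[OF P(1)]) auto
        then show "?n (\<lambda>x. \<iota> (\<lambda>x. \<Phi> f k x + \<Phi> h k x) x - (f x + h x)) \<le> 4 * (?n (\<lambda>x. \<iota> (\<Phi> f k) x - f x) + ?n (\<lambda>x. \<iota> (\<Phi> h k) x - h x))"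
          by (simp add: \<iota>_add)
      qed simp
    qed
    moreover have "(\<lambda>k. T (\<lambda>x. \<Phi> f k x + \<Phi> h k x)) \<longlonglongrightarrow> S f + S h"
      using tendsto_add[OF Slim[OF fh(1) \<Phi>(1)[OF fh(1)] \<Phi>0[OF fh(1)]] Slim[OF fh(2) \<Phi>(1)[OF fh(2)] \<Phi>0[OF fh(2)]]]
      by (simp add: T_add \<Phi>(1) fh)
    ultimately show ?thesis by (rule LIMSEQ_unique)
  qed
  have Smult: "S (\<lambda>x. c * f x) = c * S f" if f: "f \<in> ?B" for c f
  proof -
    note [measurable] = Bm[OF f] Xm[OF \<Phi>(1)[OF f]]
    have "(\<lambda>k. T (\<lambda>x. c * \<Phi> f k x)) \<longlonglongrightarrow> S (\<lambda>x. c * f x)"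
    proof (rule Slim)
      show "(\<lambda>x. c * f x) \<in> ?B" by (rule bounded_supp_cmult[OF f])
      show "(\<lambda>x. c * \<Phi> f k x) \<in> X" for k by (intro X_mult \<Phi> f)
      show "(\<lambda>k. ?n (\<lambda>x. \<iota> (\<lambda>x. c * \<Phi> f k x) x - c * f x)) \<longlonglongrightarrow> 0"
        by (rule ennreal_tendsto_0_le[OF \<Phi>0[OF f], of _ "ennreal \<bar>c\<bar>"])
           (use Lnorm_abs_cmult[OF P(2), of "\<lambda>x. \<iota> (\<Phi> f _) x - f x" M c] in \<open>simp_all add: right_diff_distrib \<iota>_mult\<close>)
    qed
    moreover have "(\<lambda>k. T (\<lambda>x. c * \<Phi> f k x)) \<longlonglongrightarrow> c * S f"
      using tendsto_mult[OF tendsto_const[of c] Slim[OF f \<Phi>(1)[OF f] \<Phi>0[OF f]]]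
      by (simp add: T_mult \<Phi>(1) f)
    ultimately show ?thesis by (rule LIMSEQ_unique)
  qed
  have Sbd: "ennreal \<bar>S f\<bar> \<le> ennreal C * (4 * ?n f)" if f: "f \<in> ?B" for f
  proof -
    note [measurable] = Bm[OF f] Xm[OF \<Phi>(1)[OF f]]
    have l1: "(\<lambda>k. ennreal \<bar>T (\<Phi> f k)\<bar>) \<longlonglongrightarrow> ennreal \<bar>S f\<bar>"
      by (intro tendsto_ennrealI tendsto_rabs Slim[OF f \<Phi>(1)[OF f] \<Phi>0[OF f]])
    have l2: "(\<lambda>k. ennreal C * (4 * (?n (\<lambda>x. \<iota> (\<Phi> f k) x - f x) + ?n f))) \<longlonglongrightarrow> ennreal C * (4 * (0 + ?n f))"
      by (intro ennreal_tendsto_cmult tendsto_add \<Phi>0 f tendsto_const) auto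
    have l3: "ennreal \<bar>T (\<Phi> f k)\<bar> \<le> ennreal C * (4 * (?n (\<lambda>x. \<iota> (\<Phi> f k) x - f x) + ?n f))" for k
    proof -
      have "?n (\<iota> (\<Phi> f k)) \<le> 4 * (?n (\<lambda>x. \<iota> (\<Phi> f k) x - f x) + ?n f)"
        using Lnorm_triangle[OF P(1), of "\<iota> (\<Phi> f k)" M f "\<lambda>_. 0"] by simp
      then show ?thesis by (rule order_trans[OF bd[OF \<Phi>(1)[OF f]] mult_left_mono]) simp
    qed
    have "ennreal \<bar>S f\<bar> \<le> ennreal C * (4 * (0 + ?n f))" by (rule LIMSEQ_le[OF l1 l2]) (use l3 in blast)
    then show ?thesis by simp
  qed
  have ex: "\<exists>C. \<forall>u\<in>?B. (\<forall>x. x \<notin> balls j \<longrightarrow> u x = 0) \<longrightarrow> ennreal \<bar>S u\<bar> \<le> ennreal C * ?n u" for j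
    by (rule exI[of _ "\<bar>C\<bar> * 4"])
       (use Sbd in \<open>force simp: ennreal_mult mult.assoc intro: order_trans mult_right_mono ennreal_leI\<close>)
  obtain g where g[measurable]: "g \<in> borel_measurable M"
    and gI: "\<And>u. u \<in> ?B \<Longrightarrow> integrable M (\<lambda>x. u x * g x)"
    and gS: "\<And>u. u \<in> ?B \<Longrightarrow> S u = (\<integral>x. u x * g x \<partial>M)"
    by (rule bounded_supp_functional[of balls M S P, OF incseq_balls _ finite_ball Sadd Smult P(2) ex]) auto
  show thesis
  proof (rule that[OF g])
    have "Lp Q M g \<le> ennreal C * 4"
    proof (rule Lnorm_converse_Holder[OF PQ _ _ incseq_balls balls_UNIV finite_ball])
      fix \<psi> :: "'a \<Rightarrow> real" and i
      assume \<psi>[measurable]: "\<psi> \<in> borel_measurable M" and \<psi>0: "\<forall>x. 0 \<le> \<psi> x" and "\<exists>B. \<forall>x. \<psi> x \<le> B" "\<forall>x. x \<notin> balls i \<longrightarrow> \<psi> x = 0"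
      then obtain B where B: "\<And>x. \<psi> x \<le> B" "\<And>x. x \<notin> balls i \<Longrightarrow> \<psi> x = 0" by auto
      \<comment> \<open>Testing with the sign of \<open>g\<close> turns the bound for
        \<open>S\<close> into a bound for the integral of \<open>\<bar>g x\<bar> * \<psi> x\<close>,
        as the converse of Hoelder's inequality requires.\<close>
      define v where "v x = sgn (g x) * \<psi> x" for x
      have [measurable]: "v \<in> borel_measurable M" unfolding v_def by measurable
      have v: "v \<in> ?B"
        using \<psi>0 B by (intro bounded_suppI[of _ _ B _ i]) (auto simp: v_def abs_mult sgn_if intro: order_trans)
      have vg: "v x * g x = \<bar>g x\<bar> * \<psi> x" for x by (simp add: v_def abs_sgn mult_ac)
      have "(\<integral>\<^sup>+x. ennreal \<bar>g x\<bar> * ennreal (\<psi> x) \<partial>M) = (\<integral>\<^sup>+x. ennreal (v x * g x) \<partial>M)"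
        using \<psi>0 by (intro nn_integral_cong) (simp add: vg ennreal_mult)
      also have "\<dots> = ennreal (S v)"
        unfolding gS[OF v] using \<psi>0 by (intro nn_integral_eq_integral gI v) (auto simp: vg)
      also have "\<dots> \<le> ennreal \<bar>S v\<bar>" by (intro ennreal_leI) simp
      also have "\<dots> \<le> ennreal C * (4 * ?n v)" by (rule Sbd[OF v])
      also have "?n v \<le> Lnorm (ennreal P) M (\<lambda>x. ennreal (\<psi> x))"
        using \<psi>0 P by (intro Lnorm_mono_AE) (auto simp: v_def abs_mult sgn_if)
      finally show "(\<integral>\<^sup>+x. ennreal \<bar>g x\<bar> * ennreal (\<psi> x) \<partial>M) \<le> ennreal C * 4 * Lnorm (ennreal P) M (\<lambda>x. ennreal (\<psi> x))"
        by (simp add: mult.assoc mult_left_mono)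
    qed auto
    also have "\<dots> < top" by (simp add: ennreal_mult_less_top)
    finally show "Lp Q M g < top" .
    show "T u = (\<integral>x. \<iota> u x * g x \<partial>M)" if "u \<in> X" for u
      using gS[OF XB[OF that]] S\<iota>[OF that] by simp
  qed
qed

end

section \<open>The maximal function\<close>

text \<open>A stopping argument. The levels \<open>t\<close> at which the integral of
  \<open>k\<close> over \<open>{y. d y \<le> t}\<close> is at most \<open>c\<close> form a lower
  ray. Every point counted on the left has its level in that ray, and an increasing sequence of
  levels inside the ray exhausts these points, so monotone convergence keeps the bound
  \<open>c\<close>. Jumps of the integral do no harm, since only levels inside the ray are
  used.\<close>

lemma nn_integral_sublevel_le:
  fixes d :: "'a \<Rightarrow> real" and k :: "'a \<Rightarrow> ennreal"
  assumes [measurable]: "k \<in> borel_measurable M" "d \<in> borel_measurable M"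
  shows "(\<integral>\<^sup>+x. k x * (if (\<integral>\<^sup>+y. k y * (if d y \<le> d x then 1 else 0) \<partial>M) \<le> c then 1 else 0) \<partial>M) \<le> c"
proof -
  define \<Phi> where "\<Phi> t = (\<integral>\<^sup>+y. k y * (if d y \<le> t then 1 else 0) \<partial>M)" for t
  have mono: "\<Phi> s \<le> \<Phi> t" if "s \<le> t" for s t
    unfolding \<Phi>_def using that by (intro nn_integral_mono mult_left_mono) auto
  let ?S = "{t. \<Phi> t \<le> c}"
  have *: "(\<integral>\<^sup>+x. k x * (if \<Phi> (d x) \<le> c then 1 else 0) \<partial>M) \<le> c"
    if t: "incseq t" "\<And>i::nat. t i \<in> ?S" "\<And>s. s \<in> ?S \<Longrightarrow> \<exists>i. s \<le> t i" for t
  proof -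
    have "(\<integral>\<^sup>+x. k x * (if \<Phi> (d x) \<le> c then 1 else 0) \<partial>M) \<le> (\<integral>\<^sup>+x. (SUP i. k x * (if d x \<le> t i then 1 else 0)) \<partial>M)"
    proof (rule nn_integral_mono)
      fix x
      show "k x * (if \<Phi> (d x) \<le> c then 1 else 0) \<le> (SUP i. k x * (if d x \<le> t i then 1 else 0))"
      proof (cases "\<Phi> (d x) \<le> c")
        case True
        then obtain i where "d x \<le> t i" using t(3)[of "d x"] by auto
        then show ?thesis using True by (intro SUP_upper2[of i]) auto
      qed simp
    qed
    also have "\<dots> = (SUP i. \<Phi> (t i))" unfolding \<Phi>_def
      using t(1) by (intro nn_integral_monotone_convergence_SUP)
        (auto simp: incseq_def le_fun_def intro!: mult_left_mono intro: order_trans)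
    also have "\<dots> \<le> c" using t(2) by (intro SUP_least) auto
    finally show ?thesis .
  qed
  have "(\<integral>\<^sup>+x. k x * (if \<Phi> (d x) \<le> c then 1 else 0) \<partial>M) \<le> c"
  \<comment> \<open>The ray has a maximum, is empty, is bounded without a maximum, or is the whole
    line; the exhausting sequence is chosen accordingly.\<close>
  proof (cases "\<exists>t\<in>?S. \<forall>s\<in>?S. s \<le> t")
    case True
    then obtain t where "t \<in> ?S" "\<forall>s\<in>?S. s \<le> t" by blast
    then show ?thesis by (intro *[of "\<lambda>_. t"]) auto
  next
    case nomax: False
    show ?thesis
    proof (cases "?S = {}")
      case True
      then have "\<not> \<Phi> (d x) \<le> c" for x by auto
      then show ?thesis by simp
    next
      case ne: False
      show ?thesis
      proof (cases "bdd_above ?S")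
        case True
        let ?s = "Sup ?S"
        have le: "s \<le> ?s" if "s \<in> ?S" for s using cSup_upper[OF that True] .
        have lt: "s < ?s" if s: "s \<in> ?S" for s
        proof -
          obtain s' where "s' \<in> ?S" "\<not> s' \<le> s" using nomax s by auto
          then show ?thesis using le[of s'] by auto
        qed
        show ?thesis
        proof (rule *[of "\<lambda>i. ?s - 1 / real (Suc i)"])
          show "incseq (\<lambda>i. ?s - 1 / real (Suc i))"
            by (auto simp: incseq_def intro!: divide_left_mono)
          fix i
          have "?s - 1 / real (Suc i) < ?s" by simp
          then obtain s where "s \<in> ?S" "?s - 1 / real (Suc i) < s"
            using less_cSup_iff[OF ne True] by blast
          then show "?s - 1 / real (Suc i) \<in> ?S" using mono[of "?s - 1 / real (Suc i)" s] by auto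
        next
          fix s assume "s \<in> ?S"
          then have "0 < ?s - s" using lt by simp
          then obtain i where "1 / real (Suc i) < ?s - s" using nat_approx_posE by blast
          then show "\<exists>i. s \<le> ?s - 1 / real (Suc i)" by (intro exI[of _ i]) simp
        qed
      next
        case False
        have all: "t \<in> ?S" for t
        proof -
          obtain s where "s \<in> ?S" "t \<le> s" using False unfolding bdd_above_def by (metis linear)
          then show ?thesis using mono[of t s] by auto
        qed
        then show ?thesis
          by (intro *[of real]) (auto simp: incseq_def real_arch_simple)
      qed
    qed
  qed
  then show ?thesis by (simp add: \<Phi>_def)
qed

lemma measurable_pred_ball [measurable (raw)]:
  fixes f g :: "'b \<Rightarrow> 'a::{metric_space, second_countable_topology}"
  assumes [measurable]: "f \<in> borel_measurable M" "g \<in> borel_measurable M" "h \<in> borel_measurable M"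
  shows "Measurable.pred M (\<lambda>x. f x \<in> ball (g x) (h x))"
  unfolding mem_ball by measurable

text \<open>Normalised by \<open>\<rho> ^ n\<close> and not by the measure of the ball. With
  Lebesgue measure and Whitney averages for \<open>H\<close> this is the Carleson functional; with a
  measure of growth \<open>n\<close> it is a maximal function dominated by a multiple of the centred
  Hardy-Littlewood one. One definition serves both.\<close>

definition ball_sup :: "'a::euclidean_space measure \<Rightarrow> nat \<Rightarrow> ('a \<Rightarrow> ennreal) \<Rightarrow> 'a \<Rightarrow> ennreal" where
  "ball_sup M n H \<xi> = (SUP \<rho>\<in>{0<..}. (\<integral>\<^sup>+x\<in>ball \<xi> \<rho>. H x \<partial>M) / ennreal (\<rho> ^ n))"

lemma ball_sup_ge: "0 < \<rho> \<Longrightarrow> (\<integral>\<^sup>+x\<in>ball \<xi> \<rho>. H x \<partial>M) / ennreal (\<rho> ^ n) \<le> ball_sup M n H \<xi>"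
  unfolding ball_sup_def by (rule SUP_upper) auto

lemma ball_sup_le:
  "(\<And>\<rho>. 0 < \<rho> \<Longrightarrow> (\<integral>\<^sup>+x\<in>ball \<xi> \<rho>. H x \<partial>M) / ennreal (\<rho> ^ n) \<le> C) \<Longrightarrow> ball_sup M n H \<xi> \<le> C"
  unfolding ball_sup_def by (rule SUP_least) auto

lemma ball_integral_le:
  assumes "0 < \<rho>"
  shows "(\<integral>\<^sup>+x\<in>ball \<xi> \<rho>. H x \<partial>M) \<le> ennreal (\<rho> ^ n) * ball_sup M n H \<xi>"
proof -
  have "(\<integral>\<^sup>+x\<in>ball \<xi> \<rho>. H x \<partial>M) = ennreal (\<rho> ^ n) * ((\<integral>\<^sup>+x\<in>ball \<xi> \<rho>. H x \<partial>M) / ennreal (\<rho> ^ n))"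
    using assms by (subst mult.commute, subst ennreal_divide_times) (simp add: ennreal_divide_self)
  also have "\<dots> \<le> ennreal (\<rho> ^ n) * ball_sup M n H \<xi>" by (intro mult_left_mono ball_sup_ge assms) auto
  finally show ?thesis .
qed

text \<open>Lower semicontinuity: the integral over an open ball is the supremum of the integrals
  over smaller concentric balls, and a smaller ball still fits into the ball of the original radius
  about any nearby centre.\<close>

lemma open_ball_sup_superlevel:
  assumes "sets M = sets borel" and H: "H \<in> borel_measurable borel"
  shows "open {\<xi>. t < ball_sup M n H \<xi>}"
proof (unfold open_contains_ball, rule ballI)
  note [measurable_cong] = assms(1) note [measurable] = H
  fix \<xi> assume "\<xi> \<in> {\<xi>. t < ball_sup M n H \<xi>}"
  then obtain \<rho> where \<rho>: "0 < \<rho>" "t < (\<integral>\<^sup>+x\<in>ball \<xi> \<rho>. H x \<partial>M) / ennreal (\<rho> ^ n)"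
    unfolding ball_sup_def less_SUP_iff by auto
  \<comment> \<open>The offset 2 makes the first radius \<open>\<rho> / 2\<close> and hence
    positive.\<close>
  define r where "r k = \<rho> - \<rho> / real (k + 2)" for k :: nat
  have r: "0 < r k" "r k < \<rho>" for k using \<rho> by (auto simp: r_def field_simps add_pos_nonneg)
  have rinc: "r k \<le> r l" if "k \<le> l" for k l
    using \<rho> that by (auto simp: r_def intro!: divide_left_mono)
  have "indicator (ball \<xi> \<rho>) x \<le> (SUP k. indicator (ball \<xi> (r k)) x :: ennreal)" for x
  proof (cases "x \<in> ball \<xi> \<rho>")
    case True
    then have "0 < (\<rho> - dist \<xi> x) / \<rho>" using \<rho> by simp
    then obtain k where k: "1 / real (Suc k) < (\<rho> - dist \<xi> x) / \<rho>" using nat_approx_posE by blast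
    have "1 / real (k + 2) \<le> 1 / real (Suc k)" by (intro divide_left_mono) auto
    then have "1 / real (k + 2) < (\<rho> - dist \<xi> x) / \<rho>" using k by linarith
    then have "x \<in> ball \<xi> (r k)" using \<rho> by (simp add: r_def field_simps)
    then show ?thesis by (intro SUP_upper2[of k]) (auto simp: indicator_def)
  qed simp
  then have "(\<integral>\<^sup>+x\<in>ball \<xi> \<rho>. H x \<partial>M) \<le> (\<integral>\<^sup>+x. (SUP k. H x * indicator (ball \<xi> (r k)) x) \<partial>M)"
    by (intro nn_integral_mono) (simp add: SUP_mult_left_ennreal[symmetric] mult_left_mono)
  also have "\<dots> = (SUP k. \<integral>\<^sup>+x\<in>ball \<xi> (r k). H x \<partial>M)"
  proof (rule nn_integral_monotone_convergence_SUP)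
    show "incseq (\<lambda>k x. H x * indicator (ball \<xi> (r k)) x)"
    proof (rule incseq_SucI, rule le_funI)
      fix k x
      have "ball \<xi> (r k) \<subseteq> ball \<xi> (r (Suc k))" using rinc[of k "Suc k"] by auto
      then show "H x * indicator (ball \<xi> (r k)) x \<le> H x * indicator (ball \<xi> (r (Suc k))) x"
        by (intro mult_left_mono) (auto simp: indicator_def)
    qed
  qed measurable
  finally have "t < (SUP k. \<integral>\<^sup>+x\<in>ball \<xi> (r k). H x \<partial>M) / ennreal (\<rho> ^ n)"
    using \<rho> by (meson divide_right_mono_ennreal order_less_le_trans)
  also have "\<dots> = (SUP k. (\<integral>\<^sup>+x\<in>ball \<xi> (r k). H x \<partial>M) / ennreal (\<rho> ^ n))"
    unfolding divide_ennreal_def by (rule SUP_mult_right_ennreal)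
  finally obtain k where k: "t < (\<integral>\<^sup>+x\<in>ball \<xi> (r k). H x \<partial>M) / ennreal (\<rho> ^ n)"
    unfolding less_SUP_iff by auto
  show "\<exists>e>0. ball \<xi> e \<subseteq> {\<xi>. t < ball_sup M n H \<xi>}"
  proof (intro exI conjI)
    show "0 < \<rho> - r k" using r[of k] by simp
    show "ball \<xi> (\<rho> - r k) \<subseteq> {\<xi>. t < ball_sup M n H \<xi>}"
    proof
      fix \<zeta> assume \<zeta>: "\<zeta> \<in> ball \<xi> (\<rho> - r k)"
      have sub: "ball \<xi> (r k) \<subseteq> ball \<zeta> \<rho>"
      proof
        fix y assume "y \<in> ball \<xi> (r k)"
        with \<zeta> show "y \<in> ball \<zeta> \<rho>" using dist_triangle[of \<zeta> y \<xi>] by (simp add: dist_commute)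
      qed
      have "(\<integral>\<^sup>+x\<in>ball \<xi> (r k). H x \<partial>M) / ennreal (\<rho> ^ n) \<le> (\<integral>\<^sup>+x\<in>ball \<zeta> \<rho>. H x \<partial>M) / ennreal (\<rho> ^ n)"
        using sub by (intro divide_right_mono_ennreal nn_integral_mono mult_left_mono) (auto simp: indicator_def)
      also have "\<dots> \<le> ball_sup M n H \<zeta>" by (rule ball_sup_ge[OF \<rho>(1)])
      finally show "\<zeta> \<in> {\<xi>. t < ball_sup M n H \<xi>}" using k by auto
    qed
  qed
qed

lemma borel_measurable_of_open_superlevel:
  fixes f :: "'a::topological_space \<Rightarrow> ennreal"
  assumes "\<And>t. open {x. t < f x}" shows "f \<in> borel_measurable borel"
  by (rule borel_measurableI_greater) (use assms in simp)

lemma borel_measurable_ball_sup: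
  assumes "sets M = sets borel" "H \<in> borel_measurable borel"
  shows "ball_sup M n H \<in> borel_measurable borel"
  by (intro borel_measurable_of_open_superlevel open_ball_sup_superlevel assms)

text \<open>For finite \<open>y\<close> this is the integral of a power from 0 to \<open>y\<close>.
  For \<open>y = top\<close> the integral dominates those of all finite levels and therefore
  diverges.\<close>

lemma epowr_layer_cake:
  assumes \<theta>: "0 < \<theta>"
  shows "epowr y \<theta> = (\<integral>\<^sup>+t. ennreal (\<theta> * t powr (\<theta> - 1)) * (if 0 < t \<and> ennreal t < y then 1 else 0) \<partial>lborel)"
    (is "_ = ?L y")
proof -
  have Lreal: "?L (ennreal b) = ennreal (b powr \<theta>)" if b: "0 \<le> b" for b
  proof -
    let ?f = "\<lambda>t. if t \<in> {0..b} then \<theta> * t powr (\<theta> - 1) else 0"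
    have "((\<lambda>t. t powr (\<theta> - 1)) has_integral (b powr (\<theta> - 1 + 1) / (\<theta> - 1 + 1))) {0..b}"
      using \<theta> b by (intro has_integral_powr_from_0) auto
    from has_integral_mult_right[OF this, of \<theta>]
    have "((\<lambda>t. \<theta> * t powr (\<theta> - 1)) has_integral (b powr \<theta>)) {0..b}" using \<theta> by simp
    then have "(?f has_integral (b powr \<theta>)) UNIV" by (subst has_integral_restrict_UNIV)
    then have "integral\<^sup>N lborel ?f = b powr \<theta>"
      using \<theta> by (intro nn_integral_has_integral_lborel) auto
    moreover have "?L (ennreal b) = integral\<^sup>N lborel ?f"
    proof (rule nn_integral_cong_AE)
      have "AE t in lborel. t \<noteq> b" by (rule AE_lborel_singleton)
      then show "AE t in lborel. ennreal (\<theta> * t powr (\<theta> - 1)) * (if 0 < t \<and> ennreal t < ennreal b then 1 else 0) = ennreal (?f t)"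
        by eventually_elim (use b in \<open>auto simp: ennreal_less_iff\<close>)
    qed
    ultimately show ?thesis by simp
  qed
  show ?thesis
  proof (cases y)
    case (real b)
    then show ?thesis using Lreal[of b] by (simp add: epowr_ennreal)
  next
    case top
    have ge: "ennreal (b powr \<theta>) \<le> ?L top" if "0 \<le> b" for b
      unfolding Lreal[OF that, symmetric] by (intro nn_integral_mono mult_left_mono) auto
    have "of_nat k \<le> ?L top" for k :: nat
      using ge[of "real k powr (1 / \<theta>)"] \<theta> by (cases "k = 0") (auto simp: powr_powr ennreal_of_nat_eq_real_of_nat)
    then have "?L top = top"
    proof (rule_tac ccontr)
      assume all: "\<And>k. of_nat k \<le> ?L top" and "?L top \<noteq> top"
      then have "?L top < top" by (simp only: top.not_eq_extremum)
      then obtain k where "?L top < of_nat k" using ennreal_Ex_less_of_nat by auto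
      then show False using all[of k] by simp
    qed
    then show ?thesis using top by simp
  qed
qed

text \<open>Growth is assumed at every centre, on the support of \<open>M\<close> or off it, because
  shadows and dilated balls are centred at points of the domain.\<close>

locale growth_measure = 
  fixes M :: "'a::euclidean_space measure" and n :: nat and C\<^sub>1 :: real
  assumes sets_M [simp, measurable_cong]: "sets M = sets borel"
    and n_pos: "1 \<le> n" and C\<^sub>1: "0 < C\<^sub>1"
    and growth: "\<And>z \<rho>. 0 < \<rho> \<Longrightarrow> emeasure M (ball z \<rho>) \<le> ennreal (C\<^sub>1 * \<rho> ^ n)"
begin

sublocale locally_finite_borel M
proof
  show "emeasure M (ball x r) < top" for x r
    using growth[of r x] by (cases "0 < r") (auto intro: order_le_less_trans simp: ball_empty)
qed simp

sublocale sigma_finite_measure M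
proof
  show "\<exists>A. countable A \<and> A \<subseteq> sets M \<and> \<Union> A = space M \<and> (\<forall>a\<in>A. emeasure M a \<noteq> \<infinity>)"
    by (rule exI[of _ "range balls"]) (use balls_UNIV finite_ball in \<open>auto simp: less_top\<close>)
qed

abbreviation "maximal \<equiv> ball_sup M n"

lemma borel_measurable_maximal [measurable]: "f \<in> borel_measurable borel \<Longrightarrow> maximal f \<in> borel_measurable borel"
  by (rule borel_measurable_ball_sup) auto

text \<open>Vitali covering. The measure of a dilated ball is compared with the power
  \<open>r ^ n\<close> of its radius, which the choice of the balls bounds by the integral of
  \<open>f\<close>; the growth bound thus does the work of a doubling condition.\<close>

lemma maximal_weak:
  assumes f[measurable]: "f \<in> borel_measurable borel" and t: "0 < t"
  shows "ennreal t * emeasure M {\<xi>. ennreal t < maximal f \<xi>} \<le> ennreal (C\<^sub>1 * 5 ^ n) * (\<integral>\<^sup>+x. f x \<partial>M)"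
proof (cases "(\<integral>\<^sup>+x. f x \<partial>M) = top")
  case True
  then show ?thesis using C\<^sub>1 by (simp add: ennreal_mult_top)
next
  case False
  then obtain F where F: "(\<integral>\<^sup>+x. f x \<partial>M) = ennreal F" "0 \<le> F" by (cases "\<integral>\<^sup>+x. f x \<partial>M") auto
  let ?S = "{\<xi>. ennreal t < maximal f \<xi>}"
  have S[measurable]: "?S \<in> sets borel"
    by (intro borel_open open_ball_sup_superlevel sets_M f)
  have "\<exists>\<rho>>0. ennreal (t * \<rho> ^ n) < (\<integral>\<^sup>+x\<in>ball \<xi> \<rho>. f x \<partial>M)" if "\<xi> \<in> ?S" for \<xi>
  proof -
    from that have "\<exists>\<rho>\<in>{0<..}. ennreal t < (\<integral>\<^sup>+x\<in>ball \<xi> \<rho>. f x \<partial>M) / ennreal (\<rho> ^ n)"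
      by (simp only: mem_Collect_eq ball_sup_def less_SUP_iff)
    then obtain \<rho> where \<rho>: "0 < \<rho>" "ennreal t < (\<integral>\<^sup>+x\<in>ball \<xi> \<rho>. f x \<partial>M) / ennreal (\<rho> ^ n)"
      by auto
    then have "ennreal t * ennreal (\<rho> ^ n) < (\<integral>\<^sup>+x\<in>ball \<xi> \<rho>. f x \<partial>M)"
    proof (rule_tac ccontr)
      assume *: "\<not> ennreal t * ennreal (\<rho> ^ n) < (\<integral>\<^sup>+x\<in>ball \<xi> \<rho>. f x \<partial>M)"
      have "(\<integral>\<^sup>+x\<in>ball \<xi> \<rho>. f x \<partial>M) / ennreal (\<rho> ^ n) \<le> (ennreal t * ennreal (\<rho> ^ n)) / ennreal (\<rho> ^ n)"
        using * by (intro divide_right_mono_ennreal) simp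
      also have "\<dots> = ennreal t" using \<open>0 < \<rho>\<close> by (intro mult_divide_eq_ennreal) auto
      finally show False using \<rho>(2) by simp
    qed
    then show ?thesis using \<rho> t by (auto simp: ennreal_mult)
  qed
  then obtain r where r: "\<And>\<xi>. \<xi> \<in> ?S \<Longrightarrow> 0 < r \<xi>"
    "\<And>\<xi>. \<xi> \<in> ?S \<Longrightarrow> ennreal (t * r \<xi> ^ n) < (\<integral>\<^sup>+x\<in>ball \<xi> (r \<xi>). f x \<partial>M)" by metis
  \<comment> \<open>The covering lemma needs bounded radii. For radii at least 1 one has
    \<open>r \<xi> \<le> r \<xi> ^ n\<close>, and the finite total integral of \<open>f\<close>
    bounds the right-hand side by \<open>F / t\<close>.\<close>
  have rb: "r \<xi> \<le> max 1 (F / t)" if "\<xi> \<in> ?S" for \<xi>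
  proof (cases "1 \<le> r \<xi>")
    case True
    have "ennreal (t * r \<xi> ^ n) < (\<integral>\<^sup>+x\<in>ball \<xi> (r \<xi>). f x \<partial>M)" by (rule r(2)[OF that])
    also have "\<dots> \<le> (\<integral>\<^sup>+x. f x \<partial>M)" by (intro nn_integral_mono) (auto simp: indicator_def)
    also have "\<dots> = ennreal F" by (rule F)
    finally have "t * r \<xi> ^ n < F" using t r(1)[OF that] by (simp add: ennreal_less_iff)
    moreover have "r \<xi> \<le> r \<xi> ^ n" using True n_pos self_le_power[of "r \<xi>" n] by simp
    then have "t * r \<xi> \<le> t * r \<xi> ^ n" using t by simp
    ultimately have "t * r \<xi> \<le> F" by simp
    then have "r \<xi> \<le> F / t" using t by (simp add: field_simps)
    then show ?thesis by simp
  qed simp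
  obtain C where C: "countable C" "C \<subseteq> ?S"
    "pairwise (\<lambda>i j. disjnt (ball i (r i)) (ball j (r j))) C"
    "?S \<subseteq> (\<Union>i\<in>C. ball i (5 * r i))"
  proof (rule Vitali_covering_lemma_balls[where S="?S" and K="?S" and a="\<lambda>i. i" and r=r and B="max 1 (F / t)"])
    show "?S \<subseteq> (\<Union>i\<in>?S. ball i (r i))" using r(1) by auto
    show "0 < r i \<and> r i \<le> max 1 (F / t)" if "i \<in> ?S" for i using r(1)[OF that] rb[OF that] by blast
  qed blast
  have "emeasure M ?S = (\<integral>\<^sup>+x. indicator ?S x \<partial>M)" by simp
  also have "\<dots> \<le> (\<integral>\<^sup>+x. (\<integral>\<^sup>+i. indicator (ball i (5 * r i)) x \<partial>count_space C) \<partial>M)"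
  proof (rule nn_integral_mono)
    fix x
    show "indicator ?S x \<le> (\<integral>\<^sup>+i. indicator (ball i (5 * r i)) x \<partial>count_space C)"
    proof (cases "x \<in> ?S")
      case True
      then obtain i where i: "i \<in> C" "x \<in> ball i (5 * r i)" using C(4) by blast
      then have "indicator ?S x \<le> (indicator (ball i (5 * r i)) x :: ennreal)" by (simp add: indicator_def)
      also have "\<dots> \<le> (\<integral>\<^sup>+i. indicator (ball i (5 * r i)) x \<partial>count_space C)"
        by (rule nn_integral_ge_point[OF i(1)])
      finally show ?thesis .
    qed simp
  qed
  also have "\<dots> = (\<integral>\<^sup>+i. \<integral>\<^sup>+x. indicator (ball i (5 * r i)) x \<partial>M \<partial>count_space C)"
    by (rule nn_integral_count_space_nn_integral[OF C(1)]) auto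
  also have "\<dots> = (\<integral>\<^sup>+i. emeasure M (ball i (5 * r i)) \<partial>count_space C)" by simp
  finally have "ennreal t * emeasure M ?S \<le> ennreal t * (\<integral>\<^sup>+i. emeasure M (ball i (5 * r i)) \<partial>count_space C)"
    by (rule mult_left_mono) simp
  also have "\<dots> = (\<integral>\<^sup>+i. ennreal t * emeasure M (ball i (5 * r i)) \<partial>count_space C)"
    by (rule nn_integral_cmult[symmetric]) simp
  also have "\<dots> \<le> (\<integral>\<^sup>+i. ennreal (C\<^sub>1 * 5 ^ n) * (\<integral>\<^sup>+x\<in>ball i (r i). f x \<partial>M) \<partial>count_space C)"
  proof (rule nn_integral_mono)
    fix i assume "i \<in> space (count_space C)"
    then have i: "i \<in> ?S" using C(2) by auto
    have "ennreal t * emeasure M (ball i (5 * r i)) \<le> ennreal t * ennreal (C\<^sub>1 * (5 * r i) ^ n)"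
      using r(1)[OF i] by (intro mult_left_mono growth) auto
    also have "\<dots> = ennreal (C\<^sub>1 * 5 ^ n) * ennreal (t * r i ^ n)"
      using t C\<^sub>1 r(1)[OF i] by (simp add: ennreal_mult[symmetric] power_mult_distrib mult_ac)
    also have "\<dots> \<le> ennreal (C\<^sub>1 * 5 ^ n) * (\<integral>\<^sup>+x\<in>ball i (r i). f x \<partial>M)"
      using r(2)[OF i] by (intro mult_left_mono) auto
    finally show "ennreal t * emeasure M (ball i (5 * r i)) \<le> ennreal (C\<^sub>1 * 5 ^ n) * (\<integral>\<^sup>+x\<in>ball i (r i). f x \<partial>M)" .
  qed
  also have "\<dots> = ennreal (C\<^sub>1 * 5 ^ n) * (\<integral>\<^sup>+i. (\<integral>\<^sup>+x\<in>ball i (r i). f x \<partial>M) \<partial>count_space C)"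
    by (rule nn_integral_cmult) simp
  also have "(\<integral>\<^sup>+i. (\<integral>\<^sup>+x\<in>ball i (r i). f x \<partial>M) \<partial>count_space C) = (\<integral>\<^sup>+i. emeasure (density M f) (ball i (r i)) \<partial>count_space C)"
    by (intro nn_integral_cong) (simp add: emeasure_density)
  also have "\<dots> = emeasure (density M f) (\<Union>i\<in>C. ball i (r i))"
    using C(1,3) by (intro emeasure_UN_countable[symmetric]) (auto simp: disjoint_family_on_def pairwise_def disjnt_def)
  also have "\<dots> \<le> emeasure (density M f) (space (density M f))" by (rule emeasure_space)
  also have "\<dots> = (\<integral>\<^sup>+x. f x \<partial>M)" by (simp add: emeasure_density)
  finally show ?thesis by (simp add: mult_left_mono)
qed

text \<open>Marcinkiewicz interpolation between the weak type bound and the trivial bound for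
  bounded functions, carried out with the layer-cake formula.\<close>

lemma maximal_strong:
  assumes s: "1 < s"
  shows "\<exists>K\<ge>0. \<forall>f\<in>borel_measurable borel. Lnorm (ennreal s) M (maximal f) \<le> ennreal K * Lnorm (ennreal s) M f"
proof -
  \<comment> \<open>With \<open>B = 2 * C\<^sub>1\<close>, values of \<open>f\<close> below
    \<open>t / B\<close> contribute at most \<open>t / 2\<close> to the maximal function.
    \<open>A\<close> is the weak type constant at level \<open>t / 2\<close>, and
    \<open>s / (s - 1)\<close> arises when the layer-cake weight of exponent \<open>s\<close>,
    divided by \<open>t\<close>, is rewritten as the weight of exponent
    \<open>s - 1\<close>.\<close>
  define B where "B = 2 * C\<^sub>1"
  define A where "A = 2 * C\<^sub>1 * 5 ^ n"
  define L where "L = A * (s / (s - 1))"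
  define K where "K = L * B powr (s - 1)"
  have AB: "0 < A" "0 < B" "0 < L" using C\<^sub>1 s by (auto simp: A_def B_def L_def)
  have K0: "0 \<le> K" using AB s by (simp add: K_def)
  have main: "(\<integral>\<^sup>+\<xi>. epowr (maximal f \<xi>) s \<partial>M) \<le> ennreal K * (\<integral>\<^sup>+\<xi>. epowr (f \<xi>) s \<partial>M)"
    if f[measurable]: "f \<in> borel_measurable borel" for f
  proof -
    interpret L: pair_sigma_finite lborel M by unfold_locales
    define h where "h t \<xi> = (if ennreal t < ennreal B * f \<xi> then 1 else 0 :: ennreal)" for t \<xi>
    define Z where "Z t = {\<xi>. ennreal t < maximal f \<xi>}" for t
    have hm[measurable]: "(\<lambda>(t, \<xi>). h t \<xi>) \<in> borel_measurable (borel \<Otimes>\<^sub>M borel)" unfolding h_def by measurable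
    have Zm[measurable]: "Z t \<in> sets borel" for t
      using open_ball_sup_superlevel[OF sets_M f, of "ennreal t" n] by (simp add: Z_def)
    \<comment> \<open>The weak type bound is applied to \<open>f1\<close>, the part of
      \<open>f\<close> above \<open>t / B\<close>, at half the level.\<close>
    have lev: "emeasure M (Z t) \<le> ennreal (A / t) * (\<integral>\<^sup>+\<xi>. f \<xi> * h t \<xi> \<partial>M)" if t: "0 < t" for t
    proof -
      define f1 where "f1 \<xi> = f \<xi> * h t \<xi>" for \<xi>
      have f1[measurable]: "f1 \<in> borel_measurable borel" unfolding f1_def by measurable
      have le: "f \<xi> \<le> f1 \<xi> + ennreal (t / B)" for \<xi>
      proof (cases "ennreal t < ennreal B * f \<xi>")
        case False
        then have "ennreal B * f \<xi> \<le> ennreal B * ennreal (t / B)" using AB t by (simp add: ennreal_mult[symmetric])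
        then have "f \<xi> \<le> ennreal (t / B)" by (rule ennreal_mult_left_cancel_le[OF AB(2)])
        then show ?thesis by (simp add: add_increasing)
      qed (simp add: f1_def h_def)
      have "maximal f \<xi> \<le> maximal f1 \<xi> + ennreal (t / 2)" for \<xi>
      proof (rule ball_sup_le)
        fix \<rho> :: real assume \<rho>: "0 < \<rho>"
        let ?I = "\<lambda>f. \<integral>\<^sup>+x\<in>ball \<xi> \<rho>. f x \<partial>M"
        have "?I f \<le> (\<integral>\<^sup>+x. f1 x * indicator (ball \<xi> \<rho>) x + ennreal (t / B) * indicator (ball \<xi> \<rho>) x \<partial>M)"
          using le by (intro nn_integral_mono) (simp add: distrib_right[symmetric] mult_right_mono)
        also have "\<dots> = ?I f1 + ennreal (t / B) * emeasure M (ball \<xi> \<rho>)"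
          by (subst nn_integral_add) (auto simp: nn_integral_cmult_indicator)
        also have "\<dots> \<le> ?I f1 + ennreal (t / B) * ennreal (C\<^sub>1 * \<rho> ^ n)"
          by (intro add_left_mono mult_left_mono growth \<rho>) auto
        also have "ennreal (t / B) * ennreal (C\<^sub>1 * \<rho> ^ n) = ennreal (t / 2) * ennreal (\<rho> ^ n)"
          using C\<^sub>1 t \<rho> by (simp add: ennreal_mult[symmetric] B_def)
        finally have "?I f / ennreal (\<rho> ^ n) \<le> (?I f1 + ennreal (t / 2) * ennreal (\<rho> ^ n)) / ennreal (\<rho> ^ n)"
          by (rule divide_right_mono_ennreal)
        also have "\<dots> = ?I f1 / ennreal (\<rho> ^ n) + ennreal (t / 2)"
          using \<rho> by (simp add: add_divide_distrib_ennreal mult_divide_eq_ennreal)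
        also have "\<dots> \<le> maximal f1 \<xi> + ennreal (t / 2)" by (intro add_right_mono ball_sup_ge \<rho>)
        finally show "?I f / ennreal (\<rho> ^ n) \<le> maximal f1 \<xi> + ennreal (t / 2)" .
      qed
      then have sub: "Z t \<subseteq> {\<xi>. ennreal (t / 2) < maximal f1 \<xi>}"
        unfolding Z_def
      proof safe
        fix \<xi> assume "ennreal t < maximal f \<xi>" "\<And>\<xi>. maximal f \<xi> \<le> maximal f1 \<xi> + ennreal (t / 2)"
        then have "ennreal (t / 2) + ennreal (t / 2) < maximal f1 \<xi> + ennreal (t / 2)"
          using t by (simp add: ennreal_plus[symmetric] del: ennreal_plus) (meson order_less_le_trans)
        then show "ennreal (t / 2) < maximal f1 \<xi>" by (meson add_right_mono not_le)
      qed
      have "ennreal (t / 2) * emeasure M (Z t) \<le> ennreal (t / 2) * emeasure M {\<xi>. ennreal (t / 2) < maximal f1 \<xi>}"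
        using sub open_ball_sup_superlevel[OF sets_M f1, of "ennreal (t / 2)" n] by (intro mult_left_mono emeasure_mono) auto
      also have "\<dots> \<le> ennreal (C\<^sub>1 * 5 ^ n) * (\<integral>\<^sup>+x. f1 x \<partial>M)"
        using t by (intro maximal_weak f1) auto
      also have "\<dots> = ennreal (t / 2) * (ennreal (A / t) * (\<integral>\<^sup>+x. f1 x \<partial>M))"
        using t C\<^sub>1 by (simp add: mult.assoc[symmetric] ennreal_mult[symmetric] A_def)
      finally show ?thesis unfolding f1_def by (rule ennreal_mult_left_cancel_le[rotated]) (use t in simp)
    qed
    let ?d = "\<lambda>t. ennreal ((s - 1) * t powr (s - 1 - 1))"
    have "(\<integral>\<^sup>+\<xi>. epowr (maximal f \<xi>) s \<partial>M)
      = (\<integral>\<^sup>+\<xi>. \<integral>\<^sup>+t. ennreal (s * t powr (s - 1)) * (if 0 < t \<and> ennreal t < maximal f \<xi> then 1 else 0) \<partial>lborel \<partial>M)"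
      using s by (intro nn_integral_cong epowr_layer_cake) auto
    also have "\<dots> = (\<integral>\<^sup>+t. \<integral>\<^sup>+\<xi>. ennreal (s * t powr (s - 1)) * (if 0 < t \<and> ennreal t < maximal f \<xi> then 1 else 0) \<partial>M \<partial>lborel)"
      by (rule L.Fubini') measurable
    also have "\<dots> \<le> (\<integral>\<^sup>+t. \<integral>\<^sup>+\<xi>. ennreal L * f \<xi> * (?d t * (if 0 < t \<and> ennreal t < ennreal B * f \<xi> then 1 else 0)) \<partial>M \<partial>lborel)"
    proof (rule nn_integral_mono)
      fix t :: real
      show "(\<integral>\<^sup>+\<xi>. ennreal (s * t powr (s - 1)) * (if 0 < t \<and> ennreal t < maximal f \<xi> then 1 else 0) \<partial>M)
         \<le> (\<integral>\<^sup>+\<xi>. ennreal L * f \<xi> * (?d t * (if 0 < t \<and> ennreal t < ennreal B * f \<xi> then 1 else 0)) \<partial>M)"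
      proof (cases "0 < t")
        case t: True
        have "(\<integral>\<^sup>+\<xi>. ennreal (s * t powr (s - 1)) * (if 0 < t \<and> ennreal t < maximal f \<xi> then 1 else 0) \<partial>M)
            = (\<integral>\<^sup>+\<xi>. ennreal (s * t powr (s - 1)) * indicator (Z t) \<xi> \<partial>M)"
          using t by (intro nn_integral_cong) (auto simp: indicator_def Z_def)
        also have "\<dots> = ennreal (s * t powr (s - 1)) * emeasure M (Z t)"
          by (rule nn_integral_cmult_indicator) simp
        also have "\<dots> \<le> ennreal (s * t powr (s - 1)) * (ennreal (A / t) * (\<integral>\<^sup>+\<xi>. f \<xi> * h t \<xi> \<partial>M))"
          by (intro mult_left_mono lev t) simp
        also have "\<dots> = ennreal L * ?d t * (\<integral>\<^sup>+\<xi>. f \<xi> * h t \<xi> \<partial>M)"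
        proof -
          have "t powr (s - 1) = t * t powr (s - 1 - 1)" using t by (simp add: powr_mult_base)
          then have "s * t powr (s - 1) * (A / t) = L * ((s - 1) * t powr (s - 1 - 1))"
            using t s by (simp add: L_def)
          then show ?thesis using s t AB by (simp add: mult.assoc[symmetric] ennreal_mult[symmetric])
        qed
        also have "\<dots> = (\<integral>\<^sup>+\<xi>. ennreal L * ?d t * (f \<xi> * h t \<xi>) \<partial>M)"
          by (rule nn_integral_cmult[symmetric]) measurable
        also have "\<dots> = (\<integral>\<^sup>+\<xi>. ennreal L * f \<xi> * (?d t * (if 0 < t \<and> ennreal t < ennreal B * f \<xi> then 1 else 0)) \<partial>M)"
          using t by (intro nn_integral_cong) (simp add: h_def mult_ac)
        finally show ?thesis by simp
      qed simp
    qed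
    also have "\<dots> = (\<integral>\<^sup>+\<xi>. \<integral>\<^sup>+t. ennreal L * f \<xi> * (?d t * (if 0 < t \<and> ennreal t < ennreal B * f \<xi> then 1 else 0)) \<partial>lborel \<partial>M)"
      by (rule L.Fubini'[symmetric]) measurable
    also have "\<dots> = (\<integral>\<^sup>+\<xi>. ennreal L * f \<xi> * epowr (ennreal B * f \<xi>) (s - 1) \<partial>M)"
      using s by (intro nn_integral_cong) (subst nn_integral_cmult, measurable, simp add: epowr_layer_cake[of "s - 1"])
    also have "\<dots> = (\<integral>\<^sup>+\<xi>. ennreal K * epowr (f \<xi>) s \<partial>M)"
    proof (intro nn_integral_cong)
      fix \<xi>
      have "epowr (f \<xi>) s = f \<xi> * epowr (f \<xi>) (s - 1)" using epowr_add[of 1 "s - 1" "f \<xi>"] s by simp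
      moreover have "epowr (ennreal B * f \<xi>) (s - 1) = ennreal (B powr (s - 1)) * epowr (f \<xi>) (s - 1)"
        using s AB by (simp add: epowr_mult epowr_ennreal)
      moreover have "ennreal K = ennreal L * ennreal (B powr (s - 1))"
        unfolding K_def using AB by (intro ennreal_mult) auto
      ultimately show "ennreal L * f \<xi> * epowr (ennreal B * f \<xi>) (s - 1) = ennreal K * epowr (f \<xi>) s"
        by (simp only: mult_ac)
    qed
    also have "\<dots> = ennreal K * (\<integral>\<^sup>+\<xi>. epowr (f \<xi>) s \<partial>M)" by (rule nn_integral_cmult) measurable
    finally show ?thesis .
  qed
  show ?thesis
  proof (intro exI[of _ "K powr (1 / s)"] conjI ballI)
    fix f :: "'a \<Rightarrow> ennreal" assume "f \<in> borel_measurable borel"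
    then have "Lnorm (ennreal s) M (maximal f) \<le> epowr (ennreal K * (\<integral>\<^sup>+\<xi>. epowr (f \<xi>) s \<partial>M)) (1 / s)"
      unfolding Lnorm_ennreal[OF order_less_trans[OF zero_less_one s]] using s by (intro epowr_mono main) auto
    then show "Lnorm (ennreal s) M (maximal f) \<le> ennreal (K powr (1 / s)) * Lnorm (ennreal s) M f"
      using s K0 by (simp add: epowr_mult epowr_ennreal Lnorm_ennreal)
  qed simp
qed

end

section \<open>Nontangential cones and the Carleson inequality\<close>

text \<open>Here \<open>a\<close> is the aperture and \<open>c\<close> the Whitney constant. The
  lower density bound is asked at radii up to \<open>\<delta> x\<close> for some point
  \<open>x\<close> of the domain, the scales at which shadows are measured.\<close>

locale nt_domain = growth_measure M n C\<^sub>1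
  for M :: "'a::euclidean_space measure" and n C\<^sub>1 +
  fixes \<Omega> :: "'a set" and a c \<kappa> :: real
  assumes open_Om: "open \<Omega>" and frontier_ne: "frontier \<Omega> \<noteq> {}"
    and a_pos: "0 < a" and c_pos: "0 < c" and c_half: "c \<le> 1 / 2" and \<kappa>_pos: "0 < \<kappa>"
    and M_null: "emeasure M (- frontier \<Omega>) = 0"
    and lower: "\<And>x \<xi> t. x \<in> \<Omega> \<Longrightarrow> \<xi> \<in> frontier \<Omega> \<Longrightarrow> 0 < t \<Longrightarrow> t \<le> bdry_dist \<Omega> x \<Longrightarrow>
        ennreal (\<kappa> * t ^ n) \<le> emeasure M (ball \<xi> t)"
begin

abbreviation "\<delta> \<equiv> bdry_dist \<Omega>"

lemma \<delta>_pos: "x \<in> \<Omega> \<Longrightarrow> 0 < \<delta> x"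
  unfolding bdry_dist_def using frontier_ne open_Om frontier_closed[of \<Omega>]
  by (intro infdist_pos_not_in_closed) (auto simp: frontier_def interior_open)

lemma \<delta>_nonneg: "0 \<le> \<delta> x"
  by (simp add: bdry_dist_def infdist_nonneg)

lemma \<delta>_le: "\<xi> \<in> frontier \<Omega> \<Longrightarrow> \<delta> x \<le> dist x \<xi>"
  by (simp add: bdry_dist_def infdist_le)

lemma \<delta>_triangle: "\<delta> x \<le> \<delta> y + dist x y"
  unfolding bdry_dist_def by (rule infdist_triangle)

lemma \<delta>_attained: obtains \<xi> where "\<xi> \<in> frontier \<Omega>" "dist x \<xi> = \<delta> x"
  using infdist_attains_inf[OF frontier_closed frontier_ne, of x] by (metis bdry_dist_def)

lemma continuous_on_\<delta>: "continuous_on S \<delta>"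
  unfolding bdry_dist_def[abs_def] by (intro continuous_intros)

lemma borel_measurable_\<delta> [measurable]: "\<delta> \<in> borel_measurable borel"
  by (rule borel_measurable_continuous_onI[OF continuous_on_\<delta>])

lemma borel_\<Omega> [measurable]: "\<Omega> \<in> sets borel"
  using open_Om by simp

lemma ball_\<delta>_subset:
  assumes "x \<in> \<Omega>" "r \<le> \<delta> x" shows "ball x r \<subseteq> \<Omega>"
proof (rule ccontr)
  assume n: "\<not> ball x r \<subseteq> \<Omega>"
  then have "0 < r" by (metis ball_eq_empty empty_subsetI not_le)
  then have "x \<in> ball x r" by simp
  then have "ball x r \<inter> frontier \<Omega> \<noteq> {}"
    using n assms(1) \<open>x \<in> ball x r\<close> by (intro connected_Int_frontier) blast+
  then show False using \<delta>_le[of _ x] assms(2) by fastforce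
qed

lemma near:
  assumes "x \<in> \<Omega>" "y \<in> ball x (c * \<delta> x)"
  shows "y \<in> \<Omega>" "\<delta> x \<le> 2 * \<delta> y" "\<delta> y \<le> 2 * \<delta> x" "dist x y < \<delta> x / 2"
proof -
  have cd: "c * \<delta> x \<le> \<delta> x / 2" using c_half \<delta>_nonneg[of x] mult_right_mono[of c "1/2" "\<delta> x"] by simp
  then show "y \<in> \<Omega>" using assms ball_\<delta>_subset[OF assms(1), of "c * \<delta> x"] \<delta>_nonneg[of x] by auto
  show d: "dist x y < \<delta> x / 2" using assms cd by simp
  show "\<delta> x \<le> 2 * \<delta> y" using d \<delta>_triangle[of x y] by simp
  show "\<delta> y \<le> 2 * \<delta> x" using d \<delta>_triangle[of y x] \<delta>_nonneg[of x] by (simp add: dist_commute)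
qed

definition \<kappa>\<^sub>2 :: real where "\<kappa>\<^sub>2 = \<kappa> * min a 1 ^ n"

lemma \<kappa>\<^sub>2_pos: "0 < \<kappa>\<^sub>2"
  using \<kappa>_pos a_pos by (simp add: \<kappa>\<^sub>2_def)

text \<open>The ball \<open>ball x ((1 + a) * \<delta> x)\<close> is the shadow of \<open>x\<close>:
  its points are those whose cone contains \<open>x\<close>. It contains the ball of radius
  \<open>min a 1 * \<delta> x\<close> about a nearest boundary point, and the minimum with 1 keeps
  this radius in the range of \<open>lower\<close>.\<close>

lemma cone_lower:
  assumes x: "x \<in> \<Omega>"
  shows "ennreal (\<kappa>\<^sub>2 * \<delta> x ^ n) \<le> emeasure M (ball x ((1 + a) * \<delta> x))"
proof -
  obtain \<xi> where \<xi>: "\<xi> \<in> frontier \<Omega>" "dist x \<xi> = \<delta> x" by (rule \<delta>_attained)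
  have d: "0 < \<delta> x" by (rule \<delta>_pos[OF x])
  have m: "0 < min a 1" "min a 1 * \<delta> x \<le> \<delta> x" "min a 1 * \<delta> x \<le> a * \<delta> x"
    using a_pos d by (auto simp: mult_le_cancel_right1 intro!: mult_right_mono)
  have "ennreal (\<kappa>\<^sub>2 * \<delta> x ^ n) = ennreal (\<kappa> * (min a 1 * \<delta> x) ^ n)"
    by (simp add: \<kappa>\<^sub>2_def power_mult_distrib mult_ac)
  also have "\<dots> \<le> emeasure M (ball \<xi> (min a 1 * \<delta> x))"
    using m d by (intro lower[OF x \<xi>(1)]) auto
  also have "\<dots> \<le> emeasure M (ball x ((1 + a) * \<delta> x))"
  proof (rule emeasure_mono)
    show "ball \<xi> (min a 1 * \<delta> x) \<subseteq> ball x ((1 + a) * \<delta> x)"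
    proof
      fix y assume "y \<in> ball \<xi> (min a 1 * \<delta> x)"
      then show "y \<in> ball x ((1 + a) * \<delta> x)"
        using dist_triangle[of x y \<xi>] \<xi> m by (simp add: algebra_simps)
    qed
  qed simp
  finally show ?thesis .
qed

lemma pair_sigma_finite_lborel_M: "pair_sigma_finite lborel M"
  by unfold_locales

text \<open>Truncating the conical integral of \<open>H\<close> at the height where it exceeds a multiple of the
  Carleson functional \<open>Cl\<close> keeps, by Chebyshev, a fixed portion of the shadow \<open>ball x ((1 + a) * \<delta> x)\<close>
  of every point \<open>x\<close>.\<close>

theorem carleson_inequality:
  obtains K where "0 < K"
    "\<And>U H. U \<in> borel_measurable borel \<Longrightarrow> H \<in> borel_measurable borel \<Longrightarrow>
      (\<integral>\<^sup>+x\<in>\<Omega>. U x * H x \<partial>lborel) \<le> ennreal K *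
        (\<integral>\<^sup>+\<xi>. (SUP x\<in>nt_cone \<Omega> a \<xi>. U x) * ball_sup lborel n (\<lambda>x. H x * indicator \<Omega> x) \<xi> \<partial>M)"
proof -
  interpret L: pair_sigma_finite lborel M by (rule pair_sigma_finite_lborel_M)
  \<comment> \<open>\<open>B1 * \<delta> y ^ n\<close> bounds the measure of the shadow of
    \<open>y\<close>. In \<open>K1\<close> the factor \<open>(3 * (1 + a)) ^ n\<close> compares
    \<open>R ^ n\<close> with \<open>\<delta> x ^ n\<close>, and the 2 keeps the bad set below half
    of the lower bound for the shadow of \<open>x\<close>.\<close>
  define B1 where "B1 = C\<^sub>1 * (1 + a) ^ n"
  define K1 where "K1 = 2 * B1 * (3 * (1 + a)) ^ n / \<kappa>\<^sub>2"
  have pos: "0 < B1" "0 < K1" "0 < 1 + a" "0 < \<kappa>\<^sub>2" using C\<^sub>1 a_pos \<kappa>\<^sub>2_pos by (auto simp: B1_def K1_def)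
  show thesis
  proof (rule that[of "2 / \<kappa>\<^sub>2 * K1"])
    show "0 < 2 / \<kappa>\<^sub>2 * K1" using pos by simp
    fix U H :: "'a \<Rightarrow> ennreal"
    assume [measurable]: "U \<in> borel_measurable borel" "H \<in> borel_measurable borel"
    let ?H = "\<lambda>x. H x * indicator \<Omega> x"
    define Cl where "Cl = ball_sup lborel n ?H"
    have Clm[measurable]: "Cl \<in> borel_measurable borel"
      unfolding Cl_def by (rule borel_measurable_ball_sup) auto
    \<comment> \<open>Integrated over \<xi> this kernel returns \<open>H x\<close> up to constants,
      by the upper and lower bounds for shadows; integrated over \<open>x\<close> it gives the
      conical integral of \<open>H\<close> at \<xi>.\<close>
    define k where "k x \<xi> = (if x \<in> \<Omega> \<and> dist x \<xi> < (1 + a) * \<delta> x then H x * ennreal (1 / \<delta> x ^ n) else 0)" for x \<xi>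
    have km[measurable]: "case_prod k \<in> borel_measurable (borel \<Otimes>\<^sub>M borel)"
      unfolding k_def by measurable
    have km1: "(\<lambda>x. k x \<xi>) \<in> borel_measurable borel" for \<xi>
      unfolding k_def by measurable
    define A where "A t \<xi> = (\<integral>\<^sup>+y. k y \<xi> * (if \<delta> y \<le> t then 1 else 0) \<partial>lborel)" for t \<xi>
    have Am[measurable]: "case_prod A \<in> borel_measurable (borel \<Otimes>\<^sub>M borel)"
      unfolding A_def by measurable
    \<comment> \<open>The part of the shadow of \<open>x\<close> where the stopping condition does
      not yet cut off the height \<open>\<delta> x\<close>.\<close>
    define G where "G x = {\<xi>. dist x \<xi> < (1 + a) * \<delta> x \<and> A (\<delta> x) \<xi> \<le> ennreal K1 * Cl \<xi>}" for x
    have Gm[measurable]: "G x \<in> sets borel" for x unfolding G_def by measurable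
    have GM: "ennreal (\<kappa>\<^sub>2 / 2 * \<delta> x ^ n) \<le> emeasure M (G x)" if x: "x \<in> \<Omega>" for x
    proof -
      have d: "0 < \<delta> x" by (rule \<delta>_pos[OF x])
      let ?B = "ball x ((1 + a) * \<delta> x)"
      define Bad where "Bad = {\<xi>\<in>?B. \<not> A (\<delta> x) \<xi> \<le> ennreal K1 * Cl \<xi>}"
      have Badm[measurable]: "Bad \<in> sets borel" unfolding Bad_def by measurable
      \<comment> \<open>Points \<open>y\<close> with \<open>\<delta> y \<le> \<delta> x\<close>
        whose shadow meets that of \<open>x\<close> lie within
        \<open>2 * (1 + a) * \<delta> x\<close> of \<open>x\<close>; recentring at a point of the
        shadow adds another \<open>(1 + a) * \<delta> x\<close>.\<close>
      define R where "R = 3 * (1 + a) * \<delta> x"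
      have R: "0 < R" using pos d by (simp add: R_def)
      define I where "I = (\<integral>\<^sup>+y\<in>ball x (2 * (1 + a) * \<delta> x). ?H y \<partial>lborel)"
      have ClB: "I / ennreal (R ^ n) \<le> Cl \<xi>" if "\<xi> \<in> ?B" for \<xi>
      proof -
        have "ball x (2 * (1 + a) * \<delta> x) \<subseteq> ball \<xi> R"
        proof
          fix y assume "y \<in> ball x (2 * (1 + a) * \<delta> x)"
          then show "y \<in> ball \<xi> R" using that dist_triangle[of \<xi> y x]
            by (simp add: R_def dist_commute algebra_simps)
        qed
        then have "I \<le> (\<integral>\<^sup>+y\<in>ball \<xi> R. ?H y \<partial>lborel)"
          unfolding I_def by (intro nn_integral_mono mult_left_mono) (auto simp: indicator_def)
        then have "I / ennreal (R ^ n) \<le> (\<integral>\<^sup>+y\<in>ball \<xi> R. ?H y \<partial>lborel) / ennreal (R ^ n)"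
          by (rule divide_right_mono_ennreal)
        also have "\<dots> \<le> Cl \<xi>" unfolding Cl_def by (rule ball_sup_ge[OF R])
        finally show ?thesis .
      qed
      have AI: "(\<integral>\<^sup>+\<xi>\<in>?B. A (\<delta> x) \<xi> \<partial>M) \<le> ennreal B1 * I"
      proof -
        have "(\<integral>\<^sup>+\<xi>\<in>?B. A (\<delta> x) \<xi> \<partial>M) = (\<integral>\<^sup>+\<xi>. \<integral>\<^sup>+y. k y \<xi> * (if \<delta> y \<le> \<delta> x then 1 else 0) * indicator ?B \<xi> \<partial>lborel \<partial>M)"
          unfolding A_def by (intro nn_integral_cong nn_integral_multc[symmetric]) measurable
        also have "\<dots> = (\<integral>\<^sup>+y. \<integral>\<^sup>+\<xi>. k y \<xi> * (if \<delta> y \<le> \<delta> x then 1 else 0) * indicator ?B \<xi> \<partial>M \<partial>lborel)"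
          by (rule L.Fubini') measurable
        also have "\<dots> \<le> (\<integral>\<^sup>+y. ennreal B1 * (?H y * indicator (ball x (2 * (1 + a) * \<delta> x)) y) \<partial>lborel)"
        proof (rule nn_integral_mono)
          fix y
          show "(\<integral>\<^sup>+\<xi>. k y \<xi> * (if \<delta> y \<le> \<delta> x then 1 else 0) * indicator ?B \<xi> \<partial>M)
             \<le> ennreal B1 * (?H y * indicator (ball x (2 * (1 + a) * \<delta> x)) y)"
          proof (cases "y \<in> \<Omega> \<and> \<delta> y \<le> \<delta> x \<and> y \<in> ball x (2 * (1 + a) * \<delta> x)")
            case True
            then have dy: "0 < \<delta> y" using \<delta>_pos by blast
            have "(\<integral>\<^sup>+\<xi>. k y \<xi> * (if \<delta> y \<le> \<delta> x then 1 else 0) * indicator ?B \<xi> \<partial>M)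
                \<le> (\<integral>\<^sup>+\<xi>. H y * ennreal (1 / \<delta> y ^ n) * indicator (ball y ((1 + a) * \<delta> y)) \<xi> \<partial>M)"
              by (intro nn_integral_mono) (auto simp: k_def indicator_def)
            also have "\<dots> = H y * ennreal (1 / \<delta> y ^ n) * emeasure M (ball y ((1 + a) * \<delta> y))"
              by (rule nn_integral_cmult_indicator) simp
            also have "\<dots> \<le> H y * ennreal (1 / \<delta> y ^ n) * ennreal (C\<^sub>1 * ((1 + a) * \<delta> y) ^ n)"
              using pos dy by (intro mult_left_mono growth) auto
            also have "\<dots> = H y * ennreal B1"
              using dy C\<^sub>1 pos by (simp add: mult.assoc ennreal_mult[symmetric] B1_def power_mult_distrib)
            finally show ?thesis using True by (simp add: mult.commute)
          next
            case False
            have "k y \<xi> * (if \<delta> y \<le> \<delta> x then 1 else 0) * indicator ?B \<xi> = 0" for \<xi>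
            proof (rule ccontr)
              assume "k y \<xi> * (if \<delta> y \<le> \<delta> x then 1 else 0) * indicator ?B \<xi> \<noteq> 0"
              then have *: "y \<in> \<Omega>" "dist y \<xi> < (1 + a) * \<delta> y" "\<delta> y \<le> \<delta> x" "dist x \<xi> < (1 + a) * \<delta> x"
                by (auto simp: k_def indicator_def split: if_splits)
              have "(1 + a) * \<delta> y \<le> (1 + a) * \<delta> x" using * pos by simp
              then have "dist x y < 2 * (1 + a) * \<delta> x" using * dist_triangle2[of x y \<xi>] by (simp add: algebra_simps)
              then show False using False * by simp
            qed
            then show ?thesis by (simp only: nn_integral_const mult_zero_left zero_le)
          qed
        qed
        also have "\<dots> = ennreal B1 * I" unfolding I_def by (rule nn_integral_cmult) measurable
        finally show ?thesis .
      qed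
      have Bsplit: "emeasure M ?B \<le> emeasure M (G x) + emeasure M Bad"
      proof -
        have "?B = G x \<union> Bad" by (auto simp: G_def Bad_def)
        then show ?thesis using emeasure_subadditive[of "G x" M Bad] by simp
      qed
      have BadM: "emeasure M Bad \<le> ennreal (\<kappa>\<^sub>2 / 2 * \<delta> x ^ n)"
      \<comment> \<open>Chebyshev's inequality divides by \<open>I\<close>. If \<open>I\<close> is
        infinite, so is the Carleson functional on the whole shadow, and no point is bad; if
        \<open>I\<close> is 0, the truncated conical integral vanishes almost everywhere on the
        shadow.\<close>
      proof (cases I)
        case top
        then have "Cl \<xi> = top" if "\<xi> \<in> ?B" for \<xi>
          using ClB[OF that] by (simp add: ennreal_top_divide top_unique)
        then have "Bad = {}" using pos by (auto simp: Bad_def ennreal_mult_top)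
        then show ?thesis by simp
      next
        case (real i)
        show ?thesis
        proof (cases "i = 0")
          case True
          then have "(\<integral>\<^sup>+\<xi>\<in>?B. A (\<delta> x) \<xi> \<partial>M) = 0" using AI real by simp
          then have "AE \<xi> in M. A (\<delta> x) \<xi> * indicator ?B \<xi> = 0"
            by (subst (asm) nn_integral_0_iff_AE) measurable
          then have "AE \<xi> in M. \<xi> \<notin> Bad" by eventually_elim (auto simp: Bad_def)
          then have "emeasure M Bad = 0" by (subst (asm) AE_iff_measurable[of Bad]) auto
          then show ?thesis by simp
        next
          case False
          then have i: "0 < i" using real by simp
          let ?m = "K1 * (i / R ^ n)"
          have m: "0 < ?m" using i R pos by simp
          have "ennreal ?m * emeasure M Bad = (\<integral>\<^sup>+\<xi>. ennreal ?m * indicator Bad \<xi> \<partial>M)"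
            by (rule nn_integral_cmult_indicator[symmetric]) simp
          also have "\<dots> \<le> (\<integral>\<^sup>+\<xi>\<in>?B. A (\<delta> x) \<xi> \<partial>M)"
          proof (rule nn_integral_mono)
            fix \<xi>
            show "ennreal ?m * indicator Bad \<xi> \<le> A (\<delta> x) \<xi> * indicator ?B \<xi>"
            proof (cases "\<xi> \<in> Bad")
              case True
              then have \<xi>: "\<xi> \<in> ?B" "ennreal K1 * Cl \<xi> \<le> A (\<delta> x) \<xi>" by (auto simp: Bad_def)
              have "ennreal ?m = ennreal K1 * (I / ennreal (R ^ n))"
              proof -
                have "ennreal ?m = ennreal K1 * ennreal (i / R ^ n)"
                  using R pos i by (intro ennreal_mult) auto
                then show ?thesis using real R i by (simp add: divide_ennreal)
              qed
              also have "\<dots> \<le> ennreal K1 * Cl \<xi>" by (intro mult_left_mono ClB \<xi>) simp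
              finally show ?thesis using \<xi> True by simp
            qed simp
          qed
          also have "\<dots> \<le> ennreal (B1 * i)" using AI real pos by (simp add: ennreal_mult)
          finally have le: "ennreal ?m * emeasure M Bad \<le> ennreal (B1 * i)" .
          have eq: "B1 * i = ?m * (\<kappa>\<^sub>2 / 2 * \<delta> x ^ n)"
          proof -
            have gen: "B1 * i = (2 * B1 * X / \<kappa>\<^sub>2) * (i / (X * D)) * (\<kappa>\<^sub>2 / 2 * D)" if "0 < X" "0 < D" for X D
              using that pos by (simp add: field_simps)
            have "R ^ n = (3 * (1 + a)) ^ n * \<delta> x ^ n" by (simp add: R_def power_mult_distrib)
            then show ?thesis using gen[of "(3 * (1 + a)) ^ n" "\<delta> x ^ n"] pos d unfolding K1_def by simp
          qed
          have "ennreal ?m * emeasure M Bad \<le> ennreal ?m * ennreal (\<kappa>\<^sub>2 / 2 * \<delta> x ^ n)"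
            using le unfolding eq using m pos d by (simp add: ennreal_mult[symmetric])
          then show ?thesis by (rule ennreal_mult_left_cancel_le[OF m])
        qed
      qed
      have "ennreal (\<kappa>\<^sub>2 / 2 * \<delta> x ^ n) + ennreal (\<kappa>\<^sub>2 / 2 * \<delta> x ^ n) = ennreal (\<kappa>\<^sub>2 * \<delta> x ^ n)"
        using pos d by (simp add: ennreal_plus[symmetric] del: ennreal_plus)
      also have "\<dots> \<le> emeasure M (G x) + emeasure M Bad" using cone_lower[OF x] Bsplit by (rule order_trans)
      also have "\<dots> \<le> emeasure M (G x) + ennreal (\<kappa>\<^sub>2 / 2 * \<delta> x ^ n)" by (intro add_left_mono BadM)
      finally have "ennreal (\<kappa>\<^sub>2 / 2 * \<delta> x ^ n) + ennreal (\<kappa>\<^sub>2 / 2 * \<delta> x ^ n)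
          \<le> ennreal (\<kappa>\<^sub>2 / 2 * \<delta> x ^ n) + emeasure M (G x)" by (simp only: add.commute)
      then show ?thesis unfolding ennreal_add_left_cancel_le by (rule disjE) (simp_all only: infinity_ennreal_def ennreal_neq_top)
    qed
    define N where "N \<xi> = (SUP x\<in>nt_cone \<Omega> a \<xi>. U x)" for \<xi>
    have [measurable]: "N \<in> borel_measurable borel"
    proof (rule borel_measurable_of_open_superlevel)
      fix t
      have "{\<xi>. t < N \<xi>} = (\<Union>x\<in>{x\<in>\<Omega>. t < U x}. ball x ((1 + a) * \<delta> x))"
        unfolding N_def less_SUP_iff by (auto simp: nt_cone_def)
      also have "open \<dots>" by auto
      finally show "open {\<xi>. t < N \<xi>}" .
    qed
    let ?g = "\<lambda>x \<xi>. if A (\<delta> x) \<xi> \<le> ennreal K1 * Cl \<xi> then 1 else 0 :: ennreal"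
    have gm[measurable]: "(\<lambda>(x, \<xi>). ?g x \<xi>) \<in> borel_measurable (borel \<Otimes>\<^sub>M borel)"
      by measurable
    have "(\<integral>\<^sup>+x\<in>\<Omega>. U x * H x \<partial>lborel) \<le> (\<integral>\<^sup>+x. \<integral>\<^sup>+\<xi>. ennreal (2 / \<kappa>\<^sub>2) * (U x * (k x \<xi> * ?g x \<xi>)) \<partial>M \<partial>lborel)"
    proof (rule nn_integral_mono)
      fix x
      show "U x * H x * indicator \<Omega> x \<le> (\<integral>\<^sup>+\<xi>. ennreal (2 / \<kappa>\<^sub>2) * (U x * (k x \<xi> * ?g x \<xi>)) \<partial>M)"
      proof (cases "x \<in> \<Omega>")
        case True
        then have d: "0 < \<delta> x" by (rule \<delta>_pos)
        have 1: "ennreal (2 / \<kappa>\<^sub>2) * ennreal (1 / \<delta> x ^ n) * ennreal (\<kappa>\<^sub>2 / 2 * \<delta> x ^ n) = 1"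
          using pos d by (simp add: ennreal_mult[symmetric])
        have "U x * H x * indicator \<Omega> x = U x * H x * (ennreal (2 / \<kappa>\<^sub>2) * ennreal (1 / \<delta> x ^ n) * ennreal (\<kappa>\<^sub>2 / 2 * \<delta> x ^ n))"
          unfolding 1 using True by simp
        also have "\<dots> \<le> U x * H x * (ennreal (2 / \<kappa>\<^sub>2) * ennreal (1 / \<delta> x ^ n) * emeasure M (G x))"
          by (intro mult_left_mono GM True) auto
        also have "\<dots> = (U x * H x * ennreal (2 / \<kappa>\<^sub>2) * ennreal (1 / \<delta> x ^ n)) * emeasure M (G x)"
          by (simp add: mult_ac)
        also have "\<dots> = (\<integral>\<^sup>+\<xi>. (U x * H x * ennreal (2 / \<kappa>\<^sub>2) * ennreal (1 / \<delta> x ^ n)) * indicator (G x) \<xi> \<partial>M)"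
          by (rule nn_integral_cmult_indicator[symmetric]) simp
        also have "\<dots> = (\<integral>\<^sup>+\<xi>. ennreal (2 / \<kappa>\<^sub>2) * (U x * (k x \<xi> * ?g x \<xi>)) \<partial>M)"
          using True by (intro nn_integral_cong) (auto simp: k_def G_def indicator_def mult_ac)
        finally show ?thesis .
      qed simp
    qed
    also have "\<dots> = (\<integral>\<^sup>+\<xi>. \<integral>\<^sup>+x. ennreal (2 / \<kappa>\<^sub>2) * (U x * (k x \<xi> * ?g x \<xi>)) \<partial>lborel \<partial>M)"
      by (rule L.Fubini'[symmetric]) measurable
    also have "\<dots> \<le> (\<integral>\<^sup>+\<xi>. ennreal (2 / \<kappa>\<^sub>2 * K1) * (N \<xi> * Cl \<xi>) \<partial>M)"
    proof (rule nn_integral_mono)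
      fix \<xi>
      have "(\<integral>\<^sup>+x. ennreal (2 / \<kappa>\<^sub>2) * (U x * (k x \<xi> * ?g x \<xi>)) \<partial>lborel)
          \<le> (\<integral>\<^sup>+x. (ennreal (2 / \<kappa>\<^sub>2) * N \<xi>) * (k x \<xi> * ?g x \<xi>) \<partial>lborel)"
      proof (rule nn_integral_mono)
        fix x
        have "U x * k x \<xi> \<le> N \<xi> * k x \<xi>"
        proof (cases "x \<in> nt_cone \<Omega> a \<xi>")
          case True
          then show ?thesis unfolding N_def by (intro mult_right_mono SUP_upper) auto
        qed (auto simp: k_def nt_cone_def)
        then show "ennreal (2 / \<kappa>\<^sub>2) * (U x * (k x \<xi> * ?g x \<xi>)) \<le> (ennreal (2 / \<kappa>\<^sub>2) * N \<xi>) * (k x \<xi> * ?g x \<xi>)"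
          by (auto simp: mult.assoc intro!: mult_left_mono)
      qed
      also have "\<dots> = (ennreal (2 / \<kappa>\<^sub>2) * N \<xi>) * (\<integral>\<^sup>+x. k x \<xi> * ?g x \<xi> \<partial>lborel)"
        by (rule nn_integral_cmult) measurable
      \<comment> \<open>The stopping argument with \<delta> as the level function: below the
        stopping height the conical integral is at most the stopping value, without loss of a
        constant.\<close>
      also have "\<dots> \<le> (ennreal (2 / \<kappa>\<^sub>2) * N \<xi>) * (ennreal K1 * Cl \<xi>)"
        unfolding A_def by (intro mult_left_mono nn_integral_sublevel_le) (auto simp: km1)
      also have "\<dots> = ennreal (2 / \<kappa>\<^sub>2 * K1) * (N \<xi> * Cl \<xi>)"
      proof -
        have "ennreal (2 / \<kappa>\<^sub>2 * K1) = ennreal (2 / \<kappa>\<^sub>2) * ennreal K1" using pos by (intro ennreal_mult) auto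
        then show ?thesis by (simp only: mult_ac)
      qed
      finally show "(\<integral>\<^sup>+x. ennreal (2 / \<kappa>\<^sub>2) * (U x * (k x \<xi> * ?g x \<xi>)) \<partial>lborel) \<le> ennreal (2 / \<kappa>\<^sub>2 * K1) * (N \<xi> * Cl \<xi>)" .
    qed
    also have "\<dots> = ennreal (2 / \<kappa>\<^sub>2 * K1) * (\<integral>\<^sup>+\<xi>. N \<xi> * Cl \<xi> \<partial>M)"
      by (rule nn_integral_cmult) measurable
    finally show "(\<integral>\<^sup>+x\<in>\<Omega>. U x * H x \<partial>lborel) \<le> ennreal (2 / \<kappa>\<^sub>2 * K1) *
        (\<integral>\<^sup>+\<xi>. (SUP x\<in>nt_cone \<Omega> a \<xi>. U x) * ball_sup lborel n (\<lambda>x. H x * indicator \<Omega> x) \<xi> \<partial>M)"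
      by (simp add: N_def Cl_def)
  qed
qed

end

section \<open>Averages over Whitney balls\<close>

text \<open>Lebesgue measurable functions given on \<open>S\<close> are traded for Borel functions
  on the whole space, so that joint measurability and Fubini become available.\<close>

lemma borel_representative:
  fixes f :: "'a::euclidean_space \<Rightarrow> real"
  assumes "f \<in> borel_measurable (lebesgue_on S)" and S: "S \<in> sets borel"
  obtains g where "g \<in> borel_measurable borel" "\<And>x. x \<notin> S \<Longrightarrow> g x = 0"
    "AE x in lborel. x \<in> S \<longrightarrow> f x = g x"
proof -
  have "(\<lambda>x. if x \<in> S then f x else 0) \<in> borel_measurable lebesgue"
    using assms by (intro borel_measurable_if_I) auto
  then obtain h where h: "h \<in> borel_measurable lborel" "AE x in lborel. (if x \<in> S then f x else 0) = h x"
    using completion_ex_borel_measurable_real[of _ lborel] by blast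
  show thesis
  proof (rule that[of "\<lambda>x. if x \<in> S then h x else 0"])
    show "(\<lambda>x. if x \<in> S then h x else 0) \<in> borel_measurable borel" using h(1) S by simp
    show "AE x in lborel. x \<in> S \<longrightarrow> f x = (if x \<in> S then h x else 0)"
      using h(2) by eventually_elim auto
  qed simp
qed

lemma AE_lebesgue_on_iff:
  assumes "S \<in> sets borel"
  shows "(AE x in lebesgue_on S. P x) \<longleftrightarrow> (AE x in lborel. x \<in> S \<longrightarrow> P x)"
  using assms by (subst AE_restrict_space_iff) (auto simp: AE_completion_iff)

lemma Laverage_cong_AE:
  assumes "f \<in> borel_measurable (lebesgue_on B)" "g \<in> borel_measurable (lebesgue_on B)"
    and B: "B \<in> sets borel" and AE: "AE x in lborel. x \<in> B \<longrightarrow> f x = g x"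
  shows "Laverage q f B = Laverage q g B"
proof -
  have 1: "esssup (lebesgue_on B) (\<lambda>y. ennreal \<bar>f y\<bar>) = esssup (lebesgue_on B) (\<lambda>y. ennreal \<bar>g y\<bar>)"
  proof (rule esssup_AE_cong)
    show "AE x in lebesgue_on B. ennreal \<bar>f x\<bar> = ennreal \<bar>g x\<bar>"
      unfolding AE_lebesgue_on_iff[OF B] using AE by eventually_elim auto
  qed (use assms in measurable)
  have 2: "(\<integral>\<^sup>+y\<in>B. ennreal (\<bar>f y\<bar> powr enn2real q) \<partial>lebesgue) = (\<integral>\<^sup>+y\<in>B. ennreal (\<bar>g y\<bar> powr enn2real q) \<partial>lebesgue)"
    unfolding nn_integral_completion using AE
  proof (intro nn_integral_cong_AE)
    show "AE y in lborel. ennreal (\<bar>f y\<bar> powr enn2real q) * indicator B y = ennreal (\<bar>g y\<bar> powr enn2real q) * indicator B y"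
      using AE by eventually_elim (auto simp: indicator_def)
  qed
  show ?thesis unfolding Laverage_def by (simp only: 1 2)
qed

text \<open>\<open>R\<close> is real, so its conjugate is either real or infinite. The disjunction
  exposes these two cases, which need different arguments, where an equation between extended reals
  would hide them.\<close>

definition conj_exp :: "real \<Rightarrow> ennreal \<Rightarrow> bool" where
  "conj_exp R q \<longleftrightarrow> (R = 1 \<and> q = \<infinity>) \<or> (\<exists>Q. 1 < R \<and> 1 < Q \<and> 1 / R + 1 / Q = 1 \<and> q = ennreal Q)"

lemma conj_exp_cases: "conj_exp R q \<Longrightarrow> q = \<infinity> \<or> (\<exists>Q>0. q = ennreal Q)"
  unfolding conj_exp_def by (metis less_trans zero_less_one)

context nt_domain
begin

abbreviation "L0 \<equiv> borel_measurable (lebesgue_on \<Omega>)"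

abbreviation "Wball x \<equiv> ball x (c * \<delta> x)"

definition vol :: "'a \<Rightarrow> real" where "vol x = unit_ball_vol DIM('a) * (c * \<delta> x) ^ DIM('a)"

text \<open>The normalised indicator of the Whitney ball of \<open>x\<close>, as a Borel kernel in
  both variables. As a function of \<open>y\<close> it averages; as a function of \<open>x\<close>,
  for \<open>y\<close> in the domain, its mass is bounded above and below, so that averaging can be
  undone by Fubini.\<close>

definition \<phi> :: "'a \<Rightarrow> 'a \<Rightarrow> ennreal" where
  "\<phi> x y = (if x \<in> \<Omega> \<and> dist x y < c * \<delta> x then ennreal (1 / vol x) else 0)"

abbreviation avg :: "'a \<Rightarrow> ('a \<Rightarrow> ennreal) \<Rightarrow> ennreal" where
  "avg x f \<equiv> \<integral>\<^sup>+y. \<phi> x y * f y \<partial>lborel"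

abbreviation avgm :: "'a \<Rightarrow> 'a measure" where "avgm x \<equiv> density lborel (\<phi> x)"

lemma vol_pos: "x \<in> \<Omega> \<Longrightarrow> 0 < vol x"
  using \<delta>_pos[of x] c_pos by (simp add: vol_def)

lemma emeasure_Wball: "x \<in> \<Omega> \<Longrightarrow> emeasure lborel (Wball x) = ennreal (vol x)"
  using \<delta>_pos[of x] c_pos by (simp add: vol_def emeasure_ball)

lemma measurable_\<phi> [measurable]: "case_prod \<phi> \<in> borel_measurable (borel \<Otimes>\<^sub>M borel)"
  unfolding \<phi>_def vol_def by measurable

lemma \<phi>_eq: "x \<in> \<Omega> \<Longrightarrow> \<phi> x y = indicator (Wball x) y * ennreal (1 / vol x)"
  by (auto simp: \<phi>_def indicator_def)

lemma nn_integral_\<phi>: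
  assumes "x \<in> \<Omega>" "f \<in> borel_measurable borel"
  shows "avg x f = (\<integral>\<^sup>+y\<in>Wball x. f y \<partial>lborel) * ennreal (1 / vol x)"
  using assms(2) by (subst nn_integral_multc[symmetric]) (auto simp: \<phi>_eq[OF assms(1)] mult_ac intro!: nn_integral_cong)

lemma \<phi>_mass: "x \<in> \<Omega> \<Longrightarrow> (\<integral>\<^sup>+y. \<phi> x y \<partial>lborel) = 1"
  using nn_integral_\<phi>[of x "\<lambda>_. 1"] vol_pos[of x]
  by (simp add: emeasure_Wball ennreal_mult[symmetric])

lemma lborel_on_Wball: "x \<in> \<Omega> \<Longrightarrow> Wball x \<subseteq> \<Omega>"
  using near(1) by blast

lemma Laverage_eq_finite:
  assumes x: "x \<in> \<Omega>" and f[measurable]: "f \<in> borel_measurable borel" and R: "0 < R"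
  shows "Laverage (ennreal R) f (Wball x) = Lp R (avgm x) f"
proof -
  have "(\<integral>\<^sup>+y. epowr (ennreal \<bar>f y\<bar>) R \<partial>avgm x) = avg x (\<lambda>y. ennreal (\<bar>f y\<bar> powr R))"
    by (subst nn_integral_density) (auto simp: epowr_ennreal)
  also have "\<dots> = (\<integral>\<^sup>+y\<in>Wball x. ennreal (\<bar>f y\<bar> powr R) \<partial>lborel) * ennreal (1 / vol x)"
    by (rule nn_integral_\<phi>[OF x]) measurable
  also have "\<dots> = (\<integral>\<^sup>+y\<in>Wball x. ennreal (\<bar>f y\<bar> powr R) \<partial>lborel) / ennreal (vol x)"
    using vol_pos[OF x] by (simp add: divide_ennreal_def inverse_ennreal inverse_eq_divide)
  finally show ?thesis
    using R x emeasure_Wball[OF x] by (simp add: Laverage_def Lnorm_ennreal nn_integral_completion)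
qed

lemma Laverage_eq_infinity:
  assumes x: "x \<in> \<Omega>" and f[measurable]: "f \<in> borel_measurable borel"
  shows "Laverage \<infinity> f (Wball x) = Lnorm \<infinity> (avgm x) (\<lambda>y. ennreal \<bar>f y\<bar>)"
proof -
  have m1: "(\<lambda>y. ennreal \<bar>f y\<bar>) \<in> borel_measurable (lebesgue_on (Wball x))"
    by (intro measurable_restrict_space1) (auto intro: measurable_completion)
  have m2: "(\<lambda>y. ennreal \<bar>f y\<bar>) \<in> borel_measurable (avgm x)" by simp
  have "(AE y in lebesgue_on (Wball x). ennreal \<bar>f y\<bar> \<le> z) \<longleftrightarrow> (AE y in avgm x. ennreal \<bar>f y\<bar> \<le> z)" for z
    using vol_pos[OF x] x
    by (subst AE_lebesgue_on_iff, simp, subst AE_density, simp)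
       (auto simp: \<phi>_def)
  then show ?thesis
    unfolding Laverage_def Lnorm_def by (simp add: esssup_eq_AE m1 m2)
qed

definition W :: "ennreal \<Rightarrow> ('a \<Rightarrow> real) \<Rightarrow> 'a \<Rightarrow> ennreal" where
  "W q f x = (if x \<in> \<Omega> then Laverage q f (Wball x) else 0)"

lemma W_cong_AE:
  assumes "f \<in> L0" "g \<in> L0"
    and AE: "AE x in lborel. x \<in> \<Omega> \<longrightarrow> f x = g x"
  shows "W q f = W q g"
proof
  fix x
  show "W q f x = W q g x"
  proof (cases "x \<in> \<Omega>")
    case True
    have sub: "Wball x \<subseteq> \<Omega>" by (rule lborel_on_Wball[OF True])
    have m: "h \<in> borel_measurable (lebesgue_on (Wball x))" if "h \<in> L0" for h :: "'a \<Rightarrow> real"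
      by (rule measurable_restrict_mono[OF that sub])
    have "AE y in lborel. y \<in> Wball x \<longrightarrow> f y = g y" using AE by eventually_elim (use sub in auto)
    then show ?thesis using True assms by (simp add: W_def) (intro Laverage_cong_AE m, auto)
  qed (simp add: W_def)
qed

lemma borel_lebesgue_on: "f \<in> borel_measurable borel \<Longrightarrow> f \<in> borel_measurable (lebesgue_on S)"
  by (intro measurable_restrict_space1 measurable_completion) simp

lemma W_representative:
  assumes "f \<in> L0"
  obtains g where "g \<in> borel_measurable borel" "\<And>x. x \<notin> \<Omega> \<Longrightarrow> g x = 0" "AE x in lborel. x \<in> \<Omega> \<longrightarrow> f x = g x"
    "\<And>q. W q f = W q g"
proof -
  obtain g where g: "g \<in> borel_measurable borel" "\<And>x. x \<notin> \<Omega> \<Longrightarrow> g x = 0" "AE x in lborel. x \<in> \<Omega> \<longrightarrow> f x = g x"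
    using borel_representative[OF assms borel_\<Omega>] by blast
  have "W q f = W q g" for q
    by (rule W_cong_AE[OF assms borel_lebesgue_on[OF g(1)] g(3)])
  with g show thesis by (rule that)
qed

lemma W_eq_finite:
  "x \<in> \<Omega> \<Longrightarrow> f \<in> borel_measurable borel \<Longrightarrow> 0 < R \<Longrightarrow>
    W (ennreal R) f x = epowr (avg x (\<lambda>y. ennreal (\<bar>f y\<bar> powr R))) (1 / R)"
  by (simp add: W_def Laverage_eq_finite Lnorm_ennreal nn_integral_density epowr_ennreal)

lemma W_infinity_le_iff:
  assumes x: "x \<in> \<Omega>" and f[measurable]: "f \<in> borel_measurable borel"
  shows "W \<infinity> f x \<le> t \<longleftrightarrow> (AE y in lborel. dist x y < c * \<delta> x \<longrightarrow> ennreal \<bar>f y\<bar> \<le> t)"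
proof -
  have eqW: "W \<infinity> f x = esssup (avgm x) (\<lambda>y. ennreal \<bar>f y\<bar>)"
    using Laverage_eq_infinity[OF x f] x by (simp add: W_def Lnorm_def)
  have "W \<infinity> f x \<le> t \<longleftrightarrow> (AE y in avgm x. ennreal \<bar>f y\<bar> \<le> t)"
    unfolding eqW
  proof
    assume "esssup (avgm x) (\<lambda>y. ennreal \<bar>f y\<bar>) \<le> t"
    then show "AE y in avgm x. ennreal \<bar>f y\<bar> \<le> t"
      using esssup_AE[of "\<lambda>y. ennreal \<bar>f y\<bar>" "avgm x"] by (auto elim: eventually_mono intro: order_trans)
  next
    assume "AE y in avgm x. ennreal \<bar>f y\<bar> \<le> t"
    then show "esssup (avgm x) (\<lambda>y. ennreal \<bar>f y\<bar>) \<le> t" by (intro esssup_I) auto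
  qed
  also have "\<dots> \<longleftrightarrow> (AE y in lborel. dist x y < c * \<delta> x \<longrightarrow> ennreal \<bar>f y\<bar> \<le> t)"
    using vol_pos[OF x] x by (subst AE_density, simp) (auto simp: \<phi>_def)
  finally show ?thesis .
qed

lemma borel_measurable_W_finite [measurable]:
  assumes [measurable]: "f \<in> borel_measurable borel" and R: "0 < R"
  shows "W (ennreal R) f \<in> borel_measurable borel"
proof -
  have "W (ennreal R) f = (\<lambda>x. if x \<in> \<Omega> then epowr (avg x (\<lambda>y. ennreal (\<bar>f y\<bar> powr R))) (1 / R) else 0)"
    using W_eq_finite[OF _ assms] by (auto simp: W_def fun_eq_iff)
  also have "\<dots> \<in> borel_measurable borel" by measurable
  finally show ?thesis .
qed

text \<open>An essential supremum is no integral with a parameter, but its sublevel sets are zero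
  sets of one: \<open>W \<infinity> f x \<le> t\<close> says that the part of the Whitney ball where
  \<open>\<bar>f\<bar>\<close> exceeds \<open>t\<close> has measure 0, and this measure is a Borel
  function of \<open>x\<close>.\<close>

lemma borel_measurable_W_infinity:
  assumes [measurable]: "f \<in> borel_measurable borel"
  shows "W \<infinity> f \<in> borel_measurable borel"
proof (rule borel_measurableI_le)
  fix t
  let ?g = "\<lambda>x. \<integral>\<^sup>+y. (if dist x y < c * \<delta> x \<and> t < ennreal \<bar>f y\<bar> then 1 else 0 :: ennreal) \<partial>lborel"
  have "W \<infinity> f x \<le> t \<longleftrightarrow> x \<notin> \<Omega> \<or> ?g x = 0" for x
  proof (cases "x \<in> \<Omega>")
    case True
    have "?g x = 0 \<longleftrightarrow> (AE y in lborel. (if dist x y < c * \<delta> x \<and> t < ennreal \<bar>f y\<bar> then 1 else 0 :: ennreal) = 0)"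
      by (rule nn_integral_0_iff_AE) measurable
    also have "\<dots> \<longleftrightarrow> W \<infinity> f x \<le> t"
      unfolding W_infinity_le_iff[OF True assms] by (intro AE_cong) auto
    finally show ?thesis using True by simp
  qed (simp add: W_def)
  then have "{x \<in> space borel. W \<infinity> f x \<le> t} = {x \<in> space borel. x \<notin> \<Omega> \<or> ?g x = 0}" by auto
  also have "\<dots> \<in> sets borel" by measurable
  finally show "{x \<in> space borel. W \<infinity> f x \<le> t} \<in> sets borel" .
qed

lemma borel_measurable_W_borel:
  assumes "conj_exp R q" "f \<in> borel_measurable borel"
  shows "W q f \<in> borel_measurable borel"
  using assms borel_measurable_W_finite[of f] borel_measurable_W_infinity[of f] by (auto simp: conj_exp_def)

lemma borel_measurable_W:
  assumes "f \<in> L0"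
  shows "conj_exp R q \<Longrightarrow> W q f \<in> borel_measurable borel" "0 < R \<Longrightarrow> W (ennreal R) f \<in> borel_measurable borel"
proof -
  obtain g where "g \<in> borel_measurable borel" "\<And>q. W q f = W q g" using W_representative[OF assms] by metis
  then show "conj_exp R q \<Longrightarrow> W q f \<in> borel_measurable borel" "0 < R \<Longrightarrow> W (ennreal R) f \<in> borel_measurable borel"
    using borel_measurable_W_borel borel_measurable_W_finite by simp_all
qed

lemma W_Holder:
  assumes x: "x \<in> \<Omega>" and [measurable]: "f \<in> borel_measurable borel" "g \<in> borel_measurable borel" and "conj_exp R q"
  shows "(\<integral>\<^sup>+y. \<phi> x y * ennreal \<bar>f y * g y\<bar> \<partial>lborel) \<le> W (ennreal R) f x * W q g x"
proof -
  have eq: "(\<integral>\<^sup>+y. \<phi> x y * ennreal \<bar>f y * g y\<bar> \<partial>lborel) = (\<integral>\<^sup>+y. ennreal \<bar>f y\<bar> * ennreal \<bar>g y\<bar> \<partial>avgm x)"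
    by (subst nn_integral_density) (auto simp: abs_mult ennreal_mult)
  from assms(4) consider "R = 1" "q = \<infinity>" | Q where "1 < R" "1 < Q" "1 / R + 1 / Q = 1" "q = ennreal Q"
    unfolding conj_exp_def by blast
  then show ?thesis
  proof cases
    case 1
    have "AE y in lborel. \<phi> x y * ennreal \<bar>f y * g y\<bar> \<le> (\<phi> x y * ennreal \<bar>f y\<bar>) * W q g x"
      using W_infinity_le_iff[OF x assms(3), of "W \<infinity> g x", THEN iffD1, OF order_refl]
      by eventually_elim (auto simp: \<phi>_def abs_mult ennreal_mult 1 mult.assoc intro!: mult_left_mono)
    then have "(\<integral>\<^sup>+y. \<phi> x y * ennreal \<bar>f y * g y\<bar> \<partial>lborel) \<le> (\<integral>\<^sup>+y. (\<phi> x y * ennreal \<bar>f y\<bar>) * W q g x \<partial>lborel)"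
      by (rule nn_integral_mono_AE)
    also have "\<dots> = avg x (\<lambda>y. ennreal \<bar>f y\<bar>) * W q g x" by (rule nn_integral_multc) measurable
    also have "\<dots> = W (ennreal R) f x * W q g x" using x 1 by (subst W_eq_finite) auto
    finally show ?thesis .
  next
    case 2
    then show ?thesis unfolding eq using x
      by (simp add: W_def Laverage_eq_finite) (rule Lnorm_Holder, auto)
  qed
qed

lemma W_add_le:
  assumes "f \<in> L0" "g \<in> L0" and R: "1 \<le> R"
  shows "W (ennreal R) (\<lambda>y. f y + g y) x \<le> 4 * (W (ennreal R) f x + W (ennreal R) g x)"
proof (cases "x \<in> \<Omega>")
  case x: True
  obtain f' where f': "f' \<in> borel_measurable borel" "AE x in lborel. x \<in> \<Omega> \<longrightarrow> f x = f' x" "\<And>q. W q f = W q f'"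
    using W_representative[OF assms(1)] by metis
  obtain g' where g': "g' \<in> borel_measurable borel" "AE x in lborel. x \<in> \<Omega> \<longrightarrow> g x = g' x" "\<And>q. W q g = W q g'"
    using W_representative[OF assms(2)] by metis
  note [measurable] = f'(1) g'(1)
  have R0: "0 < R" using R by simp
  have AE: "AE x in lborel. x \<in> \<Omega> \<longrightarrow> f x + g x = f' x + g' x"
    using f'(2) g'(2) by eventually_elim auto
  have "W (ennreal R) (\<lambda>y. f y + g y) = W (ennreal R) (\<lambda>y. f' y + g' y)"
  proof (rule W_cong_AE)
    show "(\<lambda>y. f y + g y) \<in> L0" using assms by measurable
    show "(\<lambda>y. f' y + g' y) \<in> L0" by (rule borel_lebesgue_on) measurable
  qed (rule AE)
  then have "W (ennreal R) (\<lambda>y. f y + g y) x = Lp R (avgm x) (\<lambda>y. f' y + g' y)"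
    using x by (simp add: W_def Laverage_eq_finite R0)
  also have "\<dots> \<le> Lnorm (ennreal R) (avgm x) (\<lambda>y. ennreal \<bar>f' y\<bar> + ennreal \<bar>g' y\<bar>)"
    using R by (intro Lnorm_mono_AE AE_I2) (auto simp: ennreal_plus[symmetric] simp del: ennreal_plus intro!: ennreal_leI)
  also have "\<dots> \<le> 4 * (Lp R (avgm x) f' + Lp R (avgm x) g')"
    by (rule Lnorm_add_le[OF R]) auto
  also have "\<dots> = 4 * (W (ennreal R) f x + W (ennreal R) g x)"
    using x by (simp add: f'(3) g'(3) W_def Laverage_eq_finite R0)
  finally show ?thesis .
qed (simp add: W_def)

text \<open>If \<open>y\<close> lies in the Whitney ball of \<open>x\<close>, then
  \<open>\<delta> x\<close> and \<open>\<delta> y\<close> agree up to a factor 2. Hence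
  \<open>x\<close> is within \<open>2 * c * \<delta> y\<close> of \<open>y\<close>, while its
  Whitney ball has radius at least \<open>c * \<delta> y / 2\<close>; the constant is the ratio of
  the two volumes.\<close>

lemma \<phi>_dual_upper:
  assumes y: "y \<in> \<Omega>"
  shows "(\<integral>\<^sup>+x. \<phi> x y \<partial>lborel) \<le> ennreal (4 ^ DIM('a))"
proof -
  have d: "0 < \<delta> y" by (rule \<delta>_pos[OF y])
  let ?v = "unit_ball_vol DIM('a) * (c * \<delta> y / 2) ^ DIM('a)"
  have v: "0 < ?v" using d c_pos by simp
  have "(\<integral>\<^sup>+x. \<phi> x y \<partial>lborel) \<le> (\<integral>\<^sup>+x. ennreal (1 / ?v) * indicator (ball y (2 * c * \<delta> y)) x \<partial>lborel)"
  proof (rule nn_integral_mono)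
    fix x
    show "\<phi> x y \<le> ennreal (1 / ?v) * indicator (ball y (2 * c * \<delta> y)) x"
    proof (cases "x \<in> \<Omega> \<and> dist x y < c * \<delta> x")
      case True
      then have n: "\<delta> x \<le> 2 * \<delta> y" "\<delta> y \<le> 2 * \<delta> x" using near(2,3)[of x y] by auto
      have "c * \<delta> x \<le> 2 * c * \<delta> y" using n c_pos by simp
      then have "x \<in> ball y (2 * c * \<delta> y)" using True by (simp add: dist_commute)
      moreover have "?v \<le> vol x"
        unfolding vol_def using n c_pos d by (intro mult_left_mono power_mono) auto
      then have "1 / vol x \<le> 1 / ?v" using v by (intro divide_left_mono) auto
      ultimately show ?thesis using True by (simp add: \<phi>_def ennreal_leI)
    qed (auto simp: \<phi>_def)
  qed
  also have "\<dots> = ennreal (1 / ?v) * ennreal (unit_ball_vol DIM('a) * (2 * c * \<delta> y) ^ DIM('a))"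
    using d c_pos by (subst nn_integral_cmult_indicator) (auto simp: emeasure_ball)
  also have "\<dots> = ennreal (4 ^ DIM('a))"
  proof -
    have "(2 * c * \<delta> y) ^ DIM('a) = 4 ^ DIM('a) * (c * \<delta> y / 2) ^ DIM('a)"
    proof -
      have "2 * c * \<delta> y = 4 * (c * \<delta> y / 2)" by simp
      then show ?thesis by (metis power_mult_distrib)
    qed
    then show ?thesis using v d c_pos by (auto simp: ennreal_mult[symmetric] less_imp_neq[OF unit_ball_vol_pos, symmetric])
  qed
  finally show ?thesis .
qed

text \<open>The mirror image of the upper bound: every \<open>x\<close> within
  \<open>c * \<delta> y / 2\<close> of \<open>y\<close> has \<open>y\<close> in its Whitney ball,
  whose radius is at most \<open>2 * c * \<delta> y\<close>.\<close>

lemma \<phi>_dual_lower: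
  assumes y: "y \<in> \<Omega>"
  shows "1 \<le> ennreal (4 ^ DIM('a)) * (\<integral>\<^sup>+x. \<phi> x y \<partial>lborel)"
proof -
  have d: "0 < \<delta> y" by (rule \<delta>_pos[OF y])
  let ?v = "unit_ball_vol DIM('a) * (2 * c * \<delta> y) ^ DIM('a)"
  have v: "0 < ?v" using d c_pos by simp
  have "ennreal (1 / ?v) * ennreal (unit_ball_vol DIM('a) * (c * \<delta> y / 2) ^ DIM('a))
      = (\<integral>\<^sup>+x. ennreal (1 / ?v) * indicator (ball y (c * \<delta> y / 2)) x \<partial>lborel)"
    using d c_pos by (subst nn_integral_cmult_indicator) (auto simp: emeasure_ball)
  also have "\<dots> \<le> (\<integral>\<^sup>+x. \<phi> x y \<partial>lborel)"
  proof (rule nn_integral_mono)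
    fix x
    show "ennreal (1 / ?v) * indicator (ball y (c * \<delta> y / 2)) x \<le> \<phi> x y"
    proof (cases "x \<in> ball y (c * \<delta> y / 2)")
      case True
      have "c * \<delta> y / 2 \<le> c * \<delta> y" using c_pos d by simp
      then have "x \<in> Wball y" using True by auto
      then have n: "x \<in> \<Omega>" "\<delta> y \<le> 2 * \<delta> x" "\<delta> x \<le> 2 * \<delta> y" using near[OF y] by auto
      have "c * \<delta> y / 2 \<le> c * \<delta> x" using n c_pos by simp
      then have dx: "dist x y < c * \<delta> x" using True by (simp add: dist_commute)
      have "vol x \<le> ?v"
        unfolding vol_def using n c_pos \<delta>_nonneg[of x] by (intro mult_left_mono power_mono) auto
      then have "1 / ?v \<le> 1 / vol x" using vol_pos[OF n(1)] v by (intro divide_left_mono) auto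
      then show ?thesis using n dx True by (simp only: \<phi>_def ennreal_leI indicator_simps if_True simp_thms mult_1_right)
    qed simp
  qed
  finally have "ennreal (4 ^ DIM('a)) * (ennreal (1 / ?v) * ennreal (unit_ball_vol DIM('a) * (c * \<delta> y / 2) ^ DIM('a)))
      \<le> ennreal (4 ^ DIM('a)) * (\<integral>\<^sup>+x. \<phi> x y \<partial>lborel)" by (rule mult_left_mono) simp
  moreover have "ennreal (4 ^ DIM('a)) * (ennreal (1 / ?v) * ennreal (unit_ball_vol DIM('a) * (c * \<delta> y / 2) ^ DIM('a))) = 1"
  proof -
    have "(2 * c * \<delta> y) ^ DIM('a) = 4 ^ DIM('a) * (c * \<delta> y / 2) ^ DIM('a)"
    proof -
      have "2 * c * \<delta> y = 4 * (c * \<delta> y / 2)" by simp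
      then show ?thesis by (metis power_mult_distrib)
    qed
    then show ?thesis using v d c_pos by (auto simp: ennreal_mult[symmetric] less_imp_neq[OF unit_ball_vol_pos, symmetric])
  qed
  ultimately show ?thesis by simp
qed

text \<open>Fubini against the lower bound for the mass of \<phi> in its first variable.\<close>

lemma averaging:
  assumes f[measurable]: "f \<in> borel_measurable borel"
  shows "(\<integral>\<^sup>+y\<in>\<Omega>. f y \<partial>lborel) \<le> ennreal (4 ^ DIM('a)) * (\<integral>\<^sup>+x\<in>\<Omega>. avg x f \<partial>lborel)"
proof -
  have "(\<integral>\<^sup>+y\<in>\<Omega>. f y \<partial>lborel) \<le> (\<integral>\<^sup>+y. ennreal (4 ^ DIM('a)) * (\<integral>\<^sup>+x. \<phi> x y * f y \<partial>lborel) \<partial>lborel)"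
  proof (rule nn_integral_mono)
    fix y
    show "f y * indicator \<Omega> y \<le> ennreal (4 ^ DIM('a)) * (\<integral>\<^sup>+x. \<phi> x y * f y \<partial>lborel)"
    proof (cases "y \<in> \<Omega>")
      case True
      have "1 * f y \<le> (ennreal (4 ^ DIM('a)) * (\<integral>\<^sup>+x. \<phi> x y \<partial>lborel)) * f y"
        by (intro mult_right_mono \<phi>_dual_lower True) auto
      then show ?thesis using True by (simp add: nn_integral_multc mult.assoc)
    qed simp
  qed
  also have "\<dots> = ennreal (4 ^ DIM('a)) * (\<integral>\<^sup>+y. \<integral>\<^sup>+x. \<phi> x y * f y \<partial>lborel \<partial>lborel)"
    by (rule nn_integral_cmult) measurable
  also have "(\<integral>\<^sup>+y. \<integral>\<^sup>+x. \<phi> x y * f y \<partial>lborel \<partial>lborel) = (\<integral>\<^sup>+x. \<integral>\<^sup>+y. \<phi> x y * f y \<partial>lborel \<partial>lborel)"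
    by (rule lborel_pair.Fubini') measurable
  also have "\<dots> = (\<integral>\<^sup>+x\<in>\<Omega>. avg x f \<partial>lborel)"
    by (intro nn_integral_cong) (auto simp: \<phi>_def indicator_def)
  finally show ?thesis .
qed

lemma nt_max_eq: "nt_max \<Omega> a c q u \<xi> = (SUP x\<in>nt_cone \<Omega> a \<xi>. W q u x)"
  unfolding nt_max_def W_def by (intro SUP_cong) (auto simp: nt_cone_def)

text \<open>For every \<open>u\<close> the superlevel sets are unions of shadows, which are open
  balls.\<close>

lemma borel_measurable_nt_max [measurable]: "nt_max \<Omega> a c q u \<in> borel_measurable borel"
proof (rule borel_measurable_of_open_superlevel)
  fix t
  have "{\<xi>. t < nt_max \<Omega> a c q u \<xi>} = (\<Union>x\<in>{x\<in>\<Omega>. t < W q u x}. ball x ((1 + a) * \<delta> x))"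
    unfolding nt_max_eq less_SUP_iff by (auto simp: nt_cone_def)
  also have "open \<dots>" by auto
  finally show "open {\<xi>. t < nt_max \<Omega> a c q u \<xi>}" .
qed

lemma carleson_eq: "carleson n \<Omega> c q H = ball_sup lborel n (W q H)"
  unfolding carleson_def ball_sup_def nn_integral_completion
  by (intro ext SUP_cong refl arg_cong2[where f="(/)"] nn_integral_cong) (auto simp: W_def indicator_def)

lemma W_indicator: "W q f x * indicator \<Omega> x = W q f x"
  by (simp add: W_def indicator_def)

lemma borel_measurable_carleson:
  assumes "f \<in> L0" "conj_exp R q"
  shows "carleson n \<Omega> c q f \<in> borel_measurable borel"
  unfolding carleson_eq using borel_measurable_W(1)[OF assms] by (intro borel_measurable_ball_sup) auto

text \<open>Averaging comes first, because Hoelder's inequality on each Whitney ball is what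
  produces \<open>W (ennreal R) u\<close> and \<open>W q F\<close>; the Carleson inequality then
  takes these two as \<open>U\<close> and \<open>H\<close>. The constant does not depend on the
  exponents.\<close>

theorem carleson_duality_bound:
  obtains K where "0 < K"
    "\<And>R q u F. conj_exp R q \<Longrightarrow> u \<in> L0 \<Longrightarrow> F \<in> L0 \<Longrightarrow>
      (\<integral>\<^sup>+x\<in>\<Omega>. ennreal \<bar>u x * F x\<bar> \<partial>lborel) \<le> ennreal K * (\<integral>\<^sup>+\<xi>. nt_max \<Omega> a c (ennreal R) u \<xi> * carleson n \<Omega> c q F \<xi> \<partial>M)"
proof -
  obtain K where K: "0 < K" "\<And>U H. U \<in> borel_measurable borel \<Longrightarrow> H \<in> borel_measurable borel \<Longrightarrow>
      (\<integral>\<^sup>+x\<in>\<Omega>. U x * H x \<partial>lborel) \<le> ennreal K *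
        (\<integral>\<^sup>+\<xi>. (SUP x\<in>nt_cone \<Omega> a \<xi>. U x) * ball_sup lborel n (\<lambda>x. H x * indicator \<Omega> x) \<xi> \<partial>M)"
    using carleson_inequality by blast
  show thesis
  proof (rule that[of "4 ^ DIM('a) * K"])
    show "0 < 4 ^ DIM('a) * K" using K(1) by simp
    fix R q and u F :: "'a \<Rightarrow> real"
    assume c: "conj_exp R q" and u: "u \<in> L0" and F: "F \<in> L0"
    obtain u' where u': "u' \<in> borel_measurable borel" "AE x in lborel. x \<in> \<Omega> \<longrightarrow> u x = u' x" "\<And>q. W q u = W q u'"
      using W_representative[OF u] by metis
    obtain F' where F': "F' \<in> borel_measurable borel" "AE x in lborel. x \<in> \<Omega> \<longrightarrow> F x = F' x" "\<And>q. W q F = W q F'"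
      using W_representative[OF F] by metis
    note [measurable] = u'(1) F'(1)
    have R: "0 < R" using c by (auto simp: conj_exp_def)
    have "(\<integral>\<^sup>+x\<in>\<Omega>. ennreal \<bar>u x * F x\<bar> \<partial>lborel) = (\<integral>\<^sup>+x\<in>\<Omega>. ennreal \<bar>u' x * F' x\<bar> \<partial>lborel)"
    proof (intro nn_integral_cong_AE)
      show "AE x in lborel. ennreal \<bar>u x * F x\<bar> * indicator \<Omega> x = ennreal \<bar>u' x * F' x\<bar> * indicator \<Omega> x"
        using u'(2) F'(2) by eventually_elim (auto simp: indicator_def)
    qed
    also have "\<dots> \<le> ennreal (4 ^ DIM('a)) * (\<integral>\<^sup>+x\<in>\<Omega>. (\<integral>\<^sup>+y. \<phi> x y * ennreal \<bar>u' y * F' y\<bar> \<partial>lborel) \<partial>lborel)"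
      by (rule averaging) measurable
    also have "\<dots> \<le> ennreal (4 ^ DIM('a)) * (\<integral>\<^sup>+x\<in>\<Omega>. W (ennreal R) u' x * W q F' x \<partial>lborel)"
      by (intro mult_left_mono nn_integral_mono) (auto simp: indicator_def intro!: W_Holder[OF _ _ _ c])
    also have "\<dots> \<le> ennreal (4 ^ DIM('a)) * (ennreal K *
        (\<integral>\<^sup>+\<xi>. (SUP x\<in>nt_cone \<Omega> a \<xi>. W (ennreal R) u' x) * ball_sup lborel n (\<lambda>x. W q F' x * indicator \<Omega> x) \<xi> \<partial>M))"
      by (intro mult_left_mono K(2) borel_measurable_W_borel[OF c] borel_measurable_W_finite R) auto
    also have "\<dots> = ennreal (4 ^ DIM('a) * K) * (\<integral>\<^sup>+\<xi>. nt_max \<Omega> a c (ennreal R) u \<xi> * carleson n \<Omega> c q F \<xi> \<partial>M)"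
      using K(1) by (simp add: W_indicator nt_max_eq carleson_eq u'(3) F'(3) ennreal_mult mult.assoc)
    finally show "(\<integral>\<^sup>+x\<in>\<Omega>. ennreal \<bar>u x * F x\<bar> \<partial>lborel)
        \<le> ennreal (4 ^ DIM('a) * K) * (\<integral>\<^sup>+\<xi>. nt_max \<Omega> a c (ennreal R) u \<xi> * carleson n \<Omega> c q F \<xi> \<partial>M)" .
  qed
qed

lemma nt_max_add_le:
  assumes "f \<in> L0" "g \<in> L0" and R: "1 \<le> R"
  shows "nt_max \<Omega> a c (ennreal R) (\<lambda>y. f y + g y) \<xi> \<le> 4 * (nt_max \<Omega> a c (ennreal R) f \<xi> + nt_max \<Omega> a c (ennreal R) g \<xi>)"
  unfolding nt_max_eq
  by (intro SUP_least order_trans[OF W_add_le[OF assms]] mult_left_mono add_mono SUP_upper) auto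

end

section \<open>Bounding the Carleson functional by duality\<close>

text \<open>Hoelder's inequality in \<open>density M k\<close>, applied to \<open>w\<close> and the
  constant 1. Since the kernel has mass at most \<open>B\<close> and not exactly 1, a power of
  \<open>B\<close> appears.\<close>

lemma epowr_weighted_Jensen:
  assumes R: "1 \<le> R" and B: "1 \<le> B" and [measurable]: "k \<in> borel_measurable M" "w \<in> borel_measurable M"
    and k: "(\<integral>\<^sup>+x. k x \<partial>M) \<le> ennreal B"
  shows "epowr (\<integral>\<^sup>+x. k x * w x \<partial>M) R \<le> ennreal (B powr (R - 1)) * (\<integral>\<^sup>+x. k x * epowr (w x) R \<partial>M)"
proof (cases "R = 1")
  case True
  then show ?thesis using B by simp
next
  case False
  then have R1: "1 < R" using R by simp
  define Q where "Q = R / (R - 1)"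
  have Q: "1 < Q" "1 / Q + 1 / R = 1" "(1 / Q) * R = R - 1" using R1 by (auto simp: Q_def field_simps)
  have R0: "0 < R" "0 < Q" using R1 Q by auto
  have "(\<integral>\<^sup>+x. k x * w x \<partial>M) = (\<integral>\<^sup>+x. 1 * w x \<partial>density M k)" by (subst nn_integral_density) auto
  also have "\<dots> \<le> Lnorm (ennreal Q) (density M k) (\<lambda>_. 1) * Lnorm (ennreal R) (density M k) w"
    by (rule Lnorm_Holder[OF Q(1) R1 Q(2)]) auto
  also have "Lnorm (ennreal Q) (density M k) (\<lambda>_. 1) \<le> epowr (ennreal B) (1 / Q)"
    unfolding Lnorm_ennreal[OF R0(2)] using k Q(1)
    by (intro epowr_mono) (auto simp: emeasure_density)
  finally have "epowr (\<integral>\<^sup>+x. k x * w x \<partial>M) R \<le> epowr (epowr (ennreal B) (1 / Q) * Lnorm (ennreal R) (density M k) w) R"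
    by (intro epowr_mono R0) (simp add: mult_right_mono)
  also have "\<dots> = ennreal (B powr (R - 1)) * (\<integral>\<^sup>+x. epowr (w x) R \<partial>density M k)"
    using B Q(3) by (simp add: epowr_mult R0 epowr_Lnorm epowr_ennreal powr_powr)
  also have "(\<integral>\<^sup>+x. epowr (w x) R \<partial>density M k) = (\<integral>\<^sup>+x. k x * epowr (w x) R \<partial>M)"
    by (rule nn_integral_density) auto
  finally show ?thesis .
qed

context nt_domain
begin

section \<open>Compact exhaustion of the domain\<close>

definition KK :: "nat \<Rightarrow> 'a set" where
  "KK j = {x \<in> \<Omega>. norm x \<le> real j \<and> 1 / real (Suc j) \<le> \<delta> x}"

lemma KK_sub: "KK j \<subseteq> \<Omega>"
  by (auto simp: KK_def)

text \<open>The lower bound on \<delta> excludes frontier points, so the domain may be replaced by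
  its closure in the description of \<open>KK j\<close>.\<close>

lemma compact_KK: "compact (KK j)"
proof -
  have "KK j = closure \<Omega> \<inter> (cball 0 (real j) \<inter> \<delta> -` {1 / real (Suc j)..})"
  proof (rule set_eqI, rule iffI)
    fix x assume "x \<in> closure \<Omega> \<inter> (cball 0 (real j) \<inter> \<delta> -` {1 / real (Suc j)..})"
    then have x: "x \<in> closure \<Omega>" "x \<in> cball 0 (real j)" "\<delta> x \<in> {1 / real (Suc j)..}" by auto
    then have "0 < \<delta> x" by (auto intro: order_less_le_trans[of _ "1 / real (Suc j)"])
    then have "x \<notin> frontier \<Omega>" using \<delta>_le[of x x] by auto
    then have "x \<in> \<Omega>" using x(1) open_Om by (auto simp: frontier_def interior_open)
    then show "x \<in> KK j" using x by (simp add: KK_def)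
  next
    fix x assume x: "x \<in> KK j"
    then show "x \<in> closure \<Omega> \<inter> (cball 0 (real j) \<inter> \<delta> -` {1 / real (Suc j)..})"
      using closure_subset by (auto simp: KK_def)
  qed
  moreover have "closed (\<delta> -` {1 / real (Suc j)..})"
    using continuous_closed_vimage[OF closed_atLeast] continuous_on_\<delta>[of UNIV] by (simp add: continuous_on_eq_continuous_at closed_vimage)
  ultimately show ?thesis by (simp add: closed_Int_compact compact_Int_closed)
qed

lemma borel_KK [measurable]: "KK j \<in> sets borel"
  using compact_KK by (simp add: borel_compact)

lemma incseq_KK: "incseq KK"
proof (rule incseq_SucI)
  fix j
  have "1 / real (Suc (Suc j)) \<le> 1 / real (Suc j)" by (intro divide_left_mono) auto
  then show "KK j \<subseteq> KK (Suc j)" by (auto simp: KK_def)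
qed

lemma KK_exhausts:
  assumes "x \<in> \<Omega>" obtains j where "x \<in> KK j"
proof -
  obtain i where i: "1 / real (Suc i) < \<delta> x" using nat_approx_posE[OF \<delta>_pos[OF assms]] by blast
  obtain k where k: "norm x \<le> real k" using real_arch_simple by blast
  have "1 / real (Suc (max i k)) \<le> 1 / real (Suc i)" by (intro divide_left_mono) auto
  then have "x \<in> KK (max i k)" using i k assms by (auto simp: KK_def)
  then show thesis by (rule that)
qed

lemma compact_sub_KK:
  assumes "compact K" "K \<subseteq> \<Omega>" obtains j where "K \<subseteq> KK j"
proof (cases "K = {}")
  case False
  obtain x0 where x0: "x0 \<in> K" "\<And>x. x \<in> K \<Longrightarrow> \<delta> x0 \<le> \<delta> x"
    using continuous_attains_inf[OF assms(1) False continuous_on_\<delta>] by blast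
  have "0 < \<delta> x0" using x0 assms \<delta>_pos by blast
  then obtain i where i: "1 / real (Suc i) < \<delta> x0" using nat_approx_posE by blast
  obtain B where B: "\<And>x. x \<in> K \<Longrightarrow> norm x \<le> B" using compact_imp_bounded[OF assms(1)] unfolding bounded_iff by blast
  obtain k where k: "B \<le> real k" using real_arch_simple by blast
  have le: "1 / real (Suc (max i k)) \<le> 1 / real (Suc i)" by (intro divide_left_mono) auto
  have "x \<in> KK (max i k)" if "x \<in> K" for x
    using x0(2)[OF that] B[OF that] i k le that assms(2) by (auto simp: KK_def)
  then show thesis by (intro that) blast
qed (use that in blast)

lemma KK_finite: "emeasure lborel (KK j) < top"
  using emeasure_compact_finite[OF compact_KK] by simp

abbreviation "test_funs \<equiv> bounded_supp lborel KK"

lemma AE_frontier: "AE \<xi> in M. \<xi> \<in> frontier \<Omega>"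
  using M_null by (intro AE_I'[of "- frontier \<Omega>"]) (auto simp: null_sets_def)

section \<open>Conical integrals and averages over shadows\<close>

definition kk :: "'a \<Rightarrow> 'a \<Rightarrow> ennreal" where
  "kk x \<zeta> = (if x \<in> \<Omega> \<and> dist x \<zeta> < (1 + a) * \<delta> x then ennreal (1 / \<delta> x ^ n) else 0)"

lemma measurable_kk [measurable]: "case_prod kk \<in> borel_measurable (borel \<Otimes>\<^sub>M borel)"
  unfolding kk_def by measurable

lemma kk_eq: "x \<in> \<Omega> \<Longrightarrow> kk x \<zeta> = ennreal (1 / \<delta> x ^ n) * indicator (ball x ((1 + a) * \<delta> x)) \<zeta>"
  by (auto simp: kk_def indicator_def)

lemma kk_mass: "x \<in> \<Omega> \<Longrightarrow> ennreal \<kappa>\<^sub>2 \<le> (\<integral>\<^sup>+\<zeta>. kk x \<zeta> \<partial>M)"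
proof -
  assume x: "x \<in> \<Omega>"
  have d: "0 < \<delta> x" by (rule \<delta>_pos[OF x])
  have "ennreal \<kappa>\<^sub>2 = ennreal (1 / \<delta> x ^ n) * ennreal (\<kappa>\<^sub>2 * \<delta> x ^ n)"
    using d \<kappa>\<^sub>2_pos by (simp add: ennreal_mult[symmetric])
  also have "\<dots> \<le> ennreal (1 / \<delta> x ^ n) * emeasure M (ball x ((1 + a) * \<delta> x))"
    by (intro mult_left_mono cone_lower x) auto
  also have "\<dots> = (\<integral>\<^sup>+\<zeta>. kk x \<zeta> \<partial>M)"
    by (simp add: kk_eq[OF x] nn_integral_cmult_indicator)
  finally show ?thesis .
qed

definition area :: "('a \<Rightarrow> ennreal) \<Rightarrow> 'a \<Rightarrow> ennreal" where
  "area h \<zeta> = (\<integral>\<^sup>+x. kk x \<zeta> * h x \<partial>lborel)"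

lemma borel_measurable_area [measurable]:
  assumes [measurable]: "h \<in> borel_measurable borel" shows "area h \<in> borel_measurable borel"
  unfolding area_def by measurable

text \<open>A point \<open>x\<close> of the domain in \<open>ball \<xi> \<rho>\<close> has
  \<open>\<delta> x < \<rho>\<close>, so its shadow lies in the ball of radius
  \<open>(2 + a) * \<rho>\<close> about \<xi>. Spreading \<open>h x\<close> over the shadow, on
  which \<open>kk x\<close> has mass at least \<open>\<kappa>\<^sub>2\<close>, and exchanging the
  integrals bounds the Lebesgue integral of \<open>h\<close> by a boundary integral of
  \<open>area h\<close>.\<close>

lemma ball_sup_le_maximal_area:
  assumes [measurable]: "h \<in> borel_measurable borel" and h0: "\<And>x. x \<notin> \<Omega> \<Longrightarrow> h x = 0" and \<xi>: "\<xi> \<in> frontier \<Omega>"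
  shows "ball_sup lborel n h \<xi> \<le> ennreal ((2 + a) ^ n / \<kappa>\<^sub>2) * maximal (area h) \<xi>"
proof (rule ball_sup_le)
  interpret L: pair_sigma_finite lborel M by (rule pair_sigma_finite_lborel_M)
  fix \<rho> :: real assume \<rho>: "0 < \<rho>"
  let ?S = "(2 + a) * \<rho>"
  have S: "0 < ?S" using \<rho> a_pos by simp
  have "(\<integral>\<^sup>+x\<in>ball \<xi> \<rho>. h x \<partial>lborel)
      \<le> (\<integral>\<^sup>+x. \<integral>\<^sup>+\<zeta>. ennreal (1 / \<kappa>\<^sub>2) * (h x * indicator (ball \<xi> \<rho>) x * kk x \<zeta>) \<partial>M \<partial>lborel)"
  proof (rule nn_integral_mono)
    fix x
    show "h x * indicator (ball \<xi> \<rho>) x \<le> (\<integral>\<^sup>+\<zeta>. ennreal (1 / \<kappa>\<^sub>2) * (h x * indicator (ball \<xi> \<rho>) x * kk x \<zeta>) \<partial>M)"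
    proof (cases "x \<in> \<Omega>")
      case True
      have "h x * indicator (ball \<xi> \<rho>) x = (ennreal (1 / \<kappa>\<^sub>2) * (h x * indicator (ball \<xi> \<rho>) x)) * ennreal \<kappa>\<^sub>2"
      proof -
        have e: "ennreal (1 / \<kappa>\<^sub>2) * ennreal \<kappa>\<^sub>2 = 1" using \<kappa>\<^sub>2_pos by (simp add: ennreal_mult[symmetric])
        have "(ennreal (1 / \<kappa>\<^sub>2) * (h x * indicator (ball \<xi> \<rho>) x)) * ennreal \<kappa>\<^sub>2
            = (h x * indicator (ball \<xi> \<rho>) x) * (ennreal (1 / \<kappa>\<^sub>2) * ennreal \<kappa>\<^sub>2)" by (simp only: mult_ac)
        then show ?thesis by (simp only: e mult_1_right)
      qed
      also have "\<dots> \<le> (ennreal (1 / \<kappa>\<^sub>2) * (h x * indicator (ball \<xi> \<rho>) x)) * (\<integral>\<^sup>+\<zeta>. kk x \<zeta> \<partial>M)"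
        by (intro mult_left_mono kk_mass True) auto
      also have "\<dots> = (\<integral>\<^sup>+\<zeta>. (ennreal (1 / \<kappa>\<^sub>2) * (h x * indicator (ball \<xi> \<rho>) x)) * kk x \<zeta> \<partial>M)"
        by (rule nn_integral_cmult[symmetric]) measurable
      finally show ?thesis by (simp add: mult.assoc)
    qed (simp add: h0)
  qed
  also have "\<dots> = (\<integral>\<^sup>+\<zeta>. \<integral>\<^sup>+x. ennreal (1 / \<kappa>\<^sub>2) * (h x * indicator (ball \<xi> \<rho>) x * kk x \<zeta>) \<partial>lborel \<partial>M)"
    by (rule L.Fubini'[symmetric]) measurable
  also have "\<dots> \<le> (\<integral>\<^sup>+\<zeta>. ennreal (1 / \<kappa>\<^sub>2) * (area h \<zeta> * indicator (ball \<xi> ?S) \<zeta>) \<partial>M)"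
  proof (rule nn_integral_mono)
    fix \<zeta>
    have "h x * indicator (ball \<xi> \<rho>) x * kk x \<zeta> \<le> kk x \<zeta> * h x * indicator (ball \<xi> ?S) \<zeta>" for x
    proof (cases "x \<in> ball \<xi> \<rho> \<and> x \<in> \<Omega> \<and> dist x \<zeta> < (1 + a) * \<delta> x")
      case True
      have "\<delta> x < \<rho>" using \<delta>_le[OF \<xi>, of x] True by (simp add: dist_commute)
      then have "(1 + a) * \<delta> x \<le> (1 + a) * \<rho>" using a_pos by (intro mult_left_mono) auto
      then have "\<zeta> \<in> ball \<xi> ?S" using True dist_triangle[of \<xi> \<zeta> x] by (simp add: dist_commute algebra_simps)
      then show ?thesis by (simp add: mult_ac indicator_def)
    qed (auto simp: kk_def indicator_def)
    then have "(\<integral>\<^sup>+x. ennreal (1 / \<kappa>\<^sub>2) * (h x * indicator (ball \<xi> \<rho>) x * kk x \<zeta>) \<partial>lborel)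
        \<le> (\<integral>\<^sup>+x. ennreal (1 / \<kappa>\<^sub>2) * (kk x \<zeta> * h x * indicator (ball \<xi> ?S) \<zeta>) \<partial>lborel)"
      by (intro nn_integral_mono mult_left_mono) auto
    also have "\<dots> = ennreal (1 / \<kappa>\<^sub>2) * (area h \<zeta> * indicator (ball \<xi> ?S) \<zeta>)"
      by (simp add: nn_integral_cmult nn_integral_multc area_def)
    finally show "(\<integral>\<^sup>+x. ennreal (1 / \<kappa>\<^sub>2) * (h x * indicator (ball \<xi> \<rho>) x * kk x \<zeta>) \<partial>lborel)
        \<le> ennreal (1 / \<kappa>\<^sub>2) * (area h \<zeta> * indicator (ball \<xi> ?S) \<zeta>)" .
  qed
  also have "\<dots> = ennreal (1 / \<kappa>\<^sub>2) * (\<integral>\<^sup>+\<zeta>\<in>ball \<xi> ?S. area h \<zeta> \<partial>M)"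
    by (rule nn_integral_cmult) measurable
  also have "\<dots> \<le> ennreal (1 / \<kappa>\<^sub>2) * (ennreal (?S ^ n) * maximal (area h) \<xi>)"
    by (intro mult_left_mono ball_integral_le S) auto
  finally have "(\<integral>\<^sup>+x\<in>ball \<xi> \<rho>. h x \<partial>lborel) / ennreal (\<rho> ^ n)
      \<le> (ennreal (1 / \<kappa>\<^sub>2) * (ennreal (?S ^ n) * maximal (area h) \<xi>)) / ennreal (\<rho> ^ n)"
    by (rule divide_right_mono_ennreal)
  also have "\<dots> = (ennreal ((2 + a) ^ n / \<kappa>\<^sub>2) * maximal (area h) \<xi> * ennreal (\<rho> ^ n)) / ennreal (\<rho> ^ n)"
  proof -
    have "ennreal (1 / \<kappa>\<^sub>2) * ennreal (?S ^ n) = ennreal ((2 + a) ^ n / \<kappa>\<^sub>2) * ennreal (\<rho> ^ n)"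
      using \<rho> a_pos \<kappa>\<^sub>2_pos by (simp add: ennreal_mult[symmetric] power_mult_distrib)
    then have "ennreal (1 / \<kappa>\<^sub>2) * (ennreal (?S ^ n) * maximal (area h) \<xi>) = ennreal ((2 + a) ^ n / \<kappa>\<^sub>2) * maximal (area h) \<xi> * ennreal (\<rho> ^ n)"
      by (metis mult.assoc mult.commute)
    then show ?thesis by simp
  qed
  also have "\<dots> = ennreal ((2 + a) ^ n / \<kappa>\<^sub>2) * maximal (area h) \<xi>"
    using \<rho> by (intro mult_divide_eq_ennreal) auto
  finally show "(\<integral>\<^sup>+x\<in>ball \<xi> \<rho>. h x \<partial>lborel) / ennreal (\<rho> ^ n) \<le> ennreal ((2 + a) ^ n / \<kappa>\<^sub>2) * maximal (area h) \<xi>" .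
qed

text \<open>The adjoint of \<open>area\<close>, see \<open>area_pairing\<close>. As the mass of
  \<open>kk x\<close> is comparable to 1, this is the average over the shadow of \<open>x\<close> up
  to constants.\<close>

definition shadow_avg :: "('a \<Rightarrow> ennreal) \<Rightarrow> 'a \<Rightarrow> ennreal" where
  "shadow_avg \<psi> x = (\<integral>\<^sup>+\<zeta>. kk x \<zeta> * \<psi> \<zeta> \<partial>M)"

lemma borel_measurable_shadow_avg [measurable]:
  assumes [measurable]: "\<psi> \<in> borel_measurable borel" shows "shadow_avg \<psi> \<in> borel_measurable borel"
  unfolding shadow_avg_def by measurable

lemma area_pairing:
  assumes [measurable]: "h \<in> borel_measurable borel" "\<psi> \<in> borel_measurable borel"
  shows "(\<integral>\<^sup>+\<zeta>. area h \<zeta> * \<psi> \<zeta> \<partial>M) = (\<integral>\<^sup>+x. h x * shadow_avg \<psi> x \<partial>lborel)"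
proof -
  interpret L: pair_sigma_finite lborel M by (rule pair_sigma_finite_lborel_M)
  have "(\<integral>\<^sup>+\<zeta>. area h \<zeta> * \<psi> \<zeta> \<partial>M) = (\<integral>\<^sup>+\<zeta>. \<integral>\<^sup>+x. h x * (kk x \<zeta> * \<psi> \<zeta>) \<partial>lborel \<partial>M)"
    unfolding area_def by (subst nn_integral_multc[symmetric]) (auto simp: mult_ac)
  also have "\<dots> = (\<integral>\<^sup>+x. \<integral>\<^sup>+\<zeta>. h x * (kk x \<zeta> * \<psi> \<zeta>) \<partial>M \<partial>lborel)"
    by (rule L.Fubini') measurable
  also have "\<dots> = (\<integral>\<^sup>+x. h x * shadow_avg \<psi> x \<partial>lborel)"
    unfolding shadow_avg_def by (intro nn_integral_cong nn_integral_cmult) measurable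
  finally show ?thesis .
qed

text \<open>The Whitney balls of \<open>x\<close> and \<open>z\<close> share the point
  \<open>y\<close>, so \<open>\<delta> x\<close> and \<open>\<delta> z\<close> agree up to a factor
  4 and \<open>dist z x < 5 / 2 * \<delta> z\<close>. The shadow of \<open>x\<close> is then within
  \<open>(1 + a) + 5 / 2 + 4 * (1 + a)\<close> times \<open>\<delta> z\<close> of \<xi>, rounded up
  to \<open>8 + 5 * a\<close>; the \<open>4 ^ n\<close> compares \<open>1 / \<delta> x ^ n\<close>
  with \<open>1 / \<delta> z ^ n\<close>.\<close>

lemma shadow_avg_le_maximal:
  assumes [measurable]: "\<psi> \<in> borel_measurable borel"
    and z: "z \<in> nt_cone \<Omega> a \<xi>" and y: "dist z y < c * \<delta> z" and x: "x \<in> \<Omega>" "dist x y < c * \<delta> x"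
  shows "shadow_avg \<psi> x \<le> ennreal (4 ^ n * (8 + 5 * a) ^ n) * maximal \<psi> \<xi>" "dist z x < 3 * \<delta> z"
proof -
  have zO: "z \<in> \<Omega>" "dist z \<xi> < (1 + a) * \<delta> z" using z by (auto simp: nt_cone_def)
  have ny: "y \<in> \<Omega>" "\<delta> z \<le> 2 * \<delta> y" "\<delta> y \<le> 2 * \<delta> z" "dist z y < \<delta> z / 2" using near[OF zO(1), of y] y by auto
  have nx: "\<delta> x \<le> 2 * \<delta> y" "\<delta> y \<le> 2 * \<delta> x" "dist x y < \<delta> x / 2" using near[OF x(1), of y] x(2) by auto
  have d: "0 < \<delta> z" "0 < \<delta> x" using \<delta>_pos zO x by auto
  have zx: "dist z x < 5 / 2 * \<delta> z" using nx ny dist_triangle2[of z x y] by simp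
  then show "dist z x < 3 * \<delta> z" using d by simp
  let ?S = "(8 + 5 * a) * \<delta> z"
  have S: "0 < ?S" using d a_pos by simp
  have "shadow_avg \<psi> x \<le> (\<integral>\<^sup>+\<zeta>. ennreal (4 ^ n / \<delta> z ^ n) * (\<psi> \<zeta> * indicator (ball \<xi> ?S) \<zeta>) \<partial>M)"
    unfolding shadow_avg_def
  proof (rule nn_integral_mono)
    fix \<zeta>
    show "kk x \<zeta> * \<psi> \<zeta> \<le> ennreal (4 ^ n / \<delta> z ^ n) * (\<psi> \<zeta> * indicator (ball \<xi> ?S) \<zeta>)"
    proof (cases "dist x \<zeta> < (1 + a) * \<delta> x")
      case True
      have "(1 + a) * \<delta> x \<le> (1 + a) * (4 * \<delta> z)" using nx ny a_pos by (intro mult_left_mono) auto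
      then have "dist \<xi> \<zeta> < ?S"
        using True zx zO dist_triangle[of \<xi> \<zeta> z] dist_triangle[of z \<zeta> x] d by (simp add: dist_commute algebra_simps)
      moreover have "1 / \<delta> x ^ n \<le> 4 ^ n / \<delta> z ^ n"
      proof -
        have "\<delta> z ^ n \<le> (4 * \<delta> x) ^ n" using nx ny d by (intro power_mono) auto
        then show ?thesis using d by (simp add: field_simps power_mult_distrib)
      qed
      ultimately show ?thesis using True x by (auto simp: kk_def indicator_def intro!: mult_right_mono ennreal_leI)
    qed (simp add: kk_def)
  qed
  also have "\<dots> = ennreal (4 ^ n / \<delta> z ^ n) * (\<integral>\<^sup>+\<zeta>\<in>ball \<xi> ?S. \<psi> \<zeta> \<partial>M)"
    by (rule nn_integral_cmult) measurable
  also have "\<dots> \<le> ennreal (4 ^ n / \<delta> z ^ n) * (ennreal (?S ^ n) * maximal \<psi> \<xi>)"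
    by (intro mult_left_mono ball_integral_le S) auto
  also have "\<dots> = ennreal (4 ^ n * (8 + 5 * a) ^ n) * maximal \<psi> \<xi>"
    using d a_pos by (simp add: mult.assoc[symmetric] ennreal_mult[symmetric] power_mult_distrib)
  finally show "shadow_avg \<psi> x \<le> ennreal (4 ^ n * (8 + 5 * a) ^ n) * maximal \<psi> \<xi>" .
qed

text \<open>The function below is the average over \<open>x\<close> of normalised local extremisers \<open>w x\<close>, with
  amplitudes given by the averages of \<open>\<psi>\<close> over the shadow of \<open>x\<close>.\<close>

definition dual_test :: "('a \<Rightarrow> ennreal) \<Rightarrow> ('a \<Rightarrow> 'a \<Rightarrow> ennreal) \<Rightarrow> 'a \<Rightarrow> ennreal" where
  "dual_test \<psi> w y = (\<integral>\<^sup>+x. \<phi> x y * (shadow_avg \<psi> x * w x y) \<partial>lborel)"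

text \<open>On the Whitney ball of \<open>z\<close> only points \<open>x\<close> within
  \<open>3 * \<delta> z\<close> contribute, with amplitudes at most a multiple of
  \<open>maximal \<psi> \<xi>\<close>. Jensen's inequality for the kernel \<phi> in
  \<open>x\<close>, Fubini, and the normalisation of \<open>w x\<close> leave the volume of a ball
  of radius \<open>3 * \<delta> z\<close> relative to that of the Whitney ball.\<close>

lemma dual_test_bound:
  assumes R: "1 \<le> R"
  shows "\<exists>C\<ge>0. \<forall>\<psi> w \<xi> z. \<psi> \<in> borel_measurable borel \<longrightarrow> case_prod w \<in> borel_measurable (borel \<Otimes>\<^sub>M borel) \<longrightarrow>
      (\<forall>x\<in>\<Omega>. avg x (\<lambda>y. epowr (w x y) R) \<le> 1) \<longrightarrow> z \<in> nt_cone \<Omega> a \<xi> \<longrightarrow>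
      epowr (avg z (\<lambda>y. epowr (dual_test \<psi> w y) R)) (1 / R) \<le> ennreal C * maximal \<psi> \<xi>"
proof -
  \<comment> \<open>\<open>C4\<close> comes from \<open>shadow_avg_le_maximal\<close>,
    \<open>B\<close> bounds the mass of \<phi> in its first variable, and \<open>V\<close> is the
    ratio of the volumes of the balls of radius \<open>3 * \<delta> z\<close> and
    \<open>c * \<delta> z\<close>.\<close>
  define C4 where "C4 = 4 ^ n * (8 + 5 * a) ^ n"
  define B :: real where "B = 4 ^ DIM('a)"
  define V where "V = (3 / c) ^ DIM('a)"
  define D where "D = C4 powr R * B powr (R - 1) * V"
  have nn: "0 < C4" "1 \<le> B" "0 < V" "0 < D" "0 < R" using a_pos c_pos R by (auto simp: C4_def B_def V_def D_def)
  show ?thesis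
  proof (intro exI[of _ "D powr (1 / R)"] conjI allI impI)
    fix \<psi> :: "'a \<Rightarrow> ennreal" and w :: "'a \<Rightarrow> 'a \<Rightarrow> ennreal" and \<xi> z
    assume [measurable]: "\<psi> \<in> borel_measurable borel" "case_prod w \<in> borel_measurable (borel \<Otimes>\<^sub>M borel)"
      and w: "\<forall>x\<in>\<Omega>. avg x (\<lambda>y. epowr (w x y) R) \<le> 1" and z: "z \<in> nt_cone \<Omega> a \<xi>"
    have w1[measurable]: "w x \<in> borel_measurable borel" "(\<lambda>x. w x y) \<in> borel_measurable borel" for x y by measurable
    have zO: "z \<in> \<Omega>" using z by (simp add: nt_cone_def)
    have dz: "0 < \<delta> z" by (rule \<delta>_pos[OF zO])
    let ?m = "ennreal C4 * maximal \<psi> \<xi>"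
    let ?X = "ball z (3 * \<delta> z)"
    have "avg z (\<lambda>y. epowr (dual_test \<psi> w y) R)
       \<le> (\<integral>\<^sup>+y. \<phi> z y * (epowr ?m R * (ennreal (B powr (R - 1)) * (\<integral>\<^sup>+x. indicator ?X x * (\<phi> x y * epowr (w x y) R) \<partial>lborel))) \<partial>lborel)"
    proof (rule nn_integral_mono)
      fix y
      show "\<phi> z y * epowr (dual_test \<psi> w y) R \<le> \<phi> z y * (epowr ?m R * (ennreal (B powr (R - 1)) * (\<integral>\<^sup>+x. indicator ?X x * (\<phi> x y * epowr (w x y) R) \<partial>lborel)))"
      proof (cases "dist z y < c * \<delta> z")
        case True
        have yO: "y \<in> \<Omega>" using near(1)[OF zO] True by simp
        have "dual_test \<psi> w y \<le> (\<integral>\<^sup>+x. ?m * (indicator ?X x * \<phi> x y * w x y) \<partial>lborel)"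
          unfolding dual_test_def
        proof (rule nn_integral_mono)
          fix x
          show "\<phi> x y * (shadow_avg \<psi> x * w x y) \<le> ?m * (indicator ?X x * \<phi> x y * w x y)"
          proof (cases "x \<in> \<Omega> \<and> dist x y < c * \<delta> x")
            case T: True
            then have "shadow_avg \<psi> x \<le> ?m" "x \<in> ?X"
              using shadow_avg_le_maximal[of \<psi> z \<xi> y x] z True by (auto simp: C4_def)
            then have "shadow_avg \<psi> x * (\<phi> x y * w x y) \<le> ?m * (\<phi> x y * w x y)" by (intro mult_right_mono) auto
            then show ?thesis using \<open>x \<in> ?X\<close> by (simp only: mult_ac indicator_simps mult_1_left mult_1_right)
          qed (auto simp: \<phi>_def)
        qed
        also have "\<dots> = ?m * (\<integral>\<^sup>+x. (indicator ?X x * \<phi> x y) * w x y \<partial>lborel)"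
          by (rule nn_integral_cmult) measurable
        finally have "epowr (dual_test \<psi> w y) R \<le> epowr (?m * (\<integral>\<^sup>+x. (indicator ?X x * \<phi> x y) * w x y \<partial>lborel)) R"
          by (intro epowr_mono nn)
        also have "\<dots> = epowr ?m R * epowr (\<integral>\<^sup>+x. (indicator ?X x * \<phi> x y) * w x y \<partial>lborel) R"
          by (rule epowr_mult[OF nn(5)])
        also have "epowr (\<integral>\<^sup>+x. (indicator ?X x * \<phi> x y) * w x y \<partial>lborel) R
            \<le> ennreal (B powr (R - 1)) * (\<integral>\<^sup>+x. (indicator ?X x * \<phi> x y) * epowr (w x y) R \<partial>lborel)"
        proof (rule epowr_weighted_Jensen[OF R nn(2)])
          have "(\<integral>\<^sup>+x. indicator ?X x * \<phi> x y \<partial>lborel) \<le> (\<integral>\<^sup>+x. \<phi> x y \<partial>lborel)"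
            by (intro nn_integral_mono) (auto simp: indicator_def)
          also have "\<dots> \<le> ennreal B" unfolding B_def by (rule \<phi>_dual_upper[OF yO])
          finally show "(\<integral>\<^sup>+x. indicator ?X x * \<phi> x y \<partial>lborel) \<le> ennreal B" .
        qed measurable
        finally show ?thesis by (simp add: mult_left_mono mult.assoc)
      qed (simp add: \<phi>_def)
    qed
    also have "\<dots> \<le> (\<integral>\<^sup>+y. (epowr ?m R * ennreal (B powr (R - 1)) * ennreal (1 / vol z)) * (\<integral>\<^sup>+x. indicator ?X x * (\<phi> x y * epowr (w x y) R) \<partial>lborel) \<partial>lborel)"
    proof (rule nn_integral_mono)
      fix y
      let ?i = "\<integral>\<^sup>+x. indicator ?X x * (\<phi> x y * epowr (w x y) R) \<partial>lborel"
      have "\<phi> z y * (epowr ?m R * (ennreal (B powr (R - 1)) * ?i)) \<le> ennreal (1 / vol z) * (epowr ?m R * (ennreal (B powr (R - 1)) * ?i))"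
        by (intro mult_right_mono) (auto simp: \<phi>_def)
      then show "\<phi> z y * (epowr ?m R * (ennreal (B powr (R - 1)) * ?i)) \<le> (epowr ?m R * ennreal (B powr (R - 1)) * ennreal (1 / vol z)) * ?i"
        by (simp only: mult_ac)
    qed
    also have "\<dots> = (epowr ?m R * ennreal (B powr (R - 1)) * ennreal (1 / vol z)) * (\<integral>\<^sup>+y. \<integral>\<^sup>+x. indicator ?X x * (\<phi> x y * epowr (w x y) R) \<partial>lborel \<partial>lborel)"
      by (rule nn_integral_cmult) measurable
    also have "(\<integral>\<^sup>+y. \<integral>\<^sup>+x. indicator ?X x * (\<phi> x y * epowr (w x y) R) \<partial>lborel \<partial>lborel)
        = (\<integral>\<^sup>+x. \<integral>\<^sup>+y. indicator ?X x * (\<phi> x y * epowr (w x y) R) \<partial>lborel \<partial>lborel)"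
      by (rule lborel_pair.Fubini') measurable
    also have "\<dots> \<le> (\<integral>\<^sup>+x. indicator ?X x \<partial>lborel)"
    proof (rule nn_integral_mono)
      fix x
      have "(\<integral>\<^sup>+y. indicator ?X x * (\<phi> x y * epowr (w x y) R) \<partial>lborel) = indicator ?X x * avg x (\<lambda>y. epowr (w x y) R)"
        by (rule nn_integral_cmult) measurable
      also have "\<dots> \<le> indicator ?X x * 1"
      proof (rule mult_left_mono)
        show "avg x (\<lambda>y. epowr (w x y) R) \<le> 1"
          using w by (cases "x \<in> \<Omega>") (auto simp: \<phi>_def)
      qed simp
      finally show "(\<integral>\<^sup>+y. indicator ?X x * (\<phi> x y * epowr (w x y) R) \<partial>lborel) \<le> indicator ?X x" by simp
    qed
    also have "\<dots> = ennreal (vol z * V)"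
    proof -
      have "3 * \<delta> z = (3 / c) * (c * \<delta> z)" using c_pos by simp
      then have "(3 * \<delta> z) ^ DIM('a) = V * (c * \<delta> z) ^ DIM('a)" unfolding V_def by (metis power_mult_distrib)
      then show ?thesis using dz by (simp add: emeasure_ball vol_def mult_ac)
    qed
    finally have "avg z (\<lambda>y. epowr (dual_test \<psi> w y) R)
        \<le> (epowr ?m R * ennreal (B powr (R - 1)) * ennreal (1 / vol z)) * ennreal (vol z * V)" by (simp add: mult_left_mono)
    also have "\<dots> = epowr ?m R * (ennreal (B powr (R - 1)) * (ennreal (1 / vol z) * ennreal (vol z * V)))" by (simp only: mult.assoc)
    also have "ennreal (1 / vol z) * ennreal (vol z * V) = ennreal V"
      using vol_pos[OF zO] nn by (simp add: ennreal_mult[symmetric])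
    also have "epowr ?m R * (ennreal (B powr (R - 1)) * ennreal V) = ennreal D * epowr (maximal \<psi> \<xi>) R"
    proof -
      have "ennreal D = ennreal (C4 powr R) * (ennreal (B powr (R - 1)) * ennreal V)"
        unfolding D_def using nn by (simp add: ennreal_mult mult.assoc)
      then show ?thesis using nn by (simp add: epowr_mult epowr_ennreal mult_ac)
    qed
    finally have "epowr (avg z (\<lambda>y. epowr (dual_test \<psi> w y) R)) (1 / R) \<le> epowr (ennreal D * epowr (maximal \<psi> \<xi>) R) (1 / R)"
      using nn by (intro epowr_mono) auto
    also have "\<dots> = ennreal (D powr (1 / R)) * maximal \<psi> \<xi>"
      using nn by (simp add: epowr_mult epowr_inverse epowr_ennreal)
    finally show "epowr (avg z (\<lambda>y. epowr (dual_test \<psi> w y) R)) (1 / R) \<le> ennreal (D powr (1 / R)) * maximal \<psi> \<xi>" .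
  qed simp
qed

text \<open>For \<open>1 < R\<close> the power \<open>Q - 1\<close> of the normalised
  \<open>\<bar>F\<bar>\<close> gives equality in Hoelder's inequality. For \<open>R = 1\<close> the
  essential supremum need not be attained, so the normalised indicator of the set where
  \<open>\<bar>F\<bar>\<close> exceeds half of it is used; this is the origin of the factor 2.
  Explicit formulas keep \<open>w\<close> jointly measurable.\<close>

lemma local_extremiser:
  assumes F[measurable]: "F \<in> borel_measurable borel" and hfin: "\<And>x. x \<in> \<Omega> \<Longrightarrow> W q F x < top" and q: "conj_exp R q"
  obtains w where "case_prod w \<in> borel_measurable (borel \<Otimes>\<^sub>M borel)"
    "\<And>x. x \<in> \<Omega> \<Longrightarrow> avg x (\<lambda>y. epowr (w x y) R) \<le> 1"
    "\<And>x. x \<in> \<Omega> \<Longrightarrow> W q F x \<le> 2 * avg x (\<lambda>y. w x y * ennreal \<bar>F y\<bar>)"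
proof -
  have hm[measurable]: "W q F \<in> borel_measurable borel" by (rule borel_measurable_W_borel[OF q F])
  from q consider "R = 1" "q = \<infinity>" | Q where "1 < R" "1 < Q" "1 / R + 1 / Q = 1" "q = ennreal Q"
    unfolding conj_exp_def by blast
  then show thesis
  proof cases
    case 1
    define E where "E x y = (if W q F x < 2 * ennreal \<bar>F y\<bar> then 1 else 0 :: ennreal)" for x y
    have Em[measurable]: "case_prod E \<in> borel_measurable (borel \<Otimes>\<^sub>M borel)" unfolding E_def by measurable
    define m where "m x = avg x (E x)" for x
    have mm[measurable]: "m \<in> borel_measurable borel" unfolding m_def by measurable
    have Em1[measurable]: "E x \<in> borel_measurable borel" for x unfolding E_def by measurable
    show thesis
    proof (rule that[of "\<lambda>x y. E x y * inverse (m x)"])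
      show "(\<lambda>(x, y). E x y * inverse (m x)) \<in> borel_measurable (borel \<Otimes>\<^sub>M borel)" by measurable
      fix x assume x: "x \<in> \<Omega>"
      have m1: "m x \<le> 1"
      proof -
        have "m x \<le> (\<integral>\<^sup>+y. \<phi> x y \<partial>lborel)" unfolding m_def by (intro nn_integral_mono) (auto simp: E_def)
        then show ?thesis using \<phi>_mass[OF x] by simp
      qed
      have "avg x (\<lambda>y. epowr (E x y * inverse (m x)) R) = (\<integral>\<^sup>+y. (\<phi> x y * E x y) * inverse (m x) \<partial>lborel)"
        using 1 by (simp add: mult.assoc)
      also have "\<dots> = m x * inverse (m x)" unfolding m_def by (rule nn_integral_multc) measurable
      also have "\<dots> \<le> 1"
      proof (cases "m x = 0")
        case False
        moreover have "m x < top" using m1 by (auto intro: order_le_less_trans)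
        ultimately show ?thesis by (simp add: divide_ennreal_def[symmetric] ennreal_divide_self)
      qed simp
      finally show "avg x (\<lambda>y. epowr (E x y * inverse (m x)) R) \<le> 1" .
      show "W q F x \<le> 2 * avg x (\<lambda>y. E x y * inverse (m x) * ennreal \<bar>F y\<bar>)"
      proof (cases "W q F x = 0")
        case False
        obtain h where h: "W q F x = ennreal h" "0 < h" using hfin[OF x] False by (cases "W q F x") auto
        \<comment> \<open>Otherwise half of the essential supremum would already be an essential
          bound.\<close>
        have "m x \<noteq> 0"
        proof
          assume "m x = 0"
          then have "AE y in lborel. \<phi> x y * E x y = 0"
            unfolding m_def by (subst (asm) nn_integral_0_iff_AE) measurable
          then have "AE y in lborel. dist x y < c * \<delta> x \<longrightarrow> ennreal \<bar>F y\<bar> \<le> ennreal (h / 2)"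
          proof eventually_elim
            fix y assume y: "\<phi> x y * E x y = 0"
            show "dist x y < c * \<delta> x \<longrightarrow> ennreal \<bar>F y\<bar> \<le> ennreal (h / 2)"
            proof
              assume d: "dist x y < c * \<delta> x"
              then have "\<phi> x y \<noteq> 0" using x vol_pos[OF x] by (simp add: \<phi>_def ennreal_eq_0_iff)
              then have "2 * ennreal \<bar>F y\<bar> \<le> ennreal h" using y h by (auto simp: E_def split: if_splits)
              then have "2 * \<bar>F y\<bar> \<le> h" using h(2)
                by (simp add: ennreal_mult[symmetric] ennreal_numeral[symmetric] del: ennreal_numeral)
              then show "ennreal \<bar>F y\<bar> \<le> ennreal (h / 2)" by (intro ennreal_leI) simp
            qed
          qed
          then have "W \<infinity> F x \<le> ennreal (h / 2)" using W_infinity_le_iff[OF x F] by blast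
          then show False using h 1 by (simp add: ennreal_le_iff)
        qed
        moreover have "m x < top" using m1 by (auto intro: order_le_less_trans)
        ultimately have mi: "m x * inverse (m x) = 1" by (simp add: divide_ennreal_def[symmetric] ennreal_divide_self)
        have "W q F x = W q F x * (m x * inverse (m x))" by (simp add: mi)
        also have "\<dots> = (\<integral>\<^sup>+y. (\<phi> x y * E x y) * (inverse (m x) * W q F x) \<partial>lborel)"
          unfolding m_def by (subst nn_integral_multc) (measurable, simp add: mult_ac)
        also have "\<dots> \<le> (\<integral>\<^sup>+y. 2 * (\<phi> x y * (E x y * inverse (m x) * ennreal \<bar>F y\<bar>)) \<partial>lborel)"
        proof (rule nn_integral_mono)
          fix y
          have "E x y * W q F x \<le> E x y * (2 * ennreal \<bar>F y\<bar>)" by (auto simp: E_def)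
          then have "(\<phi> x y * inverse (m x)) * (E x y * W q F x) \<le> (\<phi> x y * inverse (m x)) * (E x y * (2 * ennreal \<bar>F y\<bar>))"
            by (rule mult_left_mono) simp
          then show "(\<phi> x y * E x y) * (inverse (m x) * W q F x) \<le> 2 * (\<phi> x y * (E x y * inverse (m x) * ennreal \<bar>F y\<bar>))"
            by (simp only: mult_ac)
        qed
        also have "\<dots> = 2 * avg x (\<lambda>y. E x y * inverse (m x) * ennreal \<bar>F y\<bar>)"
          by (rule nn_integral_cmult) measurable
        finally show ?thesis .
      qed simp
    qed
  next
    case 2
    have QR: "(Q - 1) * R = Q" using conjugate_exponents[OF 2(1,3)] by simp
    have R0: "0 < R" "0 < Q" using 2 by auto
    define hr where "hr x = enn2real (W q F x)" for x
    have hrm[measurable]: "hr \<in> borel_measurable borel" unfolding hr_def by measurable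
    have hr: "W q F x = ennreal (hr x)" "0 \<le> hr x" if "x \<in> \<Omega>" for x using hfin[OF that] by (auto simp: hr_def)
    have int: "avg x (\<lambda>y. ennreal (\<bar>F y\<bar> powr Q)) = ennreal (hr x powr Q)" if x: "x \<in> \<Omega>" for x
    proof -
      have "epowr (W q F x) Q = avg x (\<lambda>y. ennreal (\<bar>F y\<bar> powr Q))"
        using x R0 by (simp add: 2(4) W_eq_finite epowr_inverse)
      then show ?thesis using hr[OF x] by (simp add: epowr_ennreal)
    qed
    show thesis
    proof (rule that[of "\<lambda>x y. ennreal ((\<bar>F y\<bar> / hr x) powr (Q - 1))"])
      show "(\<lambda>(x, y). ennreal ((\<bar>F y\<bar> / hr x) powr (Q - 1))) \<in> borel_measurable (borel \<Otimes>\<^sub>M borel)" by measurable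
      fix x assume x: "x \<in> \<Omega>"
      have "\<phi> x y * epowr (ennreal ((\<bar>F y\<bar> / hr x) powr (Q - 1))) R = \<phi> x y * ennreal (\<bar>F y\<bar> powr Q) * ennreal (1 / hr x powr Q)" for y
        using hr[OF x] by (simp add: epowr_ennreal powr_powr QR powr_divide ennreal_mult[symmetric] mult.assoc)
      then have "avg x (\<lambda>y. epowr (ennreal ((\<bar>F y\<bar> / hr x) powr (Q - 1))) R) = ennreal (hr x powr Q) * ennreal (1 / hr x powr Q)"
        by (simp add: nn_integral_multc int[OF x])
      also have "\<dots> \<le> 1" by (simp add: ennreal_mult[symmetric])
      finally show "avg x (\<lambda>y. epowr (ennreal ((\<bar>F y\<bar> / hr x) powr (Q - 1))) R) \<le> 1" .
      have "\<phi> x y * (ennreal ((\<bar>F y\<bar> / hr x) powr (Q - 1)) * ennreal \<bar>F y\<bar>) = \<phi> x y * ennreal (\<bar>F y\<bar> powr Q) * ennreal (1 / hr x powr (Q - 1))" for y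
      proof -
        have "\<bar>F y\<bar> powr Q = \<bar>F y\<bar> powr (Q - 1) * \<bar>F y\<bar>"
          using powr_add[of "\<bar>F y\<bar>" "Q - 1" 1] by simp
        then show ?thesis using hr[OF x] by (simp add: powr_divide ennreal_mult[symmetric] mult.assoc)
      qed
      then have eq: "avg x (\<lambda>y. ennreal ((\<bar>F y\<bar> / hr x) powr (Q - 1)) * ennreal \<bar>F y\<bar>) = ennreal (hr x powr Q) * ennreal (1 / hr x powr (Q - 1))"
        by (simp add: nn_integral_multc int[OF x])
      have "hr x powr Q * (1 / hr x powr (Q - 1)) = hr x"
      proof (cases "hr x = 0")
        case False
        have "hr x powr Q = hr x powr (Q - 1) * hr x"
          using powr_add[of "hr x" "Q - 1" 1] hr[OF x] by simp
        then show ?thesis using False by simp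
      qed simp
      then have "avg x (\<lambda>y. ennreal ((\<bar>F y\<bar> / hr x) powr (Q - 1)) * ennreal \<bar>F y\<bar>) = W q F x"
        unfolding eq hr(1)[OF x] by (simp add: ennreal_mult[symmetric])
      then show "W q F x \<le> 2 * avg x (\<lambda>y. ennreal ((\<bar>F y\<bar> / hr x) powr (Q - 1)) * ennreal \<bar>F y\<bar>)"
        by (simp add: mult_2 add_increasing)
    qed
  qed
qed

section \<open>Norm bounds for the density of a functional\<close>

abbreviation Nn :: "real \<Rightarrow> real \<Rightarrow> ('a \<Rightarrow> real) \<Rightarrow> ennreal" where
  "Nn R P u \<equiv> Lnorm (ennreal P) M (nt_max \<Omega> a c (ennreal R) u)"

lemma test_funs_borel: "u \<in> test_funs \<Longrightarrow> u \<in> borel_measurable borel"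
  by (simp add: bounded_supp_def)

text \<open>As \<open>c \<le> 1 / 2\<close>, the closed Whitney ball is a compact subset of the
  domain.\<close>

lemma KK_in_local:
  assumes x: "x \<in> \<Omega>" obtains j where "Wball x \<subseteq> KK j"
proof -
  have "c * \<delta> x < \<delta> x" using c_half \<delta>_pos[OF x] mult_strict_right_mono[of c 1 "\<delta> x"] by simp
  then have "cball x (c * \<delta> x) \<subseteq> ball x (\<delta> x)" by auto
  then have "cball x (c * \<delta> x) \<subseteq> \<Omega>" using ball_\<delta>_subset[OF x, of "\<delta> x"] by auto
  then obtain j where "cball x (c * \<delta> x) \<subseteq> KK j" using compact_sub_KK[OF compact_cball] by metis
  with ball_subset_cball that show thesis by blast
qed

lemma W_finite_of_local:
  assumes F[measurable]: "F \<in> borel_measurable borel" and q: "conj_exp R q" and x: "x \<in> \<Omega>"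
    and fin: "\<And>j. Lnorm q lborel (\<lambda>x. ennreal \<bar>F x\<bar> * indicator (KK j) x) < top"
  shows "W q F x < top"
proof -
  obtain j where j: "Wball x \<subseteq> KK j" using KK_in_local[OF x] .
  let ?f = "\<lambda>x. ennreal \<bar>F x\<bar> * indicator (KK j) x"
  from conj_exp_cases[OF q] consider "q = \<infinity>" | Q where "0 < Q" "q = ennreal Q" by blast
  then show ?thesis
  proof cases
    case 1
    have "AE y in lborel. ?f y \<le> esssup lborel ?f" by (rule esssup_AE)
    then have "AE y in lborel. dist x y < c * \<delta> x \<longrightarrow> ennreal \<bar>F y\<bar> \<le> esssup lborel ?f"
      by eventually_elim (use j in \<open>auto simp: subset_eq\<close>)
    then have "W q F x \<le> esssup lborel ?f" unfolding 1 W_infinity_le_iff[OF x F] .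
    then show ?thesis using fin[of j] 1 by (simp add: Lnorm_def le_less_trans)
  next
    case 2
    have "(\<integral>\<^sup>+y\<in>Wball x. ennreal (\<bar>F y\<bar> powr Q) \<partial>lborel) \<le> (\<integral>\<^sup>+y. epowr (?f y) Q \<partial>lborel)"
      using j 2(1) by (intro nn_integral_mono) (auto simp: indicator_def epowr_ennreal subset_eq)
    also have "\<dots> < top" using fin[of j] 2 by (simp add: Lnorm_ennreal)
    finally show ?thesis
      using 2 x nn_integral_\<phi>[OF x, of "\<lambda>y. ennreal (\<bar>F y\<bar> powr Q)"] by (simp add: W_eq_finite ennreal_mult_less_top)
  qed
qed

lemma Lloc_of_local:
  assumes F[measurable]: "F \<in> borel_measurable borel" and q: "conj_exp R q"
    and fin: "\<And>j. Lnorm q lborel (\<lambda>x. ennreal \<bar>F x\<bar> * indicator (KK j) x) < top"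
  shows "F \<in> Lloc q \<Omega>"
proof -
  have "Lnorm q (lebesgue_on L) (\<lambda>x. ennreal \<bar>F x\<bar>) < \<infinity>" if L: "compact L" "L \<subseteq> \<Omega>" for L
  proof -
    have Lb[measurable]: "L \<in> sets borel" using L by (simp add: borel_compact)
    obtain j where j: "L \<subseteq> KK j" using compact_sub_KK[OF L] .
    let ?f = "\<lambda>x. ennreal \<bar>F x\<bar> * indicator (KK j) x"
    from conj_exp_cases[OF q] consider "q = \<infinity>" | Q where "0 < Q" "q = ennreal Q" by blast
    then show ?thesis
    proof cases
      case 1
      have Fm: "(\<lambda>y. ennreal \<bar>F y\<bar>) \<in> borel_measurable (lebesgue_on L)"
        by (intro measurable_restrict_space1) (auto intro: measurable_completion)
      have "AE y in lborel. ?f y \<le> esssup lborel ?f" by (rule esssup_AE)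
      then have "AE y in lebesgue_on L. ennreal \<bar>F y\<bar> \<le> esssup lborel ?f"
        unfolding AE_lebesgue_on_iff[OF Lb] by eventually_elim (use j in auto)
      from esssup_I[OF Fm this] show ?thesis using fin[of j] 1 by (simp add: Lnorm_def le_less_trans)
    next
      case 2
      have "(\<integral>\<^sup>+y. epowr (ennreal \<bar>F y\<bar>) Q \<partial>lebesgue_on L) = (\<integral>\<^sup>+y\<in>L. epowr (ennreal \<bar>F y\<bar>) Q \<partial>lborel)"
        by (subst nn_integral_restrict_space) (auto simp: nn_integral_completion)
      also have "\<dots> \<le> (\<integral>\<^sup>+y. epowr (?f y) Q \<partial>lborel)"
        using j by (intro nn_integral_mono) (auto simp: indicator_def)
      also have "\<dots> < top" using fin[of j] 2 by (simp add: Lnorm_ennreal)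
      finally show ?thesis using 2 by (simp add: Lnorm_ennreal)
    qed
  qed
  then show ?thesis unfolding Lloc_def using borel_lebesgue_on[OF F] by blast
qed

text \<open>Duality on the compact set \<open>KK j\<close>, tested with \<open>sgn F\<close> times a
  weight. For \<open>R = 1\<close> the weight is the indicator of the set where
  \<open>\<bar>F\<bar>\<close> exceeds the bound, and that set turns out to be null.\<close>

lemma local_dual_bound:
  assumes F[measurable]: "F \<in> borel_measurable borel" and q: "conj_exp R q"
    and FI: "\<And>u. u \<in> test_funs \<Longrightarrow> integrable lborel (\<lambda>x. u x * F x)"
    and bd: "\<And>u. u \<in> test_funs \<Longrightarrow> (\<forall>x. x \<notin> KK j \<longrightarrow> u x = 0) \<Longrightarrow> ennreal \<bar>\<integral>x. u x * F x \<partial>lborel\<bar> \<le> ennreal C * Lp R lborel u"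
  shows "Lnorm q lborel (\<lambda>x. ennreal \<bar>F x\<bar> * indicator (KK j) x) < top"
proof -
  have key: "(\<integral>\<^sup>+x. ennreal \<bar>F x\<bar> * indicator (KK j) x * ennreal (\<psi> x) \<partial>lborel)
      \<le> ennreal C * Lnorm (ennreal R) lborel (\<lambda>x. ennreal (\<psi> x * indicator (KK j) x))"
    if [measurable]: "\<psi> \<in> borel_measurable borel" and \<psi>: "\<And>x. 0 \<le> \<psi> x" "\<And>x. \<psi> x \<le> B" for \<psi> B
  proof -
    define u where "u x = sgn (F x) * (\<psi> x * indicator (KK j) x)" for x
    have um: "u \<in> borel_measurable borel" unfolding u_def by measurable
    have ab: "\<bar>u x\<bar> \<le> \<psi> x * indicator (KK j) x" for x using \<psi> by (auto simp: u_def abs_mult sgn_if indicator_def)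
    have u0: "u x = 0" if "x \<notin> KK j" for x using that by (simp add: u_def)
    have u: "u \<in> test_funs"
      by (rule bounded_suppI[of _ _ B _ j]) (use um u0 \<psi> order_trans[OF ab] order_trans[OF \<psi>] in \<open>auto simp: indicator_def\<close>)
    have uF: "u x * F x = \<bar>F x\<bar> * indicator (KK j) x * \<psi> x" for x by (simp add: u_def abs_sgn mult_ac)
    have "(\<integral>\<^sup>+x. ennreal \<bar>F x\<bar> * indicator (KK j) x * ennreal (\<psi> x) \<partial>lborel) = (\<integral>\<^sup>+x. ennreal (u x * F x) \<partial>lborel)"
      using \<psi> by (intro nn_integral_cong) (simp add: uF ennreal_mult ennreal_indicator)
    also have "\<dots> = ennreal (\<integral>x. u x * F x \<partial>lborel)"
      by (rule nn_integral_eq_integral[OF FI[OF u]]) (use \<psi> in \<open>simp add: uF\<close>)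
    also have "\<dots> \<le> ennreal \<bar>\<integral>x. u x * F x \<partial>lborel\<bar>" by (intro ennreal_leI) simp
    also have "\<dots> \<le> ennreal C * Lp R lborel u" using bd[OF u] u0 by blast
    also have "\<dots> \<le> ennreal C * Lnorm (ennreal R) lborel (\<lambda>x. ennreal (\<psi> x * indicator (KK j) x))"
      using q ab by (intro mult_left_mono Lnorm_mono_AE AE_I2 ennreal_leI) (auto simp: conj_exp_def)
    finally show ?thesis .
  qed
  from q consider "R = 1" "q = \<infinity>" | Q where "1 < R" "1 / R + 1 / Q = 1" "q = ennreal Q"
    unfolding conj_exp_def by blast
  then show ?thesis
  proof cases
    case 1
    define A where "A = {x\<in>KK j. \<bar>C\<bar> < \<bar>F x\<bar>}"
    have [measurable]: "A \<in> sets borel" unfolding A_def by measurable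
    let ?I = "\<lambda>f. \<integral>\<^sup>+x. f x * indicator A x \<partial>lborel"
    have "?I (\<lambda>x. ennreal \<bar>F x\<bar>) \<le> ennreal C * emeasure lborel A"
    proof -
      have "?I (\<lambda>x. ennreal \<bar>F x\<bar>) = (\<integral>\<^sup>+x. ennreal \<bar>F x\<bar> * indicator (KK j) x * ennreal (indicator A x) \<partial>lborel)"
        by (intro nn_integral_cong) (auto simp: A_def indicator_def)
      also have "\<dots> \<le> ennreal C * Lnorm (ennreal R) lborel (\<lambda>x. ennreal (indicator A x * indicator (KK j) x))"
        by (rule key[of _ 1]) auto
      also have "Lnorm (ennreal R) lborel (\<lambda>x. ennreal (indicator A x * indicator (KK j) x)) = emeasure lborel A"
      proof -
        have "(\<integral>\<^sup>+x. ennreal (indicator A x * indicator (KK j) x) \<partial>lborel) = (\<integral>\<^sup>+x. indicator A x \<partial>lborel)"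
          by (intro nn_integral_cong) (auto simp: A_def indicator_def)
        moreover have "0 < R" using 1 by simp
        ultimately show ?thesis using 1 by (simp only: Lnorm_ennreal) simp
      qed
      finally show ?thesis .
    qed
    also have "\<dots> \<le> ?I (\<lambda>x. ennreal \<bar>C\<bar>)"
      by (simp add: nn_integral_cmult_indicator mult_right_mono ennreal_leI)
    finally have le: "?I (\<lambda>x. ennreal \<bar>F x\<bar>) \<le> ?I (\<lambda>x. ennreal \<bar>C\<bar>)" .
    have "emeasure lborel A \<le> emeasure lborel (KK j)" by (rule emeasure_mono) (auto simp: A_def)
    then have fin: "?I (\<lambda>x. ennreal \<bar>C\<bar>) < top"
      using KK_finite[of j] by (simp add: nn_integral_cmult_indicator ennreal_mult_less_top le_less_trans)
    \<comment> \<open>On \<open>A\<close> the excess of \<open>\<bar>F\<bar>\<close> over the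
      constant is positive. Cancelling the finite integral of the constant shows that the integral
      of the excess is 0.\<close>
    have "?I (\<lambda>x. ennreal \<bar>C\<bar>) + ?I (\<lambda>x. ennreal (\<bar>F x\<bar> - \<bar>C\<bar>)) = ?I (\<lambda>x. ennreal \<bar>F x\<bar>)"
      by (subst nn_integral_add[symmetric])
         (auto simp: A_def indicator_def ennreal_plus[symmetric] simp del: ennreal_plus intro!: nn_integral_cong)
    then have "?I (\<lambda>x. ennreal \<bar>C\<bar>) + ?I (\<lambda>x. ennreal (\<bar>F x\<bar> - \<bar>C\<bar>)) \<le> ?I (\<lambda>x. ennreal \<bar>C\<bar>) + 0" using le by simp
    then have "?I (\<lambda>x. ennreal (\<bar>F x\<bar> - \<bar>C\<bar>)) = 0"
      unfolding ennreal_add_left_cancel_le using fin by auto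
    then have "AE x in lborel. ennreal (\<bar>F x\<bar> - \<bar>C\<bar>) * indicator A x = 0"
      by (subst (asm) nn_integral_0_iff_AE) measurable
    then have "AE x in lborel. ennreal \<bar>F x\<bar> * indicator (KK j) x \<le> ennreal \<bar>C\<bar>"
    proof eventually_elim
      fix x assume "ennreal (\<bar>F x\<bar> - \<bar>C\<bar>) * indicator A x = 0"
      then have "x \<notin> A" by (auto simp: A_def ennreal_eq_0_iff)
      then show "ennreal \<bar>F x\<bar> * indicator (KK j) x \<le> ennreal \<bar>C\<bar>" by (auto simp: A_def indicator_def intro: ennreal_leI)
    qed
    then have "esssup lborel (\<lambda>x. ennreal \<bar>F x\<bar> * indicator (KK j) x) \<le> ennreal \<bar>C\<bar>" by (intro esssup_I) measurable
    then show ?thesis using 1 by (simp add: Lnorm_def le_less_trans)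
  next
    case 2
    have "Lnorm (ennreal Q) lborel (\<lambda>x. ennreal \<bar>F x\<bar> * indicator (KK j) x) \<le> ennreal C"
    proof (rule Lnorm_converse_Holder[OF 2(1,2), of _ _ "\<lambda>i. ball 0 (real i)"])
      show "incseq (\<lambda>i. ball (0::'a) (real i))" by (auto simp: incseq_def)
      show "space lborel \<subseteq> (\<Union>i. ball (0::'a) (real i))" using balls_UNIV by simp
      show "emeasure lborel (ball (0::'a) (real i)) < top" for i
        using emeasure_lborel_ball_finite[unfolded infinity_ennreal_def] .
      fix \<psi> :: "'a \<Rightarrow> real"
      assume \<psi>: "\<psi> \<in> borel_measurable lborel" "\<forall>x. 0 \<le> \<psi> x" "\<exists>B. \<forall>x. \<psi> x \<le> B"
      then obtain B where "\<And>x. \<psi> x \<le> B" by blast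
      with \<psi> have "(\<integral>\<^sup>+x. ennreal \<bar>F x\<bar> * indicator (KK j) x * ennreal (\<psi> x) \<partial>lborel)
          \<le> ennreal C * Lnorm (ennreal R) lborel (\<lambda>x. ennreal (\<psi> x * indicator (KK j) x))" by (intro key[of _ B]) auto
      also have "\<dots> \<le> ennreal C * Lnorm (ennreal R) lborel (\<lambda>x. ennreal (\<psi> x))"
        using 2(1) \<psi>(2) by (intro mult_left_mono Lnorm_mono_AE AE_I2 ennreal_leI) (auto simp: indicator_def)
      finally show "(\<integral>\<^sup>+x. ennreal \<bar>F x\<bar> * indicator (KK j) x * ennreal (\<psi> x) \<partial>lborel)
          \<le> ennreal C * Lnorm (ennreal R) lborel (\<lambda>x. ennreal (\<psi> x))" .
    qed auto
    then show ?thesis using 2 by (simp add: le_less_trans)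
  qed
qed

text \<open>In contrast to \<open>local_dual_bound\<close>, the assumed bound is by the full norm,
  with one constant for all test functions. The maximal theorem is used on both sides of the
  duality: at exponent \<open>P\<close> for the weight \<psi> and at exponent \<open>P'\<close> for
  the conical integral.\<close>

theorem dual_norm_bound:
  assumes PQ: "1 < P" "1 / P + 1 / P' = 1" and q: "conj_exp R q"
    and Fm[measurable]: "F \<in> borel_measurable borel" and Wfin: "\<And>x. x \<in> \<Omega> \<Longrightarrow> W q F x < top"
    and FI: "\<And>u. u \<in> test_funs \<Longrightarrow> integrable lborel (\<lambda>x. u x * F x)"
    and FK: "\<And>u. u \<in> test_funs \<Longrightarrow> ennreal \<bar>\<integral>x. u x * F x \<partial>lborel\<bar> \<le> ennreal K * Nn R P u"
  shows "Lnorm (ennreal P') M (carleson n \<Omega> c q F) < top"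
proof -
  have R: "1 \<le> R" "0 < R" using q by (auto simp: conj_exp_def)
  have P': "1 < P'" using conjugate_exponents[OF PQ] by simp
  have P0: "0 < P" "0 < P'" using PQ P' by auto
  obtain C3 where C3: "0 \<le> C3" and bound: "\<And>\<psi> w \<xi> z. \<psi> \<in> borel_measurable borel \<Longrightarrow> case_prod w \<in> borel_measurable (borel \<Otimes>\<^sub>M borel) \<Longrightarrow>
      (\<forall>x\<in>\<Omega>. avg x (\<lambda>y. epowr (w x y) R) \<le> 1) \<Longrightarrow> z \<in> nt_cone \<Omega> a \<xi> \<Longrightarrow>
      epowr (avg z (\<lambda>y. epowr (dual_test \<psi> w y) R)) (1 / R) \<le> ennreal C3 * maximal \<psi> \<xi>"
    using dual_test_bound[OF R(1)] by blast
  obtain K1 where K1: "\<And>f. f \<in> borel_measurable borel \<Longrightarrow> Lnorm (ennreal P) M (maximal f) \<le> ennreal K1 * Lnorm (ennreal P) M f"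
    using maximal_strong[OF PQ(1)] by blast
  obtain K2 where K2: "\<And>f. f \<in> borel_measurable borel \<Longrightarrow> Lnorm (ennreal P') M (maximal f) \<le> ennreal K2 * Lnorm (ennreal P') M f"
    using maximal_strong[OF P'] by blast
  define C5 where "C5 = (2 + a) ^ n / \<kappa>\<^sub>2"
  let ?F = "\<lambda>y. ennreal \<bar>F y\<bar>"
  obtain w where wm[measurable]: "case_prod w \<in> borel_measurable (borel \<Otimes>\<^sub>M borel)"
    and w1: "\<And>x. x \<in> \<Omega> \<Longrightarrow> avg x (\<lambda>y. epowr (w x y) R) \<le> 1"
    and w2: "\<And>x. x \<in> \<Omega> \<Longrightarrow> W q F x \<le> 2 * avg x (\<lambda>y. w x y * ?F y)"
    using local_extremiser[OF Fm Wfin q] by blast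
  have wm1[measurable]: "w x \<in> borel_measurable borel" "(\<lambda>x. w x y) \<in> borel_measurable borel" for x y by measurable
  let ?h = "W q F"
  have hm[measurable]: "?h \<in> borel_measurable borel" by (rule borel_measurable_W_borel[OF q Fm])
  let ?C = "2 * (ennreal K * (ennreal C3 * ennreal K1))"
  \<comment> \<open>The converse of Hoelder's inequality reduces the norm of the conical integral to
    its pairings with \<psi>; \<open>area_pairing\<close>, the extremisers and Fubini turn such a
    pairing into one of \<open>\<bar>F\<bar>\<close> with the function \<open>D\<close>.\<close>
  have A: "Lnorm (ennreal P') M (area ?h) \<le> ?C"
  proof (rule Lnorm_converse_Holder[OF PQ _ _ incseq_balls balls_UNIV finite_ball])
    show "area ?h \<in> borel_measurable M" by measurable
    fix \<psi> :: "'a \<Rightarrow> real" and i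
    assume "\<psi> \<in> borel_measurable M"
    then have [measurable]: "\<psi> \<in> borel_measurable borel" by (simp cong: measurable_cong_sets)
    let ?\<psi> = "\<lambda>x. ennreal (\<psi> x)"
    define D where "D = dual_test ?\<psi> w"
    have Dm[measurable]: "D \<in> borel_measurable borel" unfolding D_def dual_test_def by measurable
    have D0: "D y = 0" if "y \<notin> \<Omega>" for y
    proof -
      have "\<phi> x y = 0" for x using near(1)[of x y] that by (auto simp: \<phi>_def)
      then show ?thesis by (simp add: D_def dual_test_def)
    qed
    let ?i = "\<lambda>x y. \<phi> x y * (shadow_avg ?\<psi> x * w x y) * ?F y"
    have "(\<integral>\<^sup>+\<zeta>. area ?h \<zeta> * ?\<psi> \<zeta> \<partial>M) = (\<integral>\<^sup>+x. ?h x * shadow_avg ?\<psi> x \<partial>lborel)"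
      by (rule area_pairing) measurable
    also have "\<dots> \<le> (\<integral>\<^sup>+x. 2 * avg x (\<lambda>y. w x y * ?F y) * shadow_avg ?\<psi> x \<partial>lborel)"
    proof (intro nn_integral_mono mult_right_mono)
      show "?h x \<le> 2 * avg x (\<lambda>y. w x y * ?F y)" for x
        using w2[of x] by (cases "x \<in> \<Omega>") (auto simp: W_def)
    qed simp
    also have "\<dots> = (\<integral>\<^sup>+x. 2 * (\<integral>\<^sup>+y. ?i x y \<partial>lborel) \<partial>lborel)"
      by (intro nn_integral_cong, subst mult.assoc, subst nn_integral_multc[symmetric]) (measurable, simp only: mult_ac)
    also have "\<dots> = 2 * (\<integral>\<^sup>+x. \<integral>\<^sup>+y. ?i x y \<partial>lborel \<partial>lborel)"
      by (rule nn_integral_cmult) measurable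
    also have "(\<integral>\<^sup>+x. \<integral>\<^sup>+y. ?i x y \<partial>lborel \<partial>lborel) = (\<integral>\<^sup>+y. \<integral>\<^sup>+x. ?i x y \<partial>lborel \<partial>lborel)"
      by (rule lborel_pair.Fubini'[symmetric]) measurable
    also have "\<dots> = (\<integral>\<^sup>+y. D y * ?F y \<partial>lborel)"
      unfolding D_def dual_test_def by (intro nn_integral_cong nn_integral_multc) measurable
    also have "\<dots> \<le> ennreal K * (ennreal C3 * (ennreal K1 * Lnorm (ennreal P) M ?\<psi>))"
    proof -
      \<comment> \<open>\<open>D\<close> need not be bounded or have compact support in the domain;
        its truncations are admissible and increase to it.\<close>
      define d where "d m y = min (D y) (of_nat m) * indicator (KK m) y" for m and y :: 'a
      have dm[measurable]: "d m \<in> borel_measurable borel" for m unfolding d_def by measurable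
      have d_le: "d m y \<le> D y" "d m y \<le> of_nat m" for m y by (auto simp: d_def indicator_def)
      have dinc: "d m y \<le> d l y" if "m \<le> l" for m l y
        unfolding d_def using that incseqD[OF incseq_KK that] by (intro mult_mono min.mono) (auto simp: indicator_def)
      have "(\<integral>\<^sup>+y. D y * ?F y \<partial>lborel) \<le> (\<integral>\<^sup>+y. (SUP m. d m y * ?F y) \<partial>lborel)"
      proof (rule nn_integral_mono)
        fix y
        have "D y \<le> (SUP m. d m y)"
        proof (cases "y \<in> \<Omega>")
          case True
          obtain j where j: "y \<in> KK j" using KK_exhausts[OF True] .
          show ?thesis
          proof (rule dense_le)
            fix t assume t: "t < D y"
            then have "t < top" by (meson order_less_le_trans top_greatest)
            then obtain m where m: "t < of_nat m" using ennreal_Ex_less_of_nat by blast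
            have "y \<in> KK (max m j)" using j incseqD[OF incseq_KK, of j "max m j"] by auto
            moreover have "(of_nat m :: ennreal) \<le> of_nat (max m j)" by (intro of_nat_mono) simp
            ultimately have "t \<le> d (max m j) y" using t m by (simp add: d_def less_imp_le less_le_trans)
            then show "t \<le> (SUP m. d m y)" by (rule SUP_upper2[OF UNIV_I])
          qed
        qed (simp add: D0)
        then show "D y * ?F y \<le> (SUP m. d m y * ?F y)"
          unfolding SUP_mult_right_ennreal[symmetric] by (rule mult_right_mono) simp
      qed
      also have "\<dots> = (SUP m. \<integral>\<^sup>+y. d m y * ?F y \<partial>lborel)"
        by (rule nn_integral_monotone_convergence_SUP) (auto simp: incseq_def le_fun_def intro!: mult_right_mono dinc)
      also have "\<dots> \<le> ennreal K * (ennreal C3 * (ennreal K1 * Lnorm (ennreal P) M ?\<psi>))"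
      proof (rule SUP_least)
        fix m :: nat
        define u where "u y = sgn (F y) * enn2real (d m y)" for y
        have um[measurable]: "u \<in> borel_measurable borel" unfolding u_def by measurable
        have dfin: "d m y < top" for y
          using d_le(2)[of m y] by (rule le_less_trans) (simp add: ennreal_of_nat_eq_real_of_nat)
        have ab: "\<bar>u y\<bar> \<le> enn2real (d m y)" for y by (simp add: u_def abs_mult sgn_if)
        have ub: "\<bar>u y\<bar> \<le> real m" for y
        proof -
          have "enn2real (d m y) \<le> real m"
            by (rule enn2real_leI) (use d_le(2)[of m y] in \<open>auto simp: ennreal_of_nat_eq_real_of_nat\<close>)
          then show ?thesis using ab[of y] by simp
        qed
        have ut: "u \<in> test_funs"
          by (rule bounded_suppI[of _ _ "real m" _ m]) (use ub in \<open>auto simp: u_def d_def\<close>)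
        have e: "u y * F y = enn2real (d m y) * \<bar>F y\<bar>" for y by (simp add: u_def abs_sgn mult_ac)
        have "(\<integral>\<^sup>+y. d m y * ?F y \<partial>lborel) = (\<integral>\<^sup>+y. ennreal (u y * F y) \<partial>lborel)"
          using dfin by (intro nn_integral_cong) (simp add: e ennreal_mult ennreal_enn2real)
        also have "\<dots> = ennreal (\<integral>y. u y * F y \<partial>lborel)"
          by (rule nn_integral_eq_integral[OF FI[OF ut]]) (simp add: e)
        also have "\<dots> \<le> ennreal \<bar>\<integral>y. u y * F y \<partial>lborel\<bar>" by (intro ennreal_leI) simp
        also have "\<dots> \<le> ennreal K * Nn R P u" by (rule FK[OF ut])
        also have "Nn R P u \<le> Lnorm (ennreal P) M (\<lambda>\<xi>. ennreal C3 * maximal ?\<psi> \<xi>)"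
        proof (rule Lnorm_mono_AE[OF P0(1)], rule AE_I2)
          fix \<xi>
          show "nt_max \<Omega> a c (ennreal R) u \<xi> \<le> ennreal C3 * maximal ?\<psi> \<xi>"
            unfolding nt_max_eq
          proof (rule SUP_least)
            fix z assume z: "z \<in> nt_cone \<Omega> a \<xi>"
            have "W (ennreal R) u z = epowr (avg z (\<lambda>y. ennreal (\<bar>u y\<bar> powr R))) (1 / R)"
              using z R by (intro W_eq_finite) (auto simp: nt_cone_def)
            also have "\<dots> \<le> epowr (avg z (\<lambda>y. epowr (dual_test ?\<psi> w y) R)) (1 / R)"
            proof (intro epowr_mono nn_integral_mono mult_left_mono)
              fix y
              have "ennreal \<bar>u y\<bar> \<le> d m y" using ennreal_leI[OF ab[of y]] dfin[of y] by (simp add: ennreal_enn2real)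
              then have "epowr (ennreal \<bar>u y\<bar>) R \<le> epowr (D y) R"
                by (intro epowr_mono R order_trans[OF _ d_le(1)])
              then show "ennreal (\<bar>u y\<bar> powr R) \<le> epowr (dual_test ?\<psi> w y) R" by (simp add: D_def epowr_ennreal)
            qed (use R in auto)
            also have "\<dots> \<le> ennreal C3 * maximal ?\<psi> \<xi>"
              using w1 z by (intro bound) auto
            finally show "W (ennreal R) u z \<le> ennreal C3 * maximal ?\<psi> \<xi>" .
          qed
        qed
        also have "\<dots> = ennreal C3 * Lnorm (ennreal P) M (maximal ?\<psi>)"
          by (rule Lnorm_cmult[OF P0(1)]) measurable
        also have "\<dots> \<le> ennreal C3 * (ennreal K1 * Lnorm (ennreal P) M ?\<psi>)"
          by (intro mult_left_mono K1) auto
        finally show "(\<integral>\<^sup>+y. d m y * ?F y \<partial>lborel) \<le> ennreal K * (ennreal C3 * (ennreal K1 * Lnorm (ennreal P) M ?\<psi>))"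
          by (simp add: mult_left_mono)
      qed
      finally show ?thesis .
    qed
    finally have "(\<integral>\<^sup>+\<zeta>. area ?h \<zeta> * ?\<psi> \<zeta> \<partial>M) \<le> 2 * (ennreal K * (ennreal C3 * (ennreal K1 * Lnorm (ennreal P) M ?\<psi>)))"
      by (simp add: mult_left_mono)
    then show "(\<integral>\<^sup>+\<zeta>. area ?h \<zeta> * ?\<psi> \<zeta> \<partial>M) \<le> ?C * Lnorm (ennreal P) M ?\<psi>"
      by (simp only: mult.assoc)
  qed simp
  \<comment> \<open>The comparison with the maximal function of the conical integral holds at
    frontier points, which carry all of \<open>M\<close>.\<close>
  have "Lnorm (ennreal P') M (carleson n \<Omega> c q F) \<le> Lnorm (ennreal P') M (\<lambda>\<xi>. ennreal C5 * maximal (area ?h) \<xi>)"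
  proof (rule Lnorm_mono_AE[OF P0(2)])
    show "AE \<xi> in M. carleson n \<Omega> c q F \<xi> \<le> ennreal C5 * maximal (area ?h) \<xi>"
      using AE_frontier
    proof eventually_elim
      fix \<xi> assume "\<xi> \<in> frontier \<Omega>"
      then show "carleson n \<Omega> c q F \<xi> \<le> ennreal C5 * maximal (area ?h) \<xi>"
        unfolding carleson_eq C5_def by (intro ball_sup_le_maximal_area) (auto simp: W_def)
    qed
  qed
  also have "\<dots> = ennreal C5 * Lnorm (ennreal P') M (maximal (area ?h))"
    by (rule Lnorm_cmult[OF P0(2)]) measurable
  also have "\<dots> \<le> ennreal C5 * (ennreal K2 * ?C)"
    by (intro mult_left_mono order_trans[OF K2] A) auto
  also have "\<dots> < top" by (simp add: ennreal_mult_less_top)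
  finally show ?thesis .
qed

section \<open>Boundary values\<close>

lemma W_le:
  assumes [measurable]: "v \<in> borel_measurable borel" and R: "0 < R" and B: "0 \<le> B"
    and le: "\<And>y. y \<in> Wball x \<Longrightarrow> \<bar>v y\<bar> \<le> B"
  shows "W (ennreal R) v x \<le> ennreal B"
proof (cases "x \<in> \<Omega>")
  case x: True
  have "avg x (\<lambda>y. ennreal (\<bar>v y\<bar> powr R)) \<le> avg x (\<lambda>y. ennreal (B powr R))"
  proof (rule nn_integral_mono)
    fix y
    show "\<phi> x y * ennreal (\<bar>v y\<bar> powr R) \<le> \<phi> x y * ennreal (B powr R)"
      using le[of y] R by (cases "y \<in> Wball x") (auto simp: \<phi>_def intro!: mult_left_mono ennreal_leI powr_mono2)
  qed
  also have "\<dots> = ennreal (B powr R)" using \<phi>_mass[OF x] by (simp add: nn_integral_multc)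
  finally have "W (ennreal R) v x \<le> epowr (ennreal (B powr R)) (1 / R)"
    using R x by (simp add: W_eq_finite epowr_mono)
  then show ?thesis using R B by (simp add: epowr_ennreal powr_powr)
qed (simp add: W_def)

lemma W_ge:
  assumes [measurable]: "v \<in> borel_measurable borel" and R: "0 < R" and B: "0 \<le> B" and x: "x \<in> \<Omega>"
    and ge: "\<And>y. y \<in> Wball x \<Longrightarrow> B \<le> \<bar>v y\<bar>"
  shows "ennreal B \<le> W (ennreal R) v x"
proof -
  have "ennreal (B powr R) = avg x (\<lambda>y. ennreal (B powr R))" using \<phi>_mass[OF x] by (simp add: nn_integral_multc)
  also have "\<dots> \<le> avg x (\<lambda>y. ennreal (\<bar>v y\<bar> powr R))"
  proof (rule nn_integral_mono)
    fix y
    show "\<phi> x y * ennreal (B powr R) \<le> \<phi> x y * ennreal (\<bar>v y\<bar> powr R)"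
      using ge[of y] R B by (cases "y \<in> Wball x") (auto simp: \<phi>_def intro!: mult_left_mono ennreal_leI powr_mono2)
  qed
  finally have "epowr (ennreal (B powr R)) (1 / R) \<le> W (ennreal R) v x"
    using R x by (simp add: W_eq_finite epowr_mono)
  then show ?thesis using R B by (simp add: epowr_ennreal powr_powr)
qed

text \<open>Whitney balls of points of a cone stay in the cone of aperture \<open>2 + 2 * a\<close>:
  the distance to \<xi> is below \<open>\<delta> x / 2 + (1 + a) * \<delta> x\<close>, and
  \<open>\<delta> x \<le> 2 * \<delta> y\<close>.\<close>

lemma cone_dist:
  assumes "x \<in> nt_cone \<Omega> a \<xi>" "y \<in> Wball x"
  shows "y \<in> \<Omega>" "dist y \<xi> < (3 + 2 * a) * \<delta> y"
proof -
  have x: "x \<in> \<Omega>" "dist x \<xi> < (1 + a) * \<delta> x" using assms by (auto simp: nt_cone_def)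
  note n = near[OF x(1) assms(2)]
  show "y \<in> \<Omega>" by (rule n)
  have "(1 + a) * \<delta> x \<le> (1 + a) * (2 * \<delta> y)" using n a_pos by (intro mult_left_mono) auto
  then show "dist y \<xi> < (3 + 2 * a) * \<delta> y"
    using x n dist_triangle[of y \<xi> x] by (simp add: dist_commute algebra_simps)
qed

lemma nt_max_le:
  assumes "v \<in> borel_measurable borel" "0 < R" "0 \<le> B"
    and "\<And>y. y \<in> \<Omega> \<Longrightarrow> dist y \<xi> < (3 + 2 * a) * \<delta> y \<Longrightarrow> \<bar>v y\<bar> \<le> B"
  shows "nt_max \<Omega> a c (ennreal R) v \<xi> \<le> ennreal B"
  unfolding nt_max_eq
proof (rule SUP_least)
  fix x assume x: "x \<in> nt_cone \<Omega> a \<xi>"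
  show "W (ennreal R) v x \<le> ennreal B"
    by (rule W_le[OF assms(1-3)]) (use cone_dist[OF x] assms(4) in blast)
qed

text \<open>A radius beyond which the nontangential maximal function vanishes when the function is
  supported in \<open>cball 0 \<rho>\<close>: a point \<xi> that sees \<open>y\<close> is within
  \<open>(3 + 2 * a) * \<delta> y\<close> of \<open>y\<close>, and
  \<open>\<delta> y \<le> \<delta> 0 + \<rho>\<close>.\<close>

definition nt_radius :: "real \<Rightarrow> real" where
  "nt_radius \<rho> = \<rho> + (3 + 2 * a) * (\<delta> 0 + \<rho>)"

lemma nt_radius_bound:
  assumes "norm y \<le> \<rho>" "dist y \<xi> < (3 + 2 * a) * \<delta> y"
  shows "\<xi> \<in> cball 0 (nt_radius \<rho>)"
proof -
  have "\<delta> y \<le> \<delta> 0 + \<rho>" using \<delta>_triangle[of y 0] assms by simp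
  then have "(3 + 2 * a) * \<delta> y \<le> (3 + 2 * a) * (\<delta> 0 + \<rho>)" using a_pos by (intro mult_left_mono) auto
  then have "dist y \<xi> \<le> (3 + 2 * a) * (\<delta> 0 + \<rho>)" using assms(2) by simp
  moreover have "norm \<xi> \<le> norm y + dist y \<xi>" using norm_triangle_ineq4[of y "y - \<xi>"] by (simp add: dist_norm)
  ultimately show ?thesis using assms(1) by (simp add: nt_radius_def)
qed

lemma nt_max_support:
  assumes "v \<in> borel_measurable borel" "0 < R" "\<And>y. y \<in> \<Omega> \<Longrightarrow> v y \<noteq> 0 \<Longrightarrow> norm y \<le> \<rho>"
    and "\<xi> \<notin> cball 0 (nt_radius \<rho>)"
  shows "nt_max \<Omega> a c (ennreal R) v \<xi> = 0"
proof -
  have "nt_max \<Omega> a c (ennreal R) v \<xi> \<le> ennreal 0"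
    by (rule nt_max_le[OF assms(1,2)]) (use assms(3,4) nt_radius_bound in \<open>fastforce+\<close>)
  then show ?thesis by simp
qed

lemma finite_cball: "emeasure M (cball x r) < top"
proof -
  have "emeasure M (cball x r) \<le> emeasure M (ball x (r + 1))" by (intro emeasure_mono) auto
  then show ?thesis using finite_ball[of x "r + 1"] by (rule order_le_less_trans)
qed

lemma Nn_bounded_support:
  assumes "v \<in> borel_measurable borel" "0 < R" "0 < P" "0 \<le> B"
    and "\<And>y. y \<in> \<Omega> \<Longrightarrow> \<bar>v y\<bar> \<le> B" "\<And>y. y \<in> \<Omega> \<Longrightarrow> v y \<noteq> 0 \<Longrightarrow> norm y \<le> \<rho>"
  shows "Nn R P v < top"
proof -
  have "Nn R P v \<le> ennreal B * epowr (emeasure M (cball 0 (nt_radius \<rho>))) (1 / P)"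
  proof (rule Lnorm_bounded_support[OF assms(3)])
    fix \<xi>
    show "nt_max \<Omega> a c (ennreal R) v \<xi> \<le> ennreal B * indicator (cball 0 (nt_radius \<rho>)) \<xi>"
      using nt_max_support[OF assms(1,2,6), of \<xi>] nt_max_le[OF assms(1,2,4,5), of \<xi>]
      by (cases "\<xi> \<in> cball 0 (nt_radius \<rho>)") auto
  qed simp
  also have "\<dots> < top" using finite_cball by (simp add: ennreal_mult_less_top)
  finally show ?thesis .
qed

text \<open>Whitney balls that meet \<open>KK j\<close> have volume at least \<open>v0\<close>, so
  averages over them are controlled by the integral over the whole space, and the maximal function
  has bounded support. The constant depends on \<open>j\<close>; the estimate makes bounded
  functionals continuous for the L^R norm on each \<open>KK j\<close>.\<close>

lemma Nn_le_Lnorm: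
  assumes R: "0 < R" and P: "0 < P"
  shows "\<exists>C. \<forall>v\<in>test_funs. (\<forall>x. x \<notin> KK j \<longrightarrow> v x = 0) \<longrightarrow>
    Nn R P v \<le> ennreal C * Lp R lborel v"
proof -
  define v0 where "v0 = unit_ball_vol DIM('a) * (c * (1 / real (Suc j) / 2)) ^ DIM('a)"
  have v0: "0 < v0" using c_pos by (simp add: v0_def)
  define S where "S = cball (0::'a) (nt_radius (real j))"
  obtain m where m: "emeasure M S = ennreal m" "0 \<le> m"
    using finite_cball[of 0 "nt_radius (real j)"] by (cases "emeasure M S") (auto simp: S_def)
  show ?thesis
  proof (intro exI[of _ "(1 / v0) powr (1 / R) * m powr (1 / P)"] ballI impI)
    fix v assume v: "v \<in> test_funs" and vj: "\<forall>x. x \<notin> KK j \<longrightarrow> v x = 0"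
    have vm[measurable]: "v \<in> borel_measurable borel" by (rule test_funs_borel[OF v])
    let ?L = "Lp R lborel v"
    have W: "W (ennreal R) v x \<le> ennreal ((1 / v0) powr (1 / R)) * ?L" if x: "x \<in> \<Omega>" for x
    proof -
      have "avg x (\<lambda>y. ennreal (\<bar>v y\<bar> powr R)) \<le> (\<integral>\<^sup>+y. ennreal (1 / v0) * ennreal (\<bar>v y\<bar> powr R) \<partial>lborel)"
      proof (rule nn_integral_mono)
        fix y
        show "\<phi> x y * ennreal (\<bar>v y\<bar> powr R) \<le> ennreal (1 / v0) * ennreal (\<bar>v y\<bar> powr R)"
        proof (cases "y \<in> KK j \<and> dist x y < c * \<delta> x")
          case True
          then have "\<delta> y \<le> 2 * \<delta> x" "1 / real (Suc j) \<le> \<delta> y" using near(3)[OF x, of y] by (auto simp: KK_def)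
          then have "1 / real (Suc j) \<le> 2 * \<delta> x" by (meson order_trans)
          then have "1 / real (Suc j) / 2 \<le> (2 * \<delta> x) / 2" by (rule divide_right_mono) simp
          then have "1 / real (Suc j) / 2 \<le> \<delta> x" by simp
          then have "v0 \<le> vol x" unfolding v0_def vol_def using c_pos by (intro mult_left_mono power_mono) auto
          then have "1 / vol x \<le> 1 / v0" using v0 by (intro divide_left_mono) auto
          then show ?thesis using x True by (auto simp: \<phi>_def intro!: mult_right_mono ennreal_leI)
        next
          case False
          then show ?thesis using vj by (auto simp: \<phi>_def)
        qed
      qed
      also have "\<dots> = ennreal (1 / v0) * (\<integral>\<^sup>+y. ennreal (\<bar>v y\<bar> powr R) \<partial>lborel)" by (rule nn_integral_cmult) measurable
      finally have "W (ennreal R) v x \<le> epowr (ennreal (1 / v0) * (\<integral>\<^sup>+y. ennreal (\<bar>v y\<bar> powr R) \<partial>lborel)) (1 / R)"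
        using R x by (simp add: W_eq_finite epowr_mono)
      also have "\<dots> = ennreal ((1 / v0) powr (1 / R)) * ?L"
        using R v0 by (simp add: epowr_mult epowr_ennreal Lnorm_ennreal)
      finally show ?thesis .
    qed
    have "Nn R P v \<le> (ennreal ((1 / v0) powr (1 / R)) * ?L) * epowr (emeasure M S) (1 / P)"
    proof (rule Lnorm_bounded_support[OF P])
      fix \<xi>
      show "nt_max \<Omega> a c (ennreal R) v \<xi> \<le> (ennreal ((1 / v0) powr (1 / R)) * ?L) * indicator S \<xi>"
      proof (cases "\<xi> \<in> S")
        case True
        have "nt_max \<Omega> a c (ennreal R) v \<xi> \<le> ennreal ((1 / v0) powr (1 / R)) * ?L"
          unfolding nt_max_eq by (rule SUP_least, rule W) (simp add: nt_cone_def)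
        then show ?thesis using True by simp
      next
        case False
        have "norm y \<le> real j" if "v y \<noteq> 0" for y using vj that by (auto simp: KK_def)
        then have "nt_max \<Omega> a c (ennreal R) v \<xi> = 0"
          using False by (intro nt_max_support[OF vm R]) (auto simp: S_def)
        then show ?thesis by simp
      qed
    qed (simp add: S_def)
    also have "\<dots> = ennreal ((1 / v0) powr (1 / R) * m powr (1 / P)) * ?L"
    proof -
      have "ennreal ((1 / v0) powr (1 / R) * m powr (1 / P)) = ennreal ((1 / v0) powr (1 / R)) * ennreal (m powr (1 / P))"
        by (rule ennreal_mult) auto
      then show ?thesis using m by (simp only: epowr_ennreal mult_ac)
    qed
    finally show "Nn R P v \<le> ennreal ((1 / v0) powr (1 / R) * m powr (1 / P)) * ?L" .
  qed
qed

text \<open>The constant 4 of the triangle inequality is paid twice, for the averages over Whitney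
  balls and for the norm on the boundary.\<close>

lemma Nn_add_le:
  assumes "f \<in> L0" "g \<in> L0" "1 \<le> R" "1 \<le> P"
  shows "Nn R P (\<lambda>x. f x + g x) \<le> 16 * (Nn R P f + Nn R P g)"
proof -
  have P0: "0 < P" using assms by simp
  have [measurable]: "nt_max \<Omega> a c (ennreal R) h \<in> borel_measurable M" for h by measurable
  have "Nn R P (\<lambda>x. f x + g x) \<le> Lnorm (ennreal P) M (\<lambda>\<xi>. 4 * (nt_max \<Omega> a c (ennreal R) f \<xi> + nt_max \<Omega> a c (ennreal R) g \<xi>))"
    by (intro Lnorm_mono_AE P0 AE_I2 nt_max_add_le assms)
  also have "\<dots> = 4 * Lnorm (ennreal P) M (\<lambda>\<xi>. nt_max \<Omega> a c (ennreal R) f \<xi> + nt_max \<Omega> a c (ennreal R) g \<xi>)"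
    by (rule Lnorm_cmult[OF P0]) measurable
  also have "\<dots> \<le> 4 * (4 * (Nn R P f + Nn R P g))"
    by (intro mult_left_mono Lnorm_add_le assms) auto
  also have "\<dots> = 16 * (Nn R P f + Nn R P g)" by (simp add: mult.assoc[symmetric])
  finally show ?thesis .
qed

lemma W_cmult:
  assumes "f \<in> L0" "0 < R"
  shows "W (ennreal R) (\<lambda>y. s * f y) x = ennreal \<bar>s\<bar> * W (ennreal R) f x"
proof (cases "x \<in> \<Omega>")
  case x: True
  obtain f' where f': "f' \<in> borel_measurable borel" "AE x in lborel. x \<in> \<Omega> \<longrightarrow> f x = f' x" "\<And>q. W q f = W q f'"
    using W_representative[OF assms(1)] by metis
  note [measurable] = f'(1)
  have "W (ennreal R) (\<lambda>y. s * f y) = W (ennreal R) (\<lambda>y. s * f' y)"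
  proof (rule W_cong_AE)
    show "(\<lambda>y. s * f y) \<in> L0" using assms by measurable
    show "(\<lambda>y. s * f' y) \<in> L0" by (rule borel_lebesgue_on) measurable
    show "AE x in lborel. x \<in> \<Omega> \<longrightarrow> s * f x = s * f' x" using f'(2) by eventually_elim auto
  qed
  then show ?thesis
    using x Lnorm_abs_cmult[OF assms(2), of f' "avgm x" s] assms(2) by (simp add: f'(3) W_def Laverage_eq_finite)
qed (simp add: W_def)

lemma Nn_cmult:
  assumes "f \<in> L0" "0 < R" "0 < P"
  shows "Nn R P (\<lambda>x. s * f x) = ennreal \<bar>s\<bar> * Nn R P f"
proof -
  have "nt_max \<Omega> a c (ennreal R) (\<lambda>x. s * f x) = (\<lambda>\<xi>. ennreal \<bar>s\<bar> * nt_max \<Omega> a c (ennreal R) f \<xi>)"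
    unfolding nt_max_eq W_cmult[OF assms(1,2)] by (simp add: SUP_mult_left_ennreal fun_eq_iff nt_max_eq)
  then show ?thesis by (simp add: Lnorm_cmult[OF assms(3)])
qed

lemma Nn_cong:
  assumes "\<And>x. x \<in> \<Omega> \<Longrightarrow> f x = g x" shows "Nn R P f = Nn R P g"
proof -
  have "Laverage (ennreal R) f (Wball x) = Laverage (ennreal R) g (Wball x)" if x: "x \<in> \<Omega>" for x
  proof -
    have "f y = g y" if "y \<in> Wball x" for y using lborel_on_Wball[OF x] that assms by blast
    then have 1: "(\<integral>\<^sup>+y\<in>Wball x. ennreal (\<bar>f y\<bar> powr enn2real (ennreal R)) \<partial>lebesgue) = (\<integral>\<^sup>+y\<in>Wball x. ennreal (\<bar>g y\<bar> powr enn2real (ennreal R)) \<partial>lebesgue)"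
      by (intro nn_integral_cong) (auto simp: indicator_def)
    show ?thesis unfolding Laverage_def by (simp only: 1) simp
  qed
  then have "W (ennreal R) f = W (ennreal R) g" by (auto simp: W_def)
  then have "nt_max \<Omega> a c (ennreal R) f = nt_max \<Omega> a c (ennreal R) g" by (simp add: nt_max_eq fun_eq_iff)
  then show ?thesis by simp
qed

section \<open>Continuous functions on the closure and their boundary values\<close>

abbreviation "CC \<equiv> Cc (closure \<Omega>)"

text \<open>Elements of \<open>CC\<close> are arbitrary off the closure. \<open>ext\<close> and
  \<open>te\<close> replace them by Borel functions on the whole space that agree with them on the
  closure and on the frontier.\<close>

definition ext :: "('a \<Rightarrow> real) \<Rightarrow> 'a \<Rightarrow> real" where
  "ext u x = (if x \<in> closure \<Omega> then u x else 0)"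

definition te :: "('a \<Rightarrow> real) \<Rightarrow> 'a \<Rightarrow> real" where
  "te u x = (if x \<in> frontier \<Omega> then u x else 0)"

lemma frontier_sub_closure: "frontier \<Omega> \<subseteq> closure \<Omega>"
  by (auto simp: frontier_def)

lemma ext_eq: "x \<in> \<Omega> \<Longrightarrow> ext u x = u x" "x \<in> frontier \<Omega> \<Longrightarrow> ext u x = u x"
  using closure_subset frontier_sub_closure by (auto simp: ext_def)

lemma CC_borel: "u \<in> CC \<Longrightarrow> ext u \<in> borel_measurable borel"
proof -
  assume u: "u \<in> CC"
  have "(\<lambda>x. indicator (closure \<Omega>) x *\<^sub>R u x) \<in> borel_measurable borel"
    using u by (intro borel_measurable_continuous_on_indicator) (auto simp: Cc_def)
  also have "(\<lambda>x. indicator (closure \<Omega>) x *\<^sub>R u x) = ext u" by (auto simp: ext_def indicator_def)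
  finally show ?thesis .
qed

lemma te_borel: "u \<in> CC \<Longrightarrow> te u \<in> borel_measurable borel"
proof -
  assume u: "u \<in> CC"
  note [measurable] = CC_borel[OF u]
  have "te u = (\<lambda>x. if x \<in> frontier \<Omega> then ext u x else 0)" using frontier_sub_closure by (auto simp: te_def ext_def fun_eq_iff)
  also have "\<dots> \<in> borel_measurable borel" by measurable
  finally show ?thesis .
qed

lemma CC_lebesgue_on: "u \<in> CC \<Longrightarrow> u \<in> L0"
  using borel_lebesgue_on[OF CC_borel, of u \<Omega>]
  by (rule measurable_cong[THEN iffD1, rotated]) (auto simp: space_restrict_space ext_eq)

lemma CC_bounded:
  assumes "u \<in> CC"
  obtains B \<rho> where "0 \<le> B" "0 \<le> \<rho>" "\<And>x. \<bar>ext u x\<bar> \<le> B" "\<And>x. ext u x \<noteq> 0 \<Longrightarrow> norm x \<le> \<rho>"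
proof -
  obtain K where c: "continuous_on (closure \<Omega>) u" and K: "compact K" "K \<subseteq> closure \<Omega>" "\<forall>x\<in>closure \<Omega> - K. u x = 0"
    using assms by (auto simp: Cc_def)
  have "bounded (u ` K)" by (intro compact_imp_bounded compact_continuous_image continuous_on_subset[OF c] K)
  then obtain B where B: "\<forall>y\<in>u ` K. norm y \<le> B" unfolding bounded_iff by blast
  obtain \<rho> where \<rho>: "\<And>x. x \<in> K \<Longrightarrow> norm x \<le> \<rho>" using compact_imp_bounded[OF K(1)] unfolding bounded_iff by blast
  show thesis
  proof (rule that[of "max B 0" "max \<rho> 0"])
    fix x
    show "\<bar>ext u x\<bar> \<le> max B 0" using B K(3) by (cases "x \<in> K") (auto simp: ext_def)
    assume "ext u x \<noteq> 0"
    then have "x \<in> K" using K(3) by (auto simp: ext_def split: if_splits)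
    then show "norm x \<le> max \<rho> 0" using \<rho> by fastforce
  qed auto
qed

text \<open>Uniform continuity on the part of the closure in a ball whose radius exceeds that of the
  support by 1. For points at distance below 1, either both lie in that ball or \<open>u\<close>
  vanishes at both.\<close>

lemma CC_uniform:
  assumes u: "u \<in> CC" and e: "0 < e"
  obtains d where "0 < d" "\<And>x y. x \<in> closure \<Omega> \<Longrightarrow> y \<in> closure \<Omega> \<Longrightarrow> dist x y < d \<Longrightarrow> \<bar>u x - u y\<bar> < e"
proof -
  obtain B \<rho> where \<rho>: "0 \<le> \<rho>" "\<And>x. ext u x \<noteq> 0 \<Longrightarrow> norm x \<le> \<rho>" using CC_bounded[OF u] by metis
  let ?L = "closure \<Omega> \<inter> cball 0 (\<rho> + 1)"
  have c: "continuous_on ?L u" using u by (auto simp: Cc_def intro: continuous_on_subset)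
  have "compact ?L" by (simp add: closed_Int_compact)
  from compact_uniformly_continuous[OF c this] obtain d where d: "0 < d"
    "\<And>x y. x \<in> ?L \<Longrightarrow> y \<in> ?L \<Longrightarrow> dist y x < d \<Longrightarrow> dist (u y) (u x) < e"
    unfolding uniformly_continuous_on_def using e by metis
  show thesis
  proof (rule that[of "min d 1"])
    show "0 < min d 1" using d by simp
    fix x y assume xy: "x \<in> closure \<Omega>" "y \<in> closure \<Omega>" "dist x y < min d 1"
    show "\<bar>u x - u y\<bar> < e"
    proof (cases "norm x \<le> \<rho> \<or> norm y \<le> \<rho>")
      case True
      have "norm x \<le> norm y + dist x y" "norm y \<le> norm x + dist x y"
        using norm_triangle_ineq[of y "x - y"] norm_triangle_ineq4[of x "x - y"] by (auto simp: dist_norm)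
      then have "x \<in> ?L" "y \<in> ?L" using xy True by auto
      then show ?thesis using d(2)[of y x] xy by (simp add: dist_real_def)
    next
      case False
      then have "ext u x = 0" "ext u y = 0" using \<rho>(2) by blast+
      then show ?thesis using xy e by (simp add: ext_def)
    qed
  qed
qed

lemma CC_Nn_finite: "u \<in> CC \<Longrightarrow> 0 < R \<Longrightarrow> 0 < P \<Longrightarrow> Nn R P u < top"
proof -
  assume u: "u \<in> CC" and RP: "0 < R" "0 < P"
  obtain B \<rho> where B: "0 \<le> B" "\<And>x. \<bar>ext u x\<bar> \<le> B" "\<And>x. ext u x \<noteq> 0 \<Longrightarrow> norm x \<le> \<rho>" using CC_bounded[OF u] by metis
  have "Nn R P (ext u) < top" by (rule Nn_bounded_support[OF CC_borel[OF u] RP B(1)]) (use B in auto)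
  then show ?thesis using Nn_cong[of "ext u" u] ext_eq(1) by simp
qed

text \<open>In the layer where \<delta> is below \<open>e\<close>, a point that counts at \<xi> is
  within \<open>(3 + 2 * a) * e = d\<close> of \<xi>, so uniform continuity replaces its value by
  \<open>u \<xi>\<close> up to \<beta>. This error lives on the bounded set \<open>S\<close>, hence
  its norm is small with \<beta>.\<close>

lemma near_boundary_bound:
  assumes u: "u \<in> CC" and R: "0 < R" and P: "1 \<le> P" and \<eta>: "0 < \<eta>"
  obtains e where "0 < e"
    "Nn R P (\<lambda>x. if \<delta> x < e then u x else 0) \<le> 4 * Lp P M (te u) + ennreal \<eta>"
proof -
  have P0: "0 < P" using P by simp
  obtain B \<rho> where B: "0 \<le> B" "\<And>x. \<bar>ext u x\<bar> \<le> B" "\<And>x. ext u x \<noteq> 0 \<Longrightarrow> norm x \<le> \<rho>" using CC_bounded[OF u] by metis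
  define S where "S = cball (0::'a) (nt_radius \<rho>)"
  have [measurable]: "S \<in> sets borel" by (simp add: S_def)
  obtain m where m: "emeasure M S = ennreal m" "0 \<le> m"
    using finite_cball[of 0 "nt_radius \<rho>"] by (cases "emeasure M S") (auto simp: S_def)
  \<comment> \<open>Chosen so that \<open>4 * \<beta> * m powr (1 / P) \<le> \<eta>\<close>, where
    the 4 is that of \<open>Lnorm_add_le\<close>.\<close>
  define \<beta> where "\<beta> = \<eta> / (m powr (1 / P) + 1) / 4"
  have mp: "0 < m powr (1 / P) + 1" by (simp add: add_nonneg_pos)
  have \<beta>: "0 < \<beta>" using \<eta> mp by (simp add: \<beta>_def)
  obtain d where d: "0 < d" "\<And>x y. x \<in> closure \<Omega> \<Longrightarrow> y \<in> closure \<Omega> \<Longrightarrow> dist x y < d \<Longrightarrow> \<bar>u x - u y\<bar> < \<beta>"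
    using CC_uniform[OF u \<beta>] by metis
  define e where "e = d / (3 + 2 * a)"
  have e: "0 < e" "(3 + 2 * a) * e = d" using d a_pos by (auto simp: e_def)
  define v where "v x = (if \<delta> x < e then ext u x else 0)" for x
  have [measurable]: "ext u \<in> borel_measurable borel" by (rule CC_borel[OF u])
  have [measurable]: "te u \<in> borel_measurable borel" by (rule te_borel[OF u])
  have vm: "v \<in> borel_measurable borel" unfolding v_def by measurable
  have bd: "nt_max \<Omega> a c (ennreal R) v \<xi> \<le> ennreal \<bar>te u \<xi>\<bar> + ennreal \<beta> * indicator S \<xi>" if \<xi>: "\<xi> \<in> frontier \<Omega>" for \<xi>
  proof (cases "\<xi> \<in> S")
    case True
    have "nt_max \<Omega> a c (ennreal R) v \<xi> \<le> ennreal (\<bar>u \<xi>\<bar> + \<beta>)"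
    proof (rule nt_max_le[OF vm R])
      show "0 \<le> \<bar>u \<xi>\<bar> + \<beta>" using \<beta> by simp
      fix y assume y: "y \<in> \<Omega>" "dist y \<xi> < (3 + 2 * a) * \<delta> y"
      show "\<bar>v y\<bar> \<le> \<bar>u \<xi>\<bar> + \<beta>"
      proof (cases "\<delta> y < e")
        case True
        then have "(3 + 2 * a) * \<delta> y \<le> (3 + 2 * a) * e" using a_pos by (intro mult_left_mono) auto
        then have "dist y \<xi> < d" using y e by simp
        then have "\<bar>u y - u \<xi>\<bar> < \<beta>" using y \<xi> closure_subset frontier_sub_closure by (intro d(2)) auto
        then show ?thesis using True y by (simp add: v_def ext_eq)
      qed (use \<beta> in \<open>simp add: v_def\<close>)
    qed
    then show ?thesis using True \<xi> \<beta> by (simp add: te_def)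
  next
    case False
    then have "nt_max \<Omega> a c (ennreal R) v \<xi> = 0"
      by (intro nt_max_support[OF vm R, of \<rho>]) (auto simp: v_def S_def intro: B split: if_splits)
    then show ?thesis by simp
  qed
  have "Nn R P v \<le> Lnorm (ennreal P) M (\<lambda>\<xi>. ennreal \<bar>te u \<xi>\<bar> + ennreal \<beta> * indicator S \<xi>)"
  proof (rule Lnorm_mono_AE[OF P0])
    show "AE \<xi> in M. nt_max \<Omega> a c (ennreal R) v \<xi> \<le> ennreal \<bar>te u \<xi>\<bar> + ennreal \<beta> * indicator S \<xi>"
      using AE_frontier by eventually_elim (rule bd)
  qed
  also have "\<dots> \<le> 4 * (Lp P M (te u) + Lnorm (ennreal P) M (\<lambda>\<xi>. ennreal \<beta> * indicator S \<xi>))"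
    by (rule Lnorm_add_le[OF P]) measurable
  also have "\<dots> \<le> 4 * Lp P M (te u) + ennreal \<eta>"
  proof -
    have "Lnorm (ennreal P) M (\<lambda>\<xi>. ennreal \<beta> * indicator S \<xi>) \<le> ennreal \<beta> * epowr (emeasure M S) (1 / P)"
      by (rule Lnorm_bounded_support[OF P0]) (auto simp: S_def)
    also have "\<dots> = ennreal (\<beta> * m powr (1 / P))" using m \<beta> by (simp add: epowr_ennreal ennreal_mult)
    finally have "4 * Lnorm (ennreal P) M (\<lambda>\<xi>. ennreal \<beta> * indicator S \<xi>) \<le> 4 * ennreal (\<beta> * m powr (1 / P))"
      by (rule mult_left_mono) simp
    also have "\<dots> = ennreal (4 * (\<beta> * m powr (1 / P)))"
      using \<beta> by (simp add: ennreal_mult)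
    also have "\<dots> \<le> ennreal \<eta>"
    proof (rule ennreal_leI)
      have "\<beta> * (m powr (1 / P) + 1) = \<eta> / 4" using mp by (simp add: \<beta>_def field_simps)
      moreover have "\<beta> * m powr (1 / P) \<le> \<beta> * (m powr (1 / P) + 1)" using \<beta> by (intro mult_left_mono) auto
      ultimately show "4 * (\<beta> * m powr (1 / P)) \<le> \<eta>" by linarith
    qed
    finally show ?thesis by (simp add: distrib_left add_left_mono)
  qed
  finally have "Nn R P v \<le> 4 * Lp P M (te u) + ennreal \<eta>" .
  moreover have "Nn R P v = Nn R P (\<lambda>x. if \<delta> x < e then u x else 0)"
    by (rule Nn_cong) (simp add: v_def ext_eq)
  ultimately show thesis using e(1) that by simp
qed

end

text \<open>The corkscrew condition at scales below a threshold; the bound for traces uses it at a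
  scale that shrinks with the modulus of continuity of \<open>u\<close>.\<close>

locale nt_domain_corkscrew = nt_domain +
  fixes c' \<epsilon>\<^sub>0 :: real
  assumes c'_pos: "0 < c'" and \<epsilon>\<^sub>0_pos: "0 < \<epsilon>\<^sub>0"
    and cork: "\<And>\<xi> \<epsilon>. \<xi> \<in> frontier \<Omega> \<Longrightarrow> 0 < \<epsilon> \<Longrightarrow> \<epsilon> < \<epsilon>\<^sub>0 \<Longrightarrow> \<exists>z s. c' * \<epsilon> \<le> s \<and> ball z s \<subseteq> ball \<xi> \<epsilon> \<inter> \<Omega>"
begin

text \<open>Near a boundary point \<open>\<xi>\<close> the corkscrew point of scale \<open>\<epsilon>\<close> makes the nontangential maximal
  function at least \<open>\<bar>u \<xi>\<bar> - \<eta>\<close> on a set of measure comparable to \<open>\<epsilon> ^ n\<close>; averaging over \<open>\<xi>\<close> needs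
  no relation between the aperture and the corkscrew constant.\<close>

theorem trace_bound:
  assumes R: "1 \<le> R" and P: "1 \<le> P"
  obtains C where "0 < C"
    "\<And>u. u \<in> CC \<Longrightarrow> Lp P M (te u) \<le> ennreal C * Nn R P u"
proof -
  interpret MM: pair_sigma_finite M M by unfold_locales
  have P0: "0 < P" "0 < R" using P R by auto
  \<comment> \<open>The ratio of \<open>C\<^sub>1 * ((2 + a) * \<epsilon>) ^ n\<close>, which bounds
    the measure of a ball of radius \<open>S\<close>, and
    \<open>\<kappa>\<^sub>2 * (c' * \<epsilon>) ^ n\<close>, which bounds the shadow of a corkscrew
    point from below; the scale cancels.\<close>
  define C where "C = C\<^sub>1 * (2 + a) ^ n / (\<kappa>\<^sub>2 * c' ^ n)"
  have C0: "0 < C" using C\<^sub>1 a_pos \<kappa>\<^sub>2_pos c'_pos by (simp add: C_def)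
  show thesis
  proof (rule that[of "C powr (1 / P)"])
    show "0 < C powr (1 / P)" using C0 by simp
    fix u assume u: "u \<in> CC"
    have [measurable]: "te u \<in> borel_measurable borel" "ext u \<in> borel_measurable borel"
      by (rule te_borel[OF u], rule CC_borel[OF u])
    define N where "N = nt_max \<Omega> a c (ennreal R) (ext u)"
    have Nm[measurable]: "N \<in> borel_measurable borel" unfolding N_def by measurable
    have step: "(\<integral>\<^sup>+\<xi>. ennreal (max 0 (\<bar>te u \<xi>\<bar> - \<eta>) powr P) \<partial>M) \<le> ennreal C * (\<integral>\<^sup>+\<zeta>. epowr (N \<zeta>) P \<partial>M)" if \<eta>: "0 < \<eta>" for \<eta>
    proof -
      obtain d where d: "0 < d" "\<And>x y. x \<in> closure \<Omega> \<Longrightarrow> y \<in> closure \<Omega> \<Longrightarrow> dist x y < d \<Longrightarrow> \<bar>u x - u y\<bar> < \<eta>"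
        using CC_uniform[OF u \<eta>] by metis
      \<comment> \<open>At this scale the Whitney ball of the corkscrew point lies within
        \<open>d\<close> of \<xi>, so \<open>u\<close> differs from \<open>u \<xi>\<close> by less
        than \<eta> on it.\<close>
      define \<epsilon> where "\<epsilon> = min (d / 2) (\<epsilon>\<^sub>0 / 2)"
      have \<epsilon>: "0 < \<epsilon>" "\<epsilon> < \<epsilon>\<^sub>0" "2 * \<epsilon> \<le> d" using d \<epsilon>\<^sub>0_pos by (auto simp: \<epsilon>_def)
      define k where "k = \<kappa>\<^sub>2 * (c' * \<epsilon>) ^ n"
      have k: "0 < k" using \<kappa>\<^sub>2_pos c'_pos \<epsilon> by (simp add: k_def)
      define S where "S = (2 + a) * \<epsilon>"
      have S: "0 < S" using a_pos \<epsilon> by (simp add: S_def)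
      let ?v = "\<lambda>\<xi>. ennreal (max 0 (\<bar>te u \<xi>\<bar> - \<eta>) powr P)"
      have loc: "ennreal k * ?v \<xi> \<le> (\<integral>\<^sup>+\<zeta>\<in>ball \<xi> S. epowr (N \<zeta>) P \<partial>M)" if \<xi>: "\<xi> \<in> frontier \<Omega>" for \<xi>
      proof -
        obtain z s where zs: "c' * \<epsilon> \<le> s" "ball z s \<subseteq> ball \<xi> \<epsilon> \<inter> \<Omega>" using cork[OF \<xi> \<epsilon>(1,2)] by blast
        have s: "0 < s" using zs c'_pos \<epsilon> by (meson less_le_trans mult_pos_pos)
        have z: "z \<in> \<Omega>" "dist \<xi> z < \<epsilon>" 
        proof -
          have "z \<in> ball \<xi> \<epsilon> \<inter> \<Omega>" using zs(2) s centre_in_ball[of z s] by blast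
          then show "z \<in> \<Omega>" "dist \<xi> z < \<epsilon>" by auto
        qed
        \<comment> \<open>The corkscrew ball misses the frontier; hence \<open>\<delta> z\<close> is
          at least \<open>c' * \<epsilon>\<close>, while \<open>dz\<close> below gives
          \<open>\<delta> z < \<epsilon>\<close>.\<close>
        have sz: "s \<le> \<delta> z"
        proof -
          obtain \<zeta> where \<zeta>: "\<zeta> \<in> frontier \<Omega>" "dist z \<zeta> = \<delta> z" by (rule \<delta>_attained)
          then have "\<zeta> \<notin> \<Omega>" using open_Om by (auto simp: frontier_def interior_open)
          then have "\<zeta> \<notin> ball z s" using zs(2) by blast
          then show ?thesis using \<zeta> by simp
        qed
        have dz: "\<delta> z < \<epsilon>" using \<delta>_le[OF \<xi>, of z] z by (simp add: dist_commute)
        let ?m = "max 0 (\<bar>te u \<xi>\<bar> - \<eta>)"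
        have Wz: "ennreal ?m \<le> W (ennreal R) (ext u) z"
        proof (rule W_ge[OF _ P0(2) _ z(1)])
          fix y assume y: "y \<in> Wball z"
          then have "y \<in> \<Omega>" "dist z y < \<delta> z / 2" using near[OF z(1)] by auto
          moreover have "dist \<xi> y < d" using calculation z dz \<epsilon> dist_triangle[of \<xi> y z] by simp
          then have "\<bar>u \<xi> - u y\<bar> < \<eta>" using \<xi> calculation frontier_sub_closure closure_subset by (intro d(2)) auto
          ultimately show "?m \<le> \<bar>ext u y\<bar>" using \<xi> by (simp add: ext_eq te_def)
        qed simp_all
        have "ennreal k * ?v \<xi> \<le> emeasure M (ball z ((1 + a) * \<delta> z)) * ?v \<xi>"
        proof (rule mult_right_mono)
          have "ennreal k \<le> ennreal (\<kappa>\<^sub>2 * \<delta> z ^ n)"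
            unfolding k_def using \<kappa>\<^sub>2_pos c'_pos \<epsilon> zs sz by (intro ennreal_leI mult_left_mono power_mono) auto
          then show "ennreal k \<le> emeasure M (ball z ((1 + a) * \<delta> z))" using cone_lower[OF z(1)] by (rule order_trans)
        qed simp
        also have "\<dots> = (\<integral>\<^sup>+\<zeta>. ?v \<xi> * indicator (ball z ((1 + a) * \<delta> z)) \<zeta> \<partial>M)"
          by (subst nn_integral_cmult_indicator) (auto simp: mult.commute)
        also have "\<dots> \<le> (\<integral>\<^sup>+\<zeta>\<in>ball \<xi> S. epowr (N \<zeta>) P \<partial>M)"
        proof (rule nn_integral_mono)
          fix \<zeta>
          show "?v \<xi> * indicator (ball z ((1 + a) * \<delta> z)) \<zeta> \<le> epowr (N \<zeta>) P * indicator (ball \<xi> S) \<zeta>"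
          proof (cases "\<zeta> \<in> ball z ((1 + a) * \<delta> z)")
            case True
            then have "z \<in> nt_cone \<Omega> a \<zeta>" using z by (simp add: nt_cone_def)
            then have "W (ennreal R) (ext u) z \<le> N \<zeta>" unfolding N_def nt_max_eq by (rule SUP_upper)
            then have "ennreal ?m \<le> N \<zeta>" using Wz by (rule order_trans[rotated])
            then have "epowr (ennreal ?m) P \<le> epowr (N \<zeta>) P" by (rule epowr_mono[OF _ P0(1)])
            moreover have "(1 + a) * \<delta> z \<le> (1 + a) * \<epsilon>" using dz a_pos by (intro mult_left_mono) auto
            then have "\<zeta> \<in> ball \<xi> S" using True z dist_triangle[of \<xi> \<zeta> z] by (simp add: S_def algebra_simps)
            ultimately show ?thesis using True by (simp add: epowr_ennreal)
          qed simp
        qed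
        finally show ?thesis .
      qed
      have "ennreal k * (\<integral>\<^sup>+\<xi>. ?v \<xi> \<partial>M) = (\<integral>\<^sup>+\<xi>. ennreal k * ?v \<xi> \<partial>M)"
        by (rule nn_integral_cmult[symmetric]) measurable
      also have "\<dots> \<le> (\<integral>\<^sup>+\<xi>. \<integral>\<^sup>+\<zeta>. epowr (N \<zeta>) P * indicator (ball \<xi> S) \<zeta> \<partial>M \<partial>M)"
      proof (rule nn_integral_mono_AE)
        show "AE \<xi> in M. ennreal k * ?v \<xi> \<le> (\<integral>\<^sup>+\<zeta>\<in>ball \<xi> S. epowr (N \<zeta>) P \<partial>M)"
          using AE_frontier by eventually_elim (rule loc)
      qed
      \<comment> \<open>After the exchange each \<zeta> is counted only for \<xi> in
        \<open>ball \<zeta> S\<close>, whose measure is at most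
        \<open>C\<^sub>1 * S ^ n\<close>.\<close>
      also have "\<dots> = (\<integral>\<^sup>+\<zeta>. \<integral>\<^sup>+\<xi>. epowr (N \<zeta>) P * indicator (ball \<xi> S) \<zeta> \<partial>M \<partial>M)"
        by (rule MM.Fubini') measurable
      also have "\<dots> \<le> (\<integral>\<^sup>+\<zeta>. ennreal (C\<^sub>1 * S ^ n) * epowr (N \<zeta>) P \<partial>M)"
      proof (rule nn_integral_mono)
        fix \<zeta>
        have "(\<integral>\<^sup>+\<xi>. epowr (N \<zeta>) P * indicator (ball \<xi> S) \<zeta> \<partial>M) = (\<integral>\<^sup>+\<xi>. epowr (N \<zeta>) P * indicator (ball \<zeta> S) \<xi> \<partial>M)"
          by (intro nn_integral_cong) (auto simp: indicator_def dist_commute)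
        also have "\<dots> = epowr (N \<zeta>) P * emeasure M (ball \<zeta> S)" by (rule nn_integral_cmult_indicator) simp
        also have "\<dots> \<le> epowr (N \<zeta>) P * ennreal (C\<^sub>1 * S ^ n)" by (intro mult_left_mono growth S) simp
        finally show "(\<integral>\<^sup>+\<xi>. epowr (N \<zeta>) P * indicator (ball \<xi> S) \<zeta> \<partial>M) \<le> ennreal (C\<^sub>1 * S ^ n) * epowr (N \<zeta>) P"
          by (simp only: mult.commute)
      qed
      also have "\<dots> = ennreal (C\<^sub>1 * S ^ n) * (\<integral>\<^sup>+\<zeta>. epowr (N \<zeta>) P \<partial>M)" by (rule nn_integral_cmult) measurable
      finally have le: "ennreal k * (\<integral>\<^sup>+\<xi>. ?v \<xi> \<partial>M) \<le> ennreal (C\<^sub>1 * S ^ n) * (\<integral>\<^sup>+\<zeta>. epowr (N \<zeta>) P \<partial>M)" .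
      have kC: "ennreal k * ennreal C = ennreal (C\<^sub>1 * S ^ n)"
      proof -
        have "k * C = C\<^sub>1 * S ^ n"
          using \<kappa>\<^sub>2_pos c'_pos by (simp add: k_def C_def S_def power_mult_distrib)
        then show ?thesis using k C0 by (simp add: ennreal_mult[symmetric])
      qed
      have "ennreal k * (\<integral>\<^sup>+\<xi>. ?v \<xi> \<partial>M) \<le> ennreal k * (ennreal C * (\<integral>\<^sup>+\<zeta>. epowr (N \<zeta>) P \<partial>M))"
        using le by (simp only: kC mult.assoc[symmetric])
      then show ?thesis by (rule ennreal_mult_left_cancel_le[OF k])
    qed
    let ?g = "\<lambda>i \<xi>. ennreal (max 0 (\<bar>te u \<xi>\<bar> - 1 / real (Suc i)) powr P)"
    \<comment> \<open>The constant in \<open>step\<close> does not depend on \<eta>, so Fatou's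
      lemma removes the truncation as \<eta> tends to 0.\<close>
    have "(\<integral>\<^sup>+\<xi>. ennreal (\<bar>te u \<xi>\<bar> powr P) \<partial>M) \<le> (\<integral>\<^sup>+\<xi>. liminf (\<lambda>i. ?g i \<xi>) \<partial>M)"
    proof (rule nn_integral_mono)
      fix \<xi>
      have "(\<lambda>i. max 0 (\<bar>te u \<xi>\<bar> - 1 / real (Suc i))) \<longlonglongrightarrow> max 0 (\<bar>te u \<xi>\<bar> - 0)"
        using LIMSEQ_inverse_real_of_nat by (intro tendsto_max tendsto_const tendsto_diff) (simp add: inverse_eq_divide)
      then have "(\<lambda>i. ?g i \<xi>) \<longlonglongrightarrow> ennreal (max 0 (\<bar>te u \<xi>\<bar> - 0) powr P)"
        using P0 by (intro tendsto_ennrealI tendsto_powr' tendsto_const) auto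
      then have "liminf (\<lambda>i. ?g i \<xi>) = ennreal (\<bar>te u \<xi>\<bar> powr P)" by (intro lim_imp_Liminf) auto
      then show "ennreal (\<bar>te u \<xi>\<bar> powr P) \<le> liminf (\<lambda>i. ?g i \<xi>)" by simp
    qed
    also have "\<dots> \<le> liminf (\<lambda>i. \<integral>\<^sup>+\<xi>. ?g i \<xi> \<partial>M)" by (rule nn_integral_liminf) measurable
    also have "\<dots> \<le> limsup (\<lambda>i. \<integral>\<^sup>+\<xi>. ?g i \<xi> \<partial>M)" by (rule Liminf_le_Limsup) simp
    also have "\<dots> \<le> ennreal C * (\<integral>\<^sup>+\<zeta>. epowr (N \<zeta>) P \<partial>M)"
      by (rule Limsup_bounded) (auto intro!: always_eventually step)
    finally have "epowr (\<integral>\<^sup>+\<xi>. ennreal (\<bar>te u \<xi>\<bar> powr P) \<partial>M) (1 / P) \<le> epowr (ennreal C * (\<integral>\<^sup>+\<zeta>. epowr (N \<zeta>) P \<partial>M)) (1 / P)"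
      using P0 by (intro epowr_mono) auto
    also have "\<dots> = ennreal (C powr (1 / P)) * Nn R P (ext u)"
      using P0 C0 by (simp add: epowr_mult epowr_ennreal Lnorm_ennreal N_def)
    also have "Nn R P (ext u) = Nn R P u" by (rule Nn_cong) (rule ext_eq)
    finally show "Lp P M (te u) \<le> ennreal (C powr (1 / P)) * Nn R P u"
      using P0 by (simp add: Lnorm_ennreal epowr_ennreal)
  qed
qed

end

section \<open>The space and the traces of its elements\<close>

lemma Lnorm_pairing:
  fixes f g :: "'a \<Rightarrow> real"
  assumes PQ: "1 < P" "1 / P + 1 / Q = 1" and [measurable]: "f \<in> borel_measurable M" "g \<in> borel_measurable M"
    and f: "Lp P M f < top" and g: "Lp Q M g < top"
  shows "integrable M (\<lambda>x. f x * g x)"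
    "ennreal \<bar>\<integral>x. f x * g x \<partial>M\<bar> \<le> Lp P M f * Lp Q M g"
proof -
  have Q: "1 < Q" using conjugate_exponents[OF PQ] by simp
  have "(\<integral>\<^sup>+x. ennreal (norm (f x * g x)) \<partial>M) = (\<integral>\<^sup>+x. ennreal \<bar>f x\<bar> * ennreal \<bar>g x\<bar> \<partial>M)"
    by (simp add: abs_mult ennreal_mult)
  also have "\<dots> \<le> Lp P M f * Lp Q M g"
    by (rule Lnorm_Holder[OF PQ(1) Q PQ(2)]) auto
  finally have le: "(\<integral>\<^sup>+x. ennreal (norm (f x * g x)) \<partial>M) \<le> Lp P M f * Lp Q M g" .
  also have "\<dots> < top" using f g by (simp add: ennreal_mult_less_top)
  finally show int: "integrable M (\<lambda>x. f x * g x)" by (intro integrableI_bounded) auto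
  have "ennreal \<bar>\<integral>x. f x * g x \<partial>M\<bar> \<le> (\<integral>\<^sup>+x. ennreal (norm (f x * g x)) \<partial>M)"
    using integral_norm_bound_ennreal[OF int] by simp
  then show "ennreal \<bar>\<integral>x. f x * g x \<partial>M\<bar> \<le> Lp P M f * Lp Q M g"
    using le by (rule order_trans)
qed

lemma Lloc_add:
  assumes R: "1 \<le> R" and u: "u \<in> Lloc (ennreal R) S" and v: "v \<in> Lloc (ennreal R) S"
  shows "(\<lambda>x. u x + v x) \<in> Lloc (ennreal R) S"
  unfolding Lloc_def mem_Collect_eq
proof (intro conjI allI impI)
  have um: "u \<in> borel_measurable (lebesgue_on S)" "v \<in> borel_measurable (lebesgue_on S)" using u v by (auto simp: Lloc_def)
  then show "(\<lambda>x. u x + v x) \<in> borel_measurable (lebesgue_on S)" by measurable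
  fix K assume K: "compact K \<and> K \<subseteq> S"
  have [measurable]: "u \<in> borel_measurable (lebesgue_on K)" "v \<in> borel_measurable (lebesgue_on K)"
    using um K by (auto intro: measurable_restrict_mono)
  have "Lp R (lebesgue_on K) (\<lambda>x. u x + v x)
      \<le> Lnorm (ennreal R) (lebesgue_on K) (\<lambda>x. ennreal \<bar>u x\<bar> + ennreal \<bar>v x\<bar>)"
    using R by (intro Lnorm_mono_AE AE_I2) (auto simp: ennreal_plus[symmetric] simp del: ennreal_plus intro!: ennreal_leI)
  also have "\<dots> \<le> 4 * (Lp R (lebesgue_on K) u + Lp R (lebesgue_on K) v)"
    by (rule Lnorm_add_le[OF R]) measurable
  also have "\<dots> < top" using u v K by (auto simp: Lloc_def ennreal_mult_less_top)
  finally show "Lp R (lebesgue_on K) (\<lambda>x. u x + v x) < \<infinity>" by simp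
qed

lemma Lloc_cmult:
  assumes R: "0 < R" and u: "u \<in> Lloc (ennreal R) S"
  shows "(\<lambda>x. s * u x) \<in> Lloc (ennreal R) S"
  unfolding Lloc_def mem_Collect_eq
proof (intro conjI allI impI)
  have um: "u \<in> borel_measurable (lebesgue_on S)" using u by (auto simp: Lloc_def)
  then show "(\<lambda>x. s * u x) \<in> borel_measurable (lebesgue_on S)" by measurable
  fix K assume K: "compact K \<and> K \<subseteq> S"
  have "u \<in> borel_measurable (lebesgue_on K)" using um K by (auto intro: measurable_restrict_mono)
  then show "Lp R (lebesgue_on K) (\<lambda>x. s * u x) < \<infinity>"
    using u K by (auto simp: Lnorm_abs_cmult[OF R] Lloc_def ennreal_mult_less_top)
qed

lemma Lloc_bounded:
  assumes R: "0 < R" and u: "u \<in> borel_measurable (lebesgue_on S)" and B: "\<And>x. x \<in> S \<Longrightarrow> \<bar>u x\<bar> \<le> B"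
  shows "u \<in> Lloc (ennreal R) S"
  unfolding Lloc_def mem_Collect_eq
proof (intro conjI allI impI u)
  fix K assume K: "compact K \<and> K \<subseteq> S"
  have Kb: "K \<in> sets borel" using K by (simp add: borel_compact)
  have sp: "space (lebesgue_on K) = K" by (simp add: space_restrict_space)
  have "emeasure (lebesgue_on K) K = emeasure lborel K"
    using Kb by (subst emeasure_restrict_space) auto
  then have fin: "emeasure (lebesgue_on K) K < top" using emeasure_compact_finite[of K] K by simp
  have "Lp R (lebesgue_on K) u \<le> ennreal B * epowr (emeasure (lebesgue_on K) K) (1 / R)"
  proof (rule Lnorm_abs_bounded[OF R])
    show "K \<in> sets (lebesgue_on K)" using sets.top[of "lebesgue_on K"] sp by simp
  qed (use B K sp in auto)
  also have "\<dots> < top" using fin by (simp add: ennreal_mult_less_top)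
  finally show "Lp R (lebesgue_on K) u < \<infinity>" by simp
qed

lemma Cc_add: "u \<in> Cc S \<Longrightarrow> v \<in> Cc S \<Longrightarrow> (\<lambda>x. u x + v x :: real) \<in> Cc (S :: 'a::topological_space set)"
proof -
  assume u: "u \<in> Cc S" and v: "v \<in> Cc S"
  obtain K L where "compact K" "K \<subseteq> S" "\<forall>x\<in>S - K. u x = 0" "compact L" "L \<subseteq> S" "\<forall>x\<in>S - L. v x = 0"
    using u v by (auto simp: Cc_def)
  then have "compact (K \<union> L) \<and> K \<union> L \<subseteq> S \<and> (\<forall>x\<in>S - (K \<union> L). u x + v x = 0)" by auto
  then show ?thesis using u v unfolding Cc_def by (blast intro: continuous_on_add)
qed

lemma Cc_cmult: "u \<in> Cc S \<Longrightarrow> (\<lambda>x. s * u x :: real) \<in> Cc (S :: 'a::topological_space set)"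
proof -
  assume u: "u \<in> Cc S"
  then obtain K where "compact K" "K \<subseteq> S" "\<forall>x\<in>S - K. u x = 0" by (auto simp: Cc_def)
  then have "compact K \<and> K \<subseteq> S \<and> (\<forall>x\<in>S - K. s * u x = 0)" by auto
  then show ?thesis using u unfolding Cc_def by (blast intro: continuous_on_mult_left)
qed

locale nt_duality = nt_domain_corkscrew +
  fixes R P P' :: real and q :: ennreal
  assumes PQ: "1 < P" "1 / P + 1 / P' = 1" and q: "conj_exp R q"
begin

lemma RP: "1 \<le> R" "0 < R" "1 \<le> P" "0 < P" "1 < P'" "0 < P'"
  using q PQ conjugate_exponents[OF PQ] by (auto simp: conj_exp_def)

abbreviation "NN \<equiv> Nn R P"
abbreviation nP :: "('a \<Rightarrow> real) \<Rightarrow> ennreal" where "nP f \<equiv> Lp P M f"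
abbreviation nP' :: "('a \<Rightarrow> real) \<Rightarrow> ennreal" where "nP' f \<equiv> Lp P' M f"
abbreviation Cn :: "('a \<Rightarrow> real) \<Rightarrow> ennreal" where "Cn F \<equiv> Lnorm (ennreal P') M (carleson n \<Omega> c q F)"

section \<open>Approximating sequences and traces\<close>

definition approx :: "('a \<Rightarrow> real) \<Rightarrow> (nat \<Rightarrow> 'a \<Rightarrow> real) \<Rightarrow> bool" where
  "approx u U \<longleftrightarrow> (\<forall>k. U k \<in> CC) \<and> (\<lambda>k. NN (\<lambda>x. U k x - u x)) \<longlonglongrightarrow> 0"

definition Nsp :: "('a \<Rightarrow> real) set" where
  "Nsp = {u \<in> Lloc (ennreal R) \<Omega>. \<exists>U. approx u U}"

text \<open>\<open>istr u f\<close> says that \<open>f\<close> represents the trace of \<open>u\<close>; it does not determine \<open>f\<close> off a null set.\<close>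

definition istr :: "('a \<Rightarrow> real) \<Rightarrow> ('a \<Rightarrow> real) \<Rightarrow> bool" where
  "istr u f \<longleftrightarrow> f \<in> borel_measurable borel \<and> nP f < top \<and>
     (\<forall>U. approx u U \<longrightarrow> (\<lambda>k. nP (\<lambda>x. te (U k) x - f x)) \<longlonglongrightarrow> 0)"

lemma Nsp_meas: "u \<in> Nsp \<Longrightarrow> u \<in> L0"
  by (auto simp: Nsp_def Lloc_def)

lemma borel_M: "f \<in> borel_measurable borel \<Longrightarrow> f \<in> borel_measurable M"
  by (simp cong: measurable_cong_sets)

lemma te_diff: "te (\<lambda>x. u x - v x) = (\<lambda>x. te u x - te v x)"
  by (auto simp: te_def)

lemma te_add: "te (\<lambda>x. u x + v x) = (\<lambda>x. te u x + te v x)"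
  by (auto simp: te_def)

lemma te_cmult: "te (\<lambda>x. s * u x) = (\<lambda>x. s * te u x)"
  by (auto simp: te_def)

lemma CC_diff: "u \<in> CC \<Longrightarrow> v \<in> CC \<Longrightarrow> (\<lambda>x. u x - v x) \<in> CC"
  using Cc_add[of u _ "\<lambda>x. (-1) * v x"] Cc_cmult[of v _ "-1"] by simp

lemma NN_sub_le:
  assumes "f \<in> L0" "g \<in> L0"
  shows "NN (\<lambda>x. f x - g x) \<le> 16 * (NN f + NN g)"
proof -
  have "(\<lambda>x. (-1) * g x) \<in> L0" using assms(2) by measurable
  then have "NN (\<lambda>x. f x + (-1) * g x) \<le> 16 * (NN f + NN (\<lambda>x. (-1) * g x))"
    by (intro Nn_add_le assms RP)
  then show ?thesis using Nn_cmult[OF assms(2) RP(2,4), of "-1"] by simp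
qed

lemma nP_te_finite: "u \<in> CC \<Longrightarrow> nP (te u) < top"
proof -
  assume u: "u \<in> CC"
  obtain B \<rho> where B: "0 \<le> B" "\<And>x. \<bar>ext u x\<bar> \<le> B" "\<And>x. ext u x \<noteq> 0 \<Longrightarrow> norm x \<le> \<rho>" using CC_bounded[OF u] by metis
  have t: "te u x = 0 \<or> te u x = ext u x" for x using ext_eq(2) by (auto simp: te_def)
  have "nP (te u) \<le> ennreal B * epowr (emeasure M (cball 0 \<rho>)) (1 / P)"
  proof (rule Lnorm_abs_bounded[OF RP(4)])
    show "\<bar>te u x\<bar> \<le> B" for x using t[of x] B(1,2) by auto
    show "te u x = 0" if "x \<notin> cball 0 \<rho>" for x
    proof -
      have "ext u x = 0" using B(3)[of x] that by fastforce
      then show ?thesis using t[of x] by auto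
    qed
  qed simp
  also have "\<dots> < top" using finite_cball by (simp add: ennreal_mult_less_top)
  finally show ?thesis .
qed

lemma approx_diff:
  assumes "u \<in> L0" "approx u U" "approx u V"
  shows "(\<lambda>k. NN (\<lambda>x. U k x - V k x)) \<longlonglongrightarrow> 0"
proof -
  have "(\<lambda>k. NN (\<lambda>x. U k x - u x) + NN (\<lambda>x. V k x - u x)) \<longlonglongrightarrow> 0"
    using assms(2,3) tendsto_add[of "\<lambda>k. NN (\<lambda>x. U k x - u x)" 0 sequentially "\<lambda>k. NN (\<lambda>x. V k x - u x)" 0] by (simp add: approx_def)
  then show ?thesis
  proof (rule ennreal_tendsto_0_le)
    fix k
    have m: "(\<lambda>x. U k x - u x) \<in> L0" "(\<lambda>x. V k x - u x) \<in> L0"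
      using assms CC_lebesgue_on by (auto simp: approx_def intro!: borel_measurable_diff)
    show "NN (\<lambda>x. U k x - V k x) \<le> 16 * (NN (\<lambda>x. U k x - u x) + NN (\<lambda>x. V k x - u x))"
      using NN_sub_le[OF m] by simp
  qed simp
qed

text \<open>By \<open>trace_bound\<close> the boundary values of an approximating sequence are
  Cauchy, and completeness provides the limit. Boundary values of two sequences approximating the
  same \<open>u\<close> differ by a null sequence, so the limit serves for all of them.\<close>

lemma istr_exists:
  assumes u: "u \<in> Nsp" shows "\<exists>f. istr u f"
proof -
  obtain Ct where Ct: "0 < Ct" "\<And>u. u \<in> CC \<Longrightarrow> nP (te u) \<le> ennreal Ct * NN u"
    using trace_bound[OF RP(1,3)] by blast
  have um: "u \<in> L0" by (rule Nsp_meas[OF u])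
  obtain U where U: "approx u U" using u by (auto simp: Nsp_def)
  have UC: "U k \<in> CC" for k using U by (simp add: approx_def)
  have tm: "te (U k) \<in> borel_measurable M" for k by (rule borel_M[OF te_borel[OF UC]])
  have Um: "(\<lambda>x. U k x - u x) \<in> L0" for k
    using CC_lebesgue_on[OF UC] um by (intro borel_measurable_diff)
  have lim: "(\<lambda>k. NN (\<lambda>x. U k x - u x)) \<longlonglongrightarrow> 0" using U by (simp add: approx_def)
  have "\<exists>N. \<forall>k\<ge>N. \<forall>l\<ge>N. nP (\<lambda>x. te (U k) x - te (U l) x) \<le> ennreal e" if e: "0 < e" for e
  proof -
    \<comment> \<open>The 32 is 2 times the constant 16 of \<open>NN_sub_le\<close>, for two errors
      of equal size.\<close>
    have "0 < e / (Ct * 32)" using e Ct by simp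
    then have "\<forall>\<^sub>F k in sequentially. NN (\<lambda>x. U k x - u x) < ennreal (e / (Ct * 32))"
      using lim by (intro order_tendstoD(2)) auto
    then obtain N where N: "\<And>k. N \<le> k \<Longrightarrow> NN (\<lambda>x. U k x - u x) < ennreal (e / (Ct * 32))"
      unfolding eventually_sequentially by blast
    show ?thesis
    proof (intro exI allI impI)
      fix k l assume kl: "N \<le> k" "N \<le> l"
      have "nP (\<lambda>x. te (U k) x - te (U l) x) \<le> ennreal Ct * NN (\<lambda>x. U k x - U l x)"
        using Ct(2)[OF CC_diff[OF UC UC], of k l] by (simp add: te_diff)
      also have "NN (\<lambda>x. U k x - U l x) \<le> 16 * (NN (\<lambda>x. U k x - u x) + NN (\<lambda>x. U l x - u x))"
        using NN_sub_le[OF Um Um, of k l] by simp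
      also have "\<dots> \<le> 16 * (ennreal (e / (Ct * 32)) + ennreal (e / (Ct * 32)))"
        using N[OF kl(1)] N[OF kl(2)] by (intro mult_left_mono add_mono) auto
      also have "ennreal Ct * (16 * (ennreal (e / (Ct * 32)) + ennreal (e / (Ct * 32)))) = ennreal (Ct * (16 * (e / (Ct * 32) + e / (Ct * 32))))"
      proof -
        define d where "d = e / (Ct * 32)"
        have d: "0 \<le> d" using e Ct by (simp add: d_def)
        have "ennreal (Ct * (16 * (d + d))) = ennreal Ct * ennreal (16 * (d + d))" by (rule ennreal_mult) (use d Ct in auto)
        also have "ennreal (16 * (d + d)) = ennreal 16 * ennreal (d + d)" by (rule ennreal_mult) (use d in auto)
        also have "ennreal (d + d) = ennreal d + ennreal d" by (rule ennreal_plus) (use d in auto)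
        finally show ?thesis by (simp add: d_def)
      qed
      also have "Ct * (16 * (e / (Ct * 32) + e / (Ct * 32))) = e" using Ct by (simp add: field_simps)
      finally show "nP (\<lambda>x. te (U k) x - te (U l) x) \<le> ennreal e" by (simp add: mult_left_mono)
    qed
  qed
  from Lp_complete[OF RP(4) tm this]
  obtain f where f: "f \<in> borel_measurable M" "(\<lambda>k. nP (\<lambda>x. te (U k) x - f x)) \<longlonglongrightarrow> 0" by blast
  have fb: "f \<in> borel_measurable borel" using f(1) by (simp cong: measurable_cong_sets)
  have "istr u f"
    unfolding istr_def
  proof (intro conjI allI impI fb)
    have "\<forall>\<^sub>F k in sequentially. nP (\<lambda>x. te (U k) x - f x) < 1" using f(2) by (rule order_tendstoD) simp
    then obtain k where k: "nP (\<lambda>x. te (U k) x - f x) < 1" by (meson eventually_sequentially order_refl)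
    have "nP (\<lambda>x. f x - 0) \<le> 4 * (nP (\<lambda>x. f x - te (U k) x) + nP (\<lambda>x. te (U k) x - 0))"
      by (rule Lnorm_triangle[OF RP(3) f(1) tm]) simp
    also have "\<dots> < top" using k nP_te_finite[OF UC, of k]
      by (auto simp: ennreal_mult_less_top abs_minus_commute intro: order_less_trans)
    finally show "nP f < top" by simp
    fix V assume V: "approx u V"
    have VC: "V k \<in> CC" for k using V by (simp add: approx_def)
    have vm: "te (V k) \<in> borel_measurable M" for k by (rule borel_M[OF te_borel[OF VC]])
    have "(\<lambda>k. NN (\<lambda>x. V k x - U k x)) \<longlonglongrightarrow> 0" by (rule approx_diff[OF um V U])
    then have "(\<lambda>k. nP (\<lambda>x. te (V k) x - te (U k) x)) \<longlonglongrightarrow> 0"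
      by (rule ennreal_tendsto_0_le[where c="ennreal Ct"]) (use Ct(2)[OF CC_diff[OF VC UC]] in \<open>auto simp: te_diff\<close>)
    from tendsto_add[OF this f(2)]
    have "(\<lambda>k. nP (\<lambda>x. te (V k) x - te (U k) x) + nP (\<lambda>x. te (U k) x - f x)) \<longlonglongrightarrow> 0" by simp
    then show "(\<lambda>k. nP (\<lambda>x. te (V k) x - f x)) \<longlonglongrightarrow> 0"
      by (rule ennreal_tendsto_0_le[where c=4]) (rule Lnorm_triangle[OF RP(3) vm tm f(1)], simp)
  qed
  then show ?thesis by blast
qed

text \<open>To identify a trace it suffices to compute the limit along a single approximating
  sequence.\<close>

lemma istr_limit_unique:
  assumes "approx u U" "istr u f" "g \<in> borel_measurable borel" "(\<lambda>k. nP (\<lambda>x. te (U k) x - g x)) \<longlonglongrightarrow> 0"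
  shows "AE x in M. f x = g x"
proof (rule Lnorm_eq_0_unique[OF RP(3), of f M g "\<lambda>k. te (U k)"])
  have "U k \<in> CC" for k using assms(1) by (simp add: approx_def)
  then show "te (U k) \<in> borel_measurable M" for k by (intro borel_M te_borel)
qed (use assms in \<open>auto simp: istr_def intro: borel_M\<close>)

lemma istr_unique: "u \<in> Nsp \<Longrightarrow> istr u f \<Longrightarrow> istr u g \<Longrightarrow> AE x in M. f x = g x"
  by (auto simp: Nsp_def istr_def intro: istr_limit_unique)

lemma NN_finite: "u \<in> Nsp \<Longrightarrow> NN u < top"
proof -
  assume u: "u \<in> Nsp"
  obtain U where U: "approx u U" using u by (auto simp: Nsp_def)
  have UC: "U k \<in> CC" for k using U by (simp add: approx_def)
  have "\<forall>\<^sub>F k in sequentially. NN (\<lambda>x. U k x - u x) < 1" using U unfolding approx_def by (intro order_tendstoD(2)) auto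
  then obtain k where k: "NN (\<lambda>x. U k x - u x) < 1" by (meson eventually_sequentially order_refl)
  have "NN (\<lambda>x. U k x - (U k x - u x)) \<le> 16 * (NN (U k) + NN (\<lambda>x. U k x - u x))"
    by (intro NN_sub_le CC_lebesgue_on UC borel_measurable_diff Nsp_meas u)
  also have "\<dots> < top" using k CC_Nn_finite[OF UC RP(2,4), of k] by (auto simp: ennreal_mult_less_top intro: order_less_trans)
  finally show ?thesis by simp
qed

lemma istr_bound:
  obtains C where "0 \<le> C" "\<And>u f. u \<in> Nsp \<Longrightarrow> istr u f \<Longrightarrow> nP f \<le> ennreal C * NN u"
proof -
  obtain Ct where Ct: "0 < Ct" "\<And>u. u \<in> CC \<Longrightarrow> nP (te u) \<le> ennreal Ct * NN u"
    using trace_bound[OF RP(1,3)] by blast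
  show thesis
  proof (rule that[of "4 * (Ct * 16)"])
    fix u f assume u: "u \<in> Nsp" and f: "istr u f"
    obtain U where U: "approx u U" using u by (auto simp: Nsp_def)
    have UC: "U k \<in> CC" for k using U by (simp add: approx_def)
    have um: "u \<in> L0" by (rule Nsp_meas[OF u])
    have tm: "te (U k) \<in> borel_measurable M" for k by (rule borel_M[OF te_borel[OF UC]])
    have fm: "f \<in> borel_measurable M" using f by (auto simp: istr_def intro: borel_M)
    have l1: "(\<lambda>k. nP (\<lambda>x. te (U k) x - f x)) \<longlonglongrightarrow> 0" using f U by (simp add: istr_def)
    have l2: "(\<lambda>k. NN (\<lambda>x. U k x - u x)) \<longlonglongrightarrow> 0" using U by (simp add: approx_def)
    have "(\<lambda>k. 4 * (nP (\<lambda>x. te (U k) x - f x) + ennreal Ct * (16 * (NN (\<lambda>x. U k x - u x) + NN u)))) \<longlonglongrightarrow> 4 * (0 + ennreal Ct * (16 * (0 + NN u)))"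
      by (intro ennreal_tendsto_cmult tendsto_add l1 l2 tendsto_const) auto
    moreover have "nP f \<le> 4 * (nP (\<lambda>x. te (U k) x - f x) + ennreal Ct * (16 * (NN (\<lambda>x. U k x - u x) + NN u)))" for k
    proof -
      have "nP (\<lambda>x. f x - 0) \<le> 4 * (nP (\<lambda>x. f x - te (U k) x) + nP (\<lambda>x. te (U k) x - 0))"
        by (rule Lnorm_triangle[OF RP(3) fm tm]) simp
      also have "\<dots> = 4 * (nP (\<lambda>x. te (U k) x - f x) + nP (te (U k)))" by (simp add: abs_minus_commute)
      also have "\<dots> \<le> 4 * (nP (\<lambda>x. te (U k) x - f x) + ennreal Ct * (16 * (NN (\<lambda>x. U k x - u x) + NN u)))"
      proof (intro mult_left_mono add_left_mono order_trans[OF Ct(2)[OF UC]])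
        have "NN (\<lambda>x. (U k x - u x) + u x) \<le> 16 * (NN (\<lambda>x. U k x - u x) + NN u)"
          by (intro Nn_add_le borel_measurable_diff CC_lebesgue_on UC um RP)
        then show "NN (U k) \<le> 16 * (NN (\<lambda>x. U k x - u x) + NN u)" by simp
      qed auto
      finally show ?thesis by simp
    qed
    ultimately have le: "nP f \<le> 4 * (0 + ennreal Ct * (16 * (0 + NN u)))"
      by (intro LIMSEQ_le_const) blast+
    have "ennreal (4 * (Ct * 16)) = ennreal 4 * ennreal (Ct * 16)" by (rule ennreal_mult) (use Ct in auto)
    also have "ennreal (Ct * 16) = ennreal Ct * ennreal 16" by (rule ennreal_mult) (use Ct in auto)
    finally have eq: "ennreal (4 * (Ct * 16)) = ennreal 4 * (ennreal Ct * ennreal 16)" .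
    show "nP f \<le> ennreal (4 * (Ct * 16)) * NN u"
      using le unfolding eq add_0 ennreal_numeral by (simp only: mult.assoc)
  qed (use Ct in simp)
qed

lemma approx_add:
  assumes "u \<in> L0" "v \<in> L0" "approx u U" "approx v V"
  shows "approx (\<lambda>x. u x + v x) (\<lambda>k x. U k x + V k x)"
proof -
  have "(\<lambda>k. NN (\<lambda>x. U k x - u x) + NN (\<lambda>x. V k x - v x)) \<longlonglongrightarrow> 0"
    using assms(3,4) tendsto_add[of "\<lambda>k. NN (\<lambda>x. U k x - u x)" 0 sequentially "\<lambda>k. NN (\<lambda>x. V k x - v x)" 0] by (simp add: approx_def)
  then have "(\<lambda>k. NN (\<lambda>x. (U k x + V k x) - (u x + v x))) \<longlonglongrightarrow> 0"
  proof (rule ennreal_tendsto_0_le)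
    fix k
    have m: "(\<lambda>x. U k x - u x) \<in> L0" "(\<lambda>x. V k x - v x) \<in> L0"
      using assms CC_lebesgue_on by (auto simp: approx_def intro!: borel_measurable_diff)
    have "NN (\<lambda>x. (U k x - u x) + (V k x - v x)) \<le> 16 * (NN (\<lambda>x. U k x - u x) + NN (\<lambda>x. V k x - v x))"
      by (rule Nn_add_le[OF m RP(1,3)])
    moreover have "(\<lambda>x. (U k x - u x) + (V k x - v x)) = (\<lambda>x. (U k x + V k x) - (u x + v x))" by auto
    ultimately show "NN (\<lambda>x. (U k x + V k x) - (u x + v x)) \<le> 16 * (NN (\<lambda>x. U k x - u x) + NN (\<lambda>x. V k x - v x))" by simp
  qed simp
  then show ?thesis using assms by (auto simp: approx_def intro: Cc_add)
qed

lemma approx_cmult: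
  assumes "u \<in> L0" "approx u U"
  shows "approx (\<lambda>x. s * u x) (\<lambda>k x. s * U k x)"
proof -
  have "(\<lambda>k. NN (\<lambda>x. U k x - u x)) \<longlonglongrightarrow> 0" using assms by (simp add: approx_def)
  then have "(\<lambda>k. NN (\<lambda>x. s * U k x - s * u x)) \<longlonglongrightarrow> 0"
  proof (rule ennreal_tendsto_0_le)
    fix k
    have m: "(\<lambda>x. U k x - u x) \<in> L0"
      using assms CC_lebesgue_on by (auto simp: approx_def intro!: borel_measurable_diff)
    show "NN (\<lambda>x. s * U k x - s * u x) \<le> ennreal \<bar>s\<bar> * NN (\<lambda>x. U k x - u x)"
      using Nn_cmult[OF m RP(2,4), of s] by (simp add: right_diff_distrib)
  qed simp
  then show ?thesis using assms by (auto simp: approx_def intro: Cc_cmult)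
qed

lemma Nsp_add: "u \<in> Nsp \<Longrightarrow> v \<in> Nsp \<Longrightarrow> (\<lambda>x. u x + v x) \<in> Nsp"
  using approx_add[OF Nsp_meas Nsp_meas] Lloc_add[OF RP(1)] unfolding Nsp_def by blast

lemma Nsp_cmult: "u \<in> Nsp \<Longrightarrow> (\<lambda>x. s * u x) \<in> Nsp"
  using approx_cmult[OF Nsp_meas] Lloc_cmult[OF RP(2)] unfolding Nsp_def by blast

lemma istr_add:
  assumes u: "u \<in> Nsp" and v: "v \<in> Nsp" and f: "istr u f" and g: "istr v g" and h: "istr (\<lambda>x. u x + v x) h"
  shows "AE x in M. h x = f x + g x"
proof -
  obtain U V where U: "approx u U" and V: "approx v V" using u v by (auto simp: Nsp_def)
  have fg[measurable]: "f \<in> borel_measurable borel" "g \<in> borel_measurable borel" using f g by (auto simp: istr_def)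
  have UC: "U k \<in> CC" "V k \<in> CC" for k using U V by (auto simp: approx_def)
  note [measurable] = te_borel[OF UC(1)] te_borel[OF UC(2)]
  have "(\<lambda>k. nP (\<lambda>x. te (U k) x - f x) + nP (\<lambda>x. te (V k) x - g x)) \<longlonglongrightarrow> 0"
    using f g U V tendsto_add[of "\<lambda>k. nP (\<lambda>x. te (U k) x - f x)" 0 sequentially "\<lambda>k. nP (\<lambda>x. te (V k) x - g x)" 0] by (simp add: istr_def)
  then have "(\<lambda>k. nP (\<lambda>x. te (\<lambda>x. U k x + V k x) x - (f x + g x))) \<longlonglongrightarrow> 0"
  proof (rule ennreal_tendsto_0_le)
    fix k
    have "nP (\<lambda>x. (te (U k) x + te (V k) x) - (f x + g x))
        \<le> 4 * (nP (\<lambda>x. (te (U k) x + te (V k) x) - (f x + te (V k) x)) + nP (\<lambda>x. (f x + te (V k) x) - (f x + g x)))"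
      by (rule Lnorm_triangle[OF RP(3)]) measurable
    then show "nP (\<lambda>x. te (\<lambda>x. U k x + V k x) x - (f x + g x)) \<le> 4 * (nP (\<lambda>x. te (U k) x - f x) + nP (\<lambda>x. te (V k) x - g x))"
      by (simp add: te_add)
  qed simp
  then show ?thesis
    by (intro istr_limit_unique[OF approx_add[OF Nsp_meas[OF u] Nsp_meas[OF v] U V] h]) auto
qed

lemma istr_cmult:
  assumes u: "u \<in> Nsp" and f: "istr u f" and h: "istr (\<lambda>x. s * u x) h"
  shows "AE x in M. h x = s * f x"
proof -
  obtain U where U: "approx u U" using u by (auto simp: Nsp_def)
  have fg[measurable]: "f \<in> borel_measurable borel" using f by (auto simp: istr_def)
  have UC: "U k \<in> CC" for k using U by (auto simp: approx_def)
  note [measurable] = te_borel[OF UC]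
  have "(\<lambda>k. nP (\<lambda>x. te (U k) x - f x)) \<longlonglongrightarrow> 0" using f U by (simp add: istr_def)
  then have "(\<lambda>k. nP (\<lambda>x. te (\<lambda>x. s * U k x) x - s * f x)) \<longlonglongrightarrow> 0"
  proof (rule ennreal_tendsto_0_le)
    fix k
    have m: "(\<lambda>x. te (U k) x - f x) \<in> borel_measurable M" by measurable
    show "nP (\<lambda>x. te (\<lambda>x. s * U k x) x - s * f x) \<le> ennreal \<bar>s\<bar> * nP (\<lambda>x. te (U k) x - f x)"
      using Lnorm_abs_cmult[OF RP(4) m, of s] by (simp add: te_cmult right_diff_distrib)
  qed simp
  then show ?thesis
    by (intro istr_limit_unique[OF approx_cmult[OF Nsp_meas[OF u] U] h]) auto
qed

lemma CC_Nsp: "u \<in> CC \<Longrightarrow> u \<in> Nsp" "u \<in> CC \<Longrightarrow> approx u (\<lambda>_. u)"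
proof -
  assume u: "u \<in> CC"
  have "NN (\<lambda>x. u x - u x) = 0" using Nn_cmult[OF CC_lebesgue_on[OF u] RP(2,4), of 0] by simp
  then show a: "approx u (\<lambda>_. u)" using u by (simp add: approx_def)
  obtain B \<rho> where B: "\<And>x. \<bar>ext u x\<bar> \<le> B" using CC_bounded[OF u] by metis
  have "\<bar>u x\<bar> \<le> B" if "x \<in> \<Omega>" for x using B[of x] ext_eq(1)[OF that] by simp
  then have "u \<in> Lloc (ennreal R) \<Omega>" by (intro Lloc_bounded[OF RP(2) CC_lebesgue_on[OF u]])
  then show "u \<in> Nsp" using a by (auto simp: Nsp_def)
qed

lemma istr_CC: "u \<in> CC \<Longrightarrow> istr u f \<Longrightarrow> AE x in M. f x = te u x"
  by (rule istr_limit_unique[OF CC_Nsp(2)]) (auto simp: te_borel Lnorm_ennreal RP)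

section \<open>Bounded functions of compact support as elements of the space\<close>

lemma cutoff:
  obtains \<theta> :: "'a \<Rightarrow> real" where "continuous_on UNIV \<theta>" "\<And>x. 0 \<le> \<theta> x" "\<And>x. \<theta> x \<le> 1"
    "\<And>x. x \<in> KK j \<Longrightarrow> \<theta> x = 1" "\<And>x. x \<notin> KK (Suc j) \<Longrightarrow> \<theta> x = 0"
proof -
  let ?V = "\<Omega> \<inter> (ball 0 (real (Suc j)) \<inter> \<delta> -` {1 / real (Suc (Suc j))<..})"
  have "open (\<delta> -` {1 / real (Suc (Suc j))<..})"
    using continuous_on_\<delta>[of UNIV] by (simp add: continuous_on_open_vimage)
  then have V: "open ?V" using open_Om by auto
  have lt: "1 / real (Suc (Suc j)) < 1 / real (Suc j)" by (simp add: frac_less2)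
  have KV: "KK j \<subseteq> ?V" using lt by (auto simp: KK_def)
  have VK: "?V \<subseteq> KK (Suc j)" by (auto simp: KK_def)
  obtain \<theta> :: "'a \<Rightarrow> real" where \<theta>: "continuous_on UNIV \<theta>" "\<And>x. \<theta> x \<in> closed_segment 1 0"
    "\<And>x. x \<in> KK j \<Longrightarrow> \<theta> x = 1" "\<And>x. x \<in> - ?V \<Longrightarrow> \<theta> x = 0"
  proof (rule Urysohn[of "KK j" "- ?V" 1 0])
    show "closed (KK j)" by (rule compact_imp_closed[OF compact_KK])
    show "closed (- ?V)" using V by (rule closed_Compl)
    show "KK j \<inter> - ?V = {}" using KV by blast
  qed blast
  show thesis
  proof (rule that[OF \<theta>(1)])
    show "0 \<le> \<theta> x" "\<theta> x \<le> 1" for x using \<theta>(2)[of x] by (auto simp: closed_segment_eq_real_ivl)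
    show "\<theta> x = 0" if "x \<notin> KK (Suc j)" for x using \<theta>(4) VK that by blast
  qed (rule \<theta>(3))
qed

text \<open>Continuous functions approximating \<open>u\<close> in L^R are multiplied by a cutoff
  that is 1 on \<open>KK j\<close> and vanishes off \<open>KK (Suc j)\<close>. For functions
  supported there, \<open>Nn_le_Lnorm\<close> turns convergence in L^R into convergence in the norm
  of the space. The approximants vanish on the frontier, so the trace of \<open>u\<close> is
  0.\<close>

lemma test_funs_approx:
  assumes u: "u \<in> test_funs"
  obtains U where "approx u U" "\<And>k x. x \<in> frontier \<Omega> \<Longrightarrow> U k x = 0"
proof -
  interpret LL: locally_finite_borel lborel
    by unfold_locales (auto simp: emeasure_lborel_ball_finite[unfolded infinity_ennreal_def])
  obtain B j where B: "\<And>x. \<bar>u x\<bar> \<le> B" and j: "\<And>x. x \<notin> KK j \<Longrightarrow> u x = 0"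
    using u by (rule bounded_suppE) blast
  have um[measurable]: "u \<in> borel_measurable borel" by (rule test_funs_borel[OF u])
  obtain C where C: "\<And>v. v \<in> test_funs \<Longrightarrow> (\<forall>x. x \<notin> KK (Suc j) \<longrightarrow> v x = 0) \<Longrightarrow>
      NN v \<le> ennreal C * Lp R lborel v"
    using Nn_le_Lnorm[OF RP(2,4), of "Suc j"] by blast
  obtain \<theta> :: "'a \<Rightarrow> real" where \<theta>: "continuous_on UNIV \<theta>" "\<And>x. 0 \<le> \<theta> x" "\<And>x. \<theta> x \<le> 1"
    "\<And>x. x \<in> KK j \<Longrightarrow> \<theta> x = 1" "\<And>x. x \<notin> KK (Suc j) \<Longrightarrow> \<theta> x = 0"
    using cutoff[of j] by metis
  have ub: "u \<in> bounded_supp lborel LL.balls"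
  proof (rule bounded_suppI[of _ _ B _ "Suc j"])
    show "u x = 0" if "x \<notin> LL.balls (Suc j)" for x using that j[of x] by (auto simp: KK_def)
  qed (use B in auto)
  have "\<exists>\<phi>\<in>cont_supp. Lp R lborel (\<lambda>x. \<phi> x - u x) \<le> ennreal (1 / real (Suc k))" for k
    by (rule LL.cont_supp_dense[OF ub RP(1)]) simp
  then obtain \<phi> where \<phi>: "\<And>k. \<phi> k \<in> cont_supp"
    "\<And>k. Lp R lborel (\<lambda>x. \<phi> k x - u x) \<le> ennreal (1 / real (Suc k))" by metis
  define U where "U k x = \<theta> x * \<phi> k x" for k x
  have Uc: "continuous_on UNIV (U k)" for k
    unfolding U_def using \<theta>(1) \<phi>(1)[of k] by (auto simp: cont_supp_def intro!: continuous_intros)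
  have U0: "U k x = 0" if "x \<notin> KK (Suc j)" for k x using \<theta>(5)[OF that] by (simp add: U_def)
  have UC: "U k \<in> CC" for k
  proof -
    have "KK (Suc j) \<subseteq> closure \<Omega>" using KK_sub closure_subset by blast
    moreover have "continuous_on (closure \<Omega>) (U k)" by (rule continuous_on_subset[OF Uc]) simp
    moreover have "\<forall>x\<in>closure \<Omega> - KK (Suc j). U k x = 0" using U0 by simp
    ultimately show ?thesis unfolding Cc_def mem_Collect_eq using compact_KK[of "Suc j"] by blast
  qed
  have [measurable]: "U k \<in> borel_measurable borel" for k by (rule borel_measurable_continuous_onI[OF Uc])
  have vt: "(\<lambda>x. U k x - u x) \<in> test_funs" for k
  proof -
    have "bounded (U k ` KK (Suc j))"
      by (intro compact_imp_bounded compact_continuous_image continuous_on_subset[OF Uc] compact_KK) auto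
    then obtain B' where B': "\<forall>y\<in>U k ` KK (Suc j). norm y \<le> B'" unfolding bounded_iff by blast
    have Kjj: "KK j \<subseteq> KK (Suc j)" using incseq_KK by (simp add: incseq_SucD)
    show ?thesis
    proof (rule bounded_suppI[of _ _ "\<bar>B'\<bar> + B" _ "Suc j"])
      fix x
      have "\<bar>U k x\<bar> \<le> \<bar>B'\<bar>" using B' U0[of x k] by (cases "x \<in> KK (Suc j)") force+
      then show "\<bar>U k x - u x\<bar> \<le> \<bar>B'\<bar> + B" using B[of x] by linarith
      show "U k x - u x = 0" if "x \<notin> KK (Suc j)" using that U0 j Kjj by fastforce
    qed simp
  qed
  have "(\<lambda>k. NN (\<lambda>x. U k x - u x)) \<longlonglongrightarrow> 0"
  proof (rule ennreal_tendsto_0_le[where c="ennreal C" and f="\<lambda>k. ennreal (1 / real (Suc k))"])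
    show "(\<lambda>k. ennreal (1 / real (Suc k))) \<longlonglongrightarrow> 0" by (rule tendsto_ennreal_inverse_Suc)
    fix k
    have "NN (\<lambda>x. U k x - u x) \<le> ennreal C * Lp R lborel (\<lambda>x. U k x - u x)"
    proof (rule C[OF vt])
      have Kjj: "KK j \<subseteq> KK (Suc j)" using incseq_KK by (simp add: incseq_SucD)
      show "\<forall>x. x \<notin> KK (Suc j) \<longrightarrow> U k x - u x = 0" using U0 j Kjj by fastforce
    qed
    also have "Lp R lborel (\<lambda>x. U k x - u x) \<le> Lp R lborel (\<lambda>x. \<phi> k x - u x)"
    proof (intro Lnorm_mono_AE RP AE_I2 ennreal_leI)
      fix x
      have "u x = \<theta> x * u x" using \<theta>(4)[of x] j[of x] by (cases "x \<in> KK j") auto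
      then have "U k x - u x = \<theta> x * (\<phi> k x - u x)" by (simp add: U_def right_diff_distrib)
      also have "\<bar>\<dots>\<bar> \<le> \<bar>\<phi> k x - u x\<bar>" using \<theta>(2,3)[of x] by (simp add: abs_mult mult_left_le_one_le)
      finally show "\<bar>U k x - u x\<bar> \<le> \<bar>\<phi> k x - u x\<bar>" .
    qed
    also have "\<dots> \<le> ennreal (1 / real (Suc k))" by (rule \<phi>(2))
    finally show "NN (\<lambda>x. U k x - u x) \<le> ennreal C * ennreal (1 / real (Suc k))" by (simp add: mult_left_mono)
  qed simp
  then have "approx u U" using UC by (simp add: approx_def)
  moreover have "U k x = 0" if "x \<in> frontier \<Omega>" for k x
    using U0[of x k] KK_sub[of "Suc j"] that open_Om by (auto simp: frontier_def interior_open)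
  ultimately show thesis by (rule that)
qed

lemma test_funs_Nsp: "u \<in> test_funs \<Longrightarrow> u \<in> Nsp"
proof -
  assume u: "u \<in> test_funs"
  obtain U where "approx u U" using test_funs_approx[OF u] by metis
  moreover obtain B j where B: "\<And>x. \<bar>u x\<bar> \<le> B" using u by (rule bounded_suppE) blast
  have "u \<in> Lloc (ennreal R) \<Omega>"
    by (rule Lloc_bounded[OF RP(2) borel_lebesgue_on[OF test_funs_borel[OF u]] B])
  ultimately show ?thesis by (auto simp: Nsp_def)
qed

lemma istr_test_funs: "u \<in> test_funs \<Longrightarrow> istr u f \<Longrightarrow> AE x in M. f x = 0"
proof -
  assume u: "u \<in> test_funs" and f: "istr u f"
  obtain U where U: "approx u U" "\<And>k x. x \<in> frontier \<Omega> \<Longrightarrow> U k x = 0" using test_funs_approx[OF u] by metis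
  have "te (U k) = (\<lambda>x. 0)" for k using U(2) by (auto simp: te_def)
  then show ?thesis by (intro istr_limit_unique[OF U(1) f]) (auto simp: Lnorm_ennreal RP)
qed

end

section \<open>Representation of functionals\<close>

text \<open>The natural test function, the sign of \<open>e\<close> on a ball, is only a limit in
  L^P of admissible continuous functions; Hoelder's inequality carries the vanishing of the integral
  to the limit.\<close>

lemma (in locally_finite_borel) cont_supp_separates:
  assumes PQ: "1 < P" "1 / P + 1 / Q = 1" and e[measurable]: "e \<in> borel_measurable borel"
    and fin: "Lp Q M e < top"
    and zero: "\<And>\<phi>. \<phi> \<in> cont_supp \<Longrightarrow> (\<integral>x. \<phi> x * e x \<partial>M) = 0"
  shows "AE x in M. e x = 0"
proof -
  have P: "1 \<le> P" "0 < P" using PQ by auto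
  have em: "e \<in> borel_measurable M" by measurable
  have v_zero: "integrable M (\<lambda>x. \<bar>e x\<bar> * indicator (balls j) x)" "(\<integral>x. \<bar>e x\<bar> * indicator (balls j) x \<partial>M) = 0" for j
  proof -
    define v where "v x = sgn (e x) * indicator (balls j) x" for x
    have vm[measurable]: "v \<in> borel_measurable borel" unfolding v_def by measurable
    have vM: "v \<in> borel_measurable M" by measurable
    have vb: "v \<in> bounded_supp M balls"
      by (rule bounded_suppI[of _ _ 1 _ j]) (auto simp: v_def indicator_def sgn_if)
    have v0: "Lp P M v < top"
    proof -
      have "Lp P M v \<le> ennreal 1 * epowr (emeasure M (balls j)) (1 / P)"
        by (rule Lnorm_abs_bounded[OF P(2)]) (auto simp: v_def indicator_def sgn_if)
      also have "\<dots> < top" using finite_ball by (simp add: ennreal_mult_less_top)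
      finally show ?thesis .
    qed
    note vi = Lnorm_pairing(1)[OF PQ vM em v0 fin]
    have "\<forall>k. \<exists>\<phi>\<in>cont_supp. Lp P M (\<lambda>x. \<phi> x - v x) \<le> ennreal (1 / real (Suc k))"
      by (intro allI cont_supp_dense[OF vb P(1)]) simp
    then obtain \<phi> where \<phi>: "\<And>k. \<phi> k \<in> cont_supp"
      "\<And>k. Lp P M (\<lambda>x. \<phi> k x - v x) \<le> ennreal (1 / real (Suc k))" by metis
    have "(\<lambda>k. ennreal \<bar>0 - (\<integral>x. v x * e x \<partial>M)\<bar>) \<longlonglongrightarrow> 0"
    proof (rule ennreal_tendsto_0_le[where f="\<lambda>k. ennreal (1 / real (Suc k))"])
      show "(\<lambda>k. ennreal (1 / real (Suc k))) \<longlonglongrightarrow> 0" by (rule tendsto_ennreal_inverse_Suc)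
      fix k
      have [measurable]: "\<phi> k \<in> borel_measurable borel" using cont_supp_measurable[OF \<phi>(1)] by (simp cong: measurable_cong_sets)
      have dm: "(\<lambda>x. \<phi> k x - v x) \<in> borel_measurable M" by measurable
      have d0: "Lp P M (\<lambda>x. \<phi> k x - v x) < top" using \<phi>(2)[of k] by (auto intro: le_less_trans)
      have di: "integrable M (\<lambda>x. (\<phi> k x - v x) * e x)" by (rule Lnorm_pairing(1)[OF PQ dm em d0 fin])
      have "(\<integral>x. \<phi> k x * e x \<partial>M) = (\<integral>x. (\<phi> k x - v x) * e x + v x * e x \<partial>M)" by (simp add: algebra_simps)
      also have "\<dots> = (\<integral>x. (\<phi> k x - v x) * e x \<partial>M) + (\<integral>x. v x * e x \<partial>M)" by (rule Bochner_Integration.integral_add[OF di vi])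
      finally have "0 - (\<integral>x. v x * e x \<partial>M) = (\<integral>x. (\<phi> k x - v x) * e x \<partial>M)" using zero[OF \<phi>(1)[of k]] by simp
      then have "ennreal \<bar>0 - (\<integral>x. v x * e x \<partial>M)\<bar> \<le> Lp P M (\<lambda>x. \<phi> k x - v x) * Lp Q M e"
        using Lnorm_pairing(2)[OF PQ dm em d0 fin] by simp
      also have "\<dots> \<le> ennreal (1 / real (Suc k)) * Lp Q M e" by (rule mult_right_mono[OF \<phi>(2)]) simp
      finally show "ennreal \<bar>0 - (\<integral>x. v x * e x \<partial>M)\<bar> \<le> Lp Q M e * ennreal (1 / real (Suc k))"
        by (simp only: mult.commute)
    qed (rule fin)
    then have "(\<integral>x. v x * e x \<partial>M) = 0" using LIMSEQ_unique[OF _ tendsto_const] by fastforce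
    moreover have "v x * e x = \<bar>e x\<bar> * indicator (balls j) x" for x by (simp add: v_def abs_sgn mult_ac)
    ultimately show "integrable M (\<lambda>x. \<bar>e x\<bar> * indicator (balls j) x)" "(\<integral>x. \<bar>e x\<bar> * indicator (balls j) x \<partial>M) = 0" using vi by simp_all
  qed
  have "AE x in M. \<forall>j. \<bar>e x\<bar> * indicator (balls j) x = 0"
    unfolding AE_all_countable
  proof
    fix j show "AE x in M. \<bar>e x\<bar> * indicator (balls j) x = 0"
      using integral_nonneg_eq_0_iff_AE[OF v_zero(1)[of j]] v_zero(2)[of j] by simp
  qed
  then show ?thesis
  proof eventually_elim
    case (elim x)
    obtain j where "norm x < real j" using reals_Archimedean2 by blast
    then show ?case using elim[rule_format, of j] by simp
  qed
qed

context nt_duality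
begin

section \<open>The pairing over the domain\<close>

abbreviation om :: "('a \<Rightarrow> real) \<Rightarrow> ('a \<Rightarrow> real) \<Rightarrow> real" where
  "om u F \<equiv> (LINT x:\<Omega>|lebesgue. u x * F x)"

lemma Om_lebesgue: "\<Omega> \<inter> space lebesgue \<in> sets lebesgue"
  using borel_\<Omega> by simp

lemma pairing_bound:
  obtains Kc where "0 < Kc"
    "\<And>u F. u \<in> L0 \<Longrightarrow> F \<in> L0 \<Longrightarrow>
      (\<integral>\<^sup>+x\<in>\<Omega>. ennreal \<bar>u x * F x\<bar> \<partial>lborel) \<le> ennreal Kc * (NN u * Cn F)"
proof -
  obtain K where K: "0 < K" "\<And>R q u F. conj_exp R q \<Longrightarrow> u \<in> L0 \<Longrightarrow> F \<in> L0 \<Longrightarrow>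
      (\<integral>\<^sup>+x\<in>\<Omega>. ennreal \<bar>u x * F x\<bar> \<partial>lborel) \<le> ennreal K * (\<integral>\<^sup>+\<xi>. nt_max \<Omega> a c (ennreal R) u \<xi> * carleson n \<Omega> c q F \<xi> \<partial>M)"
    using carleson_duality_bound by blast
  show thesis
  proof (rule that[OF K(1)])
    fix u F :: "'a \<Rightarrow> real" assume u: "u \<in> L0" and F: "F \<in> L0"
    have [measurable]: "carleson n \<Omega> c q F \<in> borel_measurable borel" by (rule borel_measurable_carleson[OF F q])
    have "(\<integral>\<^sup>+\<xi>. nt_max \<Omega> a c (ennreal R) u \<xi> * carleson n \<Omega> c q F \<xi> \<partial>M) \<le> NN u * Cn F"
      by (rule Lnorm_Holder[OF PQ(1) RP(5) PQ(2)]) measurable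
    then show "(\<integral>\<^sup>+x\<in>\<Omega>. ennreal \<bar>u x * F x\<bar> \<partial>lborel) \<le> ennreal K * (NN u * Cn F)"
      using K(2)[OF q u F] mult_left_mono[of _ "NN u * Cn F" "ennreal K"] by (meson order_trans zero_le)
  qed
qed

lemma om_integrable:
  assumes u: "u \<in> L0" and F: "F \<in> L0"
    and fin: "NN u < top" "Cn F < top"
  shows "set_integrable lebesgue \<Omega> (\<lambda>x. u x * F x)"
proof -
  obtain Kc where Kc: "0 < Kc" "\<And>u F. u \<in> L0 \<Longrightarrow> F \<in> L0 \<Longrightarrow>
      (\<integral>\<^sup>+x\<in>\<Omega>. ennreal \<bar>u x * F x\<bar> \<partial>lborel) \<le> ennreal Kc * (NN u * Cn F)"
    using pairing_bound by blast
  have "integrable (lebesgue_on \<Omega>) (\<lambda>x. u x * F x)"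
  proof (rule integrableI_bounded)
    show "(\<lambda>x. u x * F x) \<in> L0" using u F by measurable
    have "(\<integral>\<^sup>+x. ennreal (norm (u x * F x)) \<partial>lebesgue_on \<Omega>) = (\<integral>\<^sup>+x\<in>\<Omega>. ennreal \<bar>u x * F x\<bar> \<partial>lborel)"
      by (simp add: nn_integral_restrict_space[OF Om_lebesgue] nn_integral_completion)
    also have "\<dots> < top" using fin by (intro le_less_trans[OF Kc(2)[OF u F]]) (simp add: ennreal_mult_less_top)
    finally show "(\<integral>\<^sup>+x. ennreal (norm (u x * F x)) \<partial>lebesgue_on \<Omega>) < \<infinity>" by simp
  qed
  then show ?thesis using integrable_restrict_space[OF Om_lebesgue, of "\<lambda>x. u x * F x"] by (simp add: set_integrable_def)
qed

lemma om_bound: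
  obtains Kc where "0 < Kc"
    "\<And>u F. u \<in> L0 \<Longrightarrow> F \<in> L0 \<Longrightarrow> NN u < top \<Longrightarrow> Cn F < top \<Longrightarrow>
      ennreal \<bar>om u F\<bar> \<le> ennreal Kc * (NN u * Cn F)"
proof -
  obtain Kc where Kc: "0 < Kc" "\<And>u F. u \<in> L0 \<Longrightarrow> F \<in> L0 \<Longrightarrow>
      (\<integral>\<^sup>+x\<in>\<Omega>. ennreal \<bar>u x * F x\<bar> \<partial>lborel) \<le> ennreal Kc * (NN u * Cn F)"
    using pairing_bound by blast
  show thesis
  proof (rule that[OF Kc(1)])
    fix u F :: "'a \<Rightarrow> real" assume u: "u \<in> L0" and F: "F \<in> L0"
      and fin: "NN u < top" "Cn F < top"
    have "ennreal \<bar>om u F\<bar> \<le> (\<integral>\<^sup>+x. ennreal (norm (indicator \<Omega> x *\<^sub>R (u x * F x))) \<partial>lebesgue)"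
      using integral_norm_bound_ennreal[OF om_integrable[OF u F fin, unfolded set_integrable_def]]
      by (simp add: set_lebesgue_integral_def)
    also have "\<dots> = (\<integral>\<^sup>+x\<in>\<Omega>. ennreal \<bar>u x * F x\<bar> \<partial>lborel)"
      unfolding nn_integral_completion by (intro nn_integral_cong) (auto simp: indicator_def)
    also have "\<dots> \<le> ennreal Kc * (NN u * Cn F)" by (rule Kc(2)[OF u F])
    finally show "ennreal \<bar>om u F\<bar> \<le> ennreal Kc * (NN u * Cn F)" .
  qed
qed

lemma om_lborel:
  assumes [measurable]: "u \<in> borel_measurable borel" "F \<in> borel_measurable borel" and "\<And>x. x \<notin> \<Omega> \<Longrightarrow> u x = 0"
  shows "om u F = (\<integral>x. u x * F x \<partial>lborel)"
proof -
  have "om u F = (\<integral>x. u x * F x \<partial>lebesgue)"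
    unfolding set_lebesgue_integral_def using assms(3) by (intro Bochner_Integration.integral_cong) (auto simp: indicator_def)
  also have "\<dots> = (\<integral>x. u x * F x \<partial>lborel)" by (rule integral_completion) measurable
  finally show ?thesis .
qed

lemma test_funs_outside: "u \<in> test_funs \<Longrightarrow> x \<notin> \<Omega> \<Longrightarrow> u x = 0"
proof -
  assume u: "u \<in> test_funs" and x: "x \<notin> \<Omega>"
  obtain B j where "\<And>x. x \<notin> KK j \<Longrightarrow> u x = 0" using u by (rule bounded_suppE) blast
  then show ?thesis using x KK_sub by blast
qed

lemma cont_supp_CC: "h \<in> cont_supp \<Longrightarrow> h \<in> CC"
proof -
  assume "h \<in> cont_supp"
  then obtain r where r: "continuous_on UNIV h" "\<And>x. r \<le> norm x \<Longrightarrow> h x = 0" by (auto simp: cont_supp_def)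
  have "compact (cball 0 r \<inter> closure \<Omega>)" by (intro compact_Int_closed) auto
  moreover have "\<forall>x\<in>closure \<Omega> - (cball 0 r \<inter> closure \<Omega>). h x = 0"
    by (intro ballI r(2)) auto
  moreover have "continuous_on (closure \<Omega>) h" using r(1) by (rule continuous_on_subset) simp
  ultimately show ?thesis unfolding Cc_def by blast
qed

lemma AE_te: "AE x in M. te u x = u x"
  using AE_frontier by eventually_elim (simp add: te_def)

lemma te_bounded_supp: "u \<in> CC \<Longrightarrow> te u \<in> bounded_supp M balls"
proof -
  assume u: "u \<in> CC"
  obtain B \<rho> where B: "0 \<le> B" "\<And>x. \<bar>ext u x\<bar> \<le> B" "\<And>x. ext u x \<noteq> 0 \<Longrightarrow> norm x \<le> \<rho>" using CC_bounded[OF u] by metis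
  have t: "te u x = 0 \<or> te u x = ext u x" for x using ext_eq(2) by (auto simp: te_def)
  obtain j where j: "\<rho> < real j" using reals_Archimedean2 by blast
  show ?thesis
  proof (rule bounded_suppI[of _ _ B _ j])
    show "te u \<in> borel_measurable M" by (intro borel_M te_borel u)
    show "\<bar>te u x\<bar> \<le> B" for x using t[of x] B(1,2) by auto
    show "te u x = 0" if "x \<notin> balls j" for x
    proof -
      have "ext u x = 0" using B(3)[of x] that j by fastforce
      then show ?thesis using t[of x] by auto
    qed
  qed
qed

lemma vanishing_bound:
  assumes S_add: "\<And>u v. u \<in> Nsp \<Longrightarrow> v \<in> Nsp \<Longrightarrow> S (\<lambda>x. u x + v x) = S u + S v"
    and S_mult: "\<And>s u. u \<in> Nsp \<Longrightarrow> S (\<lambda>x. s * u x) = s * (S u :: real)"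
    and bd: "\<And>u. u \<in> Nsp \<Longrightarrow> ennreal \<bar>S u\<bar> \<le> ennreal K * NN u"
    and zero: "\<And>u. u \<in> test_funs \<Longrightarrow> S u = 0" and u: "u \<in> CC"
  shows "ennreal \<bar>S u\<bar> \<le> ennreal K * (4 * nP (te u))"
proof -
  have main: "ennreal \<bar>S u\<bar> \<le> ennreal K * (4 * nP (te u) + ennreal \<eta>)" if \<eta>: "0 < \<eta>" for \<eta>
  proof -
    obtain e where e: "0 < e" "NN (\<lambda>x. if \<delta> x < e then u x else 0) \<le> 4 * nP (te u) + ennreal \<eta>"
      using near_boundary_bound[OF u RP(2,3) \<eta>] by metis
    obtain B \<rho> where B: "0 \<le> B" "\<And>x. \<bar>ext u x\<bar> \<le> B" "\<And>x. ext u x \<noteq> 0 \<Longrightarrow> norm x \<le> \<rho>" using CC_bounded[OF u] by metis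
    \<comment> \<open>The part of \<open>u\<close> at distance at least \<open>e\<close> from the
      boundary is bounded and supported in \<open>KK j\<close>, since \<open>1 / e < real j\<close>
      gives \<open>1 / real (Suc j) \<le> e\<close>; so \<open>S\<close> does not see it.\<close>
    define w where "w x = (if x \<in> \<Omega> \<and> e \<le> \<delta> x then ext u x else 0)" for x
    obtain j where j: "max \<rho> (1 / e) < real j" using reals_Archimedean2 by blast
    have [measurable]: "ext u \<in> borel_measurable borel" by (rule CC_borel[OF u])
    have [measurable]: "\<delta> \<in> borel_measurable borel" using continuous_on_\<delta> by (rule borel_measurable_continuous_onI)
    have w: "w \<in> test_funs"
    proof (rule bounded_suppI[of _ _ B _ j])
      show "w \<in> borel_measurable lborel" unfolding w_def using borel_\<Omega> by measurable
      show "\<bar>w x\<bar> \<le> B" for x using B(1,2) by (auto simp: w_def)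
      show "w x = 0" if "x \<notin> KK j" for x
      proof (rule ccontr)
        assume "w x \<noteq> 0"
        then have x: "x \<in> \<Omega>" "e \<le> \<delta> x" "norm x \<le> \<rho>" using B(3) by (auto simp: w_def split: if_splits)
        have "1 / e \<le> real (Suc j)" using j by simp
        then have "1 / real (Suc j) \<le> e" using e(1) by (simp add: field_simps)
        then show False using x j that by (auto simp: KK_def)
      qed
    qed
    have uN: "u \<in> Nsp" and wN: "(\<lambda>x. (-1) * w x) \<in> Nsp" using CC_Nsp(1)[OF u] Nsp_cmult[OF test_funs_Nsp[OF w], of "-1"] .
    have "S (\<lambda>x. u x + (-1) * w x) = S u + S (\<lambda>x. (-1) * w x)" by (rule S_add[OF uN wN])
    then have "S u = S (\<lambda>x. u x + (-1) * w x)" using S_mult[OF test_funs_Nsp[OF w], of "-1"] zero[OF w] by simp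
    then have "ennreal \<bar>S u\<bar> \<le> ennreal K * NN (\<lambda>x. u x + (-1) * w x)" using bd[OF Nsp_add[OF uN wN]] by simp
    also have "NN (\<lambda>x. u x + (-1) * w x) = NN (\<lambda>x. if \<delta> x < e then u x else 0)"
      by (rule Nn_cong) (auto simp: w_def ext_eq)
    finally show ?thesis using e(2) mult_left_mono[OF e(2), of "ennreal K"] by (auto intro: order_trans)
  qed
  have "(\<lambda>k. ennreal K * (4 * nP (te u) + ennreal (1 / real (Suc k)))) \<longlonglongrightarrow> ennreal K * (4 * nP (te u) + 0)"
  proof (intro ennreal_tendsto_cmult tendsto_add tendsto_const)
    show "(\<lambda>k. ennreal (1 / real (Suc k))) \<longlonglongrightarrow> 0" by (rule tendsto_ennreal_inverse_Suc)
  qed auto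
  then have "ennreal \<bar>S u\<bar> \<le> ennreal K * (4 * nP (te u) + 0)"
    by (rule LIMSEQ_le_const) (use main in auto)
  then show ?thesis by simp
qed

text \<open>By \<open>vanishing_bound\<close> the value on a continuous function is controlled by
  its boundary values, which are dense in L^P, so \<open>dense_functional\<close> applies with
  \<iota> = \<open>te\<close>. Both sides of the representation are continuous along approximating
  sequences, which carries it from \<open>CC\<close> to all of \<open>Nsp\<close>.\<close>

lemma vanishing_functional:
  assumes S_add: "\<And>u v. u \<in> Nsp \<Longrightarrow> v \<in> Nsp \<Longrightarrow> S (\<lambda>x. u x + v x) = S u + S v"
    and S_mult: "\<And>s u. u \<in> Nsp \<Longrightarrow> S (\<lambda>x. s * u x) = s * (S u :: real)"
    and bd: "\<And>u. u \<in> Nsp \<Longrightarrow> ennreal \<bar>S u\<bar> \<le> ennreal K * NN u"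
    and zero: "\<And>u. u \<in> test_funs \<Longrightarrow> S u = 0" and K: "0 \<le> K"
  obtains g where "g \<in> borel_measurable borel" "nP' g < top" "\<And>u f. u \<in> Nsp \<Longrightarrow> istr u f \<Longrightarrow> S u = (\<integral>x. f x * g x \<partial>M)"
proof -
  have SCC: "ennreal \<bar>S u\<bar> \<le> ennreal K * (4 * nP (te u))" if "u \<in> CC" for u
    by (rule vanishing_bound[OF S_add S_mult bd zero that])
  have S_diff: "S (\<lambda>x. u x - v x) = S u - S v" "(\<lambda>x. u x - v x) \<in> Nsp" if "u \<in> Nsp" "v \<in> Nsp" for u v
    using S_add[OF that(1) Nsp_cmult[OF that(2)], of "-1"] S_mult[OF that(2), of "-1"] Nsp_add[OF that(1) Nsp_cmult[OF that(2)], of "-1"] by simp_all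
  obtain g where g: "g \<in> borel_measurable M" "nP' g < top" and CC_eq: "\<And>u. u \<in> CC \<Longrightarrow> S u = (\<integral>x. te u x * g x \<partial>M)"
  proof (rule dense_functional[OF PQ, of CC te S "K * 4"])
    fix f and e :: real assume f: "f \<in> bounded_supp M balls" and e: "0 < e"
    obtain \<phi> where \<phi>: "\<phi> \<in> cont_supp" "nP (\<lambda>x. \<phi> x - f x) \<le> ennreal e" using cont_supp_dense[OF f RP(3) e] by blast
    have eq: "nP (\<lambda>x. te \<phi> x - f x) = nP (\<lambda>x. \<phi> x - f x)"
    proof (rule Lnorm_cong_AE[OF RP(4)])
      show "AE x in M. ennreal \<bar>te \<phi> x - f x\<bar> = ennreal \<bar>\<phi> x - f x\<bar>" using AE_te[of \<phi>] by eventually_elim simp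
    qed
    show "\<exists>u\<in>CC. nP (\<lambda>x. te u x - f x) \<le> ennreal e"
      by (rule bexI[OF _ cont_supp_CC[OF \<phi>(1)]]) (unfold eq, rule \<phi>(2))
  next
    fix u assume "u \<in> CC"
    from SCC[OF this] show "ennreal \<bar>S u\<bar> \<le> ennreal (K * 4) * nP (te u)"
      using ennreal_mult[OF K, of 4] by (simp add: mult.assoc)
  qed (auto intro!: Cc_add Cc_cmult S_add S_mult CC_Nsp te_add te_cmult te_bounded_supp)
  have gb: "g \<in> borel_measurable borel" using g(1) by (simp cong: measurable_cong_sets)
  show thesis
  proof (rule that[OF gb g(2)])
    fix u f assume u: "u \<in> Nsp" and f: "istr u f"
    obtain U where U: "approx u U" using u by (auto simp: Nsp_def)
    have UC: "U k \<in> CC" for k using U by (simp add: approx_def)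
    have l1: "(\<lambda>k. nP (\<lambda>x. te (U k) x - f x)) \<longlonglongrightarrow> 0" using f U by (simp add: istr_def)
    have l2: "(\<lambda>k. NN (\<lambda>x. U k x - u x)) \<longlonglongrightarrow> 0" using U by (simp add: approx_def)
    have fm: "f \<in> borel_measurable M" and ff: "nP f < top" using f by (auto simp: istr_def intro: borel_M)
    have tm: "te (U k) \<in> borel_measurable M" for k by (intro borel_M te_borel UC)
    have dm: "(\<lambda>x. te (U k) x - f x) \<in> borel_measurable M" for k using tm fm by measurable
    have d0: "nP (\<lambda>x. te (U k) x - f x) < top" for k
    proof -
      have "nP (\<lambda>x. te (U k) x - f x) \<le> 4 * (nP (\<lambda>x. te (U k) x - 0) + nP (\<lambda>x. 0 - f x))"
        by (rule Lnorm_triangle[OF RP(3) tm _ fm]) simp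
      also have "\<dots> < top" using nP_te_finite[OF UC, of k] ff by (simp add: ennreal_mult_less_top)
      finally show ?thesis .
    qed
    have "(\<lambda>k. S (U k)) \<longlonglongrightarrow> S u"
    proof (rule tendsto_of_ennreal_dist, rule ennreal_tendsto_0_le[OF l2])
      fix k
      show "ennreal \<bar>S (U k) - S u\<bar> \<le> ennreal K * NN (\<lambda>x. U k x - u x)"
        using bd[OF S_diff(2)[OF CC_Nsp(1)[OF UC] u], of k] S_diff(1)[OF CC_Nsp(1)[OF UC] u, of k] by simp
    qed simp
    moreover have "(\<lambda>k. S (U k)) \<longlonglongrightarrow> (\<integral>x. f x * g x \<partial>M)"
    proof (rule tendsto_of_ennreal_dist, rule ennreal_tendsto_0_le[OF l1])
      fix k
      note i = Lnorm_pairing[OF PQ dm[of k] g(1) d0[of k] g(2)]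
      have ti: "integrable M (\<lambda>x. f x * g x)" by (rule Lnorm_pairing(1)[OF PQ fm g(1) ff g(2)])
      have "S (U k) = (\<integral>x. (te (U k) x - f x) * g x + f x * g x \<partial>M)" using CC_eq[OF UC] by (simp add: algebra_simps)
      also have "\<dots> = (\<integral>x. (te (U k) x - f x) * g x \<partial>M) + (\<integral>x. f x * g x \<partial>M)"
        by (rule Bochner_Integration.integral_add[OF i(1) ti])
      finally show "ennreal \<bar>S (U k) - (\<integral>x. f x * g x \<partial>M)\<bar> \<le> nP' g * nP (\<lambda>x. te (U k) x - f x)"
        using i(2) by (simp add: mult.commute)
    qed (rule g(2))
    ultimately show "S u = (\<integral>x. f x * g x \<partial>M)" by (rule LIMSEQ_unique)
  qed
qed

theorem representation:
  assumes T_add: "\<And>u v. u \<in> Nsp \<Longrightarrow> v \<in> Nsp \<Longrightarrow> T (\<lambda>x. u x + v x) = T u + T v"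
    and T_mult: "\<And>s u. u \<in> Nsp \<Longrightarrow> T (\<lambda>x. s * u x) = s * (T u :: real)"
    and bd: "\<And>u. u \<in> Nsp \<Longrightarrow> ennreal \<bar>T u\<bar> \<le> ennreal K * NN u"
  obtains F g where "F \<in> borel_measurable borel" "F \<in> Lloc q \<Omega>" "Cn F < top"
    "g \<in> borel_measurable borel" "nP' g < top"
    "\<And>u f. u \<in> Nsp \<Longrightarrow> istr u f \<Longrightarrow> T u = om u F + (\<integral>x. f x * g x \<partial>M)"
proof -
  have loc: "\<exists>C. \<forall>u\<in>test_funs. (\<forall>x. x \<notin> KK j \<longrightarrow> u x = 0) \<longrightarrow> ennreal \<bar>T u\<bar> \<le> ennreal C * Lp R lborel u" for j
  proof -
    obtain C where C: "\<forall>v\<in>test_funs. (\<forall>x. x \<notin> KK j \<longrightarrow> v x = 0) \<longrightarrow> NN v \<le> ennreal C * Lp R lborel v"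
      using Nn_le_Lnorm[OF RP(2,4)] by metis
    show ?thesis
    proof (intro exI ballI impI)
      fix u assume u: "u \<in> test_funs" "\<forall>x. x \<notin> KK j \<longrightarrow> u x = 0"
      have "ennreal \<bar>T u\<bar> \<le> ennreal \<bar>K\<bar> * NN u"
        by (rule order_trans[OF bd[OF test_funs_Nsp[OF u(1)]]]) (simp add: mult_right_mono ennreal_leI)
      also have "\<dots> \<le> ennreal \<bar>K\<bar> * (ennreal \<bar>C\<bar> * Lp R lborel u)"
        using C u by (intro mult_left_mono order_trans[OF C[rule_format, OF u(1) u(2)[rule_format]]]) (auto intro!: mult_right_mono ennreal_leI)
      also have "\<dots> = ennreal (\<bar>K\<bar> * \<bar>C\<bar>) * Lp R lborel u"
        using ennreal_mult[of "\<bar>K\<bar>" "\<bar>C\<bar>"] by (simp add: mult.assoc)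
      finally show "ennreal \<bar>T u\<bar> \<le> ennreal (\<bar>K\<bar> * \<bar>C\<bar>) * Lp R lborel u" .
    qed
  qed
  obtain F where F: "F \<in> borel_measurable lborel" "\<And>u. u \<in> test_funs \<Longrightarrow> integrable lborel (\<lambda>x. u x * F x)"
    "\<And>u. u \<in> test_funs \<Longrightarrow> T u = (\<integral>x. u x * F x \<partial>lborel)"
  proof (rule bounded_supp_functional[of KK lborel T R])
    show "\<exists>C. \<forall>u\<in>test_funs. (\<forall>x. x \<notin> KK j \<longrightarrow> u x = 0) \<longrightarrow> ennreal \<bar>T u\<bar> \<le> ennreal C * Lp R lborel u" for j
      by (rule loc)
  qed (use incseq_KK KK_finite RP T_add T_mult test_funs_Nsp in auto)
  have Fb: "F \<in> borel_measurable borel" using F(1) by simp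
  \<comment> \<open>The local bounds place \<open>F\<close> in L^q on each \<open>KK j\<close>. In
    particular its Whitney averages are finite, as the global estimate
    \<open>dual_norm_bound\<close> requires.\<close>
  have Fq: "Lnorm q lborel (\<lambda>x. ennreal \<bar>F x\<bar> * indicator (KK j) x) < top" for j
  proof -
    obtain C where C: "\<forall>u\<in>test_funs. (\<forall>x. x \<notin> KK j \<longrightarrow> u x = 0) \<longrightarrow> ennreal \<bar>T u\<bar> \<le> ennreal C * Lp R lborel u" using loc by blast
    show ?thesis by (rule local_dual_bound[OF Fb q F(2), of j C]) (auto simp: F(3)[symmetric] C)
  qed
  have Cn: "Cn F < top"
    by (rule dual_norm_bound[OF PQ q Fb W_finite_of_local[OF Fb q _ Fq] F(2), of K]) (auto simp: F(3)[symmetric] intro: bd test_funs_Nsp)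
  have FL: "F \<in> Lloc q \<Omega>" by (rule Lloc_of_local[OF Fb q Fq])
  have Fm: "F \<in> L0" by (rule borel_lebesgue_on[OF Fb])
  obtain Kc where Kc: "0 < Kc" "\<And>u F. u \<in> L0 \<Longrightarrow> F \<in> L0 \<Longrightarrow> NN u < top \<Longrightarrow> Cn F < top \<Longrightarrow>
      ennreal \<bar>om u F\<bar> \<le> ennreal Kc * (NN u * Cn F)"
    using om_bound by blast
  obtain m where m: "Cn F = ennreal m" "0 \<le> m" using Cn by (cases "Cn F") auto
  \<comment> \<open>The remainder is bounded on \<open>Nsp\<close> because both terms are, and it
    vanishes on test functions by the choice of \<open>F\<close>.\<close>
  define S where "S u = T u - om u F" for u
  have int: "set_integrable lebesgue \<Omega> (\<lambda>x. u x * F x)" if "u \<in> Nsp" for u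
    by (rule om_integrable[OF Nsp_meas[OF that] Fm NN_finite[OF that] Cn])
  obtain g where g: "g \<in> borel_measurable borel" "nP' g < top" "\<And>u f. u \<in> Nsp \<Longrightarrow> istr u f \<Longrightarrow> S u = (\<integral>x. f x * g x \<partial>M)"
  proof (rule vanishing_functional[of S "\<bar>K\<bar> + Kc * m"])
    show "S (\<lambda>x. u x + v x) = S u + S v" if "u \<in> Nsp" "v \<in> Nsp" for u v
      using that set_integral_add(2)[OF int int, of u v] by (simp add: S_def T_add distrib_right)
    show "S (\<lambda>x. s * u x) = s * S u" if "u \<in> Nsp" for u s
      using that by (simp add: S_def T_mult right_diff_distrib mult.assoc)
    show "ennreal \<bar>S u\<bar> \<le> ennreal (\<bar>K\<bar> + Kc * m) * NN u" if u: "u \<in> Nsp" for u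
    proof -
      have "ennreal \<bar>S u\<bar> \<le> ennreal (\<bar>T u\<bar> + \<bar>om u F\<bar>)" unfolding S_def by (intro ennreal_leI abs_triangle_ineq4)
      also have "\<dots> = ennreal \<bar>T u\<bar> + ennreal \<bar>om u F\<bar>" by (rule ennreal_plus) auto
      also have "\<dots> \<le> ennreal \<bar>K\<bar> * NN u + ennreal Kc * (NN u * ennreal m)"
      proof (rule add_mono)
        show "ennreal \<bar>T u\<bar> \<le> ennreal \<bar>K\<bar> * NN u"
          by (rule order_trans[OF bd[OF u]]) (simp add: mult_right_mono ennreal_leI)
        show "ennreal \<bar>om u F\<bar> \<le> ennreal Kc * (NN u * ennreal m)"
          using Kc(2)[OF Nsp_meas[OF u] Fm NN_finite[OF u] Cn] by (simp add: m)
      qed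
      also have "\<dots> = (ennreal \<bar>K\<bar> + ennreal Kc * ennreal m) * NN u" by (simp only: distrib_right mult_ac)
      also have "ennreal Kc * ennreal m = ennreal (Kc * m)" by (rule ennreal_mult[symmetric]) (use Kc m in auto)
      also have "ennreal \<bar>K\<bar> + ennreal (Kc * m) = ennreal (\<bar>K\<bar> + Kc * m)" by (rule ennreal_plus[symmetric]) (use Kc m in auto)
      finally show ?thesis .
    qed
    show "S u = 0" if u: "u \<in> test_funs" for u
      using om_lborel[OF test_funs_borel[OF u] Fb test_funs_outside[OF u]] F(3)[OF u] by (simp add: S_def)
    show "0 \<le> \<bar>K\<bar> + Kc * m" using Kc m by simp
  qed blast
  show thesis
    by (rule that[OF Fb FL Cn g(1,2)]) (use g(3) in \<open>simp add: S_def algebra_simps\<close>)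
qed

text \<open>Test functions have trace 0 and hence determine \<open>F\<close>. Once the interior
  terms agree, continuous functions, whose traces are their restrictions to the boundary, determine
  \<open>g\<close>.\<close>

theorem representation_unique:
  assumes F: "F \<in> L0" "Cn F < top" "F' \<in> L0" "Cn F' < top"
    and g: "g \<in> borel_measurable borel" "nP' g < top" "g' \<in> borel_measurable borel" "nP' g' < top"
    and eq: "\<And>u f. u \<in> Nsp \<Longrightarrow> istr u f \<Longrightarrow> om u F + (\<integral>x. f x * g x \<partial>M) = om u F' + (\<integral>x. f x * g' x \<partial>M)"
  shows "AE x in lborel. x \<in> \<Omega> \<longrightarrow> F' x = F x" "AE x in M. g' x = g x"
proof -
  have int: "set_integrable lebesgue \<Omega> (\<lambda>x. u x * F x)" "set_integrable lebesgue \<Omega> (\<lambda>x. u x * F' x)" if "u \<in> Nsp" for u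
    by (intro om_integrable Nsp_meas that F NN_finite)+
  have Dm: "(\<lambda>x. F x - F' x) \<in> L0" using F by measurable
  obtain D where D[measurable]: "D \<in> borel_measurable borel" and D0: "\<And>x. x \<notin> \<Omega> \<Longrightarrow> D x = 0"
    and DF: "AE x in lborel. x \<in> \<Omega> \<longrightarrow> F x - F' x = D x" using borel_representative[OF Dm borel_\<Omega>] by blast
  have DF': "AE x in lebesgue. x \<in> \<Omega> \<longrightarrow> F x - F' x = D x" using AE_completion[OF DF] .
  have "AE x in lborel. \<forall>j. \<bar>D x\<bar> * indicator (KK j) x = 0"
    unfolding AE_all_countable
  proof
    fix j
    \<comment> \<open>The sign of the difference on \<open>KK j\<close> is an admissible test
      function, and it turns the integrand into \<open>\<bar>D x\<bar>\<close> there.\<close>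
    define u where "u x = sgn (D x) * indicator (KK j) x" for x
    have [measurable]: "u \<in> borel_measurable borel" unfolding u_def by measurable
    have u: "u \<in> test_funs" by (rule bounded_suppI[of _ _ 1 _ j]) (auto simp: u_def indicator_def sgn_if)
    have uN: "u \<in> Nsp" by (rule test_funs_Nsp[OF u])
    obtain f where f: "istr u f" using istr_exists[OF uN] by blast
    have f0: "(\<integral>x. f x * h x \<partial>M) = 0" if [measurable]: "h \<in> borel_measurable borel" for h
    proof -
      have [measurable]: "f \<in> borel_measurable borel" using f by (simp add: istr_def)
      have "(\<integral>x. f x * h x \<partial>M) = (\<integral>x. 0 \<partial>M)"
      proof (rule integral_cong_AE)
        show "AE x in M. f x * h x = 0" using istr_test_funs[OF u f] by eventually_elim simp
      qed measurable
      then show ?thesis by simp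
    qed
    have "om u F = om u F'" using eq[OF uN f] f0[OF g(1)] f0[OF g(3)] by simp
    then have z: "(LINT x:\<Omega>|lebesgue. u x * F x - u x * F' x) = 0" using set_integral_diff(2)[OF int[OF uN]] by simp
    have i: "set_integrable lebesgue \<Omega> (\<lambda>x. u x * F x - u x * F' x)" using set_integral_diff(1)[OF int[OF uN]] by simp
    have ae: "AE x in lebesgue. indicator \<Omega> x *\<^sub>R (u x * F x - u x * F' x) = \<bar>D x\<bar> * indicator (KK j) x"
      using DF'
    proof eventually_elim
      case (elim x)
      show ?case
      proof (cases "x \<in> \<Omega>")
        case True
        then have "u x * F x - u x * F' x = u x * D x" using elim by (simp add: right_diff_distrib[symmetric])
        also have "\<dots> = \<bar>D x\<bar> * indicator (KK j) x" by (simp add: u_def abs_sgn mult_ac)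
        finally show ?thesis using True by simp
      qed (simp add: D0)
    qed
    have mm: "(\<lambda>x. \<bar>D x\<bar> * indicator (KK j) x) \<in> borel_measurable borel" by measurable
    have ml: "(\<lambda>x. \<bar>D x\<bar> * indicator (KK j) x) \<in> borel_measurable lebesgue" using mm by (intro measurable_completion) simp
    have i2: "integrable lebesgue (\<lambda>x. \<bar>D x\<bar> * indicator (KK j) x)"
    proof (rule integrable_cong_AE_imp[OF i[unfolded set_integrable_def] ml])
      show "AE x in lebesgue. indicator \<Omega> x *\<^sub>R (u x * F x - u x * F' x) = \<bar>D x\<bar> * indicator (KK j) x" by (rule ae)
    qed
    have "(\<integral>x. \<bar>D x\<bar> * indicator (KK j) x \<partial>lebesgue) = (LINT x:\<Omega>|lebesgue. u x * F x - u x * F' x)"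
      unfolding set_lebesgue_integral_def
    proof (rule integral_cong_AE[OF ml])
      show "(\<lambda>x. indicator \<Omega> x *\<^sub>R (u x * F x - u x * F' x)) \<in> borel_measurable lebesgue"
        using i unfolding set_integrable_def by (rule borel_measurable_integrable)
      show "AE x in lebesgue. \<bar>D x\<bar> * indicator (KK j) x = indicator \<Omega> x *\<^sub>R (u x * F x - u x * F' x)"
        using ae by eventually_elim simp
    qed
    then have "(\<integral>x. \<bar>D x\<bar> * indicator (KK j) x \<partial>lebesgue) = 0" using z by simp
    then have "AE x in lebesgue. \<bar>D x\<bar> * indicator (KK j) x = 0"
      using integral_nonneg_eq_0_iff_AE[OF i2] by simp
    then show "AE x in lborel. \<bar>D x\<bar> * indicator (KK j) x = 0" by (simp add: AE_completion_iff)
  qed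
  then show FF: "AE x in lborel. x \<in> \<Omega> \<longrightarrow> F' x = F x"
    using DF
  proof eventually_elim
    case (elim x)
    show ?case
    proof
      assume x: "x \<in> \<Omega>"
      obtain j where "x \<in> KK j" using KK_exhausts[OF x] .
      then have "D x = 0" using elim(1)[rule_format, of j] by simp
      then show "F' x = F x" using elim(2) x by simp
    qed
  qed
  have FF': "AE x in lebesgue. x \<in> \<Omega> \<longrightarrow> F' x = F x" using AE_completion[OF FF] .
  note [measurable] = g(1,3)
  have gm: "g \<in> borel_measurable M" "g' \<in> borel_measurable M" by measurable
  have "AE x in M. g' x - g x = 0"
  proof (rule cont_supp_separates[OF PQ])
    show "(\<lambda>x. g' x - g x) \<in> borel_measurable borel" by measurable
    have "nP' (\<lambda>x. g' x - g x) \<le> 4 * (nP' (\<lambda>x. g' x - 0) + nP' (\<lambda>x. 0 - g x))"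
      by (rule Lnorm_triangle) (use RP in \<open>auto intro: borel_M g\<close>)
    also have "\<dots> < top" using g by (simp add: ennreal_mult_less_top)
    finally show "nP' (\<lambda>x. g' x - g x) < top" .
    fix \<phi> :: "'a \<Rightarrow> real" assume \<phi>: "\<phi> \<in> cont_supp"
    have \<phi>C: "\<phi> \<in> CC" and \<phi>N: "\<phi> \<in> Nsp" using cont_supp_CC[OF \<phi>] CC_Nsp(1) by auto
    have [measurable]: "\<phi> \<in> borel_measurable borel" using cont_supp_measurable[OF \<phi>] by (simp cong: measurable_cong_sets)
    obtain f where f: "istr \<phi> f" using istr_exists[OF \<phi>N] by blast
    have fm: "f \<in> borel_measurable M" "nP f < top" and [measurable]: "f \<in> borel_measurable borel" using f by (auto simp: istr_def intro: borel_M)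
    have f\<phi>: "AE x in M. f x = \<phi> x" using istr_CC[OF \<phi>C f] AE_te[of \<phi>] by eventually_elim simp
    have "om \<phi> F = om \<phi> F'"
      unfolding set_lebesgue_integral_def
    proof (rule integral_cong_AE)
      show "AE x in lebesgue. indicator \<Omega> x *\<^sub>R (\<phi> x * F x) = indicator \<Omega> x *\<^sub>R (\<phi> x * F' x)"
        using FF' by eventually_elim (auto simp: indicator_def)
    qed (use int[OF \<phi>N] in \<open>auto simp: set_integrable_def dest: borel_measurable_integrable\<close>)
    then have "(\<integral>x. f x * g' x \<partial>M) = (\<integral>x. f x * g x \<partial>M)" using eq[OF \<phi>N f] by simp
    moreover have "integrable M (\<lambda>x. f x * g' x)" "integrable M (\<lambda>x. f x * g x)"
      using Lnorm_pairing(1)[OF PQ fm(1) _ fm(2)] gm g by auto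
    ultimately have "(\<integral>x. f x * (g' x - g x) \<partial>M) = 0" by (simp add: right_diff_distrib)
    also have "(\<integral>x. f x * (g' x - g x) \<partial>M) = (\<integral>x. \<phi> x * (g' x - g x) \<partial>M)"
    proof (rule integral_cong_AE)
      show "AE x in M. f x * (g' x - g x) = \<phi> x * (g' x - g x)" using f\<phi> by eventually_elim simp
    qed measurable
    finally show "(\<integral>x. \<phi> x * (g' x - g x) \<partial>M) = 0" .
  qed
  then show "AE x in M. g' x = g x" by eventually_elim simp
qed

end

text \<open>\<tau> is an arbitrary choice of representatives of the traces. Such a choice is linear
  only almost everywhere, so linearity is verified after integration.\<close>

theorem (in nt_duality) pairing_functional:
  assumes F: "F \<in> L0" "Cn F < top"
    and g: "g \<in> borel_measurable borel" "nP' g < top" and \<tau>: "\<And>u. u \<in> Nsp \<Longrightarrow> istr u (\<tau> u)"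
  shows "bounded_functional Nsp NN (\<lambda>u. om u F + (\<integral>x. \<tau> u x * g x \<partial>M))"
    "\<And>u. u \<in> Nsp \<Longrightarrow> set_integrable lebesgue \<Omega> (\<lambda>x. u x * F x)"
    "\<And>u. u \<in> Nsp \<Longrightarrow> integrable M (\<lambda>x. \<tau> u x * g x)"
proof -
  have gm: "g \<in> borel_measurable M" by (rule borel_M[OF g(1)])
  have \<tau>m: "\<tau> u \<in> borel_measurable M" "nP (\<tau> u) < top" if "u \<in> Nsp" for u
    using \<tau>[OF that] by (auto simp: istr_def intro: borel_M)
  show i1: "set_integrable lebesgue \<Omega> (\<lambda>x. u x * F x)" if "u \<in> Nsp" for u
    by (intro om_integrable Nsp_meas that F NN_finite)
  show i2: "integrable M (\<lambda>x. \<tau> u x * g x)" if "u \<in> Nsp" for u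
    by (rule Lnorm_pairing(1)[OF PQ \<tau>m(1)[OF that] gm \<tau>m(2)[OF that] g(2)])
  obtain Kc where Kc: "0 < Kc" "\<And>u F. u \<in> L0 \<Longrightarrow> F \<in> L0 \<Longrightarrow> NN u < top \<Longrightarrow> Cn F < top \<Longrightarrow>
      ennreal \<bar>om u F\<bar> \<le> ennreal Kc * (NN u * Cn F)"
    using om_bound by blast
  obtain Kt where Kt: "0 \<le> Kt" "\<And>u f. u \<in> Nsp \<Longrightarrow> istr u f \<Longrightarrow> nP f \<le> ennreal Kt * NN u"
    using istr_bound by blast
  obtain m where m: "Cn F = ennreal m" "0 \<le> m" using F(2) by (cases "Cn F") auto
  obtain l where l: "nP' g = ennreal l" "0 \<le> l" using g(2) by (cases "nP' g") auto
  show "bounded_functional Nsp NN (\<lambda>u. om u F + (\<integral>x. \<tau> u x * g x \<partial>M))"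
    unfolding bounded_functional_def
  proof (intro conjI ballI allI)
    fix u v assume u: "u \<in> Nsp" and v: "v \<in> Nsp"
    have uv: "(\<lambda>x. u x + v x) \<in> Nsp" by (rule Nsp_add[OF u v])
    have "(\<integral>x. \<tau> (\<lambda>x. u x + v x) x * g x \<partial>M) = (\<integral>x. \<tau> u x * g x + \<tau> v x * g x \<partial>M)"
    proof (rule integral_cong_AE)
      show "AE x in M. \<tau> (\<lambda>x. u x + v x) x * g x = \<tau> u x * g x + \<tau> v x * g x"
        using istr_add[OF u v \<tau>[OF u] \<tau>[OF v] \<tau>[OF uv]] by eventually_elim (simp add: distrib_right)
    qed (use \<tau>m(1)[OF u] \<tau>m(1)[OF v] \<tau>m(1)[OF uv] gm in measurable)
    also have "\<dots> = (\<integral>x. \<tau> u x * g x \<partial>M) + (\<integral>x. \<tau> v x * g x \<partial>M)"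
      by (rule Bochner_Integration.integral_add[OF i2[OF u] i2[OF v]])
    finally show "om (\<lambda>x. u x + v x) F + (\<integral>x. \<tau> (\<lambda>x. u x + v x) x * g x \<partial>M)
        = (om u F + (\<integral>x. \<tau> u x * g x \<partial>M)) + (om v F + (\<integral>x. \<tau> v x * g x \<partial>M))"
      using set_integral_add(2)[OF i1[OF u] i1[OF v]] by (simp add: distrib_right)
  next
    fix s u assume u: "u \<in> Nsp"
    have su: "(\<lambda>x. s * u x) \<in> Nsp" by (rule Nsp_cmult[OF u])
    have "(\<integral>x. \<tau> (\<lambda>x. s * u x) x * g x \<partial>M) = (\<integral>x. s * (\<tau> u x * g x) \<partial>M)"
    proof (rule integral_cong_AE)
      show "AE x in M. \<tau> (\<lambda>x. s * u x) x * g x = s * (\<tau> u x * g x)"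
        using istr_cmult[OF u \<tau>[OF u] \<tau>[OF su]] by eventually_elim simp
    qed (use \<tau>m(1)[OF u] \<tau>m(1)[OF su] gm in measurable)
    then show "om (\<lambda>x. s * u x) F + (\<integral>x. \<tau> (\<lambda>x. s * u x) x * g x \<partial>M) = s * (om u F + (\<integral>x. \<tau> u x * g x \<partial>M))"
      by (simp add: distrib_left mult.assoc)
  next
    show "\<exists>K. \<forall>u\<in>Nsp. ennreal \<bar>om u F + (\<integral>x. \<tau> u x * g x \<partial>M)\<bar> \<le> ennreal K * NN u"
    proof (intro exI ballI)
      fix u assume u: "u \<in> Nsp"
      have "ennreal \<bar>om u F + (\<integral>x. \<tau> u x * g x \<partial>M)\<bar> \<le> ennreal (\<bar>om u F\<bar> + \<bar>\<integral>x. \<tau> u x * g x \<partial>M\<bar>)"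
        by (intro ennreal_leI abs_triangle_ineq)
      also have "\<dots> = ennreal \<bar>om u F\<bar> + ennreal \<bar>\<integral>x. \<tau> u x * g x \<partial>M\<bar>" by (rule ennreal_plus) auto
      also have "\<dots> \<le> ennreal Kc * (NN u * ennreal m) + ennreal Kt * NN u * ennreal l"
      proof (rule add_mono)
        show "ennreal \<bar>om u F\<bar> \<le> ennreal Kc * (NN u * ennreal m)"
          using Kc(2)[OF Nsp_meas[OF u] F(1) NN_finite[OF u] F(2)] by (simp add: m)
        have "ennreal \<bar>\<integral>x. \<tau> u x * g x \<partial>M\<bar> \<le> nP (\<tau> u) * nP' g"
          by (rule Lnorm_pairing(2)[OF PQ \<tau>m(1)[OF u] gm \<tau>m(2)[OF u] g(2)])
        also have "\<dots> \<le> ennreal Kt * NN u * ennreal l"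
          unfolding l(1) by (rule mult_right_mono[OF Kt(2)[OF u \<tau>[OF u]]]) simp
        finally show "ennreal \<bar>\<integral>x. \<tau> u x * g x \<partial>M\<bar> \<le> ennreal Kt * NN u * ennreal l" .
      qed
      also have "\<dots> = (ennreal Kc * ennreal m + ennreal Kt * ennreal l) * NN u" by (simp only: distrib_right distrib_left mult_ac)
      also have "ennreal Kc * ennreal m = ennreal (Kc * m)" by (rule ennreal_mult[symmetric]) (use Kc m in auto)
      also have "ennreal Kt * ennreal l = ennreal (Kt * l)" by (rule ennreal_mult[symmetric]) (use Kt l in auto)
      also have "ennreal (Kc * m) + ennreal (Kt * l) = ennreal (Kc * m + Kt * l)"
        by (rule ennreal_plus[symmetric]) (use Kc m Kt l in auto)
      finally show "ennreal \<bar>om u F + (\<integral>x. \<tau> u x * g x \<partial>M)\<bar> \<le> ennreal (Kc * m + Kt * l) * NN u" .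
    qed
  qed
qed

section \<open>Ahlfors regular boundaries\<close>

lemma conj_exp_ennreal:
  assumes R: "1 \<le> R" and q: "1 / ennreal R + 1 / q = 1"
  shows "conj_exp R q"
proof (cases q)
  case (real Q)
  \<comment> \<open>The value \<open>q = 0\<close> is excluded because its reciprocal is
    \<open>top\<close>.\<close>
  have Q: "0 < Q"
  proof (rule ccontr)
    assume "\<not> 0 < Q"
    then have "1 / q = top" using real by (simp add: ennreal_divide_zero divide_ennreal_def)
    then show False using q by simp
  qed
  have "ennreal (1 / R + 1 / Q) = ennreal (1 / R) + ennreal (1 / Q)" using R Q by (intro ennreal_plus) auto
  also have "\<dots> = 1 / ennreal R + 1 / q" using R Q real by (simp add: divide_ennreal[symmetric])
  finally have "1 / R + 1 / Q = 1" using q R Q by (metis ennreal_eq_1)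
  moreover from this have "1 / R < 1" "1 / Q < 1" using divide_pos_pos[OF zero_less_one Q] divide_pos_pos[OF zero_less_one, of R] R by linarith+
  then have "1 < R" "1 < Q" using R Q by (simp_all add: divide_less_eq)
  ultimately show ?thesis using real by (auto simp: conj_exp_def)
next
  case top
  then have "1 / ennreal R = 1" using q by simp
  then have "ennreal (1 / R) = 1" using R by (simp add: divide_ennreal[symmetric])
  then have "1 / R = 1" by (metis ennreal_eq_1)
  then show ?thesis using top R by (simp add: conj_exp_def)
qed

lemma dist_le_ediameter: "x \<in> S \<Longrightarrow> y \<in> S \<Longrightarrow> ennreal (dist x y) \<le> ediameter S"
  unfolding ediameter_def by (rule SUP_upper2[of x], assumption, rule SUP_upper)

lemma ediameter_pos_open:
  fixes S :: "'a::euclidean_space set"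
  assumes "open S" "S \<noteq> {}"
  obtains e where "0 < e" "ennreal e \<le> ediameter S"
proof -
  obtain x where "x \<in> S" using assms(2) by blast
  then obtain e where e: "0 < e" "cball x e \<subseteq> S" using assms(1) unfolding open_contains_cball by blast
  obtain b :: 'a where b: "b \<in> Basis" using nonempty_Basis by blast
  have "x \<in> S" "x + e *\<^sub>R b \<in> S" using e b by (auto simp: dist_norm subset_eq)
  from dist_le_ediameter[OF this] have "ennreal e \<le> ediameter S" using e b by (simp add: dist_norm)
  with e(1) show thesis by (rule that)
qed

lemma bounded_of_ediameter: "ediameter S \<le> ennreal d \<Longrightarrow> x \<in> S \<Longrightarrow> 0 \<le> d \<Longrightarrow> S \<subseteq> cball x d"
proof
  fix y assume "ediameter S \<le> ennreal d" "x \<in> S" "0 \<le> d" "y \<in> S"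
  then have "ennreal (dist x y) \<le> ennreal d" using dist_le_ediameter order_trans by metis
  then show "y \<in> cball x d" using \<open>0 \<le> d\<close> by simp
qed

text \<open>Two opposite rays from an interior point leave the bounded set at frontier points on
  either side of it.\<close>

lemma ediameter_frontier_pos:
  fixes S :: "'a::euclidean_space set"
  assumes S: "open S" "S \<noteq> {}" "bounded S"
  shows "0 < ediameter (frontier S)"
proof -
  obtain x where x: "x \<in> interior S" using S by (auto simp: interior_open)
  obtain b :: 'a where b: "b \<in> Basis" using nonempty_Basis by blast
  then have b0: "b \<noteq> 0" by auto
  obtain d where d: "0 < d" "x + d *\<^sub>R b \<in> frontier S" using ray_to_frontier[OF S(3) x b0] by metis
  obtain d' where d': "0 < d'" "x + d' *\<^sub>R (- b) \<in> frontier S" using ray_to_frontier[OF S(3) x, of "- b"] b0 by auto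
  have "(x + d *\<^sub>R b) - (x + d' *\<^sub>R (- b)) = (d + d') *\<^sub>R b" by (simp add: algebra_simps)
  then have d2: "dist (x + d *\<^sub>R b) (x + d' *\<^sub>R (- b)) = d + d'" using b d d' by (simp only: dist_norm norm_scaleR) simp
  then have "ennreal (d + d') \<le> ediameter (frontier S)" using dist_le_ediameter[OF d(2) d'(2)] by (simp only: d2)
  moreover have "0 < ennreal (d + d')" unfolding ennreal_less_zero_iff using d d' by simp
  ultimately show ?thesis by (rule less_le_trans[rotated])
qed

text \<open>The given bound covers centres in \<open>E\<close> and radii up to the diameter. If the
  diameter is finite, \<open>E\<close> is compact and a finite cover bounds its total measure, which
  handles larger radii. A ball with another centre that meets \<open>E\<close> lies in a ball of
  twice the radius about a point of \<open>E\<close>, whence \<open>2 ^ n\<close>.\<close>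

lemma ahlfors_growth:
  fixes E :: "'a::euclidean_space set"
  assumes n: "1 \<le> n" and E: "closed E" "E \<noteq> {}" "0 < ediameter E" and C: "0 < C"
    and up: "\<And>x \<rho>. x \<in> E \<Longrightarrow> 0 < \<rho> \<Longrightarrow> ennreal \<rho> \<le> ediameter E \<Longrightarrow> hausdorff_outer n (ball x \<rho> \<inter> E) \<le> ennreal (C * \<rho> ^ n)"
  obtains C' where "0 < C'" "\<And>z \<rho>. 0 < \<rho> \<Longrightarrow> hausdorff_outer n (ball z \<rho> \<inter> E) \<le> ennreal (C' * \<rho> ^ n)"
proof -
  have step: "\<exists>C2>0. \<forall>x\<in>E. \<forall>\<rho>>0. hausdorff_outer n (ball x \<rho> \<inter> E) \<le> ennreal (C2 * \<rho> ^ n)"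
  proof (cases "ediameter E")
    case top
    then show ?thesis using up C by (intro exI[of _ C]) auto
  next
    case (real d)
    then have d: "0 < d" using E(3) by simp
    obtain x0 where x0: "x0 \<in> E" using E(2) by blast
    have "E \<subseteq> cball x0 d" using bounded_of_ediameter[of E d x0] real x0 by simp
    then have "compact E" using E(1) by (meson bounded_cball bounded_subset compact_eq_bounded_closed)
    then obtain I where I: "finite I" "I \<subseteq> E" "E \<subseteq> (\<Union>x\<in>I. ball x d)"
      using compactE_image[of E E "\<lambda>x. ball x d"] d by (metis (no_types, lifting) UN_I centre_in_ball open_ball subsetI)
    have "hausdorff_outer n (\<Union>x\<in>J. ball x d \<inter> E) \<le> ennreal (real (card J) * (C * d ^ n))" if "finite J" "J \<subseteq> E" for J
      using that
    proof (induction J)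
      case empty
      then show ?case using hausdorff_outer_empty[OF n] by simp
    next
      case (insert x J)
      have "hausdorff_outer n (\<Union>x\<in>insert x J. ball x d \<inter> E) \<le> hausdorff_outer n (ball x d \<inter> E) + hausdorff_outer n (\<Union>x\<in>J. ball x d \<inter> E)"
        using hausdorff_outer_Un[OF n] by simp
      also have "\<dots> \<le> ennreal (C * d ^ n) + ennreal (real (card J) * (C * d ^ n))"
        using insert up[of x d] d real by (intro add_mono) auto
      also have "\<dots> = ennreal (C * d ^ n + real (card J) * (C * d ^ n))" using C d by (intro ennreal_plus[symmetric]) auto
      also have "C * d ^ n + real (card J) * (C * d ^ n) = real (card (insert x J)) * (C * d ^ n)"
        using insert by (simp add: algebra_simps)
      finally show ?case .
    qed
    from this[OF I(1,2)] have fin: "hausdorff_outer n E \<le> ennreal (real (card I) * (C * d ^ n))"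
      using hausdorff_outer_mono[of E "\<Union>x\<in>I. ball x d \<inter> E" n] I(3) by (auto intro: order_trans)
    show ?thesis
    proof (intro exI[of _ "C + real (card I) * C"] conjI ballI allI impI)
      show "0 < C + real (card I) * C" using C by (simp add: add_pos_nonneg)
      fix x \<rho> :: real and y assume y: "y \<in> E" and \<rho>: "0 < \<rho>"
      show "hausdorff_outer n (ball y \<rho> \<inter> E) \<le> ennreal ((C + real (card I) * C) * \<rho> ^ n)"
      proof (cases "\<rho> \<le> d")
        case True
        have "hausdorff_outer n (ball y \<rho> \<inter> E) \<le> ennreal (C * \<rho> ^ n)" using up[OF y \<rho>] True real by (simp add: ennreal_leI)
        also have "\<dots> \<le> ennreal ((C + real (card I) * C) * \<rho> ^ n)"
          using C \<rho> by (intro ennreal_leI mult_right_mono) auto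
        finally show ?thesis .
      next
        case False
        have "hausdorff_outer n (ball y \<rho> \<inter> E) \<le> ennreal (real (card I) * (C * d ^ n))"
          using hausdorff_outer_mono[of "ball y \<rho> \<inter> E" E n] fin by auto
        also have "\<dots> \<le> ennreal ((C + real (card I) * C) * \<rho> ^ n)"
        proof (rule ennreal_leI)
          have "d ^ n \<le> \<rho> ^ n" using False d by (intro power_mono) auto
          then have "real (card I) * C * d ^ n \<le> real (card I) * C * \<rho> ^ n" using C by (intro mult_left_mono) auto
          moreover have "0 \<le> C * \<rho> ^ n" using C \<rho> by simp
          ultimately show "real (card I) * (C * d ^ n) \<le> (C + real (card I) * C) * \<rho> ^ n" by (simp add: algebra_simps)
        qed
        finally show ?thesis .
      qed
    qed
  qed
  then obtain C2 where C2: "0 < C2" "\<And>x \<rho>. x \<in> E \<Longrightarrow> 0 < \<rho> \<Longrightarrow> hausdorff_outer n (ball x \<rho> \<inter> E) \<le> ennreal (C2 * \<rho> ^ n)" by blast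
  show thesis
  proof (rule that[of "C2 * 2 ^ n"])
    fix z and \<rho> :: real assume \<rho>: "0 < \<rho>"
    show "hausdorff_outer n (ball z \<rho> \<inter> E) \<le> ennreal (C2 * 2 ^ n * \<rho> ^ n)"
    proof (cases "ball z \<rho> \<inter> E = {}")
      case False
      then obtain w where w: "w \<in> E" "dist z w < \<rho>" by auto
      have "ball z \<rho> \<subseteq> ball w (2 * \<rho>)"
      proof
        fix y assume "y \<in> ball z \<rho>"
        then show "y \<in> ball w (2 * \<rho>)" using w dist_triangle[of w y z] by (simp add: dist_commute)
      qed
      then have "hausdorff_outer n (ball z \<rho> \<inter> E) \<le> hausdorff_outer n (ball w (2 * \<rho>) \<inter> E)" by (intro hausdorff_outer_mono) auto
      also have "\<dots> \<le> ennreal (C2 * (2 * \<rho>) ^ n)" using C2(2)[OF w(1), of "2 * \<rho>"] \<rho> by simp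
      finally show ?thesis by (simp add: power_mult_distrib mult.assoc)
    qed (simp add: hausdorff_outer_empty[OF n])
  qed (use C2 in simp)
qed

text \<open>The given bound stops at the diameter \<open>d\<close> of the frontier. If
  \<open>d\<close> is finite, the frontier is bounded and by the alternative so is \<Omega>; then
  the admissible radii are at most \<open>B\<close>, and shrinking the ball by the factor
  \<open>k\<close> brings its radius below \<open>d\<close> at the cost of
  \<open>k ^ n\<close>.\<close>

lemma ahlfors_lower:
  fixes \<Omega> :: "'a::euclidean_space set"
  assumes \<Omega>: "bounded \<Omega> \<or> \<not> bounded (frontier \<Omega>)" "0 < ediameter (frontier \<Omega>)" and C: "0 < C"
    and lo: "\<And>x \<rho>. x \<in> frontier \<Omega> \<Longrightarrow> 0 < \<rho> \<Longrightarrow> ennreal \<rho> \<le> ediameter (frontier \<Omega>) \<Longrightarrow>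
      ennreal (\<rho> ^ n / C) \<le> hausdorff_outer n (ball x \<rho> \<inter> frontier \<Omega>)"
  obtains \<kappa> where "0 < \<kappa>" "\<And>x \<xi> t. x \<in> \<Omega> \<Longrightarrow> \<xi> \<in> frontier \<Omega> \<Longrightarrow> 0 < t \<Longrightarrow> t \<le> bdry_dist \<Omega> x \<Longrightarrow>
      ennreal (\<kappa> * t ^ n) \<le> hausdorff_outer n (ball \<xi> t \<inter> frontier \<Omega>)"
proof (cases "ediameter (frontier \<Omega>)")
  case top
  show thesis by (rule that[of "1 / C"]) (use lo C top in auto)
next
  case (real d)
  then have d: "0 < d" using \<Omega>(2) by simp
  have "bounded (frontier \<Omega>)"
  proof (cases "frontier \<Omega> = {}")
    case False
    then obtain x0 where x0: "x0 \<in> frontier \<Omega>" by blast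
    have "frontier \<Omega> \<subseteq> cball x0 d" using bounded_of_ediameter[of "frontier \<Omega>" d x0] real x0 by simp
    then show ?thesis using bounded_subset bounded_cball by blast
  qed simp
  then have "bounded \<Omega>" using \<Omega>(1) by simp
  then have "bounded (closure \<Omega>)" by (rule bounded_closure)
  then obtain B where B: "\<And>x y. x \<in> closure \<Omega> \<Longrightarrow> y \<in> closure \<Omega> \<Longrightarrow> dist x y \<le> B"
    unfolding bounded_two_points by blast
  define k where "k = min 1 (d / max B d)"
  have k: "0 < k" "k \<le> 1" using d by (auto simp: k_def)
  show thesis
  proof (rule that[of "k ^ n / C"])
    show "0 < k ^ n / C" using k C by simp
    fix x \<xi> t assume x: "x \<in> \<Omega>" and \<xi>: "\<xi> \<in> frontier \<Omega>" and t: "0 < t" "t \<le> bdry_dist \<Omega> x"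
    have "bdry_dist \<Omega> x \<le> dist x \<xi>" unfolding bdry_dist_def by (rule infdist_le[OF \<xi>])
    also have "\<dots> \<le> B" using B x \<xi> closure_subset[of \<Omega>] by (auto simp: frontier_def)
    finally have tB: "t \<le> max B d" using t by simp
    have "k * t \<le> d / max B d * max B d" using tB t d by (intro mult_mono) (auto simp: k_def)
    then have kt: "k * t \<le> d" using d by simp
    have "ennreal (k ^ n / C * t ^ n) = ennreal ((k * t) ^ n / C)" by (simp add: power_mult_distrib)
    also have "\<dots> \<le> hausdorff_outer n (ball \<xi> (k * t) \<inter> frontier \<Omega>)"
      by (rule lo[OF \<xi>]) (use k t kt real in \<open>auto intro: ennreal_leI\<close>)
    also have "\<dots> \<le> hausdorff_outer n (ball \<xi> t \<inter> frontier \<Omega>)"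
    proof (rule hausdorff_outer_mono)
      have "k * t \<le> t" using k t by (simp add: mult_left_le_one_le)
      then show "ball \<xi> (k * t) \<inter> frontier \<Omega> \<subseteq> ball \<xi> t \<inter> frontier \<Omega>" by auto
    qed
    finally show "ennreal (k ^ n / C * t ^ n) \<le> hausdorff_outer n (ball \<xi> t \<inter> frontier \<Omega>)" .
  qed
qed

text \<open>\<sigma> and \<mu> are one measure, on the subspace \<open>E\<close> and on the whole
  space. In the transfer lemmas \<open>f'\<close> is a Borel function on the whole space that
  represents \<open>f\<close> on \<open>E\<close>; off \<open>E\<close> the two may differ.\<close>

locale borel_restriction =
  fixes H :: "'a::euclidean_space measure" and E :: "'a set"
  assumes sets_H [simp, measurable_cong]: "sets H = sets borel" and E [measurable]: "E \<in> sets borel"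
begin

abbreviation "\<sigma> \<equiv> restrict_space H E"
abbreviation "\<mu> \<equiv> density H (\<lambda>x. ennreal (indicator E x))"

lemma E_H: "E \<inter> space H \<in> sets H"
  using E sets_eq_imp_space_eq[OF sets_H] by simp

lemma measurable_H: "f \<in> borel_measurable borel \<Longrightarrow> f \<in> borel_measurable H"
  by (simp cong: measurable_cong_sets)

lemma nn_integral_eq:
  assumes "f' \<in> borel_measurable borel" "\<And>x. x \<in> E \<Longrightarrow> f x = f' x"
  shows "(\<integral>\<^sup>+x. f x \<partial>\<sigma>) = (\<integral>\<^sup>+x. f' x \<partial>\<mu>)"
proof -
  have "(\<integral>\<^sup>+x. f' x \<partial>\<mu>) = (\<integral>\<^sup>+x. ennreal (indicator E x) * f' x \<partial>H)"
    using assms(1) by (intro nn_integral_density measurable_H) measurable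
  also have "\<dots> = (\<integral>\<^sup>+x. f x * indicator E x \<partial>H)"
    using assms(2) by (intro nn_integral_cong) (auto simp: indicator_def)
  also have "\<dots> = (\<integral>\<^sup>+x. f x \<partial>\<sigma>)" by (rule nn_integral_restrict_space[OF E_H, symmetric])
  finally show ?thesis by simp
qed

lemma Lnorm_eq:
  assumes "0 < P" "f' \<in> borel_measurable borel" "\<And>x. x \<in> E \<Longrightarrow> f x = f' x"
  shows "Lnorm (ennreal P) \<sigma> f = Lnorm (ennreal P) \<mu> f'"
  unfolding Lnorm_ennreal[OF assms(1)]
  by (intro arg_cong[where f="\<lambda>t. epowr t (1 / P)"] nn_integral_eq) (use assms in simp_all)

lemma integral_eq:
  fixes f f' :: "'a \<Rightarrow> real"
  assumes "f' \<in> borel_measurable borel" "\<And>x. x \<in> E \<Longrightarrow> f x = f' x"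
  shows "(\<integral>x. f x \<partial>\<sigma>) = (\<integral>x. f' x \<partial>\<mu>)" "integrable \<sigma> f \<longleftrightarrow> integrable \<mu> f'"
proof -
  have i: "indicator E x *\<^sub>R f x = indicator E x *\<^sub>R f' x" for x using assms(2) by (simp add: indicator_def)
  have m: "f' \<in> borel_measurable H" "(\<lambda>x. indicator E x :: real) \<in> borel_measurable H" using assms(1) by (auto intro: measurable_H)
  show "(\<integral>x. f x \<partial>\<sigma>) = (\<integral>x. f' x \<partial>\<mu>)"
    unfolding integral_restrict_space[OF E_H] i by (rule integral_density[OF m, symmetric]) simp
  show "integrable \<sigma> f \<longleftrightarrow> integrable \<mu> f'"
    unfolding integrable_restrict_space[OF E_H] i by (rule integrable_density[OF m, symmetric]) simp
qed

lemma AE_eq: "(AE x in \<sigma>. P x) \<longleftrightarrow> (AE x in \<mu>. P x)"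
proof -
  have "(\<lambda>x. ennreal (indicator E x)) \<in> borel_measurable H" by (rule measurable_H) measurable
  then show ?thesis
    by (simp only: AE_restrict_space_iff[OF E_H] AE_density) (simp add: indicator_def)
qed

lemma restrict_measurable: "f \<in> borel_measurable borel \<Longrightarrow> f \<in> borel_measurable \<sigma>"
  by (intro measurable_restrict_space1 measurable_H)

lemma extend_measurable: "f \<in> borel_measurable \<sigma> \<Longrightarrow> (\<lambda>x. indicator E x * f x :: real) \<in> borel_measurable borel"
  using borel_measurable_restrict_space_iff[OF E_H, of f] by (simp cong: measurable_cong_sets)

end

lemma bounded_functional_cong:
  assumes "bounded_functional X N T" "\<And>u. u \<in> X \<Longrightarrow> T' u = T u"
    and "\<And>u v. u \<in> X \<Longrightarrow> v \<in> X \<Longrightarrow> (\<lambda>x. u x + v x) \<in> X" "\<And>s u. u \<in> X \<Longrightarrow> (\<lambda>x. s * u x) \<in> X"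
  shows "bounded_functional X N T'"
  using assms unfolding bounded_functional_def by simp

lemma Lnorm_zero: "Lnorm q M (\<lambda>x. 0) = 0"
proof (cases "q = \<infinity>")
  case True
  have "esssup M (\<lambda>x. 0 :: ennreal) \<le> 0" by (rule esssup_I) auto
  then show ?thesis using True by (simp add: Lnorm_def)
qed (simp add: Lnorm_def)

lemma Lnorm_empty_space: "space M = {} \<Longrightarrow> Lnorm (ennreal P) M f = 0"
  by (simp add: Lnorm_def nn_integral_empty)

theorem theorem1p8:
  fixes \<Omega> :: "'a::euclidean_space set"
    and n :: nat
    and \<alpha>\<^sub>0 c\<^sub>0 :: real
    and r r' p p' :: ennreal
  assumes "DIM('a) = n + 1" and "2 \<le> n"
    and "open \<Omega>" and "corkscrew \<Omega>" and "ahlfors_regular n (frontier \<Omega>)"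
    and "bounded \<Omega> \<or> \<not> bounded (frontier \<Omega>)"
    and "0 < \<alpha>\<^sub>0" and "0 < c\<^sub>0" and "c\<^sub>0 \<le> 1 / 2"
    and "1 \<le> r" and "r < \<infinity>" and "1 < p" and "p < \<infinity>"
    and "1 / r + 1 / r' = 1" and "1 / p + 1 / p' = 1"
  defines "\<sigma> \<equiv> bdry_measure n \<Omega>"
    and "N \<equiv> N_space n \<Omega> \<alpha>\<^sub>0 c\<^sub>0 r p"
    and "C \<equiv> C_space n \<Omega> c\<^sub>0 r' p'"
    and "tr \<equiv> bdry_trace n \<Omega> \<alpha>\<^sub>0 c\<^sub>0 r p"
  shows
    "(\<forall>F\<in>C. \<forall>g\<in>Lspace p' \<sigma>.
        (\<forall>u\<in>N. set_integrable lebesgue \<Omega> (\<lambda>x. u x * F x) \<and> integrable \<sigma> (\<lambda>\<xi>. tr u \<xi> * g \<xi>)) \<and>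
        bounded_functional N (N_norm n \<Omega> \<alpha>\<^sub>0 c\<^sub>0 r p)
          (\<lambda>u. (LINT x:\<Omega>|lebesgue. u x * F x) + (LINT \<xi>|\<sigma>. tr u \<xi> * g \<xi>)))
     \<and>
     (\<forall>T. bounded_functional N (N_norm n \<Omega> \<alpha>\<^sub>0 c\<^sub>0 r p) T \<longrightarrow>
        (\<exists>F\<in>C. \<exists>g\<in>Lspace p' \<sigma>.
           (\<forall>u\<in>N. T u = (LINT x:\<Omega>|lebesgue. u x * F x) + (LINT \<xi>|\<sigma>. tr u \<xi> * g \<xi>)) \<and>
           (\<forall>F'\<in>C. \<forall>g'\<in>Lspace p' \<sigma>.
              (\<forall>u\<in>N. T u = (LINT x:\<Omega>|lebesgue. u x * F' x) + (LINT \<xi>|\<sigma>. tr u \<xi> * g' \<xi>)) \<longrightarrow>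
              (AE x in lebesgue. x \<in> \<Omega> \<longrightarrow> F' x = F x) \<and> (AE \<xi> in \<sigma>. g' \<xi> = g \<xi>))))"
proof -
  have n: "1 \<le> n" using \<open>2 \<le> n\<close> by simp
  define R P where "R = enn2real r" and "P = enn2real p"
  have rR: "r = ennreal R" and R: "1 \<le> R"
  proof -
    show "r = ennreal R" using \<open>r < \<infinity>\<close> by (simp add: R_def)
    then show "1 \<le> R" using \<open>1 \<le> r\<close> by (metis ennreal_le_1 linorder_linear order_antisym ennreal_eq_1 order_refl)
  qed
  have pP: "p = ennreal P" and P: "1 < P"
  proof -
    show "p = ennreal P" using \<open>p < \<infinity>\<close> by (simp add: P_def)
    then show "1 < P" using \<open>1 < p\<close> by (metis ennreal_le_1 not_le)
  qed
  have rr: "conj_exp R r'" using conj_exp_ennreal[OF R] \<open>1 / r + 1 / r' = 1\<close> rR by simp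
  have "conj_exp P p'" using conj_exp_ennreal[of P] P \<open>1 / p + 1 / p' = 1\<close> pP by simp
  then obtain P' where P': "1 < P'" "1 / P + 1 / P' = 1" "p' = ennreal P'" using P by (auto simp: conj_exp_def)
  show ?thesis
  proof (cases "\<Omega> = {}")
    \<comment> \<open>The empty domain has empty frontier, so \<sigma> lives on the empty space and
      all norms vanish. It is treated apart because the locales assume a nonempty frontier.\<close>
    case True
    have sp: "space \<sigma> = {}" using True by (simp add: \<sigma>_def bdry_measure_def space_restrict_space)
    have L0: "Lnorm (ennreal Q) \<sigma> f = 0" for Q and f :: "'a \<Rightarrow> ennreal" by (rule Lnorm_empty_space[OF sp])
    have int: "integrable \<sigma> h" "(LINT \<xi>|\<sigma>. h \<xi>) = 0" for h :: "'a \<Rightarrow> real"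
    proof -
      show "integrable \<sigma> h" using Bochner_Integration.integrable_cong[OF refl, of \<sigma> h "\<lambda>_. 0"] sp by simp
      show "(LINT \<xi>|\<sigma>. h \<xi>) = 0" using Bochner_Integration.integral_cong[OF refl, of \<sigma> h "\<lambda>_. 0"] sp by simp
    qed
    have om: "set_integrable lebesgue {} h" "(LINT x:{}|lebesgue. h x) = 0" for h :: "'a \<Rightarrow> real"
      by (simp_all add: set_integrable_def set_lebesgue_integral_def)
    have N0: "N_norm n \<Omega> \<alpha>\<^sub>0 c\<^sub>0 r p u = 0" for u
      unfolding N_norm_def pP using L0 by (simp add: \<sigma>_def)
    have C0: "(\<lambda>_. 0) \<in> C"
      unfolding C_def C_space_def Lloc_def C_norm_def P'(3) using L0 by (simp add: Lnorm_zero \<sigma>_def)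
    have g0: "(\<lambda>_. 0) \<in> Lspace p' \<sigma>" by (simp add: Lspace_def Lnorm_zero)
    have T0: "\<forall>u\<in>N. T u = 0" if "bounded_functional N (N_norm n \<Omega> \<alpha>\<^sub>0 c\<^sub>0 r p) T" for T
      using that by (auto simp: bounded_functional_def N0)
    have Z: "bounded_functional N (N_norm n \<Omega> \<alpha>\<^sub>0 c\<^sub>0 r p) (\<lambda>_. 0)" by (simp add: bounded_functional_def)
    show ?thesis
      using T0 C0 g0 Z unfolding True by (auto simp: om int sp intro!: bexI[of _ "\<lambda>_. 0"] AE_I2)
  next
    case False
    define E where "E = frontier \<Omega>"
    define H where "H = (hausdorff_measure n :: 'a measure)"
    have bE: "bounded \<Omega> \<or> \<not> bounded E" using \<open>bounded \<Omega> \<or> \<not> bounded (frontier \<Omega>)\<close> by (simp add: E_def)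
    \<comment> \<open>The whole space is unbounded and its frontier is empty, hence bounded; the
      alternative rules it out.\<close>
    have "\<Omega> \<noteq> UNIV" using \<open>bounded \<Omega> \<or> \<not> bounded (frontier \<Omega>)\<close> not_bounded_UNIV by auto
    then have E0: "E \<noteq> {}" using False by (simp add: E_def frontier_eq_empty)
    have Ecl: "closed E" by (simp add: E_def)
    have Eb: "E \<in> sets borel" using Ecl by simp
    interpret S: borel_restriction H E by unfold_locales (simp_all add: H_def Eb)
    have \<sigma>: "\<sigma> = S.\<sigma>" by (simp add: \<sigma>_def bdry_measure_def E_def H_def)
    \<comment> \<open>A frontier of diameter 0 is a single point and hence bounded; then \<Omega> is
      bounded, and opposite rays give two frontier points.\<close>
    have diamE: "0 < ediameter E"
    proof (cases "ediameter E = 0")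
      case True
      obtain x where x: "x \<in> E" using E0 by blast
      have "E \<subseteq> cball x 0" using bounded_of_ediameter[of E 0 x] True x by simp
      then have "bounded E" using bounded_subset bounded_cball by blast
      then have "bounded \<Omega>" using bE by simp
      then show ?thesis using ediameter_frontier_pos[OF \<open>open \<Omega>\<close> False] by (simp add: E_def)
    qed (simp add: zero_less_iff_neq_zero)
    obtain A where A: "0 < A" "\<And>x \<rho>. x \<in> E \<Longrightarrow> 0 < \<rho> \<Longrightarrow> ennreal \<rho> \<le> ediameter E \<Longrightarrow>
        ennreal (\<rho> ^ n / A) \<le> hausdorff_outer n (ball x \<rho> \<inter> E) \<and> hausdorff_outer n (ball x \<rho> \<inter> E) \<le> ennreal (A * \<rho> ^ n)"
      using \<open>ahlfors_regular n (frontier \<Omega>)\<close> unfolding ahlfors_regular_def E_def by blast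
    obtain C1 where C1: "0 < C1" "\<And>z \<rho>. 0 < \<rho> \<Longrightarrow> hausdorff_outer n (ball z \<rho> \<inter> E) \<le> ennreal (C1 * \<rho> ^ n)"
      using ahlfors_growth[OF n Ecl E0 diamE A(1)] A(2) by blast
    obtain \<kappa> where \<kappa>: "0 < \<kappa>" "\<And>x \<xi> t. x \<in> \<Omega> \<Longrightarrow> \<xi> \<in> E \<Longrightarrow> 0 < t \<Longrightarrow> t \<le> bdry_dist \<Omega> x \<Longrightarrow>
        ennreal (\<kappa> * t ^ n) \<le> hausdorff_outer n (ball \<xi> t \<inter> E)"
      using ahlfors_lower[OF bE[unfolded E_def] diamE[unfolded E_def] A(1)] A(2) unfolding E_def by blast
    \<comment> \<open>A positive lower bound for the diameter of \<Omega> serves as threshold for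
      the corkscrew scales in the locale.\<close>
    obtain \<epsilon> where \<epsilon>: "0 < \<epsilon>" "ennreal \<epsilon> \<le> ediameter \<Omega>" using ediameter_pos_open[OF \<open>open \<Omega>\<close> False] by blast
    obtain k where k: "0 < k" "\<And>x \<rho>. x \<in> E \<Longrightarrow> 0 < \<rho> \<Longrightarrow> ennreal \<rho> < 2 * ediameter \<Omega> \<Longrightarrow>
        \<exists>z s. k * \<rho> \<le> s \<and> ball z s \<subseteq> ball x \<rho> \<inter> \<Omega>"
      using \<open>corkscrew \<Omega>\<close> unfolding corkscrew_def E_def by blast
    have em: "emeasure S.\<mu> B = hausdorff_outer n (B \<inter> E)" if B: "B \<in> sets borel" for B
    proof -
      have "emeasure S.\<mu> B = (\<integral>\<^sup>+x. ennreal (indicator E x) * indicator B x \<partial>H)"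
        using B by (intro emeasure_density S.measurable_H) auto
      also have "\<dots> = (\<integral>\<^sup>+x. indicator (B \<inter> E) x \<partial>H)" by (intro nn_integral_cong) (auto simp: indicator_def)
      also have "\<dots> = emeasure H (B \<inter> E)" using B Eb by simp
      also have "\<dots> = hausdorff_outer n (B \<inter> E)" unfolding H_def using B Eb n by (intro emeasure_hausdorff_measure) auto
      finally show ?thesis .
    qed
    interpret D: nt_duality S.\<mu> n C1 \<Omega> \<alpha>\<^sub>0 c\<^sub>0 \<kappa> k \<epsilon> R P P' r'
    proof
      show "sets S.\<mu> = sets borel" by simp
      show "emeasure S.\<mu> (ball z \<rho>) \<le> ennreal (C1 * \<rho> ^ n)" if "0 < \<rho>" for z \<rho>
        using C1(2)[OF that] by (simp add: em)
      show "emeasure S.\<mu> (- frontier \<Omega>) = 0"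
        using em[of "- frontier \<Omega>"] hausdorff_outer_empty[OF n] by (simp add: E_def)
      show "ennreal (\<kappa> * t ^ n) \<le> emeasure S.\<mu> (ball \<xi> t)"
        if "x \<in> \<Omega>" "\<xi> \<in> frontier \<Omega>" "0 < t" "t \<le> bdry_dist \<Omega> x" for x \<xi> t
        using \<kappa>(2)[of x \<xi> t] that em[of "ball \<xi> t"] by (simp add: E_def)
      show "\<exists>z s. k * \<rho> \<le> s \<and> ball z s \<subseteq> ball \<xi> \<rho> \<inter> \<Omega>" if "\<xi> \<in> frontier \<Omega>" "0 < \<rho>" "\<rho> < \<epsilon>" for \<xi> \<rho>
      proof (rule k(2))
        have "ennreal \<rho> < ennreal \<epsilon>" using that by (simp add: ennreal_less_iff)
        also have "\<dots> \<le> 1 * ediameter \<Omega>" using \<epsilon>(2) by simp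
        also have "\<dots> \<le> 2 * ediameter \<Omega>" by (intro mult_right_mono) auto
        finally show "ennreal \<rho> < 2 * ediameter \<Omega>" .
      qed (use that in \<open>simp_all add: E_def\<close>)
    qed (use n C1(1) E0 \<kappa>(1) k(1) \<epsilon>(1) P P'(2) rr \<open>open \<Omega>\<close> \<open>0 < \<alpha>\<^sub>0\<close> \<open>0 < c\<^sub>0\<close> \<open>c\<^sub>0 \<le> 1 / 2\<close> in \<open>simp_all add: E_def\<close>)

    \<comment> \<open>Identification of norms, spaces and traces with those of the locale\<close>
    have NN: "N_norm n \<Omega> \<alpha>\<^sub>0 c\<^sub>0 r p = D.NN"
    proof
      fix u
      show "N_norm n \<Omega> \<alpha>\<^sub>0 c\<^sub>0 r p u = D.NN u"
        unfolding N_norm_def \<sigma>[unfolded \<sigma>_def] rR pP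
        by (rule S.Lnorm_eq[OF D.RP(4) D.borel_measurable_nt_max]) simp
    qed
    have Nsp: "N = D.Nsp"
      unfolding N_def N_space_def D.Nsp_def D.approx_def NN by (simp add: rR)
    have Cn: "C_norm n \<Omega> c\<^sub>0 r' p' F = D.Cn F" if "F \<in> borel_measurable (lebesgue_on \<Omega>)" for F
      unfolding C_norm_def \<sigma>[unfolded \<sigma>_def] P'(3)
      by (rule S.Lnorm_eq[OF D.RP(6) D.borel_measurable_carleson[OF that rr]]) simp
    have CI: "F \<in> C \<longleftrightarrow> F \<in> Lloc r' \<Omega> \<and> D.Cn F < top" for F
      using Cn[of F] by (auto simp: C_def C_space_def Lloc_def)
    have Cm: "F \<in> borel_measurable (lebesgue_on \<Omega>)" if "F \<in> C" for F
      using that by (simp add: C_def C_space_def Lloc_def)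
    \<comment> \<open>Boundary functions are measurable on the frontier only; cutting them off there
      makes them Borel functions on the whole space.\<close>
    define res where "res f x = indicator E x * f x" for f :: "'a \<Rightarrow> real" and x
    have res_E: "x \<in> E \<Longrightarrow> f x = res f x" for f x by (simp add: res_def)
    have res_borel: "f \<in> borel_measurable \<sigma> \<Longrightarrow> res f \<in> borel_measurable borel" for f
      unfolding res_def \<sigma> by (rule S.extend_measurable)
    have Lres: "Lp Q \<sigma> f = Lp Q S.\<mu> f'"
      if "0 < Q" "f' \<in> borel_measurable borel" "\<And>x. x \<in> E \<Longrightarrow> f x = f' x" for Q and f f' :: "'a \<Rightarrow> real"
      unfolding \<sigma> by (rule S.Lnorm_eq[OF that(1)]) (use that in auto)
    have key: "Lnorm p \<sigma> (\<lambda>\<xi>. ennreal \<bar>U \<xi> - f \<xi>\<bar>) = D.nP (\<lambda>x. D.te U x - f' x)"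
      if "U \<in> D.CC" "f' \<in> borel_measurable borel" "\<And>x. x \<in> E \<Longrightarrow> f x = f' x" for U f f'
      unfolding pP
    proof (rule Lres[OF D.RP(4)])
      show "(\<lambda>x. D.te U x - f' x) \<in> borel_measurable borel" using D.te_borel[OF that(1)] that(2) by measurable
      show "U x - f x = D.te U x - f' x" if "x \<in> E" for x
        using that \<open>\<And>x. x \<in> E \<Longrightarrow> f x = f' x\<close> by (simp add: D.te_def E_def)
    qed
    define tr' where "tr' u = res (tr u)" for u
    have istr: "D.istr u (tr' u)" if u: "u \<in> N" for u
    proof -
      \<comment> \<open>The predicate under the choice operator in \<open>bdry_trace\<close>. A
        function from \<open>istr_exists\<close> satisfies it, hence so does the chosen
        \<open>tr u\<close>, and its cut-off \<open>tr' u\<close> is a trace in the sense of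
        \<open>istr\<close>.\<close>
      let ?Q = "\<lambda>f. f \<in> Lspace p \<sigma> \<and> (\<forall>U. (\<forall>k::nat. U k \<in> D.CC) \<and> (\<lambda>k. D.NN (\<lambda>x. U k x - u x)) \<longlonglongrightarrow> 0 \<longrightarrow>
          (\<lambda>k. Lnorm p \<sigma> (\<lambda>\<xi>. ennreal \<bar>U k \<xi> - f \<xi>\<bar>)) \<longlonglongrightarrow> 0)"
      obtain f where f: "D.istr u f" using D.istr_exists u Nsp by blast
      then have fb: "f \<in> borel_measurable borel" "D.nP f < top" by (auto simp: D.istr_def)
      have "?Q f"
      proof (intro conjI allI impI)
        show "f \<in> Lspace p \<sigma>"
          using fb Lres[OF D.RP(4) fb(1), of f] S.restrict_measurable[OF fb(1)] by (simp add: Lspace_def \<sigma> pP)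
        fix U assume U: "(\<forall>k::nat. U k \<in> D.CC) \<and> (\<lambda>k. D.NN (\<lambda>x. U k x - u x)) \<longlonglongrightarrow> 0"
        then have "(\<lambda>k. D.nP (\<lambda>x. D.te (U k) x - f x)) \<longlonglongrightarrow> 0" using f by (simp add: D.istr_def D.approx_def)
        then show "(\<lambda>k. Lnorm p \<sigma> (\<lambda>\<xi>. ennreal \<bar>U k \<xi> - f \<xi>\<bar>)) \<longlonglongrightarrow> 0" using key[OF _ fb(1), of _ f] U by simp
      qed
      then have "?Q (SOME f. ?Q f)" by (rule someI[where P = ?Q])
      moreover have "tr u = (SOME f. ?Q f)" unfolding tr_def bdry_trace_def NN \<sigma>_def ..
      ultimately have t: "?Q (tr u)" by simp
      then have tb: "tr' u \<in> borel_measurable borel" unfolding tr'_def by (intro res_borel) (simp add: Lspace_def)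
      have te: "x \<in> E \<Longrightarrow> tr u x = tr' u x" for x unfolding tr'_def by (rule res_E)
      show ?thesis
        unfolding D.istr_def
      proof (intro conjI allI impI tb)
        show "D.nP (tr' u) < top" using t Lres[OF D.RP(4) tb te] by (simp add: Lspace_def pP)
        fix U assume U: "D.approx u U"
        then have "(\<lambda>k. Lnorm p \<sigma> (\<lambda>\<xi>. ennreal \<bar>U k \<xi> - tr u \<xi>\<bar>)) \<longlonglongrightarrow> 0" using t by (simp add: D.approx_def)
        then show "(\<lambda>k. D.nP (\<lambda>x. D.te (U k) x - tr' u x)) \<longlonglongrightarrow> 0"
          using key[OF _ tb te] U by (simp add: D.approx_def)
      qed
    qed
    have gres: "res g \<in> borel_measurable borel" "D.nP' (res g) < top" if "g \<in> Lspace p' \<sigma>" for g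
    proof -
      show b: "res g \<in> borel_measurable borel" using that by (intro res_borel) (simp add: Lspace_def)
      show "D.nP' (res g) < top" using that Lres[OF D.RP(6) b res_E] by (simp add: Lspace_def P'(3))
    qed
    have bdry: "(LINT \<xi>|\<sigma>. tr u \<xi> * g \<xi>) = (\<integral>x. tr' u x * g' x \<partial>S.\<mu>)"
      "integrable \<sigma> (\<lambda>\<xi>. tr u \<xi> * g \<xi>) \<longleftrightarrow> integrable S.\<mu> (\<lambda>x. tr' u x * g' x)"
      if "u \<in> N" "g' \<in> borel_measurable borel" "\<And>x. x \<in> E \<Longrightarrow> g x = g' x" for u g g'
    proof -
      have "tr' u \<in> borel_measurable borel" using istr[OF that(1)] by (simp add: D.istr_def)
      then have m: "(\<lambda>x. tr' u x * g' x) \<in> borel_measurable borel" using that(2) by measurable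
      have e: "tr u x * g x = tr' u x * g' x" if "x \<in> E" for x
        using that \<open>\<And>x. x \<in> E \<Longrightarrow> g x = g' x\<close> by (simp add: tr'_def res_def)
      show "(LINT \<xi>|\<sigma>. tr u \<xi> * g \<xi>) = (\<integral>x. tr' u x * g' x \<partial>S.\<mu>)"
        "integrable \<sigma> (\<lambda>\<xi>. tr u \<xi> * g \<xi>) \<longleftrightarrow> integrable S.\<mu> (\<lambda>x. tr' u x * g' x)"
        unfolding \<sigma> by (rule S.integral_eq[OF m e], assumption)+
    qed

    \<comment> \<open>Boundedness, existence and uniqueness, carried back to the boundary
      measure\<close>
    show ?thesis
    proof (intro conjI ballI allI impI)
      fix F g assume F: "F \<in> C" and g: "g \<in> Lspace p' \<sigma>"
      note pf = D.pairing_functional[OF Cm[OF F] CI[THEN iffD1, OF F, THEN conjunct2] gres[OF g] istr[unfolded Nsp]]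
      show "set_integrable lebesgue \<Omega> (\<lambda>x. u x * F x)" if "u \<in> N" for u using pf(2) that Nsp by simp
      show "integrable \<sigma> (\<lambda>\<xi>. tr u \<xi> * g \<xi>)" if "u \<in> N" for u
        using pf(3) that Nsp bdry(2)[OF that gres(1)[OF g] res_E] by simp
      show "bounded_functional N (N_norm n \<Omega> \<alpha>\<^sub>0 c\<^sub>0 r p) (\<lambda>u. (LINT x:\<Omega>|lebesgue. u x * F x) + (LINT \<xi>|\<sigma>. tr u \<xi> * g \<xi>))"
        unfolding NN Nsp
      proof (rule bounded_functional_cong[OF pf(1)])
        show "D.om u F + (LINT \<xi>|\<sigma>. tr u \<xi> * g \<xi>) = D.om u F + (\<integral>x. tr' u x * res g x \<partial>S.\<mu>)" if "u \<in> D.Nsp" for u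
          using bdry(1)[OF _ gres(1)[OF g] res_E] that Nsp by simp
      qed (auto intro: D.Nsp_add D.Nsp_cmult)
    next
      fix T assume "bounded_functional N (N_norm n \<Omega> \<alpha>\<^sub>0 c\<^sub>0 r p) T"
      then have T: "bounded_functional D.Nsp D.NN T" by (simp add: NN Nsp)
      then obtain K where K: "\<And>u. u \<in> D.Nsp \<Longrightarrow> ennreal \<bar>T u\<bar> \<le> ennreal K * D.NN u" unfolding bounded_functional_def by blast
      obtain F g where F: "F \<in> borel_measurable borel" "F \<in> Lloc r' \<Omega>" "D.Cn F < top"
        and g: "g \<in> borel_measurable borel" "D.nP' g < top"
        and rep: "\<And>u f. u \<in> D.Nsp \<Longrightarrow> D.istr u f \<Longrightarrow> T u = D.om u F + (\<integral>x. f x * g x \<partial>S.\<mu>)"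
      proof (rule D.representation[of T K])
        show "T (\<lambda>x. u x + v x) = T u + T v" if "u \<in> D.Nsp" "v \<in> D.Nsp" for u v using T that by (simp add: bounded_functional_def)
        show "T (\<lambda>x. s * u x) = s * T u" if "u \<in> D.Nsp" for s u using T that by (simp add: bounded_functional_def)
      qed (use K in blast)+
      have FC: "F \<in> C" using F CI by simp
      have gL: "g \<in> Lspace p' \<sigma>"
        using g Lres[OF D.RP(6) g(1), of g] S.restrict_measurable[OF g(1)] by (simp add: Lspace_def \<sigma> P'(3))
      show "\<exists>F\<in>C. \<exists>g\<in>Lspace p' \<sigma>.
           (\<forall>u\<in>N. T u = (LINT x:\<Omega>|lebesgue. u x * F x) + (LINT \<xi>|\<sigma>. tr u \<xi> * g \<xi>)) \<and>
           (\<forall>F'\<in>C. \<forall>g'\<in>Lspace p' \<sigma>.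
              (\<forall>u\<in>N. T u = (LINT x:\<Omega>|lebesgue. u x * F' x) + (LINT \<xi>|\<sigma>. tr u \<xi> * g' \<xi>)) \<longrightarrow>
              (AE x in lebesgue. x \<in> \<Omega> \<longrightarrow> F' x = F x) \<and> (AE \<xi> in \<sigma>. g' \<xi> = g \<xi>))"
      proof (rule bexI[OF _ FC], rule bexI[OF _ gL], rule conjI, goal_cases)
        case 1
        show ?case using rep istr bdry(1)[OF _ g(1), of _ g] Nsp by simp
      next
        case 2
        show ?case
        proof (intro ballI impI)
          fix F' g' assume F': "F' \<in> C" and g': "g' \<in> Lspace p' \<sigma>"
            and T': "\<forall>u\<in>N. T u = (LINT x:\<Omega>|lebesgue. u x * F' x) + (LINT \<xi>|\<sigma>. tr u \<xi> * g' \<xi>)"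
          have eq: "D.om u F + (\<integral>x. f x * g x \<partial>S.\<mu>) = D.om u F' + (\<integral>x. f x * res g' x \<partial>S.\<mu>)"
            if u: "u \<in> D.Nsp" and f: "D.istr u f" for u f
          proof -
            have uN: "u \<in> N" using u Nsp by simp
            \<comment> \<open>Uniqueness in the locale asks for the identity with every
              representative \<open>f\<close> of the trace; it agrees with \<open>tr' u\<close>
              almost everywhere.\<close>
            have "(\<integral>x. f x * res g' x \<partial>S.\<mu>) = (\<integral>x. tr' u x * res g' x \<partial>S.\<mu>)"
            proof (rule integral_cong_AE)
              have m: "f \<in> borel_measurable S.\<mu>" "tr' u \<in> borel_measurable S.\<mu>" "res g' \<in> borel_measurable S.\<mu>"
                using f istr[OF uN] gres(1)[OF g'] by (auto simp: D.istr_def intro: D.borel_M)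
              then show "(\<lambda>x. f x * res g' x) \<in> borel_measurable S.\<mu>" "(\<lambda>x. tr' u x * res g' x) \<in> borel_measurable S.\<mu>"
                by (auto intro: borel_measurable_times)
              show "AE x in S.\<mu>. f x * res g' x = tr' u x * res g' x"
                using D.istr_unique[OF u f istr[OF uN]] by eventually_elim simp
            qed
            then show ?thesis
              using rep[OF u f] T' uN bdry(1)[OF uN gres(1)[OF g'] res_E] by simp
          qed
          note uniq = D.representation_unique[OF Cm[OF FC] F(3) Cm[OF F'] CI[THEN iffD1, OF F', THEN conjunct2] g gres[OF g'] eq]
          show "(AE x in lebesgue. x \<in> \<Omega> \<longrightarrow> F' x = F x) \<and> (AE \<xi> in \<sigma>. g' \<xi> = g \<xi>)"
          proof
            show "AE x in lebesgue. x \<in> \<Omega> \<longrightarrow> F' x = F x" by (rule AE_completion) (rule uniq(1))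
            have "AE \<xi> in \<sigma>. res g' \<xi> = g \<xi>" unfolding \<sigma> S.AE_eq by (rule uniq(2))
            moreover have "AE \<xi> in \<sigma>. \<xi> \<in> E" by (rule AE_I2) (simp add: \<sigma> space_restrict_space)
            ultimately show "AE \<xi> in \<sigma>. g' \<xi> = g \<xi>" by eventually_elim (simp add: res_def)
          qed
        qed
      qed
    qed
  qed
qed

end
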